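(* Assume conditions (Coercivity 1), (Coercivity 2), (Riccati) and (Slater) stated in the context. Then $\widehat u_2$ is an optimal feedback strategy of the leader (i.e. $\widehat u_2\in U_2^{ad}$ minimizes $u_2\mapsto J_2(X^*(u_2),u_1^*(u_2),u_2)$ over $U_2^{ad}$) if the following KKT condition holds for some $\lambda^*\in\mathbb R^l$: $$\begin{cases} \widehat u_2=\Big(\begin{bmatrix}0^{m\times n}&E_2^{-1}B_2^\top\phi_1\end{bmatrix}-\begin{bmatrix}E_2^{-1}B_2^\top&0^{m\times n}\end{bmatrix}\phi_2\Big)\widehat Z-\Big(\begin{bmatrix}E_2^{-1}B_2^\top&0^{m\times n}\end{bmatrix}\psi_2+E_2^{-1}\gamma\Big)\lambda^*,\\ \lambda_i^*\ge0\ (i\in\mathcal I_1),\quad\rho_i(\lambda^* )-a_i\le0\ (i\in\mathcal I_1),\\ \lambda_i^*(\rho_i(\lambda^* )-a_i)=0\ (i\in\mathcal I_1),\quad\rho_i(\lambda^* )=a_i\ (i\in\mathcal I_2), \end{cases}$$ where $(\widehat Z,\widehat P,\widehat Q)$ is the unique solution $(Z,P,Q)$ of the forward-backward system in the context with $\lambda=\lambda^*$, $(\psi_2,\widetilde\psi_2)$ is the unique solution of the BSDE in the context, and $$(\rho_1(\lambda^* ),\dots,\rho_l(\lambda^* ))^\top=\rho(u_2^*(\lambda^* ))=\mathbb E[\psi_2^\top(s)]\widehat Z(s)-S_0\lambda^* .$$ Moreover, if $S_0$ is (strictly) positive definite, then $\lambda^*$ given by the KKT condition is the unique solution of the leader's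 dual problem: maximize $\widetilde J(\lambda,u_2^*(\lambda))$ over $\lambda\in U_0$.
   Context: Spaces. $0\le s<T$. On a complete filtered probability space satisfying the usual conditions, $B$ is a standard one-dimensional Brownian motion and $\mathcal F=\{\mathcal F_t\}$ is the filtration it generates. $\mathcal S^k$: symmetric real $k\times k$ matrices. For a Euclidean space $\mathcal H$: $\mathcal L^2_{\mathcal F}([s,T],\mathcal H)$ = progressively measurable $\mathcal H$-valued $X$ with $\mathbb E\int_s^T|X|^2dt<\infty$ (a Hilbert space with $\langle X,Y\rangle_{\mathcal L^2}=\mathbb E\int_s^T\langle X,Y\rangle dt$); $\mathcal L^2_{\mathcal F}(\Omega,C([s,T],\mathcal H))$ = continuous progressively measurable processes with $\mathbb E[\sup_t|X(t)|^2]<\infty$; $\mathcal L^\infty_{\mathcal F}(\Omega,C([s,T],\mathcal H))$ = continuous progressively measurable processes, essentially bounded uniformly in $(t,\omega)$; $\mathcal L^2_{\mathcal F_T}(\Omega,\mathcal H)$ = square-integrable $\mathcal F_T$-measurable variables. The $t$-dependence of processes is suppressed. Data. $A,C$ ($\mathbb R^{n\times n}$-valued), $B_1,B_2$ ($\mathbb R^{n\times m}$-valued), $D_1,D_2$ ($\mathcal S^n$-valued), $E_1,E_2$ ($\mathcal S^m$-valued, invertible) are bounded progressively measurable processes; $G_1,G_2$ are bounded $\mathcal F_T$-measurable $\mathcal S^n$-valued random variables (no definiteness assumed); $\xi\in\mathbb R^n$. $1\le l'\le l$ are integers, $\mathcal I_1=\{1,\dots,l'\}$, $\mathcal I_2=\{l'+1,\dots,l\}$;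 $\alpha\in\mathcal L^2_{\mathcal F}([s,T],\mathbb R^{n\times l})$, $\beta,\gamma\in\mathcal L^2_{\mathcal F}([s,T],\mathbb R^{m\times l})$, $\delta\in\mathcal L^2_{\mathcal F_T}(\Omega,\mathbb R^{n\times l})$, with $i$-th columns $\alpha_i,\beta_i,\gamma_i,\delta_i$, and $a\in\mathbb R^l$. $S_i=B_iE_i^{-1}B_i^\top$ ($i=1,2$). Game. State: $dX=[AX+B_1u_1+B_2u_2]dt+CXdB(t)$, $X(s)=\xi$. Costs: $J_k(X,u_1,u_2)=\mathbb E[\int_s^T\langle D_kX,X\rangle+\langle E_ku_k,u_k\rangle dt+\langle G_kX(T),X(T)\rangle]$, $k=1$ (follower), $k=2$ (leader). Given $u_2$, the follower minimizes $J_1$ over $u_1\in U_1^{ad}=\mathcal L^2_{\mathcal F}([s,T],\mathbb R^m)$, with optimal response $u_1^*(u_2)$ and state $X^*=X^*(u_2)$. The leader then minimizes $J_2(X^*,u_1^*,u_2)$ over $$U_2^{ad}=\{u_2\in\mathcal L^2_{\mathcal F}([s,T],\mathbb R^m):\rho_i(u_2)\le a_i\ (i\in\mathcal I_1),\ \rho_i(u_2)=a_i\ (i\in\mathcal I_2)\},$$ $$\rho(u_2)=(\rho_1(u_2),\dots,\rho_l(u_2))^\top=\mathbb E\Big[\int_s^T(\alpha^\top X^*+\beta^\top u_1^*+\gamma^\top u_2)dt+\delta^\top X^*(T)\Big].$$ (Coercivity 1) There is $\epsilon_1>0$ such that for all $\widetilde u_1\in\mathcal L^2_{\mathcal F}([s,T],\mathbb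 R^m)$, $\mathbb E[\int_s^T\langle D_1\widetilde X,\widetilde X\rangle+\langle E_1\widetilde u_1,\widetilde u_1\rangle dt+\langle G_1\widetilde X(T),\widetilde X(T)\rangle]\ge\epsilon_1\mathbb E\int_s^T|\widetilde u_1|^2dt$, where $d\widetilde X=[A\widetilde X+B_1\widetilde u_1]dt+C\widetilde XdB(t)$, $\widetilde X(s)=0$. Follower's response. Under (Coercivity 1), $(\phi_1,\widetilde\phi_1)\in\mathcal L^\infty_{\mathcal F}(\Omega,C([s,T],\mathcal S^n))\times\mathcal L^2_{\mathcal F}([s,T],\mathcal S^n)$ denotes the unique solution of $$d\phi_1=-[D_1+\phi_1A+A^\top\phi_1+\widetilde\phi_1C+C^\top\widetilde\phi_1+C^\top\phi_1C-\phi_1S_1\phi_1]dt+\widetilde\phi_1dB(t),\quad\phi_1(T)=G_1 .$$ For $u_2\in\mathcal L^2_{\mathcal F}([s,T],\mathbb R^m)$, $u_1^*(u_2)=-E_1^{-1}B_1^\top(\phi_1X^*+\psi_1)$, where $$\begin{cases}dX^*=[(A-S_1\phi_1)X^*-S_1\psi_1+B_2u_2]dt+CX^*dB(t),\\ d\psi_1=-[(A^\top-\phi_1S_1)\psi_1+C^\top\widetilde\psi_1+\phi_1B_2u_2]dt+\widetilde\psi_1dB(t),\\ X^*(s)=\xi,\quad\psi_1(T)=0.\end{cases}$$ (Coercivity 2) There is $\epsilon_2>0$ such that for all $\widetilde u_2\in\mathcal L^2_{\mathcal F}([s,T],\mathbb R^m)$, $\mathbb E[\int_s^T\langle D_2\widetilde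 X^*,\widetilde X^*\rangle+\langle E_2\widetilde u_2,\widetilde u_2\rangle dt+\langle G_2\widetilde X^*(T),\widetilde X^*(T)\rangle]\ge\epsilon_2\mathbb E\int_s^T|\widetilde u_2|^2dt$, where $(\widetilde X^*,\overline\psi_1,\widehat\psi_1)$ is the unique solution of the same system as $(X^*,\psi_1,\widetilde\psi_1)$ with $u_2$ replaced by $\widetilde u_2$ and $\xi$ by $0$. Lagrangian. $\widetilde J(\lambda,u_2)=J_2(X^*,u_1^*(u_2),u_2)+2\langle\rho(u_2)-a,\lambda\rangle$ and $U_0=\{\lambda\in\mathbb R^l:\lambda_i\ge0,\ i\in\mathcal I_1\}$. Relaxed problem for $\lambda\in U_0$: minimize $\widetilde J(\lambda,\cdot)$ over $\mathcal L^2_{\mathcal F}([s,T],\mathbb R^m)$. Block notation. $$\overline F=\begin{bmatrix}S_2&-S_1\\ -S_1&0\end{bmatrix},\ \overline C=\begin{bmatrix}C&0\\ 0&C\end{bmatrix},\ \overline A=\begin{bmatrix}A-S_1\phi_1&S_2\phi_1\\ 0&A-S_1\phi_1\end{bmatrix},\ \overline D=\begin{bmatrix}D_2&0\\ 0&\phi_1S_2\phi_1\end{bmatrix},$$ $$g=\begin{bmatrix}-B_2E_2^{-1}\gamma\\ B_1E_1^{-1}\beta\end{bmatrix},\quad h=\begin{bmatrix}\alpha-\phi_1B_1E_1^{-1}\beta\\ \phi_1B_2E_2^{-1}\gamma\end{bmatrix}.$$ (Riccati) There is a unique solution $(\phi_2,\widetilde\phi_2)\in\mathcal L^\infty_{\mathcal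 F}(\Omega,C([s,T],\mathcal S^{2n}))\times\mathcal L^2_{\mathcal F}([s,T],\mathcal S^{2n})$ of $$d\phi_2=-[\overline A^\top\phi_2+\phi_2\overline A+\overline C^\top\widetilde\phi_2+\widetilde\phi_2\overline C+\overline C^\top\phi_2\overline C-\phi_2\overline F\phi_2+\overline D]dt+\widetilde\phi_2dB(t),\quad\phi_2(T)=\begin{bmatrix}G_2&0\\ 0&0\end{bmatrix}.$$ $(\psi_2,\widetilde\psi_2)\in\mathcal L^2_{\mathcal F}(\Omega,C([s,T],\mathbb R^{2n\times l}))\times\mathcal L^2_{\mathcal F}([s,T],\mathbb R^{2n\times l})$ is the unique solution of the BSDE $$d\psi_2=-[(\overline A^\top-\phi_2\overline F)\psi_2+\overline C^\top\widetilde\psi_2+h+\phi_2g]dt+\widetilde\psi_2dB(t),\quad\psi_2(T)=\begin{bmatrix}\delta\\ 0\end{bmatrix}.$$ For $\lambda\in U_0$, $(Z,P,Q)\in\mathcal L^2_{\mathcal F}(\Omega,C([s,T],\mathbb R^{2n}))^2\times\mathcal L^2_{\mathcal F}([s,T],\mathbb R^{2n})$ is the unique solution of the forward-backward system $$\begin{cases}dZ=[\overline AZ+\overline FP+g\lambda]dt+\overline CZdB(t),\\ dP=[\overline DZ-\overline A^\top P-\overline C^\top Q+h\lambda]dt+QdB(t),\\ Z(s)=\begin{bmatrix}\xi\\ 0\end{bmatrix},\quad P(T)=-\begin{bmatrix}G_2&0\\ 0&0\end{bmatrix}Z(T)-\begin{bmatrix}\delta\\ 0\end{bmatrix}\lambda,\end{cases}$$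 (with $P=-\phi_2Z-\psi_2\lambda$), and the feedback solution of the relaxed problem is $$u_2^*(\lambda)=\Big(\begin{bmatrix}0&E_2^{-1}B_2^\top\phi_1\end{bmatrix}-\begin{bmatrix}E_2^{-1}B_2^\top&0\end{bmatrix}\phi_2\Big)Z-\Big(\begin{bmatrix}E_2^{-1}B_2^\top&0\end{bmatrix}\psi_2+E_2^{-1}\gamma\Big)\lambda .$$ The dual function is given by $$\widetilde J(\lambda,u_2^*(\lambda))=Z^\top(s)\mathbb E[\phi_2(s)]Z(s)+2\langle\mathbb E[\psi_2^\top(s)Z(s)]-a,\lambda\rangle-\langle S_0\lambda,\lambda\rangle,\quad S_0=-\mathbb E\int_s^T[\psi_2^\top g+g^\top\psi_2-\gamma^\top E_2^{-1}\gamma-\psi_2^\top\overline F\psi_2]dt .$$ (Slater) For $i=1,\dots,l$ let $(\overline X_i,\overline p_i,\overline q_i)\in\mathcal L^2_{\mathcal F}(\Omega,C([s,T],\mathbb R^n))^2\times\mathcal L^2_{\mathcal F}([s,T],\mathbb R^n)$ be the unique solution of $$\begin{cases}d\overline X_i=[(A-S_1\phi_1)\overline X_i-S_1\overline p_i-B_1E_1^{-1}\beta_i]dt+C\overline X_idB(t),\\ d\overline p_i=-[(A^\top-\phi_1S_1)\overline p_i+C^\top\overline q_i+\alpha_i-\phi_1B_1E_1^{-1}\beta_i]dt+\overline q_idB(t),\\ \overline X_i(s)=0,\quad\overline p_i(T)=-\delta_i,\end{cases}$$ and set $\widetilde\rho_i=B_2^\top(\overline p_i-\phi_1\overline X_i)+\gamma_i$,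 $\widetilde a_i=a_i+\langle\mathbb E[\overline p_i(s)],\xi\rangle$. The condition is: there is $\overline u_2\in U_2^{ad}$ with $\langle\overline u_2,\widetilde\rho_i\rangle_{\mathcal L^2}<\widetilde a_i$ for $i\in\mathcal I_1$ and $\langle\overline u_2,\widetilde\rho_i\rangle_{\mathcal L^2}=\widetilde a_i$ for $i\in\mathcal I_2$; moreover $\{\widetilde\rho_i\}_{i\in\mathcal I_2}$ is linearly independent (if $k_i\in\mathbb R$ and $\sum_{i\in\mathcal I_2}k_i\widetilde\rho_i=0$ for all $t\in[s,T]$, $\mathbb P$-a.s., then all $k_i=0$).
   Formalization: The lower right block of D̄ is taken as −φ1 S2 φ1 instead of the printed +φ1 S2 φ1 (in the Riccati equation and the forward-backward system); with the printed sign the feedback is not optimal, already for scalar deterministic data with λ*=0. *)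

theory Defs
  imports "HOL-Probability.Probability"
begin

section \<open>Brownian motion, its filtration, and spaces of processes\<close>

type_synonym ('w, 'a) process = "real \<Rightarrow> 'w \<Rightarrow> 'a"

definition natural_filtration :: "'w measure \<Rightarrow> ('w, real) process \<Rightarrow> real \<Rightarrow> 'w measure" where
  "natural_filtration M W t =
     sigma (space M) {W r -` S \<inter> space M | r S. 0 \<le> r \<and> r \<le> t \<and> S \<in> sets borel}"

definition brownian_motion :: "'w measure \<Rightarrow> ('w, real) process \<Rightarrow> bool" where
  "brownian_motion M W \<longleftrightarrow>
     prob_space M \<and>
     (\<forall>t\<ge>0. W t \<in> borel_measurable M) \<and>
     (AE \<omega> in M. W 0 \<omega> = 0 \<and> continuous_on {0..} (\<lambda>t. W t \<omega>)) \<and>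
     (\<forall>r t. 0 \<le> r \<and> r < t \<longrightarrow>
        distributed M lborel (\<lambda>\<omega>. W t \<omega> - W r \<omega>) (normal_density 0 (sqrt (t - r))) \<and>
        prob_space.indep_set M (sets (natural_filtration M W r))
          {(\<lambda>\<omega>. W t \<omega> - W r \<omega>) -` S \<inter> space M | S. S \<in> sets borel})"

text \<open>The filtration generated by the Brownian motion is augmented by the null sets, as required
  by the usual conditions; for a Brownian motion it is then automatically right-continuous.\<close>

definition bm_filtration :: "'w measure \<Rightarrow> ('w, real) process \<Rightarrow> real \<Rightarrow> 'w measure" where
  "bm_filtration M W t =
     sigma (space M)
       ({W r -` S \<inter> space M | r S. 0 \<le> r \<and> r \<le> t \<and> S \<in> sets borel} \<union> null_sets M)"

definition progressive ::
  "'w measure \<Rightarrow> ('w, real) process \<Rightarrow> real \<Rightarrow> real \<Rightarrow> ('w, 'a::euclidean_space) process \<Rightarrow> bool" where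
  "progressive M W s T X \<longleftrightarrow>
     (\<forall>t\<in>{s..T}. (\<lambda>p. X (fst p) (snd p)) \<in>
        borel_measurable (restrict_space borel {s..t} \<Otimes>\<^sub>M bm_filtration M W t))"

definition L2_process ::
  "'w measure \<Rightarrow> ('w, real) process \<Rightarrow> real \<Rightarrow> real \<Rightarrow> ('w, 'a::euclidean_space) process set" where
  "L2_process M W s T =
     {X. progressive M W s T X \<and>
         (\<integral>\<^sup>+\<omega>. (\<integral>\<^sup>+t\<in>{s..T}. ennreal ((norm (X t \<omega>))\<^sup>2) \<partial>lborel) \<partial>M) < \<infinity>}"

definition continuous_paths ::
  "'w measure \<Rightarrow> real \<Rightarrow> real \<Rightarrow> ('w, 'a::euclidean_space) process \<Rightarrow> bool" where
  "continuous_paths M s T X \<longleftrightarrow> (AE \<omega> in M. continuous_on {s..T} (\<lambda>t. X t \<omega>))"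

definition L2_continuous ::
  "'w measure \<Rightarrow> ('w, real) process \<Rightarrow> real \<Rightarrow> real \<Rightarrow> ('w, 'a::euclidean_space) process set" where
  "L2_continuous M W s T =
     {X. progressive M W s T X \<and> continuous_paths M s T X \<and>
         (\<integral>\<^sup>+\<omega>. (SUP t\<in>{s..T}. ennreal ((norm (X t \<omega>))\<^sup>2)) \<partial>M) < \<infinity>}"

definition Linf_continuous ::
  "'w measure \<Rightarrow> ('w, real) process \<Rightarrow> real \<Rightarrow> real \<Rightarrow> ('w, 'a::euclidean_space) process set" where
  "Linf_continuous M W s T =
     {X. progressive M W s T X \<and> continuous_paths M s T X \<and>
         (\<exists>K. AE \<omega> in M. \<forall>t\<in>{s..T}. norm (X t \<omega>) \<le> K)}"

definition bounded_process ::
  "'w measure \<Rightarrow> ('w, real) process \<Rightarrow> real \<Rightarrow> real \<Rightarrow> ('w, 'a::euclidean_space) process \<Rightarrow> bool" where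
  "bounded_process M W s T X \<longleftrightarrow>
     progressive M W s T X \<and> (\<exists>K. \<forall>t\<in>{s..T}. \<forall>\<omega>\<in>space M. norm (X t \<omega>) \<le> K)"

definition L2_inner ::
  "'w measure \<Rightarrow> real \<Rightarrow> real \<Rightarrow> ('w, 'a::euclidean_space) process \<Rightarrow> ('w, 'a) process \<Rightarrow> real" where
  "L2_inner M s T X Y = (\<integral>\<omega>. (LBINT t:{s..T}. X t \<omega> \<bullet> Y t \<omega>) \<partial>M)"

definition process_eq ::
  "'w measure \<Rightarrow> real \<Rightarrow> real \<Rightarrow> ('w, 'a) process \<Rightarrow> ('w, 'a) process \<Rightarrow> bool" where
  "process_eq M s T X Y \<longleftrightarrow> (AE \<omega> in M. AE t in lborel. t \<in> {s..T} \<longrightarrow> X t \<omega> = Y t \<omega>)"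

definition indistinguishable ::
  "'w measure \<Rightarrow> real \<Rightarrow> real \<Rightarrow> ('w, 'a) process \<Rightarrow> ('w, 'a) process \<Rightarrow> bool" where
  "indistinguishable M s T X Y \<longleftrightarrow> (AE \<omega> in M. \<forall>t\<in>{s..T}. X t \<omega> = Y t \<omega>)"


section \<open>The Ito integral\<close>

text \<open>A simple process is given by a list of triples \<open>(p, q, \<eta>)\<close>, standing for the sum of the
  processes \<open>\<eta> 1\<^bsub>(p,q]\<^esub>\<close> with \<open>\<eta>\<close> bounded and measurable at time \<open>p\<close>.\<close>

definition simple_process ::
  "'w measure \<Rightarrow> ('w, real) process \<Rightarrow> real \<Rightarrow> real \<Rightarrow> (real \<times> real \<times> ('w \<Rightarrow> 'a::euclidean_space)) list \<Rightarrow> bool"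
where
  "simple_process M W s T L \<longleftrightarrow>
     (\<forall>(p, q, \<eta>)\<in>set L. s \<le> p \<and> p \<le> q \<and> q \<le> T \<and>
        \<eta> \<in> borel_measurable (bm_filtration M W p) \<and> (\<exists>K. \<forall>\<omega>\<in>space M. norm (\<eta> \<omega>) \<le> K))"

definition simple_value ::
  "(real \<times> real \<times> ('w \<Rightarrow> 'a::euclidean_space)) list \<Rightarrow> ('w, 'a) process" where
  "simple_value L t \<omega> = (\<Sum>(p, q, \<eta>)\<leftarrow>L. indicat_real {p<..q} t *\<^sub>R \<eta> \<omega>)"

definition simple_integral ::
  "('w, real) process \<Rightarrow> (real \<times> real \<times> ('w \<Rightarrow> 'a::euclidean_space)) list \<Rightarrow> ('w, 'a) process" where
  "simple_integral W L t \<omega> = (\<Sum>(p, q, \<eta>)\<leftarrow>L. (W (min q t) \<omega> - W (min p t) \<omega>) *\<^sub>R \<eta> \<omega>)"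

text \<open>\<open>I\<close> is the (continuous version of the) process \<open>t \<mapsto> \<integral>\<^bsub>s\<^esub>\<^bsup>t\<^esup> H dW\<close> on \<open>[s,T]\<close>, as the
  \<open>L\<^sup>2\<close>-limit of integrals of simple processes.\<close>

definition ito_integral ::
  "'w measure \<Rightarrow> ('w, real) process \<Rightarrow> real \<Rightarrow> real \<Rightarrow>
     ('w, 'a::euclidean_space) process \<Rightarrow> ('w, 'a) process \<Rightarrow> bool" where
  "ito_integral M W s T H I \<longleftrightarrow>
     H \<in> L2_process M W s T \<and>
     continuous_paths M s T I \<and>
     (\<forall>t\<in>{s..T}. I t \<in> borel_measurable (bm_filtration M W t)) \<and>
     (\<exists>L. (\<forall>k::nat. simple_process M W s T (L k)) \<and>
        (\<lambda>k. \<integral>\<^sup>+\<omega>. (\<integral>\<^sup>+t\<in>{s..T}. ennreal ((norm (simple_value (L k) t \<omega> - H t \<omega>))\<^sup>2) \<partial>lborel) \<partial>M)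
           \<longlonglongrightarrow> 0 \<and>
        (\<forall>t\<in>{s..T}.
           (\<lambda>k. \<integral>\<^sup>+\<omega>. ennreal ((norm (simple_integral W (L k) t \<omega> - I t \<omega>))\<^sup>2) \<partial>M) \<longlonglongrightarrow> 0))"

text \<open>\<open>ito_differential M W s T X b \<sigma>\<close> is the equation \<open>dX = b dt + \<sigma> dW\<close> on \<open>[s,T]\<close>.\<close>

definition ito_differential ::
  "'w measure \<Rightarrow> ('w, real) process \<Rightarrow> real \<Rightarrow> real \<Rightarrow>
     ('w, 'a::euclidean_space) process \<Rightarrow> ('w, 'a) process \<Rightarrow> ('w, 'a) process \<Rightarrow> bool" where
  "ito_differential M W s T X b \<sigma> \<longleftrightarrow>
     (\<exists>I. ito_integral M W s T \<sigma> I \<and>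
        (AE \<omega> in M. set_integrable lborel {s..T} (\<lambda>t. b t \<omega>) \<and>
           (\<forall>t\<in>{s..T}. X t \<omega> = X s \<omega> + (LBINT r:{s..t}. b r \<omega>) + I t \<omega>)))"


section \<open>Block matrices\<close>

text \<open>The index type \<open>'p + 'q\<close> plays the role of \<open>{1..p+q}\<close>; \<open>vstack\<close> applies to vectors and,
  as matrices are vectors of rows, to matrices.\<close>

definition vstack :: "'x^'p \<Rightarrow> 'x^'q \<Rightarrow> 'x^('p + 'q)" where
  "vstack u v = (\<chi> i. case i of Inl j \<Rightarrow> u $ j | Inr j \<Rightarrow> v $ j)"

definition hstack :: "'x^'p^'r \<Rightarrow> 'x^'q^'r \<Rightarrow> 'x^('p + 'q)^'r" where
  "hstack U V = (\<chi> i. vstack (U $ i) (V $ i))"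

definition block ::
  "'x^'p^'r \<Rightarrow> 'x^'q^'r \<Rightarrow> 'x^'p^'k \<Rightarrow> 'x^'q^'k \<Rightarrow> 'x^('p + 'q)^('r + 'k)" where
  "block U V U' V' = vstack (hstack U V) (hstack U' V')"

definition symmetric_matrix :: "real^'n^'n \<Rightarrow> bool" where
  "symmetric_matrix U \<longleftrightarrow> transpose U = U"

definition positive_definite :: "real^'n^'n \<Rightarrow> bool" where
  "positive_definite U \<longleftrightarrow> symmetric_matrix U \<and> (\<forall>x. x \<noteq> 0 \<longrightarrow> (U *v x) \<bullet> x > 0)"


section \<open>Data of the game\<close>

text \<open>The constraints are indexed by the finite type \<open>'l\<close>; \<open>ineqs\<close> is the set of inequality
  constraints and its complement the set of equality constraints.\<close>

record ('w, 'n::finite, 'm::finite, 'l::finite) game =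
  Om :: "'w measure"
  BM :: "('w, real) process"
  t0 :: real
  t1 :: real
  cA :: "('w, real^'n^'n) process"
  cC :: "('w, real^'n^'n) process"
  cB1 :: "('w, real^'m^'n) process"
  cB2 :: "('w, real^'m^'n) process"
  cD1 :: "('w, real^'n^'n) process"
  cD2 :: "('w, real^'n^'n) process"
  cE1 :: "('w, real^'m^'m) process"
  cE2 :: "('w, real^'m^'m) process"
  cG1 :: "'w \<Rightarrow> real^'n^'n"
  cG2 :: "'w \<Rightarrow> real^'n^'n"
  xi :: "real^'n"
  c\<alpha> :: "('w, real^'l^'n) process"
  c\<beta> :: "('w, real^'l^'m) process"
  c\<gamma> :: "('w, real^'l^'m) process"
  c\<delta> :: "'w \<Rightarrow> real^'l^'n"
  bnd :: "real^'l"
  ineqs :: "'l set"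

type_synonym ('w, 'm) control = "('w, real^'m) process"
type_synonym ('w, 'n, 'm) state_map = "('w, 'm) control \<Rightarrow> ('w, 'm) control \<Rightarrow> ('w, real^'n) process"

definition symmetric_coeff ::
  "('w, 'n::finite, 'm::finite, 'l::finite) game \<Rightarrow> ('w, real^'k^'k) process \<Rightarrow> bool" where
  "symmetric_coeff G X \<longleftrightarrow> (\<forall>t\<in>{t0 G..t1 G}. \<forall>\<omega>\<in>space (Om G). symmetric_matrix (X t \<omega>))"

definition terminal_coeff ::
  "('w, 'n::finite, 'm::finite, 'l::finite) game \<Rightarrow> ('w \<Rightarrow> real^'k^'k) \<Rightarrow> bool" where
  "terminal_coeff G Y \<longleftrightarrow>
     Y \<in> borel_measurable (bm_filtration (Om G) (BM G) (t1 G)) \<and>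
     (\<exists>K. \<forall>\<omega>\<in>space (Om G). norm (Y \<omega>) \<le> K) \<and>
     (\<forall>\<omega>\<in>space (Om G). symmetric_matrix (Y \<omega>))"

abbreviation (input) "bounded_coeff G \<equiv> bounded_process (Om G) (BM G) (t0 G) (t1 G)"
abbreviation (input) "L2F G \<equiv> L2_process (Om G) (BM G) (t0 G) (t1 G)"
abbreviation (input) "L2C G \<equiv> L2_continuous (Om G) (BM G) (t0 G) (t1 G)"
abbreviation (input) "LinfC G \<equiv> Linf_continuous (Om G) (BM G) (t0 G) (t1 G)"
abbreviation (input) "itod G \<equiv> ito_differential (Om G) (BM G) (t0 G) (t1 G)"

definition lq_game :: "('w, 'n::finite, 'm::finite, 'l::finite) game \<Rightarrow> bool" where
  "lq_game G \<longleftrightarrow>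
     brownian_motion (Om G) (BM G) \<and> complete_measure (Om G) \<and>
     0 \<le> t0 G \<and> t0 G < t1 G \<and>
     bounded_coeff G (cA G) \<and> bounded_coeff G (cC G) \<and>
     bounded_coeff G (cB1 G) \<and> bounded_coeff G (cB2 G) \<and>
     bounded_coeff G (cD1 G) \<and> symmetric_coeff G (cD1 G) \<and>
     bounded_coeff G (cD2 G) \<and> symmetric_coeff G (cD2 G) \<and>
     bounded_coeff G (cE1 G) \<and> symmetric_coeff G (cE1 G) \<and>
     bounded_coeff G (cE2 G) \<and> symmetric_coeff G (cE2 G) \<and>
     (\<forall>t\<in>{t0 G..t1 G}. \<forall>\<omega>\<in>space (Om G). invertible (cE1 G t \<omega>) \<and> invertible (cE2 G t \<omega>)) \<and>
     terminal_coeff G (cG1 G) \<and> terminal_coeff G (cG2 G) \<and>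
     c\<alpha> G \<in> L2F G \<and> c\<beta> G \<in> L2F G \<and> c\<gamma> G \<in> L2F G \<and>
     c\<delta> G \<in> borel_measurable (bm_filtration (Om G) (BM G) (t1 G)) \<and>
     (\<integral>\<^sup>+\<omega>. ennreal ((norm (c\<delta> G \<omega>))\<^sup>2) \<partial>Om G) < \<infinity> \<and>
     ineqs G \<noteq> {}"

abbreviation invE1 :: "('w, 'n::finite, 'm::finite, 'l::finite) game \<Rightarrow> ('w, real^'m^'m) process" where
  "invE1 G t \<omega> \<equiv> matrix_inv (cE1 G t \<omega>)"

abbreviation invE2 :: "('w, 'n::finite, 'm::finite, 'l::finite) game \<Rightarrow> ('w, real^'m^'m) process" where
  "invE2 G t \<omega> \<equiv> matrix_inv (cE2 G t \<omega>)"

definition S1 :: "('w, 'n::finite, 'm::finite, 'l::finite) game \<Rightarrow> ('w, real^'n^'n) process" where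
  "S1 G t \<omega> = cB1 G t \<omega> ** invE1 G t \<omega> ** transpose (cB1 G t \<omega>)"

definition S2 :: "('w, 'n::finite, 'm::finite, 'l::finite) game \<Rightarrow> ('w, real^'n^'n) process" where
  "S2 G t \<omega> = cB2 G t \<omega> ** invE2 G t \<omega> ** transpose (cB2 G t \<omega>)"


section \<open>State equation, costs and the follower's problem\<close>

definition state_solution ::
  "('w, 'n::finite, 'm::finite, 'l::finite) game \<Rightarrow> real^'n \<Rightarrow>
     ('w, 'm) control \<Rightarrow> ('w, 'm) control \<Rightarrow> ('w, real^'n) process \<Rightarrow> bool" where
  "state_solution G x u1 u2 X \<longleftrightarrow>
     X \<in> L2C G \<and> (AE \<omega> in Om G. X (t0 G) \<omega> = x) \<and>
     itod G X
       (\<lambda>t \<omega>. cA G t \<omega> *v X t \<omega> + cB1 G t \<omega> *v u1 t \<omega> + cB2 G t \<omega> *v u2 t \<omega>)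
       (\<lambda>t \<omega>. cC G t \<omega> *v X t \<omega>)"

definition quadratic_cost ::
  "('w, 'n::finite, 'm::finite, 'l::finite) game \<Rightarrow> ('w, real^'n^'n) process \<Rightarrow> ('w, real^'m^'m) process \<Rightarrow>
     ('w \<Rightarrow> real^'n^'n) \<Rightarrow> ('w, real^'n) process \<Rightarrow> ('w, 'm) control \<Rightarrow> real" where
  "quadratic_cost G D E H X u =
     (\<integral>\<omega>. (LBINT t:{t0 G..t1 G}. (D t \<omega> *v X t \<omega>) \<bullet> X t \<omega> + (E t \<omega> *v u t \<omega>) \<bullet> u t \<omega>)
            + (H \<omega> *v X (t1 G) \<omega>) \<bullet> X (t1 G) \<omega> \<partial>Om G)"

definition J1 ::
  "('w, 'n::finite, 'm::finite, 'l::finite) game \<Rightarrow> ('w, real^'n) process \<Rightarrow>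
     ('w, 'm) control \<Rightarrow> ('w, 'm) control \<Rightarrow> real" where
  "J1 G X u1 u2 = quadratic_cost G (cD1 G) (cE1 G) (cG1 G) X u1"

definition J2 ::
  "('w, 'n::finite, 'm::finite, 'l::finite) game \<Rightarrow> ('w, real^'n) process \<Rightarrow>
     ('w, 'm) control \<Rightarrow> ('w, 'm) control \<Rightarrow> real" where
  "J2 G X u1 u2 = quadratic_cost G (cD2 G) (cE2 G) (cG2 G) X u2"

definition coercivity1 :: "('w, 'n::finite, 'm::finite, 'l::finite) game \<Rightarrow> bool" where
  "coercivity1 G \<longleftrightarrow>
     (\<exists>\<epsilon>>0. \<forall>u\<in>L2F G. \<forall>X. state_solution G 0 u (\<lambda>_ _. 0) X \<longrightarrow>
        quadratic_cost G (cD1 G) (cE1 G) (cG1 G) X u \<ge> \<epsilon> * L2_inner (Om G) (t0 G) (t1 G) u u)"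

definition symmetric_pair ::
  "('w, 'n::finite, 'm::finite, 'l::finite) game \<Rightarrow>
     ('w, real^'k^'k) process \<Rightarrow> ('w, real^'k^'k) process \<Rightarrow> bool" where
  "symmetric_pair G \<phi> \<phi>' \<longleftrightarrow>
     (AE \<omega> in Om G. \<forall>t\<in>{t0 G..t1 G}. symmetric_matrix (\<phi> t \<omega>)) \<and>
     (AE \<omega> in Om G. AE t in lborel. t \<in> {t0 G..t1 G} \<longrightarrow> symmetric_matrix (\<phi>' t \<omega>))"

definition riccati1 ::
  "('w, 'n::finite, 'm::finite, 'l::finite) game \<Rightarrow>
     ('w, real^'n^'n) process \<Rightarrow> ('w, real^'n^'n) process \<Rightarrow> bool" where
  "riccati1 G \<phi> \<phi>' \<longleftrightarrow>
     \<phi> \<in> LinfC G \<and> \<phi>' \<in> L2F G \<and> symmetric_pair G \<phi> \<phi>' \<and>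
     (AE \<omega> in Om G. \<phi> (t1 G) \<omega> = cG1 G \<omega>) \<and>
     itod G \<phi>
       (\<lambda>t \<omega>. - (cD1 G t \<omega> + \<phi> t \<omega> ** cA G t \<omega> + transpose (cA G t \<omega>) ** \<phi> t \<omega>
                + \<phi>' t \<omega> ** cC G t \<omega> + transpose (cC G t \<omega>) ** \<phi>' t \<omega>
                + transpose (cC G t \<omega>) ** \<phi> t \<omega> ** cC G t \<omega>
                - \<phi> t \<omega> ** S1 G t \<omega> ** \<phi> t \<omega>))
       \<phi>'"

definition follower_system ::
  "('w, 'n::finite, 'm::finite, 'l::finite) game \<Rightarrow> ('w, real^'n^'n) process \<Rightarrow> real^'n \<Rightarrow> ('w, 'm) control \<Rightarrow>
     ('w, real^'n) process \<Rightarrow> ('w, real^'n) process \<Rightarrow> ('w, real^'n) process \<Rightarrow> bool" where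
  "follower_system G \<phi>1 x u2 X \<psi> \<psi>' \<longleftrightarrow>
     X \<in> L2C G \<and> \<psi> \<in> L2C G \<and> \<psi>' \<in> L2F G \<and>
     (AE \<omega> in Om G. X (t0 G) \<omega> = x \<and> \<psi> (t1 G) \<omega> = 0) \<and>
     itod G X
       (\<lambda>t \<omega>. (cA G t \<omega> - S1 G t \<omega> ** \<phi>1 t \<omega>) *v X t \<omega> - S1 G t \<omega> *v \<psi> t \<omega> + cB2 G t \<omega> *v u2 t \<omega>)
       (\<lambda>t \<omega>. cC G t \<omega> *v X t \<omega>) \<and>
     itod G \<psi>
       (\<lambda>t \<omega>. - ((transpose (cA G t \<omega>) - \<phi>1 t \<omega> ** S1 G t \<omega>) *v \<psi> t \<omega>
                + transpose (cC G t \<omega>) *v \<psi>' t \<omega> + \<phi>1 t \<omega> *v (cB2 G t \<omega> *v u2 t \<omega>)))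
       \<psi>'"

text \<open>In the following, \<open>X u1 u2\<close> is the state controlled by \<open>u1\<close> and \<open>u2\<close>, and \<open>r u2\<close> is the
  follower's response to \<open>u2\<close>, so that \<open>X (r u2) u2\<close> is \<open>X\<^sup>*(u2)\<close>.\<close>

definition follower_optimal ::
  "('w, 'n::finite, 'm::finite, 'l::finite) game \<Rightarrow> ('w, 'n, 'm) state_map \<Rightarrow>
     ('w, 'm) control \<Rightarrow> ('w, 'm) control \<Rightarrow> bool" where
  "follower_optimal G X u2 v \<longleftrightarrow>
     v \<in> L2F G \<and> (\<forall>u1\<in>L2F G. J1 G (X v u2) v u2 \<le> J1 G (X u1 u2) u1 u2)"

definition follower_response ::
  "('w, 'n::finite, 'm::finite, 'l::finite) game \<Rightarrow> ('w, 'n, 'm) state_map \<Rightarrow> ('w, real^'n^'n) process \<Rightarrow>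
     (('w, 'm) control \<Rightarrow> ('w, 'm) control) \<Rightarrow>
     (('w, 'm) control \<Rightarrow> ('w, real^'n) process) \<Rightarrow> (('w, 'm) control \<Rightarrow> ('w, real^'n) process) \<Rightarrow> bool" where
  "follower_response G X \<phi>1 r \<psi>1 \<psi>1' \<longleftrightarrow>
     (\<forall>u2\<in>L2F G.
        follower_optimal G X u2 (r u2) \<and>
        follower_system G \<phi>1 (xi G) u2 (X (r u2) u2) (\<psi>1 u2) (\<psi>1' u2) \<and>
        process_eq (Om G) (t0 G) (t1 G) (r u2)
          (\<lambda>t \<omega>. - ((invE1 G t \<omega> ** transpose (cB1 G t \<omega>)) *v
                      (\<phi>1 t \<omega> *v X (r u2) u2 t \<omega> + \<psi>1 u2 t \<omega>))))"


section \<open>The leader's problem\<close>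

definition coercivity2 ::
  "('w, 'n::finite, 'm::finite, 'l::finite) game \<Rightarrow> ('w, real^'n^'n) process \<Rightarrow> bool" where
  "coercivity2 G \<phi>1 \<longleftrightarrow>
     (\<exists>\<epsilon>>0. \<forall>u\<in>L2F G. \<forall>X \<psi> \<psi>'. follower_system G \<phi>1 0 u X \<psi> \<psi>' \<longrightarrow>
        quadratic_cost G (cD2 G) (cE2 G) (cG2 G) X u \<ge> \<epsilon> * L2_inner (Om G) (t0 G) (t1 G) u u)"

definition \<rho> ::
  "('w, 'n::finite, 'm::finite, 'l::finite) game \<Rightarrow> ('w, 'n, 'm) state_map \<Rightarrow>
     (('w, 'm) control \<Rightarrow> ('w, 'm) control) \<Rightarrow> ('w, 'm) control \<Rightarrow> real^'l" where
  "\<rho> G X r u2 =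
     (\<integral>\<omega>. (LBINT t:{t0 G..t1 G}. transpose (c\<alpha> G t \<omega>) *v X (r u2) u2 t \<omega>
              + transpose (c\<beta> G t \<omega>) *v r u2 t \<omega> + transpose (c\<gamma> G t \<omega>) *v u2 t \<omega>)
            + transpose (c\<delta> G \<omega>) *v X (r u2) u2 (t1 G) \<omega> \<partial>Om G)"

definition U2ad ::
  "('w, 'n::finite, 'm::finite, 'l::finite) game \<Rightarrow> ('w, 'n, 'm) state_map \<Rightarrow>
     (('w, 'm) control \<Rightarrow> ('w, 'm) control) \<Rightarrow> ('w, 'm) control set" where
  "U2ad G X r =
     {u2 \<in> L2F G. (\<forall>i\<in>ineqs G. \<rho> G X r u2 $ i \<le> bnd G $ i) \<and> (\<forall>i\<in>- ineqs G. \<rho> G X r u2 $ i = bnd G $ i)}"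

definition leader_optimal ::
  "('w, 'n::finite, 'm::finite, 'l::finite) game \<Rightarrow> ('w, 'n, 'm) state_map \<Rightarrow>
     (('w, 'm) control \<Rightarrow> ('w, 'm) control) \<Rightarrow> ('w, 'm) control \<Rightarrow> bool" where
  "leader_optimal G X r v \<longleftrightarrow>
     v \<in> U2ad G X r \<and>
     (\<forall>u2\<in>U2ad G X r. J2 G (X (r v) v) (r v) v \<le> J2 G (X (r u2) u2) (r u2) u2)"

definition lagrangian ::
  "('w, 'n::finite, 'm::finite, 'l::finite) game \<Rightarrow> ('w, 'n, 'm) state_map \<Rightarrow>
     (('w, 'm) control \<Rightarrow> ('w, 'm) control) \<Rightarrow> real^'l \<Rightarrow> ('w, 'm) control \<Rightarrow> real" where
  "lagrangian G X r lam u2 =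
     J2 G (X (r u2) u2) (r u2) u2 + 2 * ((\<rho> G X r u2 - bnd G) \<bullet> lam)"

definition U0 :: "('w, 'n::finite, 'm::finite, 'l::finite) game \<Rightarrow> (real^'l) set" where
  "U0 G = {lam. \<forall>i\<in>ineqs G. lam $ i \<ge> 0}"


section \<open>Block coefficients and the Hamiltonian system\<close>

definition Fbar :: "('w, 'n::finite, 'm::finite, 'l::finite) game \<Rightarrow> ('w, real^('n + 'n)^('n + 'n)) process" where
  "Fbar G t \<omega> = block (S2 G t \<omega>) (- S1 G t \<omega>) (- S1 G t \<omega>) 0"

definition Cbar :: "('w, 'n::finite, 'm::finite, 'l::finite) game \<Rightarrow> ('w, real^('n + 'n)^('n + 'n)) process" where
  "Cbar G t \<omega> = block (cC G t \<omega>) 0 0 (cC G t \<omega>)"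

definition Abar ::
  "('w, 'n::finite, 'm::finite, 'l::finite) game \<Rightarrow> ('w, real^'n^'n) process \<Rightarrow>
     ('w, real^('n + 'n)^('n + 'n)) process" where
  "Abar G \<phi>1 t \<omega> =
     block (cA G t \<omega> - S1 G t \<omega> ** \<phi>1 t \<omega>) (S2 G t \<omega> ** \<phi>1 t \<omega>) 0 (cA G t \<omega> - S1 G t \<omega> ** \<phi>1 t \<omega>)"

text \<open>The lower right block is \<open>- \<phi>1 S2 \<phi>1\<close>; the source prints it without the minus sign.
  The sign is forced: the second component \<open>P2\<close> of the Hamiltonian system is the process \<open>\<psi>1\<close> of
  the follower's response to the control
  \<open>u = E2\<^sup>-\<^sup>1 B2\<^sup>T (\<phi>1 Z2 + P1) - E2\<^sup>-\<^sup>1 \<gamma> \<lambda>\<close>, so its drift has to contain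
  \<open>- \<phi>1 B2 u = - \<phi>1 S2 \<phi>1 Z2 - \<phi>1 S2 P1 + \<phi>1 B2 E2\<^sup>-\<^sup>1 \<gamma> \<lambda>\<close>, whose last two terms come from the
  transpose of \<open>Abar\<close> and from \<open>hvec\<close>. With the opposite sign, \<open>u\<close> is not optimal, already for
  deterministic scalar data without active constraints.\<close>

definition Dbar ::
  "('w, 'n::finite, 'm::finite, 'l::finite) game \<Rightarrow> ('w, real^'n^'n) process \<Rightarrow>
     ('w, real^('n + 'n)^('n + 'n)) process" where
  "Dbar G \<phi>1 t \<omega> = block (cD2 G t \<omega>) 0 0 (- (\<phi>1 t \<omega> ** S2 G t \<omega> ** \<phi>1 t \<omega>))"

definition gvec :: "('w, 'n::finite, 'm::finite, 'l::finite) game \<Rightarrow> ('w, real^'l^('n + 'n)) process" where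
  "gvec G t \<omega> =
     vstack (- (cB2 G t \<omega> ** invE2 G t \<omega> ** c\<gamma> G t \<omega>)) (cB1 G t \<omega> ** invE1 G t \<omega> ** c\<beta> G t \<omega>)"

definition hvec ::
  "('w, 'n::finite, 'm::finite, 'l::finite) game \<Rightarrow> ('w, real^'n^'n) process \<Rightarrow>
     ('w, real^'l^('n + 'n)) process" where
  "hvec G \<phi>1 t \<omega> =
     vstack (c\<alpha> G t \<omega> - \<phi>1 t \<omega> ** cB1 G t \<omega> ** invE1 G t \<omega> ** c\<beta> G t \<omega>)
            (\<phi>1 t \<omega> ** cB2 G t \<omega> ** invE2 G t \<omega> ** c\<gamma> G t \<omega>)"

definition riccati2 ::
  "('w, 'n::finite, 'm::finite, 'l::finite) game \<Rightarrow> ('w, real^'n^'n) process \<Rightarrow>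
     ('w, real^('n + 'n)^('n + 'n)) process \<Rightarrow> ('w, real^('n + 'n)^('n + 'n)) process \<Rightarrow> bool" where
  "riccati2 G \<phi>1 \<phi> \<phi>' \<longleftrightarrow>
     \<phi> \<in> LinfC G \<and> \<phi>' \<in> L2F G \<and> symmetric_pair G \<phi> \<phi>' \<and>
     (AE \<omega> in Om G. \<phi> (t1 G) \<omega> = block (cG2 G \<omega>) 0 0 0) \<and>
     itod G \<phi>
       (\<lambda>t \<omega>. - (transpose (Abar G \<phi>1 t \<omega>) ** \<phi> t \<omega> + \<phi> t \<omega> ** Abar G \<phi>1 t \<omega>
                + transpose (Cbar G t \<omega>) ** \<phi>' t \<omega> + \<phi>' t \<omega> ** Cbar G t \<omega>
                + transpose (Cbar G t \<omega>) ** \<phi> t \<omega> ** Cbar G t \<omega>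
                - \<phi> t \<omega> ** Fbar G t \<omega> ** \<phi> t \<omega> + Dbar G \<phi>1 t \<omega>))
       \<phi>'"

definition riccati2_unique ::
  "('w, 'n::finite, 'm::finite, 'l::finite) game \<Rightarrow> ('w, real^'n^'n) process \<Rightarrow>
     ('w, real^('n + 'n)^('n + 'n)) process \<Rightarrow> ('w, real^('n + 'n)^('n + 'n)) process \<Rightarrow> bool" where
  "riccati2_unique G \<phi>1 \<phi> \<phi>' \<longleftrightarrow>
     riccati2 G \<phi>1 \<phi> \<phi>' \<and>
     (\<forall>\<theta> \<theta>'. riccati2 G \<phi>1 \<theta> \<theta>' \<longrightarrow>
        indistinguishable (Om G) (t0 G) (t1 G) \<theta> \<phi> \<and> process_eq (Om G) (t0 G) (t1 G) \<theta>' \<phi>')"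

definition bsde_psi2 ::
  "('w, 'n::finite, 'm::finite, 'l::finite) game \<Rightarrow> ('w, real^'n^'n) process \<Rightarrow>
     ('w, real^('n + 'n)^('n + 'n)) process \<Rightarrow>
     ('w, real^'l^('n + 'n)) process \<Rightarrow> ('w, real^'l^('n + 'n)) process \<Rightarrow> bool" where
  "bsde_psi2 G \<phi>1 \<phi>2 \<psi> \<psi>' \<longleftrightarrow>
     \<psi> \<in> L2C G \<and> \<psi>' \<in> L2F G \<and>
     (AE \<omega> in Om G. \<psi> (t1 G) \<omega> = vstack (c\<delta> G \<omega>) 0) \<and>
     itod G \<psi>
       (\<lambda>t \<omega>. - ((transpose (Abar G \<phi>1 t \<omega>) - \<phi>2 t \<omega> ** Fbar G t \<omega>) ** \<psi> t \<omega>
                + transpose (Cbar G t \<omega>) ** \<psi>' t \<omega> + hvec G \<phi>1 t \<omega> + \<phi>2 t \<omega> ** gvec G t \<omega>))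
       \<psi>'"

definition hamiltonian_system ::
  "('w, 'n::finite, 'm::finite, 'l::finite) game \<Rightarrow> ('w, real^'n^'n) process \<Rightarrow> real^'l \<Rightarrow>
     ('w, real^('n + 'n)) process \<Rightarrow> ('w, real^('n + 'n)) process \<Rightarrow> ('w, real^('n + 'n)) process \<Rightarrow> bool" where
  "hamiltonian_system G \<phi>1 lam Z P Q \<longleftrightarrow>
     Z \<in> L2C G \<and> P \<in> L2C G \<and> Q \<in> L2F G \<and>
     (AE \<omega> in Om G. Z (t0 G) \<omega> = vstack (xi G) 0 \<and>
        P (t1 G) \<omega> = - (block (cG2 G \<omega>) 0 0 0 *v Z (t1 G) \<omega>) - vstack (c\<delta> G \<omega>) 0 *v lam) \<and>
     itod G Z
       (\<lambda>t \<omega>. Abar G \<phi>1 t \<omega> *v Z t \<omega> + Fbar G t \<omega> *v P t \<omega> + gvec G t \<omega> *v lam)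
       (\<lambda>t \<omega>. Cbar G t \<omega> *v Z t \<omega>) \<and>
     itod G P
       (\<lambda>t \<omega>. Dbar G \<phi>1 t \<omega> *v Z t \<omega> - transpose (Abar G \<phi>1 t \<omega>) *v P t \<omega>
              - transpose (Cbar G t \<omega>) *v Q t \<omega> + hvec G \<phi>1 t \<omega> *v lam)
       Q"

definition feedback ::
  "('w, 'n::finite, 'm::finite, 'l::finite) game \<Rightarrow> ('w, real^'n^'n) process \<Rightarrow>
     ('w, real^('n + 'n)^('n + 'n)) process \<Rightarrow> ('w, real^'l^('n + 'n)) process \<Rightarrow>
     ('w, real^('n + 'n)) process \<Rightarrow> real^'l \<Rightarrow> ('w, 'm) control" where
  "feedback G \<phi>1 \<phi>2 \<psi>2 Z lam t \<omega> =
     (hstack 0 (invE2 G t \<omega> ** transpose (cB2 G t \<omega>) ** \<phi>1 t \<omega>)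
        - hstack (invE2 G t \<omega> ** transpose (cB2 G t \<omega>)) 0 ** \<phi>2 t \<omega>) *v Z t \<omega>
     - (hstack (invE2 G t \<omega> ** transpose (cB2 G t \<omega>)) 0 ** \<psi>2 t \<omega>
        + invE2 G t \<omega> ** c\<gamma> G t \<omega>) *v lam"

definition S0 ::
  "('w, 'n::finite, 'm::finite, 'l::finite) game \<Rightarrow> ('w, real^'l^('n + 'n)) process \<Rightarrow> real^'l^'l" where
  "S0 G \<psi>2 =
     - (\<integral>\<omega>. (LBINT t:{t0 G..t1 G}.
            transpose (\<psi>2 t \<omega>) ** gvec G t \<omega> + transpose (gvec G t \<omega>) ** \<psi>2 t \<omega>
            - transpose (c\<gamma> G t \<omega>) ** invE2 G t \<omega> ** c\<gamma> G t \<omega>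
            - transpose (\<psi>2 t \<omega>) ** Fbar G t \<omega> ** \<psi>2 t \<omega>) \<partial>Om G)"


section \<open>Slater condition, KKT condition and dual problem\<close>

definition slater_system ::
  "('w, 'n::finite, 'm::finite, 'l::finite) game \<Rightarrow> ('w, real^'n^'n) process \<Rightarrow> 'l \<Rightarrow>
     ('w, real^'n) process \<Rightarrow> ('w, real^'n) process \<Rightarrow> ('w, real^'n) process \<Rightarrow> bool" where
  "slater_system G \<phi>1 i Y p q \<longleftrightarrow>
     Y \<in> L2C G \<and> p \<in> L2C G \<and> q \<in> L2F G \<and>
     (AE \<omega> in Om G. Y (t0 G) \<omega> = 0 \<and> p (t1 G) \<omega> = - column i (c\<delta> G \<omega>)) \<and>
     itod G Y
       (\<lambda>t \<omega>. (cA G t \<omega> - S1 G t \<omega> ** \<phi>1 t \<omega>) *v Y t \<omega> - S1 G t \<omega> *v p t \<omega>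
              - (cB1 G t \<omega> ** invE1 G t \<omega>) *v column i (c\<beta> G t \<omega>))
       (\<lambda>t \<omega>. cC G t \<omega> *v Y t \<omega>) \<and>
     itod G p
       (\<lambda>t \<omega>. - ((transpose (cA G t \<omega>) - \<phi>1 t \<omega> ** S1 G t \<omega>) *v p t \<omega>
                + transpose (cC G t \<omega>) *v q t \<omega> + column i (c\<alpha> G t \<omega>)
                - (\<phi>1 t \<omega> ** cB1 G t \<omega> ** invE1 G t \<omega>) *v column i (c\<beta> G t \<omega>)))
       q"

definition slater_rho ::
  "('w, 'n::finite, 'm::finite, 'l::finite) game \<Rightarrow> ('w, real^'n^'n) process \<Rightarrow>
     ('l \<Rightarrow> ('w, real^'n) process) \<Rightarrow> ('l \<Rightarrow> ('w, real^'n) process) \<Rightarrow> 'l \<Rightarrow> ('w, 'm) control" where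
  "slater_rho G \<phi>1 Y p i t \<omega> =
     transpose (cB2 G t \<omega>) *v (p i t \<omega> - \<phi>1 t \<omega> *v Y i t \<omega>) + column i (c\<gamma> G t \<omega>)"

definition slater_a ::
  "('w, 'n::finite, 'm::finite, 'l::finite) game \<Rightarrow> ('l \<Rightarrow> ('w, real^'n) process) \<Rightarrow> 'l \<Rightarrow> real" where
  "slater_a G p i = bnd G $ i + (\<integral>\<omega>. p i (t0 G) \<omega> \<partial>Om G) \<bullet> xi G"

definition slater ::
  "('w, 'n::finite, 'm::finite, 'l::finite) game \<Rightarrow> ('w, 'n, 'm) state_map \<Rightarrow>
     (('w, 'm) control \<Rightarrow> ('w, 'm) control) \<Rightarrow> ('w, real^'n^'n) process \<Rightarrow>
     ('l \<Rightarrow> ('w, real^'n) process) \<Rightarrow> ('l \<Rightarrow> ('w, real^'n) process) \<Rightarrow> bool" where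
  "slater G X r \<phi>1 Y p \<longleftrightarrow>
     (\<exists>v\<in>U2ad G X r.
        (\<forall>i\<in>ineqs G. L2_inner (Om G) (t0 G) (t1 G) v (slater_rho G \<phi>1 Y p i) < slater_a G p i) \<and>
        (\<forall>i\<in>- ineqs G. L2_inner (Om G) (t0 G) (t1 G) v (slater_rho G \<phi>1 Y p i) = slater_a G p i)) \<and>
     (\<forall>k::'l \<Rightarrow> real.
        (AE \<omega> in Om G. \<forall>t\<in>{t0 G..t1 G}. (\<Sum>i\<in>- ineqs G. k i *\<^sub>R slater_rho G \<phi>1 Y p i t \<omega>) = 0)
        \<longrightarrow> (\<forall>i\<in>- ineqs G. k i = 0))"

text \<open>\<open>w lam\<close> stands for the control \<open>u2\<^sup>*(lam)\<close>.\<close>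

definition kkt ::
  "('w, 'n::finite, 'm::finite, 'l::finite) game \<Rightarrow> ('w, 'n, 'm) state_map \<Rightarrow>
     (('w, 'm) control \<Rightarrow> ('w, 'm) control) \<Rightarrow> (real^'l \<Rightarrow> ('w, 'm) control) \<Rightarrow>
     ('w, 'm) control \<Rightarrow> real^'l \<Rightarrow> bool" where
  "kkt G X r w v lam \<longleftrightarrow>
     process_eq (Om G) (t0 G) (t1 G) v (w lam) \<and>
     (\<forall>i\<in>ineqs G. lam $ i \<ge> 0 \<and> \<rho> G X r (w lam) $ i - bnd G $ i \<le> 0 \<and>
        lam $ i * (\<rho> G X r (w lam) $ i - bnd G $ i) = 0) \<and>
     (\<forall>i\<in>- ineqs G. \<rho> G X r (w lam) $ i = bnd G $ i)"

definition unique_dual_solution ::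
  "('w, 'n::finite, 'm::finite, 'l::finite) game \<Rightarrow> ('w, 'n, 'm) state_map \<Rightarrow>
     (('w, 'm) control \<Rightarrow> ('w, 'm) control) \<Rightarrow> (real^'l \<Rightarrow> ('w, 'm) control) \<Rightarrow> real^'l \<Rightarrow> bool" where
  "unique_dual_solution G X r w lam \<longleftrightarrow>
     (\<forall>mu. (mu \<in> U0 G \<and> (\<forall>nu\<in>U0 G. lagrangian G X r nu (w nu) \<le> lagrangian G X r mu (w mu)))
           \<longleftrightarrow> mu = lam)"

end

theory Submission
  imports Defs
begin

text \<open>The leader's Lagrangian is a quadratic functional of his control, and its second order part is
  coercive. For \<open>\<lambda> \<in> U0\<close> the Hamiltonian system provides a stationary point: pairing the first half of
  \<open>P\<close> with the variation of the state and the second half of \<open>Z\<close> with the variation of the follower's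
  adjoint cancels the first order part. Hence, for every control \<open>v\<close>, the Lagrangian at \<open>v\<close> equals its
  value at \<open>u2\<^sup>*(\<lambda>)\<close> plus the coercive quadratic cost of \<open>v - u2\<^sup>*(\<lambda>)\<close>, and optimality under the KKT
  condition is Lagrangian duality. If \<open>\<mu>\<close> is another dual solution, the coercive term forces
  \<open>u2\<^sup>*(\<mu>) = u2\<^sup>*(\<lambda>)\<close>; then the constraint values agree, and these are affine in the multiplier with
  linear part \<open>- S0\<close>, which is injective.

  The only stochastic calculus that is needed is Ito's product rule in expectation, which follows from
  the isometry and the martingale property of the integral. The weights \<open>E1\<close> and \<open>E2\<close> are merely
  assumed to be invertible; that their inverses are essentially bounded is a consequence of the
  coercivity conditions.\<close>

section \<open>Square integrable functions\<close>

text \<open>Two obstacles shape the proof. Pointwise invertibility of \<open>cE1\<close> and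
  \<open>cE2\<close> bounds no inverse, so a priori the drifts containing \<open>S1\<close> and
  \<open>S2\<close> need not be square integrable, as the product rule demands. Coercivity is
  therefore tested with controls supported on a time interval of length \<open>h\<close>: then
  \<open>\<epsilon> |u|^2 \<le> <E u, u> + O(h) |u|^2\<close>, hence
  \<open>E \<ge> \<epsilon>/2\<close> almost everywhere. \<open>cE1\<close> is treated first, by the
  plain state equation, because the follower's system, which serves for \<open>cE2\<close>, contains
  \<open>S1\<close>. The factor \<open>h\<close> is the reason why the Gronwall lemmas carry a
  second forcing term, supported on a short interval. Moreover, controls matter only up to null
  sets, while \<open>\<rho>\<close> and \<open>J2\<close> evaluate the state assigned to one
  particular control. Uniqueness for the follower's system, which is its a priori estimate for a
  vanishing control, transfers values between versions. Costs and pairings are written as single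
  integrals over the product of time and chance, where one almost-everywhere statement covers both
  variables.\<close>

definition sq_integrable :: "'b measure \<Rightarrow> ('b \<Rightarrow> 'a::euclidean_space) \<Rightarrow> bool" where
  "sq_integrable M f \<longleftrightarrow> f \<in> borel_measurable M \<and> integrable M (\<lambda>x. (norm (f x))\<^sup>2)"

lemma sq_integrable_measurable: "sq_integrable M f \<Longrightarrow> f \<in> borel_measurable M"
  and sq_integrable_norm: "sq_integrable M f \<Longrightarrow> integrable M (\<lambda>x. (norm (f x))\<^sup>2)"
  by (auto simp: sq_integrable_def)

lemma sq_integrable_iff_nn_integral:
  "sq_integrable M f \<longleftrightarrow> f \<in> borel_measurable M \<and> (\<integral>\<^sup>+x. ennreal ((norm (f x))\<^sup>2) \<partial>M) < \<infinity>"
  unfolding sq_integrable_def integrable_iff_bounded by auto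

lemma sq_integrable_bound:
  assumes "sq_integrable M g" "f \<in> borel_measurable M" "AE x in M. norm (f x) \<le> K * norm (g x)"
  shows "sq_integrable M f"
  unfolding sq_integrable_def
proof (rule conjI[OF _ Bochner_Integration.integrable_bound[where f="\<lambda>x. K\<^sup>2 * (norm (g x))\<^sup>2"]])
  show "AE x in M. norm ((norm (f x))\<^sup>2) \<le> norm (K\<^sup>2 * (norm (g x))\<^sup>2)"
    using assms(3)
  proof eventually_elim
    case (elim x)
    then have "(norm (f x))\<^sup>2 \<le> (K * norm (g x))\<^sup>2" by (intro power_mono) auto
    then show ?case by (simp add: power_mult_distrib)
  qed
qed (use assms in \<open>auto simp: sq_integrable_def\<close>)

lemma sq_integrable_cong_AE:
  assumes "sq_integrable M g" "f \<in> borel_measurable M" "AE x in M. f x = g x"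
  shows "sq_integrable M f"
  using assms by (intro sq_integrable_bound[of M g f 1]) auto

lemma sq_integrable_add:
  assumes "sq_integrable M f" "sq_integrable M g"
  shows "sq_integrable M (\<lambda>x. f x + g x)"
  unfolding sq_integrable_def
proof (rule conjI[OF _ Bochner_Integration.integrable_bound[where f="\<lambda>x. 2 * (norm (f x))\<^sup>2 + 2 * (norm (g x))\<^sup>2"]])
  show "AE x in M. norm ((norm (f x + g x))\<^sup>2) \<le> norm (2 * (norm (f x))\<^sup>2 + 2 * (norm (g x))\<^sup>2)"
  proof (rule AE_I2)
    fix x
    have "(norm (f x + g x))\<^sup>2 \<le> (norm (f x) + norm (g x))\<^sup>2"
      by (intro power_mono norm_triangle_ineq) auto
    also have "\<dots> \<le> 2 * (norm (f x))\<^sup>2 + 2 * (norm (g x))\<^sup>2"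
      using sum_squares_bound[of "norm (f x)" "norm (g x)"] by (simp add: power2_sum)
    finally show "norm ((norm (f x + g x))\<^sup>2) \<le> norm (2 * (norm (f x))\<^sup>2 + 2 * (norm (g x))\<^sup>2)"
      by simp
  qed
qed (use assms in \<open>auto simp: sq_integrable_def\<close>)

lemma sq_integrable_bounded_linear:
  fixes F :: "'a::euclidean_space \<Rightarrow> 'b::euclidean_space"
  assumes "bounded_linear F" "sq_integrable M f"
  shows "sq_integrable M (\<lambda>x. F (f x))"
proof (rule sq_integrable_bound[OF assms(2), of _ "onorm F"])
  show "(\<lambda>x. F (f x)) \<in> borel_measurable M"
    using assms sq_integrable_measurable
    by (intro measurable_compose[of f M borel F] borel_measurable_continuous_onI)
       (auto intro: linear_continuous_on)
qed (use onorm[OF assms(1)] in auto)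

lemma sq_integrable_uminus: "sq_integrable M f \<Longrightarrow> sq_integrable M (\<lambda>x. - f x)"
  by (auto simp: sq_integrable_def)

lemma sq_integrable_diff:
  "sq_integrable M f \<Longrightarrow> sq_integrable M g \<Longrightarrow> sq_integrable M (\<lambda>x. f x - g x)"
  using sq_integrable_add[of M f "\<lambda>x. - g x"] by (simp add: sq_integrable_uminus)

lemma sq_integrable_zero: "sq_integrable M (\<lambda>x. 0)"
  by (auto simp: sq_integrable_def)

lemma sq_integrable_indicator:
  assumes "sq_integrable M f" "Measurable.pred M A"
  shows "sq_integrable M (\<lambda>x. (if A x then f x else 0))"
  using assms(2) sq_integrable_measurable[OF assms(1)]
  by (intro sq_integrable_bound[OF assms(1), of _ 1]) (auto intro!: measurable_If)

lemma integrable_inner: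
  assumes "sq_integrable M f" "sq_integrable M g"
  shows "integrable M (\<lambda>x. f x \<bullet> g x)"
proof (rule Bochner_Integration.integrable_bound[where f="\<lambda>x. (norm (f x))\<^sup>2 + (norm (g x))\<^sup>2"])
  show "AE x in M. norm (f x \<bullet> g x) \<le> norm ((norm (f x))\<^sup>2 + (norm (g x))\<^sup>2)"
  proof (rule AE_I2)
    fix x
    have "\<bar>f x \<bullet> g x\<bar> \<le> norm (f x) * norm (g x)" by (rule Cauchy_Schwarz_ineq2)
    moreover have "0 \<le> norm (f x) * norm (g x)" by simp
    ultimately show "norm (f x \<bullet> g x) \<le> norm ((norm (f x))\<^sup>2 + (norm (g x))\<^sup>2)"
      using sum_squares_bound[of "norm (f x)" "norm (g x)"] by simp
  qed
qed (use assms in \<open>auto simp: sq_integrable_def\<close>)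

lemma sq_integrable_norm_real: "sq_integrable M f \<Longrightarrow> sq_integrable M (\<lambda>x. norm (f x))"
  by (auto simp: sq_integrable_def)

lemma (in finite_measure) sq_integrable_const: "sq_integrable M (\<lambda>x. c)"
  by (auto simp: sq_integrable_def)

lemma (in finite_measure) sq_integrable_integrable:
  assumes "sq_integrable M f"
  shows "integrable M f"
proof (rule Bochner_Integration.integrable_bound[where f="\<lambda>x. norm (f x) \<bullet> 1"])
  show "integrable M (\<lambda>x. norm (f x) \<bullet> 1)"
    by (intro integrable_inner sq_integrable_norm_real assms sq_integrable_const)
qed (use assms in \<open>auto simp: sq_integrable_def\<close>)

text \<open>The polynomial \<open>t \<mapsto> ?A + 2 t ?C + t^2 ?B\<close> is the integral of
  \<open>|f + t g|^2\<close>, hence nonnegative, and its discriminant is nonpositive. If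
  \<open>?B = 0\<close> it is affine, which forces \<open>?C = 0\<close>.\<close>

lemma inner_integral_Cauchy_Schwarz:
  assumes f: "sq_integrable M f" and g: "sq_integrable M g"
  shows "(\<integral>x. f x \<bullet> g x \<partial>M)\<^sup>2 \<le> (\<integral>x. (norm (f x))\<^sup>2 \<partial>M) * (\<integral>x. (norm (g x))\<^sup>2 \<partial>M)"
    (is "?C\<^sup>2 \<le> ?A * ?B")
proof -
  have q: "0 \<le> ?A + 2 * t * ?C + t\<^sup>2 * ?B" for t :: real
  proof -
    have "0 \<le> (\<integral>x. (norm (f x + t *\<^sub>R g x))\<^sup>2 \<partial>M)" by simp
    also have "\<dots> = (\<integral>x. (norm (f x))\<^sup>2 + 2 * t * (f x \<bullet> g x) + t\<^sup>2 * (norm (g x))\<^sup>2 \<partial>M)"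
      unfolding power2_norm_eq_inner
      by (intro Bochner_Integration.integral_cong refl)
         (simp add: inner_add inner_commute algebra_simps power2_eq_square)
    also have "\<dots> = ?A + 2 * t * ?C + t\<^sup>2 * ?B"
      using integrable_inner[OF f g] sq_integrable_norm[OF f] sq_integrable_norm[OF g] by simp
    finally show ?thesis .
  qed
  show ?thesis
  proof (cases "?B = 0")
    case True
    have "?C = 0"
    proof (rule ccontr)
      assume "?C \<noteq> 0"
      \<comment> \<open>At this \<open>t\<close> the affine function takes the value
        \<open>- 1\<close>.\<close>
      then show False using q[of "- (?A + 1) / (2 * ?C)"] True by (simp add: field_simps)
    qed
    then show ?thesis using True by simp
  next
    case False
    moreover have "?B \<ge> 0" by simp
    ultimately have "?B > 0" by linarith
    \<comment> \<open>\<open>- ?C / ?B\<close> is the minimizer of the polynomial; the factor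
      \<open>?B\<close> clears the denominator.\<close>
    have "0 \<le> ?B * (?A + 2 * (- ?C / ?B) * ?C + (- ?C / ?B)\<^sup>2 * ?B)"
      using q[of "- ?C / ?B"] \<open>?B > 0\<close> by (intro mult_nonneg_nonneg) auto
    also have "\<dots> = ?A * ?B - ?C\<^sup>2"
      using \<open>?B > 0\<close> by (simp add: power2_eq_square field_simps del: integral_mult_left integral_mult_right)
    finally show ?thesis by simp
  qed
qed

text \<open>This carries bilinear identities from simple processes to their mean-square limits: the
  isometry with two varying factors, the martingale property with one of them constant.\<close>

lemma tendsto_integral_inner:
  fixes f g :: "'b \<Rightarrow> 'a::euclidean_space" and F G :: "nat \<Rightarrow> 'b \<Rightarrow> 'a"
  assumes f: "sq_integrable M f" and g: "sq_integrable M g"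
    and F: "\<And>k. sq_integrable M (F k)" and G: "\<And>k. sq_integrable M (G k)"
    and limF: "(\<lambda>k. \<integral>\<^sup>+x. ennreal ((norm (F k x - f x))\<^sup>2) \<partial>M) \<longlonglongrightarrow> 0"
    and limG: "(\<lambda>k. \<integral>\<^sup>+x. ennreal ((norm (G k x - g x))\<^sup>2) \<partial>M) \<longlonglongrightarrow> 0"
  shows "(\<lambda>k. \<integral>x. F k x \<bullet> G k x \<partial>M) \<longlonglongrightarrow> (\<integral>x. f x \<bullet> g x \<partial>M)"
proof -
  have *: "(\<lambda>k. \<integral>x. (norm (H k x - h x))\<^sup>2 \<partial>M) \<longlonglongrightarrow> 0"
    if h: "sq_integrable M h" and H: "\<And>k. sq_integrable M (H k)"
      and lim: "(\<lambda>k. \<integral>\<^sup>+x. ennreal ((norm (H k x - h x))\<^sup>2) \<partial>M) \<longlonglongrightarrow> 0"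
    for h :: "'b \<Rightarrow> 'a" and H :: "nat \<Rightarrow> 'b \<Rightarrow> 'a"
  proof -
    have "(\<integral>\<^sup>+x. ennreal ((norm (H k x - h x))\<^sup>2) \<partial>M) = ennreal (\<integral>x. (norm (H k x - h x))\<^sup>2 \<partial>M)" for k
      by (intro nn_integral_eq_integral sq_integrable_norm sq_integrable_diff H h) auto
    with lim have "(\<lambda>k. ennreal (\<integral>x. (norm (H k x - h x))\<^sup>2 \<partial>M)) \<longlonglongrightarrow> ennreal 0" by simp
    then show ?thesis by (subst (asm) tendsto_ennreal_iff) auto
  qed
  \<comment> \<open>The norms of the second factor only have to converge, so the same statement
    handles a vanishing factor and a fixed one.\<close>
  have CS: "(\<lambda>k. \<integral>x. H k x \<bullet> H' k x \<partial>M) \<longlonglongrightarrow> 0"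
    if "\<And>k. sq_integrable M (H k)" "\<And>k. sq_integrable M (H' k)"
      "(\<lambda>k. \<integral>x. (norm (H k x))\<^sup>2 \<partial>M) \<longlonglongrightarrow> 0" "(\<lambda>k. \<integral>x. (norm (H' k x))\<^sup>2 \<partial>M) \<longlonglongrightarrow> c"
    for H H' :: "nat \<Rightarrow> 'b \<Rightarrow> 'a" and c
  proof -
    have "(\<lambda>k. (\<integral>x. H k x \<bullet> H' k x \<partial>M)\<^sup>2) \<longlonglongrightarrow> 0"
    proof (rule tendsto_sandwich[OF _ _ tendsto_const])
      show "(\<lambda>k. (\<integral>x. (norm (H k x))\<^sup>2 \<partial>M) * (\<integral>x. (norm (H' k x))\<^sup>2 \<partial>M)) \<longlonglongrightarrow> 0"
        using tendsto_mult[OF that(3,4)] by simp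
    qed (use inner_integral_Cauchy_Schwarz[OF that(1,2)] in auto)
    then show ?thesis by simp
  qed
  have nF: "(\<lambda>k. \<integral>x. (norm (F k x - f x))\<^sup>2 \<partial>M) \<longlonglongrightarrow> 0" by (rule *[OF f F limF])
  have nG: "(\<lambda>k. \<integral>x. (norm (G k x - g x))\<^sup>2 \<partial>M) \<longlonglongrightarrow> 0" by (rule *[OF g G limG])
  have 1: "(\<lambda>k. \<integral>x. (F k x - f x) \<bullet> (G k x - g x) \<partial>M) \<longlonglongrightarrow> 0"
    by (rule CS[OF _ _ nF nG]) (auto intro: sq_integrable_diff f g F G)
  have 2: "(\<lambda>k. \<integral>x. (F k x - f x) \<bullet> g x \<partial>M) \<longlonglongrightarrow> 0"
    by (rule CS[OF _ _ nF tendsto_const]) (auto intro: sq_integrable_diff f g F G)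
  have 3: "(\<lambda>k. \<integral>x. (G k x - g x) \<bullet> f x \<partial>M) \<longlonglongrightarrow> 0"
    by (rule CS[OF _ _ nG tendsto_const]) (auto intro: sq_integrable_diff f g F G)
  \<comment> \<open>Expansion around \<open>f\<close> and \<open>g\<close>; each of the three error
    terms contains a difference that tends to zero in mean square.\<close>
  have "(\<integral>x. F k x \<bullet> G k x \<partial>M) = (\<integral>x. f x \<bullet> g x \<partial>M) + (\<integral>x. (F k x - f x) \<bullet> (G k x - g x) \<partial>M)
      + (\<integral>x. (F k x - f x) \<bullet> g x \<partial>M) + (\<integral>x. (G k x - g x) \<bullet> f x \<partial>M)" for k
  proof -
    have "F k x \<bullet> G k x = f x \<bullet> g x + (F k x - f x) \<bullet> (G k x - g x) + (F k x - f x) \<bullet> g x + (G k x - g x) \<bullet> f x" for x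
      by (simp add: algebra_simps inner_commute inner_diff)
    then show ?thesis
      using integrable_inner[OF f g] integrable_inner[OF sq_integrable_diff[OF F f] sq_integrable_diff[OF G g]]
        integrable_inner[OF sq_integrable_diff[OF F f] g] integrable_inner[OF sq_integrable_diff[OF G g] f]
      by (simp del: inner_diff_left inner_diff_right)
  qed
  then show ?thesis
    using tendsto_add[OF tendsto_add[OF tendsto_add[OF tendsto_const 1] 2] 3, of "\<integral>x. f x \<bullet> g x \<partial>M"]
    by simp
qed


section \<open>Moments of Brownian increments\<close>

locale brownian_interval = prob_space M for M :: "'w measure" +
  fixes W :: "('w, real) process" and s T :: real
  assumes bm: "brownian_motion M W" and s_nonneg: "0 \<le> s" and s_less_T: "s < T"
begin

abbreviation "\<F> \<equiv> bm_filtration M W"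

lemma W_measurable: "0 \<le> t \<Longrightarrow> W t \<in> borel_measurable M"
  using bm by (auto simp: brownian_motion_def)

lemma generator_subset:
  "{W r -` S \<inter> space M | r S. 0 \<le> r \<and> r \<le> t \<and> S \<in> sets borel} \<union> null_sets M \<subseteq> sets M"
  using W_measurable by (auto simp: null_sets_def intro: measurable_sets)

lemma generator_Pow:
  "{W r -` S \<inter> space M | r S. 0 \<le> r \<and> r \<le> t \<and> S \<in> sets borel} \<union> null_sets M \<subseteq> Pow (space M)"
  using generator_subset[of t] sets.space_closed by blast

lemma space_filtration [simp]: "space (\<F> t) = space M"
  unfolding bm_filtration_def by (rule space_measure_of[OF generator_Pow])

lemma sets_filtration:
  "sets (\<F> t) = sigma_sets (space M)
     ({W r -` S \<inter> space M | r S. 0 \<le> r \<and> r \<le> t \<and> S \<in> sets borel} \<union> null_sets M)"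
  unfolding bm_filtration_def by (rule sets_measure_of[OF generator_Pow])

lemma subalgebra_filtration: "subalgebra M (\<F> t)"
  unfolding subalgebra_def sets_filtration
  by (intro conjI sets.sigma_sets_subset generator_subset space_filtration)

lemma filtration_mono:
  assumes "r \<le> t"
  shows "sets (\<F> r) \<subseteq> sets (\<F> t)"
  unfolding sets_filtration
proof (intro sigma_sets_mono' Un_mono subset_refl subsetI)
  fix A assume "A \<in> {W u -` S \<inter> space M |u S. 0 \<le> u \<and> u \<le> r \<and> S \<in> sets borel}"
  then obtain u S where "A = W u -` S \<inter> space M" "0 \<le> u" "u \<le> r" "S \<in> sets borel" by auto
  with assms show "A \<in> {W u -` S \<inter> space M |u S. 0 \<le> u \<and> u \<le> t \<and> S \<in> sets borel}"
    by (intro CollectI exI[of _ u] exI[of _ S]) auto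
qed

lemma subalgebra_filtration_mono: "r \<le> t \<Longrightarrow> subalgebra (\<F> t) (\<F> r)"
  using filtration_mono by (auto simp: subalgebra_def)

lemma measurable_filtration_M: "f \<in> borel_measurable (\<F> t) \<Longrightarrow> f \<in> borel_measurable M"
  by (rule measurable_from_subalg[OF subalgebra_filtration])

lemma measurable_filtration_mono: "f \<in> borel_measurable (\<F> r) \<Longrightarrow> r \<le> t \<Longrightarrow> f \<in> borel_measurable (\<F> t)"
  by (rule measurable_from_subalg[OF subalgebra_filtration_mono])

lemma W_measurable_filtration:
  assumes "0 \<le> r" "r \<le> t"
  shows "W r \<in> borel_measurable (\<F> t)"
proof (rule measurableI)
  fix A :: "real set" assume "A \<in> sets borel"
  then have "W r -` A \<inter> space M \<in> sets (\<F> t)"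
    unfolding sets_filtration using assms by (intro sigma_sets.Basic) blast
  then show "W r -` A \<inter> space (\<F> t) \<in> sets (\<F> t)" by simp
qed simp

section \<open>Independence of increments from the augmented filtration\<close>

lemma sets_natural_filtration:
  "sets (natural_filtration M W t) = sigma_sets (space M)
     {W r -` S \<inter> space M | r S. 0 \<le> r \<and> r \<le> t \<and> S \<in> sets borel}"
  unfolding natural_filtration_def using generator_Pow[of t] by (intro sets_measure_of) blast

lemma natural_filtration_subset: "sets (natural_filtration M W t) \<subseteq> sets M"
  unfolding sets_natural_filtration using generator_subset[of t] by (intro sets.sigma_sets_subset) blast

text \<open>\<open>brownian_motion\<close> grants independence only from the natural filtration,
  whereas processes are adapted to the augmented one. The events that agree almost surely with a
  natural event form a sigma-algebra containing both kinds of generators.\<close>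

lemma filtration_AE_eq_natural:
  assumes "A \<in> sets (\<F> t)"
  shows "\<exists>A'\<in>sets (natural_filtration M W t). AE \<omega> in M. \<omega> \<in> A \<longleftrightarrow> \<omega> \<in> A'"
  using assms unfolding sets_filtration
proof induction
  case (Basic a)
  then consider "a \<in> {W r -` S \<inter> space M | r S. 0 \<le> r \<and> r \<le> t \<and> S \<in> sets borel}"
    | "a \<in> null_sets M" by blast
  then show ?case
  proof cases
    case 1
    then show ?thesis unfolding sets_natural_filtration by (intro bexI[of _ a]) auto
  next
    case 2
    then show ?thesis unfolding sets_natural_filtration
      by (intro bexI[of _ "{}"]) (auto dest: AE_not_in intro: sigma_sets.Empty)
  qed
next
  case Empty
  show ?case unfolding sets_natural_filtration by (intro bexI[of _ "{}"]) (auto intro: sigma_sets.Empty)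
next
  case (Compl a)
  then obtain a' where "a' \<in> sets (natural_filtration M W t)" "AE \<omega> in M. \<omega> \<in> a \<longleftrightarrow> \<omega> \<in> a'" by blast
  then show ?case unfolding sets_natural_filtration
    by (intro bexI[of _ "space M - a'"] sigma_sets.Compl) auto
next
  case (Union a)
  then obtain a' where a': "\<And>i. a' i \<in> sets (natural_filtration M W t)"
    "\<And>i. AE \<omega> in M. \<omega> \<in> a i \<longleftrightarrow> \<omega> \<in> a' i" by metis
  have "AE \<omega> in M. \<forall>i::nat. \<omega> \<in> a i \<longleftrightarrow> \<omega> \<in> a' i" using a'(2) by (simp add: AE_all_countable)
  then have "AE \<omega> in M. \<omega> \<in> (\<Union>i. a i) \<longleftrightarrow> \<omega> \<in> (\<Union>i. a' i)" by eventually_elim auto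
  then show ?case using a'(1) by (intro bexI[of _ "\<Union>i. a' i"]) auto
qed

text \<open>Independence involves probabilities only, so an event may be traded for its almost
  surely equal natural representative.\<close>

lemma indep_filtration_increment:
  assumes "0 \<le> r" "r < t"
  shows "indep_set (sets (\<F> r)) {(\<lambda>\<omega>. W t \<omega> - W r \<omega>) -` S \<inter> space M | S. S \<in> sets borel}"
    (is "indep_set _ ?B")
proof -
  have ind: "indep_set (sets (natural_filtration M W r)) ?B"
    using bm assms by (auto simp: brownian_motion_def)
  show ?thesis
  proof (rule indep_setI)
    show "sets (\<F> r) \<subseteq> events" using subalgebra_filtration by (auto simp: subalgebra_def)
    show B: "?B \<subseteq> events" using indep_setD_ev2[OF ind] .
    fix a b assume a: "a \<in> sets (\<F> r)" and b: "b \<in> ?B"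
    obtain a' where a': "a' \<in> sets (natural_filtration M W r)" "AE \<omega> in M. \<omega> \<in> a \<longleftrightarrow> \<omega> \<in> a'"
      using filtration_AE_eq_natural[OF a] by blast
    have m: "a \<in> events" "a' \<in> events" "b \<in> events"
      using a a'(1) b B subalgebra_filtration[of r] natural_filtration_subset by (auto simp: subalgebra_def)
    have "prob (a \<inter> b) = prob (a' \<inter> b)"
      using a'(2) m by (intro measure_eq_AE) auto
    also have "\<dots> = prob a' * prob b" by (rule indep_setD[OF ind a'(1) b])
    also have "prob a' = prob a" using a'(2) m by (intro measure_eq_AE) auto
    finally show "prob (a \<inter> b) = prob a * prob b" .
  qed
qed

lemma indep_var_increment:
  assumes "0 \<le> r" "r < t" and \<theta>: "\<theta> \<in> borel_measurable (\<F> r)"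
  shows "indep_var borel \<theta> borel (\<lambda>\<omega>. W t \<omega> - W r \<omega>)"
  unfolding indep_var_eq
proof (intro conjI indep_set_sigma_sets)
  show "random_variable borel \<theta>" by (rule measurable_filtration_M[OF \<theta>])
  show "random_variable borel (\<lambda>\<omega>. W t \<omega> - W r \<omega>)"
    using assms by (intro borel_measurable_diff W_measurable) auto
  show "indep_set {\<theta> -` A \<inter> space M |A. A \<in> sets borel} {(\<lambda>\<omega>. W t \<omega> - W r \<omega>) -` A \<inter> space M |A. A \<in> sets borel}"
    unfolding indep_set_def
  proof (rule indep_sets_mono_sets[OF indep_filtration_increment[OF assms(1,2), unfolded indep_set_def]])
    fix i
    show "(case i of True \<Rightarrow> {\<theta> -` A \<inter> space M |A. A \<in> sets borel}
       | False \<Rightarrow> {(\<lambda>\<omega>. W t \<omega> - W r \<omega>) -` A \<inter> space M |A. A \<in> sets borel})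
      \<subseteq> (case i of True \<Rightarrow> sets (\<F> r)
       | False \<Rightarrow> {(\<lambda>\<omega>. W t \<omega> - W r \<omega>) -` S \<inter> space M |S. S \<in> sets borel})"
      using measurable_sets[OF \<theta>] by (auto split: bool.split)
  qed
  have vimage_Int_stable: "Int_stable {X -` A \<inter> space M |A. A \<in> sets borel}" for X :: "'w \<Rightarrow> real"
  proof (rule Int_stableI)
    fix a b assume "a \<in> {X -` A \<inter> space M |A. A \<in> sets borel}" "b \<in> {X -` A \<inter> space M |A. A \<in> sets borel}"
    then obtain A B where "A \<in> sets borel" "B \<in> sets borel" "a = X -` A \<inter> space M" "b = X -` B \<inter> space M" by blast
    then show "a \<inter> b \<in> {X -` A \<inter> space M |A. A \<in> sets borel}"
      by (intro CollectI exI[of _ "A \<inter> B"]) auto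
  qed
  show "Int_stable {\<theta> -` A \<inter> space M |A. A \<in> sets borel}" by (rule vimage_Int_stable)
  show "Int_stable {(\<lambda>\<omega>. W t \<omega> - W r \<omega>) -` A \<inter> space M |A. A \<in> sets borel}" by (rule vimage_Int_stable)
qed

section \<open>Moments of increments and of their products\<close>

lemma increment_moments:
  assumes "0 \<le> r" "r \<le> t"
  shows "sq_integrable M (\<lambda>\<omega>. W t \<omega> - W r \<omega>)"
    and "expectation (\<lambda>\<omega>. W t \<omega> - W r \<omega>) = 0"
    and "expectation (\<lambda>\<omega>. (W t \<omega> - W r \<omega>)\<^sup>2) = t - r"
proof -
  have "sq_integrable M (\<lambda>\<omega>. W t \<omega> - W r \<omega>) \<and> expectation (\<lambda>\<omega>. W t \<omega> - W r \<omega>) = 0 \<and>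
    expectation (\<lambda>\<omega>. (W t \<omega> - W r \<omega>)\<^sup>2) = t - r"
  \<comment> \<open>The zero increment is split off, since the normal law in
    \<open>brownian_motion\<close> is stated for strictly increasing times only.\<close>
  proof (cases "r = t")
  case True
  then show ?thesis
    by (simp add: sq_integrable_zero)
next
  case False
  then have rt: "r < t" "sqrt (t - r) > 0" using assms by auto
  have D: "distributed M lborel (\<lambda>\<omega>. W t \<omega> - W r \<omega>) (normal_density 0 (sqrt (t - r)))"
    using bm assms rt by (auto simp: brownian_motion_def)
  have meas: "(\<lambda>\<omega>. W t \<omega> - W r \<omega>) \<in> borel_measurable M"
    using assms by (intro borel_measurable_diff W_measurable) auto
  have "integrable M (\<lambda>\<omega>. (W t \<omega> - W r \<omega>)\<^sup>2)"
    using integrable_normal_moment[OF rt(2), of 0 2]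
    by (subst distributed_integrable[OF D, symmetric]) auto
  moreover have E: "expectation (\<lambda>\<omega>. W t \<omega> - W r \<omega>) = 0"
    by (rule normal_distributed_expectation[OF rt(2) D])
  moreover have "expectation (\<lambda>\<omega>. (W t \<omega> - W r \<omega>)\<^sup>2) = t - r"
    using normal_distributed_variance[OF rt(2) D] E rt by simp
  ultimately show ?thesis
    using meas by (auto simp: sq_integrable_def)
  qed
  then show "sq_integrable M (\<lambda>\<omega>. W t \<omega> - W r \<omega>)" "expectation (\<lambda>\<omega>. W t \<omega> - W r \<omega>) = 0" "expectation (\<lambda>\<omega>. (W t \<omega> - W r \<omega>)\<^sup>2) = t - r"
    by auto
qed

text \<open>Integrability is all that can be asked of \<open>\<theta>\<close>: later it contains an
  earlier increment or is an inner product of square integrable variables.\<close>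

lemma expectation_times_increment:
  assumes "0 \<le> r" "r \<le> t" and \<theta>: "\<theta> \<in> borel_measurable (\<F> r)" "integrable M \<theta>"
  shows "expectation (\<lambda>\<omega>. \<theta> \<omega> * (W t \<omega> - W r \<omega>)) = 0"
    and "integrable M (\<lambda>\<omega>. \<theta> \<omega> * (W t \<omega> - W r \<omega>))"
    and "expectation (\<lambda>\<omega>. \<theta> \<omega> * (W t \<omega> - W r \<omega>)\<^sup>2) = expectation \<theta> * (t - r)"
    and "integrable M (\<lambda>\<omega>. \<theta> \<omega> * (W t \<omega> - W r \<omega>)\<^sup>2)"
proof -
  have "expectation (\<lambda>\<omega>. \<theta> \<omega> * (W t \<omega> - W r \<omega>)) = 0 \<and> integrable M (\<lambda>\<omega>. \<theta> \<omega> * (W t \<omega> - W r \<omega>)) \<and>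
    expectation (\<lambda>\<omega>. \<theta> \<omega> * (W t \<omega> - W r \<omega>)\<^sup>2) = expectation \<theta> * (t - r) \<and>
    integrable M (\<lambda>\<omega>. \<theta> \<omega> * (W t \<omega> - W r \<omega>)\<^sup>2)"
  proof (cases "r = t")
  case True
  then show ?thesis
    by simp
next
  case False
  then have rt: "r < t" using assms by auto
  note m = increment_moments[OF assms(1,2)]
  note i1 = indep_var_increment[OF assms(1) rt \<theta>(1)]
  have i2: "indep_var borel \<theta> borel (\<lambda>\<omega>. (W t \<omega> - W r \<omega>)\<^sup>2)"
    using indep_var_compose[OF i1, of "\<lambda>x. x" borel "\<lambda>x. x\<^sup>2" borel] by (simp add: o_def)
  have s1: "integrable M (\<lambda>\<omega>. W t \<omega> - W r \<omega>)" by (rule sq_integrable_integrable[OF m(1)])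
  have s2: "integrable M (\<lambda>\<omega>. (W t \<omega> - W r \<omega>)\<^sup>2)" using sq_integrable_norm[OF m(1)] by simp
  show ?thesis
    using indep_var_lebesgue_integral[OF i1 \<theta>(2) s1] indep_var_integrable[OF i1 \<theta>(2) s1]
      indep_var_lebesgue_integral[OF i2 \<theta>(2) s2] indep_var_integrable[OF i2 \<theta>(2) s2] m
    by simp
  qed
  then show "expectation (\<lambda>\<omega>. \<theta> \<omega> * (W t \<omega> - W r \<omega>)) = 0" "integrable M (\<lambda>\<omega>. \<theta> \<omega> * (W t \<omega> - W r \<omega>))" "expectation (\<lambda>\<omega>. \<theta> \<omega> * (W t \<omega> - W r \<omega>)\<^sup>2) = expectation \<theta> * (t - r)" "integrable M (\<lambda>\<omega>. \<theta> \<omega> * (W t \<omega> - W r \<omega>)\<^sup>2)"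
    by auto
qed

lemma bounded_times_increment:
  fixes \<eta> :: "'w \<Rightarrow> 'a::euclidean_space"
  assumes "0 \<le> p" "p \<le> q" "\<eta> \<in> borel_measurable M" "\<forall>\<omega>\<in>space M. norm (\<eta> \<omega>) \<le> K"
  shows "sq_integrable M (\<lambda>\<omega>. (W q \<omega> - W p \<omega>) *\<^sub>R \<eta> \<omega>)"
proof (rule sq_integrable_bound[OF increment_moments(1)[OF assms(1,2)], of _ K])
  show "(\<lambda>\<omega>. (W q \<omega> - W p \<omega>) *\<^sub>R \<eta> \<omega>) \<in> borel_measurable M"
    using assms by (intro borel_measurable_scaleR borel_measurable_diff W_measurable) auto
  show "AE \<omega> in M. norm ((W q \<omega> - W p \<omega>) *\<^sub>R \<eta> \<omega>) \<le> K * norm (W q \<omega> - W p \<omega>)"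
    using assms(4) by (intro AE_I2) (auto simp: mult.commute intro: mult_right_mono)
qed

text \<open>The longer increment is the shorter one plus an increment after \<open>q\<close>. The
  first part produces a square; the second is independent of everything known at \<open>q\<close>
  and has mean zero.\<close>

lemma expectation_two_increments_common_start:
  assumes "0 \<le> r" "r \<le> q" "q \<le> q'" and \<theta>: "\<theta> \<in> borel_measurable (\<F> r)" "\<forall>\<omega>\<in>space M. norm (\<theta> \<omega>) \<le> K"
  shows "expectation (\<lambda>\<omega>. \<theta> \<omega> * (W q \<omega> - W r \<omega>) * (W q' \<omega> - W r \<omega>)) = expectation \<theta> * (q - r)"
proof -
  have int: "integrable M \<theta>"
    using \<theta> by (intro integrable_const_bound[where B=K] AE_I2 measurable_filtration_M) auto
  have "sq_integrable M (\<lambda>\<omega>. (W q \<omega> - W r \<omega>) *\<^sub>R \<theta> \<omega>)"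
    using assms by (intro bounded_times_increment measurable_filtration_M) auto
  then have i: "integrable M (\<lambda>\<omega>. \<theta> \<omega> * (W q \<omega> - W r \<omega>))"
    by (auto dest!: sq_integrable_integrable simp: mult.commute)
  have m: "(\<lambda>\<omega>. \<theta> \<omega> * (W q \<omega> - W r \<omega>)) \<in> borel_measurable (\<F> q)"
    using assms by (intro borel_measurable_times borel_measurable_diff W_measurable_filtration)
      (auto intro: measurable_filtration_mono)
  have "expectation (\<lambda>\<omega>. \<theta> \<omega> * (W q \<omega> - W r \<omega>) * (W q' \<omega> - W r \<omega>)) =
    expectation (\<lambda>\<omega>. \<theta> \<omega> * (W q \<omega> - W r \<omega>)\<^sup>2 + \<theta> \<omega> * (W q \<omega> - W r \<omega>) * (W q' \<omega> - W q \<omega>))"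
    by (intro Bochner_Integration.integral_cong refl) (simp add: power2_eq_square algebra_simps)
  also have "\<dots> = expectation \<theta> * (q - r)"
    using expectation_times_increment[OF assms(1,2) \<theta>(1) int]
      expectation_times_increment[OF _ assms(3) m i] assms
    by (subst Bochner_Integration.integral_add) auto
  finally show ?thesis .
qed

text \<open>With \<open>p \<le> p'\<close> both coefficients are known at \<open>p'\<close>.
  Splitting the first increment at \<open>p'\<close> leaves a part known at \<open>p'\<close>, which
  contributes nothing, and a part that starts together with the second increment. The factor is the
  length of the overlap of the two time intervals.\<close>

lemma expectation_inner_increments_ordered:
  fixes \<eta> \<eta>' :: "'w \<Rightarrow> 'a::euclidean_space"
  assumes p: "0 \<le> p" "p \<le> q" and p': "p \<le> p'" "p' \<le> q'"
    and \<eta>: "\<eta> \<in> borel_measurable (\<F> p)" "\<forall>\<omega>\<in>space M. norm (\<eta> \<omega>) \<le> K"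
    and \<eta>': "\<eta>' \<in> borel_measurable (\<F> p')" "\<forall>\<omega>\<in>space M. norm (\<eta>' \<omega>) \<le> K'"
  shows "expectation (\<lambda>\<omega>. ((W q \<omega> - W p \<omega>) *\<^sub>R \<eta> \<omega>) \<bullet> ((W q' \<omega> - W p' \<omega>) *\<^sub>R \<eta>' \<omega>)) =
    expectation (\<lambda>\<omega>. \<eta> \<omega> \<bullet> \<eta>' \<omega>) * max 0 (min q q' - p')"
proof -
  define \<theta> where "\<theta> = (\<lambda>\<omega>. \<eta> \<omega> \<bullet> \<eta>' \<omega>)"
  have m: "\<theta> \<in> borel_measurable (\<F> p')"
    unfolding \<theta>_def using \<eta> \<eta>' p' by (intro borel_measurable_inner) (auto intro: measurable_filtration_mono)
  have b: "\<forall>\<omega>\<in>space M. norm (\<theta> \<omega>) \<le> K * K'"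
  proof
    fix \<omega> assume "\<omega> \<in> space M"
    have "norm (\<theta> \<omega>) \<le> norm (\<eta> \<omega>) * norm (\<eta>' \<omega>)" unfolding \<theta>_def real_norm_def by (rule Cauchy_Schwarz_ineq2)
    also have "\<dots> \<le> K * K'" using \<eta>(2) \<eta>'(2) \<open>\<omega> \<in> space M\<close>
      by (intro mult_mono) (auto intro: order_trans[OF norm_ge_zero])
    finally show "norm (\<theta> \<omega>) \<le> K * K'" .
  qed
  \<comment> \<open>Stated for every \<open>r\<close> in \<open>{p..p'}\<close>:
    \<open>r = q\<close> settles disjoint intervals, \<open>r = p'\<close> the early part of
    overlapping ones.\<close>
  have past: "expectation (\<lambda>\<omega>. \<theta> \<omega> * (W r \<omega> - W p \<omega>) * (W q' \<omega> - W p' \<omega>)) = 0 \<and>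
     integrable M (\<lambda>\<omega>. \<theta> \<omega> * (W r \<omega> - W p \<omega>) * (W q' \<omega> - W p' \<omega>))" if r: "p \<le> r" "r \<le> p'" for r
  proof -
    have "sq_integrable M (\<lambda>\<omega>. (W r \<omega> - W p \<omega>) *\<^sub>R \<theta> \<omega>)"
      using p p' r b m by (intro bounded_times_increment measurable_filtration_M) auto
    then have i: "integrable M (\<lambda>\<omega>. \<theta> \<omega> * (W r \<omega> - W p \<omega>))"
      by (auto dest!: sq_integrable_integrable simp: mult.commute)
    have "(\<lambda>\<omega>. \<theta> \<omega> * (W r \<omega> - W p \<omega>)) \<in> borel_measurable (\<F> p')"
      using p p' r m by (intro borel_measurable_times borel_measurable_diff W_measurable_filtration) auto
    then show ?thesis
      using expectation_times_increment(1,2)[OF _ p'(2) _ i] p p' by auto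
  qed
  have eq: "((W q \<omega> - W p \<omega>) *\<^sub>R \<eta> \<omega>) \<bullet> ((W q' \<omega> - W p' \<omega>) *\<^sub>R \<eta>' \<omega>) =
     \<theta> \<omega> * (W q \<omega> - W p \<omega>) * (W q' \<omega> - W p' \<omega>)" for \<omega>
    by (simp add: \<theta>_def)
  show ?thesis
  proof (cases "q \<le> p'")
    case True
    then show ?thesis unfolding eq using past[of q] p by simp
  next
    case False
    have 2: "integrable M (\<lambda>\<omega>. \<theta> \<omega> * (W q \<omega> - W p' \<omega>) * (W q' \<omega> - W p' \<omega>))"
    proof -
      have "integrable M (\<lambda>\<omega>. ((W q \<omega> - W p' \<omega>) *\<^sub>R \<theta> \<omega>) \<bullet> (W q' \<omega> - W p' \<omega>))"
        using p p' False b m by (intro integrable_inner bounded_times_increment measurable_filtration_M increment_moments) auto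
      then show ?thesis by (simp add: mult_ac)
    qed
    have "expectation (\<lambda>\<omega>. \<theta> \<omega> * (W q \<omega> - W p' \<omega>) * (W q' \<omega> - W p' \<omega>)) = expectation \<theta> * (min q q' - p')"
    proof (cases "q \<le> q'")
      case True
      then show ?thesis using expectation_two_increments_common_start[OF _ _ True m b] False p p' by simp
    next
      case F: False
      have "expectation (\<lambda>\<omega>. \<theta> \<omega> * (W q \<omega> - W p' \<omega>) * (W q' \<omega> - W p' \<omega>)) =
        expectation (\<lambda>\<omega>. \<theta> \<omega> * (W q' \<omega> - W p' \<omega>) * (W q \<omega> - W p' \<omega>))"
        by (simp add: mult_ac)
      then show ?thesis using expectation_two_increments_common_start[OF _ _ _ m b, of q' q] F p p' by simp
    qed
    moreover have "expectation (\<lambda>\<omega>. \<theta> \<omega> * (W q \<omega> - W p \<omega>) * (W q' \<omega> - W p' \<omega>)) =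
       expectation (\<lambda>\<omega>. \<theta> \<omega> * (W p' \<omega> - W p \<omega>) * (W q' \<omega> - W p' \<omega>) + \<theta> \<omega> * (W q \<omega> - W p' \<omega>) * (W q' \<omega> - W p' \<omega>))"
      by (intro Bochner_Integration.integral_cong refl) (simp add: algebra_simps)
    moreover have "\<dots> = 0 + expectation (\<lambda>\<omega>. \<theta> \<omega> * (W q \<omega> - W p' \<omega>) * (W q' \<omega> - W p' \<omega>))"
      using past[of p'] p p' 2 by (subst Bochner_Integration.integral_add) auto
    ultimately show ?thesis unfolding eq using False p' by (simp add: \<theta>_def)
  qed
qed

lemma expectation_inner_increments:
  fixes \<eta> \<eta>' :: "'w \<Rightarrow> 'a::euclidean_space"
  assumes p: "0 \<le> p" "p \<le> q" and p': "0 \<le> p'" "p' \<le> q'"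
    and \<eta>: "\<eta> \<in> borel_measurable (\<F> p)" "\<forall>\<omega>\<in>space M. norm (\<eta> \<omega>) \<le> K"
    and \<eta>': "\<eta>' \<in> borel_measurable (\<F> p')" "\<forall>\<omega>\<in>space M. norm (\<eta>' \<omega>) \<le> K'"
  shows "expectation (\<lambda>\<omega>. ((W q \<omega> - W p \<omega>) *\<^sub>R \<eta> \<omega>) \<bullet> ((W q' \<omega> - W p' \<omega>) *\<^sub>R \<eta>' \<omega>)) =
    expectation (\<lambda>\<omega>. \<eta> \<omega> \<bullet> \<eta>' \<omega>) * max 0 (min q q' - max p p')"
proof (cases "p \<le> p'")
  case True
  then show ?thesis using expectation_inner_increments_ordered[OF p True p'(2) \<eta> \<eta>'] by simp
next
  case False
  then have "p' \<le> p" by simp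
  from expectation_inner_increments_ordered[OF p' this p(2) \<eta>' \<eta>]
  have "expectation (\<lambda>\<omega>. ((W q' \<omega> - W p' \<omega>) *\<^sub>R \<eta>' \<omega>) \<bullet> ((W q \<omega> - W p \<omega>) *\<^sub>R \<eta> \<omega>)) =
    expectation (\<lambda>\<omega>. \<eta>' \<omega> \<bullet> \<eta> \<omega>) * max 0 (min q' q - p)" .
  moreover have "((W q' \<omega> - W p' \<omega>) *\<^sub>R \<eta>' \<omega>) \<bullet> ((W q \<omega> - W p \<omega>) *\<^sub>R \<eta> \<omega>) =
    ((W q \<omega> - W p \<omega>) *\<^sub>R \<eta> \<omega>) \<bullet> ((W q' \<omega> - W p' \<omega>) *\<^sub>R \<eta>' \<omega>)" "\<eta>' \<omega> \<bullet> \<eta> \<omega> = \<eta> \<omega> \<bullet> \<eta>' \<omega>" for \<omega>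
    by (rule inner_commute)+
  ultimately show ?thesis
    unfolding max.absorb1[OF \<open>p' \<le> p\<close>] min.commute[of q q'] by (simp only:)
qed

end


section \<open>Processes and the product of time and chance\<close>

lemma progressive_continuous2:
  assumes "progressive M W s T X" "progressive M W s T Y" "continuous_on UNIV (\<lambda>x. H (fst x) (snd x))"
  shows "progressive M W s T (\<lambda>t \<omega>. H (X t \<omega>) (Y t \<omega>))"
  unfolding progressive_def
proof
  fix t assume "t \<in> {s..T}"
  then show "(\<lambda>p. H (X (fst p) (snd p)) (Y (fst p) (snd p))) \<in>
      borel_measurable (restrict_space borel {s..t} \<Otimes>\<^sub>M bm_filtration M W t)"
    using assms(1,2) unfolding progressive_def
    by (intro borel_measurable_continuous_Pair[OF _ _ assms(3)]) auto
qed

lemma progressive_bounded_linear: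
  assumes "bounded_linear F" "progressive M W s T X"
  shows "progressive M W s T (\<lambda>t \<omega>. F (X t \<omega>))"
  unfolding progressive_def
proof
  have F: "F \<in> borel_measurable borel"
    using assms(1) by (intro borel_measurable_continuous_onI linear_continuous_on)
  fix t assume "t \<in> {s..T}"
  then show "(\<lambda>p. F (X (fst p) (snd p))) \<in>
      borel_measurable (restrict_space borel {s..t} \<Otimes>\<^sub>M bm_filtration M W t)"
    using assms(2) unfolding progressive_def by (intro measurable_compose[OF _ F]) auto
qed

lemma progressive_bounded_bilinear:
  assumes "bounded_bilinear F" "progressive M W s T X" "progressive M W s T Y"
  shows "progressive M W s T (\<lambda>t \<omega>. F (X t \<omega>) (Y t \<omega>))"
  by (rule progressive_continuous2[OF assms(2,3)])
     (intro bounded_bilinear.continuous_on[OF assms(1)] continuous_intros)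

lemma progressive_add: "progressive M W s T X \<Longrightarrow> progressive M W s T Y \<Longrightarrow> progressive M W s T (\<lambda>t \<omega>. X t \<omega> + Y t \<omega>)"
  unfolding progressive_def by (auto intro!: borel_measurable_add)

lemma progressive_diff: "progressive M W s T X \<Longrightarrow> progressive M W s T Y \<Longrightarrow> progressive M W s T (\<lambda>t \<omega>. X t \<omega> - Y t \<omega>)"
  unfolding progressive_def by (auto intro!: borel_measurable_diff)

lemma progressive_uminus: "progressive M W s T X \<Longrightarrow> progressive M W s T (\<lambda>t \<omega>. - X t \<omega>)"
  unfolding progressive_def by auto

lemma progressive_const: "progressive M W s T (\<lambda>t \<omega>. c)"
  unfolding progressive_def by auto

section \<open>Measurability, integrals and null sets on the product of time and chance\<close>

context brownian_interval
begin

abbreviation "TI \<equiv> restrict_space lborel {s..T}"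
abbreviation "N \<equiv> TI \<Otimes>\<^sub>M M"

sublocale time: finite_measure TI
  using s_less_T by (intro finite_measureI) (simp add: emeasure_restrict_space space_restrict_space)

sublocale prod: pair_sigma_finite TI M ..

sublocale N: finite_measure N
  by (rule finite_measure_pair_measure) unfold_locales

lemma space_TI [simp]: "space TI = {s..T}"
  by (simp add: space_restrict_space)

lemma sets_TI_eq: "sets TI = sets (restrict_space borel {s..T})"
  by (rule sets_restrict_space_cong) simp

lemma space_N: "space N = {s..T} \<times> space M"
  by (simp add: space_pair_measure)

lemma id_measurable_TI [measurable]: "(\<lambda>t. t) \<in> borel_measurable TI"
  by (auto intro: measurable_restrict_space1)

lemma le_measurable_N [measurable]: "Measurable.pred N (\<lambda>p. fst p \<le> t)"
  by measurable

text \<open>Progressive measurability at the final time is joint measurability with respect to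
  \<open>\<F> T\<close>, and the identity from \<open>N\<close> into that coarser space is
  measurable.\<close>

lemma progressive_measurable_N:
  assumes "progressive M W s T X"
  shows "(\<lambda>p. X (fst p) (snd p)) \<in> borel_measurable N"
proof -
  have X: "(\<lambda>p. X (fst p) (snd p)) \<in> borel_measurable (restrict_space borel {s..T} \<Otimes>\<^sub>M \<F> T)"
    using assms s_less_T unfolding progressive_def by auto
  have id: "(\<lambda>p. p) \<in> measurable N (restrict_space borel {s..T} \<Otimes>\<^sub>M \<F> T)"
  proof -
    have 1: "(\<lambda>p. fst p) \<in> measurable N (restrict_space borel {s..T})"
      using measurable_fst[of TI M] measurable_cong_sets[OF refl sets_TI_eq, of N] by auto
    have 2: "(\<lambda>p. snd p) \<in> measurable N (\<F> T)"
    proof (rule measurable_compose[OF measurable_snd])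
      show "(\<lambda>x. x) \<in> measurable M (\<F> T)"
        using subalgebra_filtration[of T] by (intro measurableI) (auto simp: subalgebra_def dest: sets.sets_into_space intro!: sets.Int)
    qed
    have "(\<lambda>p. (fst p, snd p)) \<in> measurable N (restrict_space borel {s..T} \<Otimes>\<^sub>M \<F> T)"
      by (rule measurable_Pair[OF 1 2])
    then show ?thesis by simp
  qed
  show ?thesis by (rule measurable_compose[OF id X])
qed

lemma progressive_adapted:
  assumes "progressive M W s T X" "t \<in> {s..T}"
  shows "X t \<in> borel_measurable (\<F> t)"
proof -
  have X: "(\<lambda>p. X (fst p) (snd p)) \<in> borel_measurable (restrict_space borel {s..t} \<Otimes>\<^sub>M \<F> t)"
    using assms unfolding progressive_def by auto
  have "Pair t \<in> measurable (\<F> t) (restrict_space borel {s..t} \<Otimes>\<^sub>M \<F> t)"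
    using assms(2) by (intro measurable_Pair1') (auto simp: space_restrict_space)
  from measurable_compose[OF this X] show ?thesis by simp
qed

lemma nn_integral_interval: "(\<integral>\<^sup>+t\<in>{s..T}. f t \<partial>lborel) = (\<integral>\<^sup>+t. f t \<partial>TI)"
  by (subst nn_integral_restrict_space) auto

lemma LBINT_interval:
  fixes f :: "real \<Rightarrow> 'a::euclidean_space"
  shows "(LBINT t:{s..T}. f t) = (\<integral>t. f t \<partial>TI)"
  by (subst integral_restrict_space) (auto simp: set_lebesgue_integral_def)

lemma LBINT_subinterval:
  fixes f :: "real \<Rightarrow> 'a::euclidean_space"
  assumes "t \<le> T"
  shows "(LBINT r:{s..t}. f r) = (\<integral>r. (if r \<le> t then f r else 0) \<partial>TI)"
  unfolding set_lebesgue_integral_def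
  by (subst integral_restrict_space) (use assms in \<open>auto intro!: Bochner_Integration.integral_cong simp: indicator_def\<close>)

lemma set_integrable_interval:
  fixes f :: "real \<Rightarrow> 'a::euclidean_space"
  shows "set_integrable lborel {s..T} f \<longleftrightarrow> integrable TI f"
  by (subst integrable_restrict_space) (auto simp: set_integrable_def)

lemma nn_integral_N:
  assumes "(\<lambda>p. f (fst p) (snd p)) \<in> borel_measurable N"
  shows "(\<integral>\<^sup>+\<omega>. (\<integral>\<^sup>+t\<in>{s..T}. f t \<omega> \<partial>lborel) \<partial>M) = (\<integral>\<^sup>+p. f (fst p) (snd p) \<partial>N)"
  unfolding nn_integral_interval using prod.nn_integral_snd[OF assms] by simp

lemma integral_N:
  fixes f :: "real \<Rightarrow> 'w \<Rightarrow> 'a::euclidean_space"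
  assumes "integrable N (\<lambda>p. f (fst p) (snd p))"
  shows "(\<integral>\<omega>. (LBINT t:{s..T}. f t \<omega>) \<partial>M) = (\<integral>p. f (fst p) (snd p) \<partial>N)"
    and "integrable M (\<lambda>\<omega>. (LBINT t:{s..T}. f t \<omega>))"
proof -
  have "integrable N (case_prod f)" using assms by (simp add: case_prod_beta')
  from prod.integral_snd[OF this] prod.integrable_snd[OF this]
  show "(\<integral>\<omega>. (LBINT t:{s..T}. f t \<omega>) \<partial>M) = (\<integral>p. f (fst p) (snd p) \<partial>N)"
    and "integrable M (\<lambda>\<omega>. (LBINT t:{s..T}. f t \<omega>))"
    by (simp_all add: LBINT_interval case_prod_beta')
qed

lemma AE_snd_N:
  assumes "AE \<omega> in M. Q \<omega>"
  shows "AE p in N. Q (snd p)"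
proof -
  obtain A where A: "A \<in> null_sets M" "{\<omega>\<in>space M. \<not> Q \<omega>} \<subseteq> A" using assms by (auto simp: eventually_ae_filter)
  have "{s..T} \<times> A \<in> null_sets N"
    using A(1) sets.top[of TI] emeasure_pair_measure_Times[of "{s..T}" TI A]
    by (auto simp: null_sets_def intro!: pair_measureI)
  then show ?thesis using A(2) by (intro AE_I'[where N="{s..T} \<times> A"]) (auto simp: space_N)
qed

lemma AE_paths_N:
  assumes "AE \<omega> in M. \<forall>t\<in>{s..T}. Q t \<omega>"
  shows "AE p in N. Q (fst p) (snd p)"
  using AE_snd_N[OF assms] AE_space by eventually_elim (auto simp: space_N)

text \<open>Iterated almost-everywhere statements may be exchanged if the exceptional set is jointly
  measurable, which accounts for the second hypothesis.\<close>

lemma AE_iterated_N: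
  assumes "AE \<omega> in M. AE t in lborel. t \<in> {s..T} \<longrightarrow> Q t \<omega>" "Measurable.pred N (\<lambda>p. Q (fst p) (snd p))"
  shows "AE p in N. Q (fst p) (snd p)"
proof -
  have m: "{p\<in>space N. Q (fst p) (snd p)} \<in> sets N" using assms(2) by (simp add: pred_def)
  have "AE \<omega> in M. AE t in TI. Q t \<omega>" using assms(1) by (subst AE_restrict_space_iff) auto
  then have "AE t in TI. AE \<omega> in M. Q t \<omega>" using prod.AE_commute[of Q, OF m] by simp
  then show ?thesis using prod.AE_pair_iff[OF m] by simp
qed

lemma pred_eq:
  fixes f g :: "'b \<Rightarrow> 'a::euclidean_space"
  assumes "f \<in> borel_measurable R" "g \<in> borel_measurable R"
  shows "Measurable.pred R (\<lambda>x. f x = g x)"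
proof -
  have "(\<lambda>x. f x - g x) \<in> borel_measurable R" using assms by simp
  then have "(\<lambda>x. f x - g x) -` {0} \<inter> space R \<in> sets R" by (rule measurable_sets) simp
  moreover have "(\<lambda>x. f x - g x) -` {0} \<inter> space R = {x\<in>space R. f x = g x}" by auto
  ultimately show ?thesis by (simp add: pred_def)
qed

lemma process_eq_iff:
  assumes "progressive M W s T X" "progressive M W s T Y"
  shows "process_eq M s T X Y \<longleftrightarrow> (AE p in N. X (fst p) (snd p) = Y (fst p) (snd p))"
proof
  assume "process_eq M s T X Y"
  then show "AE p in N. X (fst p) (snd p) = Y (fst p) (snd p)"
    unfolding process_eq_def using assms[THEN progressive_measurable_N]
    by (intro AE_iterated_N pred_eq) auto
next
  assume ae: "AE p in N. X (fst p) (snd p) = Y (fst p) (snd p)"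
  have m: "{p\<in>space N. X (fst p) (snd p) = Y (fst p) (snd p)} \<in> sets N"
    using pred_eq[OF assms[THEN progressive_measurable_N]] by (simp add: pred_def)
  have "AE \<omega> in M. AE t in TI. X t \<omega> = Y t \<omega>"
    using ae prod.AE_pair_iff[OF m] prod.AE_commute[OF m] by simp
  then show "process_eq M s T X Y" unfolding process_eq_def by (subst (asm) AE_restrict_space_iff) auto
qed

lemma L2_process_iff:
  "X \<in> L2_process M W s T \<longleftrightarrow> progressive M W s T X \<and> sq_integrable N (\<lambda>p. X (fst p) (snd p))"
proof -
  have "(\<integral>\<^sup>+\<omega>. (\<integral>\<^sup>+t\<in>{s..T}. ennreal ((norm (X t \<omega>))\<^sup>2) \<partial>lborel) \<partial>M)
     = (\<integral>\<^sup>+p. ennreal ((norm (X (fst p) (snd p)))\<^sup>2) \<partial>N)" if "progressive M W s T X"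
    using progressive_measurable_N[OF that] by (intro nn_integral_N) auto
  then show ?thesis
    unfolding L2_process_def sq_integrable_iff_nn_integral using progressive_measurable_N by auto
qed

text \<open>A bound uniform in time makes the supremum in the Gronwall argument finite. Monotonicity
  of the nonnegative integral holds even though the supremum over uncountably many times may fail to
  be measurable.\<close>

lemma L2_continuous_bounded:
  assumes "X \<in> L2_continuous M W s T"
  obtains B where "\<And>t. t \<in> {s..T} \<Longrightarrow> expectation (\<lambda>\<omega>. (norm (X t \<omega>))\<^sup>2) \<le> B"
proof
  let ?S = "\<integral>\<^sup>+\<omega>. (SUP t\<in>{s..T}. ennreal ((norm (X t \<omega>))\<^sup>2)) \<partial>M"
  have fin: "?S < \<infinity>" using assms by (auto simp: L2_continuous_def)
  fix t assume t: "t \<in> {s..T}"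
  have "X t \<in> borel_measurable M"
    using assms t by (intro measurable_filtration_M[OF progressive_adapted]) (auto simp: L2_continuous_def)
  then have "expectation (\<lambda>\<omega>. (norm (X t \<omega>))\<^sup>2) = enn2real (\<integral>\<^sup>+\<omega>. ennreal ((norm (X t \<omega>))\<^sup>2) \<partial>M)"
    by (intro integral_eq_nn_integral) auto
  also have "\<dots> \<le> enn2real ?S"
    using t fin by (intro enn2real_mono nn_integral_mono SUP_upper) auto
  finally show "expectation (\<lambda>\<omega>. (norm (X t \<omega>))\<^sup>2) \<le> enn2real ?S" .
qed

lemma L2_continuous_sq_integrable:
  assumes "X \<in> L2_continuous M W s T" "t \<in> {s..T}"
  shows "sq_integrable M (X t)"
proof -
  have "X t \<in> borel_measurable M"
    using assms by (intro measurable_filtration_M[OF progressive_adapted]) (auto simp: L2_continuous_def)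
  moreover have "(\<integral>\<^sup>+\<omega>. ennreal ((norm (X t \<omega>))\<^sup>2) \<partial>M) \<le> (\<integral>\<^sup>+\<omega>. (SUP t\<in>{s..T}. ennreal ((norm (X t \<omega>))\<^sup>2)) \<partial>M)"
    using assms(2) by (intro nn_integral_mono SUP_upper) auto
  ultimately show ?thesis
    using assms(1) unfolding sq_integrable_iff_nn_integral L2_continuous_def by (auto simp: le_less_trans)
qed

lemma L2_continuous_L2_process:
  assumes "X \<in> L2_continuous M W s T"
  shows "X \<in> L2_process M W s T"
proof -
  let ?S = "\<lambda>\<omega>. SUP t\<in>{s..T}. ennreal ((norm (X t \<omega>))\<^sup>2)"
  have p: "progressive M W s T X" and fin: "(\<integral>\<^sup>+\<omega>. ?S \<omega> \<partial>M) < \<infinity>"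
    using assms by (auto simp: L2_continuous_def)
  note m = progressive_measurable_N[OF p]
  have m': "(\<lambda>p. ennreal ((norm (X (fst p) (snd p)))\<^sup>2)) \<in> borel_measurable N" using m by simp
  have "(\<integral>\<^sup>+p. ennreal ((norm (X (fst p) (snd p)))\<^sup>2) \<partial>N) =
      (\<integral>\<^sup>+t. (\<integral>\<^sup>+\<omega>. ennreal ((norm (X t \<omega>))\<^sup>2) \<partial>M) \<partial>TI)"
    using nn_integral_fst[OF m'] by simp
  also have "\<dots> \<le> (\<integral>\<^sup>+t. (\<integral>\<^sup>+\<omega>. ?S \<omega> \<partial>M) \<partial>TI)"
    by (intro nn_integral_mono SUP_upper) auto
  also have "\<dots> = (\<integral>\<^sup>+\<omega>. ?S \<omega> \<partial>M) * emeasure TI {s..T}" by (subst nn_integral_const) simp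
  also have "\<dots> < \<infinity>"
    using fin s_less_T by (auto simp: emeasure_restrict_space ennreal_mult_less_top)
  finally show ?thesis unfolding L2_process_iff sq_integrable_iff_nn_integral using p m by simp
qed

end


section \<open>The Ito integral\<close>

context brownian_interval
begin

section \<open>Simple processes: isometry and martingale property\<close>

lemma simple_process_ConsD:
  assumes "simple_process M W s T ((p, q, \<eta>) # L)"
  shows "simple_process M W s T L" "s \<le> p" "p \<le> q" "q \<le> T" "\<eta> \<in> borel_measurable (\<F> p)"
    "\<exists>K. \<forall>\<omega>\<in>space M. norm (\<eta> \<omega>) \<le> K"
  using assms by (auto simp: simple_process_def)

lemma sq_integrable_indicator_times:
  fixes \<eta> :: "'w \<Rightarrow> 'a::euclidean_space"
  assumes "\<eta> \<in> borel_measurable M" "\<forall>\<omega>\<in>space M. norm (\<eta> \<omega>) \<le> K"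
  shows "sq_integrable N (\<lambda>x. indicat_real {p<..q} (fst x) *\<^sub>R \<eta> (snd x))"
proof (rule sq_integrable_bound[OF N.sq_integrable_const[of "1::real"], of _ K])
  have [measurable]: "\<eta> \<in> borel_measurable M" by fact
  show "(\<lambda>x. indicat_real {p<..q} (fst x) *\<^sub>R \<eta> (snd x)) \<in> borel_measurable N"
    by measurable
  show "AE x in N. norm (indicat_real {p<..q} (fst x) *\<^sub>R \<eta> (snd x)) \<le> K * norm (1::real)"
    using assms(2) by (intro AE_I2) (auto simp: space_N indicator_def intro: order_trans[OF norm_ge_zero])
qed

lemma simple_value_Cons:
  "simple_value ((p, q, \<eta>) # L) t \<omega> = indicat_real {p<..q} t *\<^sub>R \<eta> \<omega> + simple_value L t \<omega>"
  by (simp add: simple_value_def)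

lemma simple_integral_Cons:
  "simple_integral W ((p, q, \<eta>) # L) t \<omega> = (W (min q t) \<omega> - W (min p t) \<omega>) *\<^sub>R \<eta> \<omega> + simple_integral W L t \<omega>"
  by (simp add: simple_integral_def)

lemma sq_integrable_simple_value:
  fixes L :: "(real \<times> real \<times> ('w \<Rightarrow> 'a::euclidean_space)) list"
  assumes "simple_process M W s T L"
  shows "sq_integrable N (\<lambda>x. simple_value L (fst x) (snd x))"
  using assms
proof (induction L)
  case Nil
  then show ?case by (simp add: simple_value_def sq_integrable_zero)
next
  case (Cons a L)
  obtain p q \<eta> where a: "a = (p, q, \<eta>)" by (cases a)
  note D = simple_process_ConsD[OF Cons.prems[unfolded a]]
  obtain K where "\<forall>\<omega>\<in>space M. norm (\<eta> \<omega>) \<le> K" using D by blast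
  then show ?case
    unfolding a simple_value_Cons using D
    by (intro sq_integrable_add sq_integrable_indicator_times Cons.IH measurable_filtration_M)
qed

lemma sq_integrable_simple_term:
  fixes \<eta> :: "'w \<Rightarrow> 'a::euclidean_space"
  assumes "s \<le> p" "p \<le> q" "t \<in> {s..T}" "\<eta> \<in> borel_measurable (\<F> p)" "\<exists>K. \<forall>\<omega>\<in>space M. norm (\<eta> \<omega>) \<le> K"
  shows "sq_integrable M (\<lambda>\<omega>. (W (min q t) \<omega> - W (min p t) \<omega>) *\<^sub>R \<eta> \<omega>)"
proof -
  obtain K where "\<forall>\<omega>\<in>space M. norm (\<eta> \<omega>) \<le> K" using assms by blast
  then show ?thesis
    using assms s_nonneg by (intro bounded_times_increment measurable_filtration_M[of \<eta>]) auto
qed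

lemma sq_integrable_simple_integral:
  fixes L :: "(real \<times> real \<times> ('w \<Rightarrow> 'a::euclidean_space)) list"
  assumes "simple_process M W s T L" "t \<in> {s..T}"
  shows "sq_integrable M (simple_integral W L t)"
  using assms
proof (induction L)
  case Nil
  then show ?case by (simp add: simple_integral_def[abs_def] sq_integrable_zero)
next
  case (Cons a L)
  obtain p q \<eta> where a: "a = (p, q, \<eta>)" by (cases a)
  note D = simple_process_ConsD[OF Cons.prems(1)[unfolded a]]
  have "sq_integrable M (\<lambda>\<omega>. (W (min q t) \<omega> - W (min p t) \<omega>) *\<^sub>R \<eta> \<omega> + simple_integral W L t \<omega>)"
    using D Cons by (intro sq_integrable_add sq_integrable_simple_term) auto
  then show ?case unfolding a by (simp add: simple_integral_Cons[abs_def])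
qed

text \<open>Both sides are the expectation of \<open>\<eta> \<bullet> \<eta>'\<close> times the
  length of the intersection of \<open>{p<..q}\<close>, \<open>{p'<..q'}\<close> and the times up to
  \<open>t\<close>. On the right this is Fubini, on the left the covariance of two increments
  stopped at \<open>t\<close>.\<close>

lemma elementary_isometry:
  fixes \<eta> \<eta>' :: "'w \<Rightarrow> 'a::euclidean_space"
  assumes p: "s \<le> p" "p \<le> q" "q \<le> T" and p': "s \<le> p'" "p' \<le> q'" "q' \<le> T" and t: "t \<in> {s..T}"
    and \<eta>: "\<eta> \<in> borel_measurable (\<F> p)" "\<exists>K. \<forall>\<omega>\<in>space M. norm (\<eta> \<omega>) \<le> K"
    and \<eta>': "\<eta>' \<in> borel_measurable (\<F> p')" "\<exists>K. \<forall>\<omega>\<in>space M. norm (\<eta>' \<omega>) \<le> K"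
  shows "expectation (\<lambda>\<omega>. ((W (min q t) \<omega> - W (min p t) \<omega>) *\<^sub>R \<eta> \<omega>) \<bullet> ((W (min q' t) \<omega> - W (min p' t) \<omega>) *\<^sub>R \<eta>' \<omega>)) =
    (\<integral>x. (if fst x \<le> t then (indicat_real {p<..q} (fst x) *\<^sub>R \<eta> (snd x)) \<bullet> (indicat_real {p'<..q'} (fst x) *\<^sub>R \<eta>' (snd x)) else 0) \<partial>N)"
    (is "?L = ?R")
proof -
  obtain K where K: "\<forall>\<omega>\<in>space M. norm (\<eta> \<omega>) \<le> K" using \<eta> by blast
  obtain K' where K': "\<forall>\<omega>\<in>space M. norm (\<eta>' \<omega>) \<le> K'" using \<eta>' by blast
  have m[measurable]: "\<eta> \<in> borel_measurable M" "\<eta>' \<in> borel_measurable M"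
    using \<eta> \<eta>' measurable_filtration_M by blast+
  let ?e = "expectation (\<lambda>\<omega>. \<eta> \<omega> \<bullet> \<eta>' \<omega>)"
  let ?J = "{max p p'<..min (min q q') t}"
  have "integrable N (\<lambda>x. (indicat_real {p<..q} (fst x) *\<^sub>R \<eta> (snd x)) \<bullet> (indicat_real {p'<..q'} (fst x) *\<^sub>R \<eta>' (snd x)))"
    by (intro integrable_inner sq_integrable_indicator_times[OF m(1) K] sq_integrable_indicator_times[OF m(2) K'])
  from Bochner_Integration.integrable_bound[OF this,
      of "\<lambda>x. if fst x \<le> t then (indicat_real {p<..q} (fst x) *\<^sub>R \<eta> (snd x)) \<bullet> (indicat_real {p'<..q'} (fst x) *\<^sub>R \<eta>' (snd x)) else 0"]
  have "integrable N (\<lambda>x. if fst x \<le> t then (indicat_real {p<..q} (fst x) *\<^sub>R \<eta> (snd x)) \<bullet> (indicat_real {p'<..q'} (fst x) *\<^sub>R \<eta>' (snd x)) else 0)"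
    by (auto simp: abs_mult)
  then have "?R = (\<integral>r. (\<integral>\<omega>. (if r \<le> t then (indicat_real {p<..q} r *\<^sub>R \<eta> \<omega>) \<bullet> (indicat_real {p'<..q'} r *\<^sub>R \<eta>' \<omega>) else 0) \<partial>M) \<partial>TI)"
    by (subst prod.integral_fst'[symmetric]) (simp_all cong: if_cong)
  also have "\<dots> = (\<integral>r. indicat_real ?J r * ?e \<partial>TI)"
    by (intro Bochner_Integration.integral_cong refl) (auto simp: indicator_def cong: if_cong)
  also have "\<dots> = (\<integral>r. indicat_real ?J r \<partial>TI) * ?e" by simp
  also have "(\<integral>r. indicat_real ?J r \<partial>TI) = measure lborel ?J"
  proof -
    have "indicat_real {s..T} r *\<^sub>R indicat_real ?J r = indicat_real ?J r" for r
      using p p' t by (auto simp: indicator_def)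
    then have "(\<integral>r. indicat_real ?J r \<partial>TI) = (\<integral>r. indicat_real ?J r \<partial>lborel)"
      by (subst integral_restrict_space) (auto simp del: real_scaleR_def)
    then show ?thesis by simp
  qed
  also have "\<dots> = max 0 (min (min q q') t - max p p')" 
    by (cases "max p p' \<le> min (min q q') t") (auto simp del: max.bounded_iff min.bounded_iff)
  finally have R: "?R = max 0 (min (min q q') t - max p p') * ?e" .
  show ?thesis
  \<comment> \<open>The covariance formula needs coefficients measurable at the start of the stopped
    interval, which is the case if \<open>min p t = p\<close> and \<open>min p' t = p'\<close>.
    Otherwise one stopped increment is zero and the intersection is empty.\<close>
  proof (cases "p \<le> t \<and> p' \<le> t")
    case True
    have mp: "min p t = p" "min p' t = p'" using True by auto
    have "?L = ?e * max 0 (min (min q t) (min q' t) - max p p')"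
      unfolding mp using True p p' t s_nonneg
      by (intro expectation_inner_increments[OF _ _ _ _ \<eta>(1) K \<eta>'(1) K']) auto
    moreover have "min (min q t) (min q' t) = min (min q q') t" by (simp add: min_def)
    ultimately show ?thesis unfolding R by (simp only: mult.commute)
  next
    case False
    then have "?L = 0" using p p' by (auto simp: min_def)
    moreover have "min (min q q') t - max p p' \<le> 0" using False by (auto simp: min_def max_def)
    ultimately show ?thesis unfolding R by simp
  qed
qed

lemma integrable_if_le:
  assumes "integrable N f"
  shows "integrable N (\<lambda>x. if fst x \<le> t then f x else (0::real))"
proof -
  have [measurable]: "f \<in> borel_measurable N" using assms by auto
  show ?thesis by (rule Bochner_Integration.integrable_bound[OF assms]) auto
qed

text \<open>The isometry is proved in bilinear form, by induction on both lists, since the product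
  rule pairs integrals of two different integrands.\<close>

lemma simple_isometry:
  fixes L L' :: "(real \<times> real \<times> ('w \<Rightarrow> 'a::euclidean_space)) list"
  assumes L: "simple_process M W s T L" and L': "simple_process M W s T L'" and t: "t \<in> {s..T}"
  shows "expectation (\<lambda>\<omega>. simple_integral W L t \<omega> \<bullet> simple_integral W L' t \<omega>) =
    (\<integral>x. (if fst x \<le> t then simple_value L (fst x) (snd x) \<bullet> simple_value L' (fst x) (snd x) else 0) \<partial>N)"
  using L
proof (induction L)
  case Nil
  then show ?case by (simp add: simple_integral_def simple_value_def cong: if_cong)
next
  case (Cons a L)
  obtain p q \<eta> where a: "a = (p, q, \<eta>)" by (cases a)
  note D = simple_process_ConsD[OF Cons.prems(1)[unfolded a]]
  obtain K where K: "\<forall>\<omega>\<in>space M. norm (\<eta> \<omega>) \<le> K" using D by blast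
  let ?x = "\<lambda>\<omega>. (W (min q t) \<omega> - W (min p t) \<omega>) *\<^sub>R \<eta> \<omega>"
  let ?v = "\<lambda>x. indicat_real {p<..q} (fst x) *\<^sub>R \<eta> (snd x)"
  have x: "sq_integrable M ?x" using D t by (intro sq_integrable_simple_term)
  have v: "sq_integrable N ?v" using D K by (intro sq_integrable_indicator_times measurable_filtration_M[of \<eta>])
  have single: "expectation (\<lambda>\<omega>. ?x \<omega> \<bullet> simple_integral W L' t \<omega>) =
    (\<integral>x. (if fst x \<le> t then ?v x \<bullet> simple_value L' (fst x) (snd x) else 0) \<partial>N)"
    using L'
  proof (induction L')
    case Nil
    then show ?case by (simp add: simple_integral_def simple_value_def cong: if_cong)
  next
    case (Cons a' L')
    obtain p' q' \<eta>' where a': "a' = (p', q', \<eta>')" by (cases a')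
    note D' = simple_process_ConsD[OF Cons.prems(1)[unfolded a']]
    obtain K' where K': "\<forall>\<omega>\<in>space M. norm (\<eta>' \<omega>) \<le> K'" using D' by blast
    let ?x' = "\<lambda>\<omega>. (W (min q' t) \<omega> - W (min p' t) \<omega>) *\<^sub>R \<eta>' \<omega>"
    let ?v' = "\<lambda>x. indicat_real {p'<..q'} (fst x) *\<^sub>R \<eta>' (snd x)"
    have x': "sq_integrable M ?x'" using D' t by (intro sq_integrable_simple_term)
    have v': "sq_integrable N ?v'" using D' K' by (intro sq_integrable_indicator_times measurable_filtration_M[of \<eta>'])
    have "expectation (\<lambda>\<omega>. ?x \<omega> \<bullet> simple_integral W (a' # L') t \<omega>) =
      expectation (\<lambda>\<omega>. ?x \<omega> \<bullet> ?x' \<omega> + ?x \<omega> \<bullet> simple_integral W L' t \<omega>)"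
      unfolding a' simple_integral_Cons inner_add_right ..
    also have "\<dots> = expectation (\<lambda>\<omega>. ?x \<omega> \<bullet> ?x' \<omega>) + expectation (\<lambda>\<omega>. ?x \<omega> \<bullet> simple_integral W L' t \<omega>)"
      by (intro Bochner_Integration.integral_add integrable_inner x x' sq_integrable_simple_integral D' t)
    also have "\<dots> = (\<integral>x. (if fst x \<le> t then ?v x \<bullet> ?v' x else 0) \<partial>N)
       + (\<integral>x. (if fst x \<le> t then ?v x \<bullet> simple_value L' (fst x) (snd x) else 0) \<partial>N)"
      using elementary_isometry[OF D(2-4) D'(2-4) t D(5,6) D'(5,6)] Cons.IH[OF D'(1)] by simp
    also have "\<dots> = (\<integral>x. (if fst x \<le> t then ?v x \<bullet> ?v' x else 0) +
        (if fst x \<le> t then ?v x \<bullet> simple_value L' (fst x) (snd x) else 0) \<partial>N)"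
      by (intro Bochner_Integration.integral_add[symmetric] integrable_if_le integrable_inner v v' sq_integrable_simple_value D')
    also have "\<dots> = (\<integral>x. (if fst x \<le> t then ?v x \<bullet> simple_value (a' # L') (fst x) (snd x) else 0) \<partial>N)"
      unfolding a' simple_value_Cons inner_add_right by (intro Bochner_Integration.integral_cong refl) simp
    finally show ?case .
  qed
  have "expectation (\<lambda>\<omega>. simple_integral W (a # L) t \<omega> \<bullet> simple_integral W L' t \<omega>) =
    expectation (\<lambda>\<omega>. ?x \<omega> \<bullet> simple_integral W L' t \<omega> + simple_integral W L t \<omega> \<bullet> simple_integral W L' t \<omega>)"
    unfolding a simple_integral_Cons inner_add_left ..
  also have "\<dots> = expectation (\<lambda>\<omega>. ?x \<omega> \<bullet> simple_integral W L' t \<omega>) +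
     expectation (\<lambda>\<omega>. simple_integral W L t \<omega> \<bullet> simple_integral W L' t \<omega>)"
    by (intro Bochner_Integration.integral_add integrable_inner x sq_integrable_simple_integral D t L')
  also have "\<dots> = (\<integral>x. (if fst x \<le> t then ?v x \<bullet> simple_value L' (fst x) (snd x) else 0) \<partial>N)
     + (\<integral>x. (if fst x \<le> t then simple_value L (fst x) (snd x) \<bullet> simple_value L' (fst x) (snd x) else 0) \<partial>N)"
    using single Cons.IH[OF D(1)] by simp
  also have "\<dots> = (\<integral>x. (if fst x \<le> t then ?v x \<bullet> simple_value L' (fst x) (snd x) else 0)
     + (if fst x \<le> t then simple_value L (fst x) (snd x) \<bullet> simple_value L' (fst x) (snd x) else 0) \<partial>N)"
    by (intro Bochner_Integration.integral_add[symmetric] integrable_if_le integrable_inner v sq_integrable_simple_value D L')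
  also have "\<dots> = (\<integral>x. (if fst x \<le> t then simple_value (a # L) (fst x) (snd x) \<bullet> simple_value L' (fst x) (snd x) else 0) \<partial>N)"
    unfolding a simple_value_Cons inner_add_left by (intro Bochner_Integration.integral_cong refl) simp
  finally show ?case .
qed

text \<open>Only the part of \<open>{p<..q}\<close> after \<open>r\<close> distinguishes the two
  sides, and the coefficient \<open>\<zeta> \<bullet> \<eta>\<close> is already known when this part
  begins.\<close>

lemma elementary_martingale:
  fixes \<zeta> \<eta> :: "'w \<Rightarrow> 'a::euclidean_space"
  assumes p: "s \<le> p" "p \<le> q" "q \<le> T" and r: "s \<le> r" "r \<le> t" "t \<le> T"
    and \<eta>: "\<eta> \<in> borel_measurable (\<F> p)" "\<exists>K. \<forall>\<omega>\<in>space M. norm (\<eta> \<omega>) \<le> K"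
    and \<zeta>: "\<zeta> \<in> borel_measurable (\<F> r)" "sq_integrable M \<zeta>"
  shows "expectation (\<lambda>\<omega>. \<zeta> \<omega> \<bullet> ((W (min q t) \<omega> - W (min p t) \<omega>) *\<^sub>R \<eta> \<omega>)) =
    expectation (\<lambda>\<omega>. \<zeta> \<omega> \<bullet> ((W (min q r) \<omega> - W (min p r) \<omega>) *\<^sub>R \<eta> \<omega>))"
proof -
  obtain K where K: "\<forall>\<omega>\<in>space M. norm (\<eta> \<omega>) \<le> K" using \<eta> by blast
  have m: "\<eta> \<in> borel_measurable M" by (rule measurable_filtration_M[OF \<eta>(1)])
  have "sq_integrable M \<eta>"
    using K by (intro sq_integrable_bound[OF sq_integrable_const[of "1::real"] m, of K] AE_I2) simp
  then have int: "integrable M (\<lambda>\<omega>. \<zeta> \<omega> \<bullet> \<eta> \<omega>)" by (intro integrable_inner \<zeta>)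
  have int_t: "integrable M (\<lambda>\<omega>. \<zeta> \<omega> \<bullet> ((W (min q u) \<omega> - W (min p u) \<omega>) *\<^sub>R \<eta> \<omega>))" if "u \<in> {s..T}" for u
    using p \<eta> that by (intro integrable_inner \<zeta> sq_integrable_simple_term)
  \<comment> \<open>The interval ends by time \<open>r\<close> and nothing changes, or it contains
    \<open>r\<close> and the coefficient is known at \<open>r\<close>, or it starts later and the
    coefficient is known at \<open>p\<close>.\<close>
  consider "q \<le> r" | "p \<le> r" "r < q" | "r < p" by linarith
  then show ?thesis
  proof cases
    case 1
    then show ?thesis using p r by (simp add: min_absorb1)
  next
    case 2
    have "(\<lambda>\<omega>. \<zeta> \<omega> \<bullet> \<eta> \<omega>) \<in> borel_measurable (\<F> r)"
      using \<zeta> \<eta> 2 by (intro borel_measurable_inner) (auto intro: measurable_filtration_mono)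
    then have "expectation (\<lambda>\<omega>. \<zeta> \<omega> \<bullet> \<eta> \<omega> * (W (min q t) \<omega> - W r \<omega>)) = 0"
      using 2 r s_nonneg by (intro expectation_times_increment int) auto
    moreover have "\<zeta> \<omega> \<bullet> \<eta> \<omega> * (W (min q t) \<omega> - W r \<omega>) =
      \<zeta> \<omega> \<bullet> ((W (min q t) \<omega> - W (min p t) \<omega>) *\<^sub>R \<eta> \<omega>) - \<zeta> \<omega> \<bullet> ((W (min q r) \<omega> - W (min p r) \<omega>) *\<^sub>R \<eta> \<omega>)" for \<omega>
      using 2 r by (simp add: min_absorb1 min_absorb2 algebra_simps)
    ultimately have "expectation (\<lambda>\<omega>. \<zeta> \<omega> \<bullet> ((W (min q t) \<omega> - W (min p t) \<omega>) *\<^sub>R \<eta> \<omega>) - \<zeta> \<omega> \<bullet> ((W (min q r) \<omega> - W (min p r) \<omega>) *\<^sub>R \<eta> \<omega>)) = 0"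
      by simp
    then show ?thesis using int_t[of t] int_t[of r] r by (subst (asm) Bochner_Integration.integral_diff) auto
  next
    case 3
    have "expectation (\<lambda>\<omega>. \<zeta> \<omega> \<bullet> \<eta> \<omega> * (W (min q t) \<omega> - W (min p t) \<omega>)) = 0"
    proof (cases "p \<le> t")
      case True
      have "(\<lambda>\<omega>. \<zeta> \<omega> \<bullet> \<eta> \<omega>) \<in> borel_measurable (\<F> p)"
        using \<zeta> \<eta> 3 by (intro borel_measurable_inner) (auto intro: measurable_filtration_mono)
      then show ?thesis
        using True p r s_nonneg by (simp add: min_absorb1, intro expectation_times_increment int) auto
    qed (use p in \<open>simp add: min_absorb2\<close>)
    then show ?thesis using 3 p r by (simp add: min_absorb2 mult.commute)
  qed
qed

lemma simple_martingale:
  fixes \<zeta> :: "'w \<Rightarrow> 'a::euclidean_space"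
  assumes L: "simple_process M W s T L" and r: "s \<le> r" "r \<le> t" "t \<le> T"
    and \<zeta>: "\<zeta> \<in> borel_measurable (\<F> r)" "sq_integrable M \<zeta>"
  shows "expectation (\<lambda>\<omega>. \<zeta> \<omega> \<bullet> simple_integral W L t \<omega>) = expectation (\<lambda>\<omega>. \<zeta> \<omega> \<bullet> simple_integral W L r \<omega>)"
  using L
proof (induction L)
  case Nil
  then show ?case by (simp add: simple_integral_def)
next
  case (Cons a L)
  obtain p q \<eta> where a: "a = (p, q, \<eta>)" by (cases a)
  note D = simple_process_ConsD[OF Cons.prems(1)[unfolded a]]
  have "expectation (\<lambda>\<omega>. \<zeta> \<omega> \<bullet> simple_integral W (a # L) u \<omega>) =
     expectation (\<lambda>\<omega>. \<zeta> \<omega> \<bullet> ((W (min q u) \<omega> - W (min p u) \<omega>) *\<^sub>R \<eta> \<omega>)) + expectation (\<lambda>\<omega>. \<zeta> \<omega> \<bullet> simple_integral W L u \<omega>)"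
    if "u \<in> {s..T}" for u
    unfolding a simple_integral_Cons inner_add_right
    using D that by (intro Bochner_Integration.integral_add integrable_inner \<zeta> sq_integrable_simple_term sq_integrable_simple_integral)
  then show ?case
    using elementary_martingale[OF D(2-4) r D(5,6) \<zeta>] Cons.IH[OF D(1)] r by auto
qed

section \<open>Passage from simple to general integrands\<close>

lemma ito_integralE:
  assumes "ito_integral M W s T H I"
  obtains L where "\<And>k::nat. simple_process M W s T (L k)"
    "(\<lambda>k. \<integral>\<^sup>+x. ennreal ((norm (simple_value (L k) (fst x) (snd x) - H (fst x) (snd x)))\<^sup>2) \<partial>N) \<longlonglongrightarrow> 0"
    "\<And>t. t \<in> {s..T} \<Longrightarrow> (\<lambda>k. \<integral>\<^sup>+\<omega>. ennreal ((norm (simple_integral W (L k) t \<omega> - I t \<omega>))\<^sup>2) \<partial>M) \<longlonglongrightarrow> 0"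
proof -
  obtain L where L: "\<forall>k::nat. simple_process M W s T (L k)"
    "(\<lambda>k. \<integral>\<^sup>+\<omega>. (\<integral>\<^sup>+t\<in>{s..T}. ennreal ((norm (simple_value (L k) t \<omega> - H t \<omega>))\<^sup>2) \<partial>lborel) \<partial>M) \<longlonglongrightarrow> 0"
    "\<forall>t\<in>{s..T}. (\<lambda>k. \<integral>\<^sup>+\<omega>. ennreal ((norm (simple_integral W (L k) t \<omega> - I t \<omega>))\<^sup>2) \<partial>M) \<longlonglongrightarrow> 0"
    using assms unfolding ito_integral_def by blast
  have "(\<lambda>p. H (fst p) (snd p)) \<in> borel_measurable N"
    using assms by (auto simp: ito_integral_def L2_process_iff sq_integrable_def)
  then have "(\<integral>\<^sup>+\<omega>. (\<integral>\<^sup>+t\<in>{s..T}. ennreal ((norm (simple_value (L k) t \<omega> - H t \<omega>))\<^sup>2) \<partial>lborel) \<partial>M)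
     = (\<integral>\<^sup>+x. ennreal ((norm (simple_value (L k) (fst x) (snd x) - H (fst x) (snd x)))\<^sup>2) \<partial>N)" for k
    using sq_integrable_simple_value[of "L k"] L(1) by (intro nn_integral_N) (auto simp: sq_integrable_def)
  then show ?thesis using that[of L] L by simp
qed

text \<open>The definition grants convergence only. One simple integral at finite distance already
  makes \<open>I t\<close> square integrable.\<close>

lemma sq_integrable_ito_integral:
  assumes I: "ito_integral M W s T H I" and t: "t \<in> {s..T}"
  shows "sq_integrable M (I t)"
proof -
  obtain L where L: "\<And>k::nat. simple_process M W s T (L k)"
    "(\<lambda>k. \<integral>\<^sup>+\<omega>. ennreal ((norm (simple_integral W (L k) t \<omega> - I t \<omega>))\<^sup>2) \<partial>M) \<longlonglongrightarrow> 0"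
    by (rule ito_integralE[OF I]) (use t in blast)
  have m: "I t \<in> borel_measurable M"
    using I t by (auto simp: ito_integral_def intro: measurable_filtration_M)
  have "eventually (\<lambda>k. (\<integral>\<^sup>+\<omega>. ennreal ((norm (simple_integral W (L k) t \<omega> - I t \<omega>))\<^sup>2) \<partial>M) < 1) sequentially"
    using order_tendstoD(2)[OF L(2), of 1] by simp
  then obtain k where k: "(\<integral>\<^sup>+\<omega>. ennreal ((norm (simple_integral W (L k) t \<omega> - I t \<omega>))\<^sup>2) \<partial>M) < 1"
    by (auto simp: eventually_sequentially)
  have S: "sq_integrable M (simple_integral W (L k) t)" by (rule sq_integrable_simple_integral[OF L(1) t])
  have "(\<lambda>\<omega>. simple_integral W (L k) t \<omega> - I t \<omega>) \<in> borel_measurable M"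
    using sq_integrable_measurable[OF S] m by simp
  then have "sq_integrable M (\<lambda>\<omega>. simple_integral W (L k) t \<omega> - I t \<omega>)"
    unfolding sq_integrable_iff_nn_integral using less_trans[OF k, of \<infinity>] by simp
  from sq_integrable_diff[OF S this] show ?thesis by simp
qed

lemma ito_isometry:
  assumes I: "ito_integral M W s T H I" and I': "ito_integral M W s T H' I'" and t: "t \<in> {s..T}"
  shows "expectation (\<lambda>\<omega>. I t \<omega> \<bullet> I' t \<omega>) =
    (\<integral>x. (if fst x \<le> t then H (fst x) (snd x) \<bullet> H' (fst x) (snd x) else 0) \<partial>N)"
proof -
  obtain L where L: "\<And>k::nat. simple_process M W s T (L k)"
    "(\<lambda>k. \<integral>\<^sup>+x. ennreal ((norm (simple_value (L k) (fst x) (snd x) - H (fst x) (snd x)))\<^sup>2) \<partial>N) \<longlonglongrightarrow> 0"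
    "(\<lambda>k. \<integral>\<^sup>+\<omega>. ennreal ((norm (simple_integral W (L k) t \<omega> - I t \<omega>))\<^sup>2) \<partial>M) \<longlonglongrightarrow> 0"
    by (rule ito_integralE[OF I]) (use t in blast)
  obtain L' where L': "\<And>k::nat. simple_process M W s T (L' k)"
    "(\<lambda>k. \<integral>\<^sup>+x. ennreal ((norm (simple_value (L' k) (fst x) (snd x) - H' (fst x) (snd x)))\<^sup>2) \<partial>N) \<longlonglongrightarrow> 0"
    "(\<lambda>k. \<integral>\<^sup>+\<omega>. ennreal ((norm (simple_integral W (L' k) t \<omega> - I' t \<omega>))\<^sup>2) \<partial>M) \<longlonglongrightarrow> 0"
    by (rule ito_integralE[OF I']) (use t in blast)
  have H: "sq_integrable N (\<lambda>x. H (fst x) (snd x))" "sq_integrable N (\<lambda>x. H' (fst x) (snd x))"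
    using I I' by (auto simp: ito_integral_def L2_process_iff)
  \<comment> \<open>Cutting off at time \<open>t\<close> does not increase the distance, so the
    truncated integrands converge as well.\<close>
  have trunc: "(\<lambda>k. \<integral>\<^sup>+x. ennreal ((norm ((if fst x \<le> t then F k x else 0) - (if fst x \<le> t then f x else 0)))\<^sup>2) \<partial>N) \<longlonglongrightarrow> 0"
    if "(\<lambda>k. \<integral>\<^sup>+x. ennreal ((norm (F k x - f x))\<^sup>2) \<partial>N) \<longlonglongrightarrow> 0" for F :: "nat \<Rightarrow> real \<times> 'w \<Rightarrow> 'a" and f
    by (rule tendsto_sandwich[OF _ _ tendsto_const that]) (auto intro!: always_eventually nn_integral_mono)
  have "(\<lambda>k. expectation (\<lambda>\<omega>. simple_integral W (L k) t \<omega> \<bullet> simple_integral W (L' k) t \<omega>)) \<longlonglongrightarrow> expectation (\<lambda>\<omega>. I t \<omega> \<bullet> I' t \<omega>)"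
    using L L' t by (intro tendsto_integral_inner sq_integrable_ito_integral[OF I] sq_integrable_ito_integral[OF I'] sq_integrable_simple_integral)
  moreover have "(\<lambda>k. \<integral>x. (if fst x \<le> t then simple_value (L k) (fst x) (snd x) else 0) \<bullet> (if fst x \<le> t then simple_value (L' k) (fst x) (snd x) else 0) \<partial>N)
     \<longlonglongrightarrow> (\<integral>x. (if fst x \<le> t then H (fst x) (snd x) else 0) \<bullet> (if fst x \<le> t then H' (fst x) (snd x) else 0) \<partial>N)"
    using L L' by (intro tendsto_integral_inner sq_integrable_indicator H sq_integrable_simple_value trunc) auto
  moreover have "(if fst x \<le> t then a else 0) \<bullet> (if fst x \<le> t then b else 0) = (if fst x \<le> t then a \<bullet> b else 0)"
    for x :: "real \<times> 'w" and a b :: 'a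
    by simp
  ultimately show ?thesis
    using simple_isometry[OF L(1) L'(1) t] LIMSEQ_unique by simp
qed

text \<open>The martingale property is tested against square integrable variables known at
  \<open>r\<close>. This avoids vector-valued conditional expectations and is the form in which
  drift and initial value meet the integral.\<close>

lemma ito_martingale:
  assumes I: "ito_integral M W s T H I" and r: "s \<le> r" "r \<le> t" "t \<le> T"
    and \<zeta>: "\<zeta> \<in> borel_measurable (\<F> r)" "sq_integrable M \<zeta>"
  shows "expectation (\<lambda>\<omega>. \<zeta> \<omega> \<bullet> I t \<omega>) = expectation (\<lambda>\<omega>. \<zeta> \<omega> \<bullet> I r \<omega>)"
proof -
  obtain L where L: "\<And>k::nat. simple_process M W s T (L k)"
    "\<And>t. t \<in> {s..T} \<Longrightarrow> (\<lambda>k. \<integral>\<^sup>+\<omega>. ennreal ((norm (simple_integral W (L k) t \<omega> - I t \<omega>))\<^sup>2) \<partial>M) \<longlonglongrightarrow> 0"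
    by (rule ito_integralE[OF I]) blast
  have "(\<lambda>k. expectation (\<lambda>\<omega>. \<zeta> \<omega> \<bullet> simple_integral W (L k) u \<omega>)) \<longlonglongrightarrow> expectation (\<lambda>\<omega>. \<zeta> \<omega> \<bullet> I u \<omega>)" if "u \<in> {s..T}" for u
    using L that by (intro tendsto_integral_inner \<zeta>(2) sq_integrable_ito_integral[OF I] sq_integrable_simple_integral) auto
  from this[of t] this[of r] show ?thesis
    using simple_martingale[OF L(1) r \<zeta>] LIMSEQ_unique r by simp
qed

end

section \<open>Linearity of Ito integrals and Ito differentials\<close>

lemma ito_integral_bounded_linear:
  fixes F :: "'a::euclidean_space \<Rightarrow> 'b::euclidean_space"
  assumes F: "bounded_linear F" and bi: "brownian_interval M W s T" and I: "ito_integral M W s T H I"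
  shows "ito_integral M W s T (\<lambda>t \<omega>. F (H t \<omega>)) (\<lambda>t \<omega>. F (I t \<omega>))"
proof -
  interpret brownian_interval M W s T by fact
  interpret F: bounded_linear F by fact
  obtain L where L: "\<And>k::nat. simple_process M W s T (L k)"
    "(\<lambda>k. \<integral>\<^sup>+\<omega>. (\<integral>\<^sup>+t\<in>{s..T}. ennreal ((norm (simple_value (L k) t \<omega> - H t \<omega>))\<^sup>2) \<partial>lborel) \<partial>M) \<longlonglongrightarrow> 0"
    "\<And>t. t\<in>{s..T} \<Longrightarrow> (\<lambda>k. \<integral>\<^sup>+\<omega>. ennreal ((norm (simple_integral W (L k) t \<omega> - I t \<omega>))\<^sup>2) \<partial>M) \<longlonglongrightarrow> 0"
    using I unfolding ito_integral_def by blast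
  obtain K where K: "K > 0" "\<And>x. norm (F x) \<le> norm x * K" using F.pos_bounded by blast
  have bnd: "ennreal ((norm (F x - F y))\<^sup>2) \<le> ennreal (K\<^sup>2) * ennreal ((norm (x - y))\<^sup>2)" for x y
  proof -
    have "(norm (F x - F y))\<^sup>2 \<le> (norm (x - y) * K)\<^sup>2"
      using K(2)[of "x - y"] by (intro power_mono) (auto simp: F.diff)
    then show ?thesis by (simp add: ennreal_mult[symmetric] power_mult_distrib mult.commute ennreal_leI)
  qed
  \<comment> \<open>\<open>F\<close> commutes with the sums in \<open>simple_value\<close> and
    \<open>simple_integral\<close>, so applying it to the random coefficients maps an approximating
    sequence to an approximating sequence.\<close>
  define L' where "L' k = map (\<lambda>(p, q, \<eta>). (p, q, \<lambda>\<omega>. F (\<eta> \<omega>))) (L k)" for k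
  have Fm: "F \<in> borel_measurable borel"
    using F by (intro borel_measurable_continuous_onI linear_continuous_on)
  have SP: "simple_process M W s T (L' k)" for k
    unfolding simple_process_def L'_def
  proof (clarsimp)
    fix p q \<eta> assume "(p, q, \<eta>) \<in> set (L k)"
    then have "s \<le> p \<and> p \<le> q \<and> q \<le> T" and \<eta>: "\<eta> \<in> borel_measurable (\<F> p)" "\<exists>K. \<forall>\<omega>\<in>space M. norm (\<eta> \<omega>) \<le> K"
      using L(1)[of k] by (auto simp: simple_process_def)
    moreover obtain B where B: "\<forall>\<omega>\<in>space M. norm (\<eta> \<omega>) \<le> B" using \<eta> by blast
    have "\<forall>\<omega>\<in>space M. norm (F (\<eta> \<omega>)) \<le> B * K"
      using B K by (auto intro: order_trans[OF K(2)] mult_right_mono)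
    ultimately show "s \<le> p \<and> p \<le> q \<and> q \<le> T \<and> (\<lambda>\<omega>. F (\<eta> \<omega>)) \<in> borel_measurable (\<F> p) \<and> (\<exists>K. \<forall>\<omega>\<in>space M. norm (F (\<eta> \<omega>)) \<le> K)"
      using measurable_compose[OF \<eta>(1) Fm] by auto
  qed
  have "simple_value (map (\<lambda>(p, q, \<eta>). (p, q, \<lambda>\<omega>. F (\<eta> \<omega>))) l) t \<omega> = F (simple_value l t \<omega>)" for l t \<omega>
    unfolding simple_value_def by (induction l) (auto simp: F.add F.scaleR F.zero)
  then have SV: "simple_value (L' k) t \<omega> = F (simple_value (L k) t \<omega>)" for k t \<omega>
    unfolding L'_def .
  have "simple_integral W (map (\<lambda>(p, q, \<eta>). (p, q, \<lambda>\<omega>. F (\<eta> \<omega>))) l) t \<omega> = F (simple_integral W l t \<omega>)" for l t \<omega>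
    unfolding simple_integral_def by (induction l) (auto simp: F.add F.scaleR F.zero)
  then have SI: "simple_integral W (L' k) t \<omega> = F (simple_integral W (L k) t \<omega>)" for k t \<omega>
    unfolding L'_def .
  have lim: "(\<lambda>k. ennreal (K\<^sup>2) * f k) \<longlonglongrightarrow> 0" if "f \<longlonglongrightarrow> 0" for f
    using ennreal_tendsto_cmult[OF _ that, of "ennreal (K\<^sup>2)"] by simp
  have mI: "I t \<in> borel_measurable M" if "t \<in> {s..T}" for t
    using I that by (auto simp: ito_integral_def intro: measurable_filtration_M)
  have mH: "(\<lambda>p. H (fst p) (snd p)) \<in> borel_measurable N"
    using I by (auto simp: ito_integral_def L2_process_iff sq_integrable_def)
  have mL: "(\<lambda>p. simple_value (L k) (fst p) (snd p)) \<in> borel_measurable N" for k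
    by (rule sq_integrable_measurable[OF sq_integrable_simple_value[OF L(1)]])
  show ?thesis
    unfolding ito_integral_def
  proof (intro conjI exI[of _ L'] allI ballI SP)
    show "(\<lambda>t \<omega>. F (H t \<omega>)) \<in> L2_process M W s T"
      using I progressive_bounded_linear[OF F] sq_integrable_bounded_linear[OF F]
      by (auto simp: ito_integral_def L2_process_iff)
    show "continuous_paths M s T (\<lambda>t \<omega>. F (I t \<omega>))"
      using I unfolding ito_integral_def continuous_paths_def
      by (auto elim!: eventually_mono intro: F.continuous_on)
    show "(\<lambda>\<omega>. F (I t \<omega>)) \<in> borel_measurable (\<F> t)" if "t \<in> {s..T}" for t
      using I that unfolding ito_integral_def by (intro measurable_compose[OF _ Fm]) auto
    show "(\<lambda>k. \<integral>\<^sup>+\<omega>. (\<integral>\<^sup>+t\<in>{s..T}. ennreal ((norm (simple_value (L' k) t \<omega> - F (H t \<omega>)))\<^sup>2) \<partial>lborel) \<partial>M) \<longlonglongrightarrow> 0"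
    proof (rule tendsto_sandwich[OF _ _ tendsto_const lim[OF L(2)]]; (intro always_eventually allI)?)
      fix k
      have "(\<integral>\<^sup>+\<omega>. (\<integral>\<^sup>+t\<in>{s..T}. ennreal ((norm (simple_value (L' k) t \<omega> - F (H t \<omega>)))\<^sup>2) \<partial>lborel) \<partial>M) =
        (\<integral>\<^sup>+p. ennreal ((norm (F (simple_value (L k) (fst p) (snd p)) - F (H (fst p) (snd p))))\<^sup>2) \<partial>N)"
        unfolding SV using measurable_compose[OF mL Fm] measurable_compose[OF mH Fm] by (intro nn_integral_N) auto
      also have "\<dots> \<le> (\<integral>\<^sup>+p. ennreal (K\<^sup>2) * ennreal ((norm (simple_value (L k) (fst p) (snd p) - H (fst p) (snd p)))\<^sup>2) \<partial>N)"
        by (intro nn_integral_mono bnd)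
      also have "\<dots> = ennreal (K\<^sup>2) * (\<integral>\<^sup>+p. ennreal ((norm (simple_value (L k) (fst p) (snd p) - H (fst p) (snd p)))\<^sup>2) \<partial>N)"
        using mL mH by (intro nn_integral_cmult) auto
      also have "(\<integral>\<^sup>+p. ennreal ((norm (simple_value (L k) (fst p) (snd p) - H (fst p) (snd p)))\<^sup>2) \<partial>N) =
        (\<integral>\<^sup>+\<omega>. (\<integral>\<^sup>+t\<in>{s..T}. ennreal ((norm (simple_value (L k) t \<omega> - H t \<omega>))\<^sup>2) \<partial>lborel) \<partial>M)"
        using mL mH by (intro nn_integral_N[symmetric]) auto
      finally show "(\<integral>\<^sup>+\<omega>. (\<integral>\<^sup>+t\<in>{s..T}. ennreal ((norm (simple_value (L' k) t \<omega> - F (H t \<omega>)))\<^sup>2) \<partial>lborel) \<partial>M) \<le>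
        ennreal (K\<^sup>2) * (\<integral>\<^sup>+\<omega>. (\<integral>\<^sup>+t\<in>{s..T}. ennreal ((norm (simple_value (L k) t \<omega> - H t \<omega>))\<^sup>2) \<partial>lborel) \<partial>M)" .
    qed simp
    show "(\<lambda>k. \<integral>\<^sup>+\<omega>. ennreal ((norm (simple_integral W (L' k) t \<omega> - F (I t \<omega>)))\<^sup>2) \<partial>M) \<longlonglongrightarrow> 0" if t: "t \<in> {s..T}" for t
    proof (rule tendsto_sandwich[OF _ _ tendsto_const lim[OF L(3)[OF t]]]; (intro always_eventually allI)?)
      fix k
      have "(\<integral>\<^sup>+\<omega>. ennreal ((norm (simple_integral W (L' k) t \<omega> - F (I t \<omega>)))\<^sup>2) \<partial>M) \<le>
        (\<integral>\<^sup>+\<omega>. ennreal (K\<^sup>2) * ennreal ((norm (simple_integral W (L k) t \<omega> - I t \<omega>))\<^sup>2) \<partial>M)"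
        unfolding SI by (intro nn_integral_mono bnd)
      also have "\<dots> = ennreal (K\<^sup>2) * (\<integral>\<^sup>+\<omega>. ennreal ((norm (simple_integral W (L k) t \<omega> - I t \<omega>))\<^sup>2) \<partial>M)"
        using mI[OF t] sq_integrable_measurable[OF sq_integrable_simple_integral[OF L(1) t]] by (intro nn_integral_cmult) auto
      finally show "(\<integral>\<^sup>+\<omega>. ennreal ((norm (simple_integral W (L' k) t \<omega> - F (I t \<omega>)))\<^sup>2) \<partial>M) \<le>
        ennreal (K\<^sup>2) * (\<integral>\<^sup>+\<omega>. ennreal ((norm (simple_integral W (L k) t \<omega> - I t \<omega>))\<^sup>2) \<partial>M)" .
    qed simp
  qed
qed

lemma ito_integral_add:
  fixes H H' :: "('w, 'a::euclidean_space) process"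
  assumes bi: "brownian_interval M W s T" and I: "ito_integral M W s T H I" and I': "ito_integral M W s T H' I'"
  shows "ito_integral M W s T (\<lambda>t \<omega>. H t \<omega> + H' t \<omega>) (\<lambda>t \<omega>. I t \<omega> + I' t \<omega>)"
proof -
  interpret brownian_interval M W s T by fact
  obtain L where L: "\<And>k::nat. simple_process M W s T (L k)"
    "(\<lambda>k. \<integral>\<^sup>+x. ennreal ((norm (simple_value (L k) (fst x) (snd x) - H (fst x) (snd x)))\<^sup>2) \<partial>N) \<longlonglongrightarrow> 0"
    "\<And>t. t \<in> {s..T} \<Longrightarrow> (\<lambda>k. \<integral>\<^sup>+\<omega>. ennreal ((norm (simple_integral W (L k) t \<omega> - I t \<omega>))\<^sup>2) \<partial>M) \<longlonglongrightarrow> 0"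
    by (rule ito_integralE[OF I]) blast
  obtain L' where L': "\<And>k::nat. simple_process M W s T (L' k)"
    "(\<lambda>k. \<integral>\<^sup>+x. ennreal ((norm (simple_value (L' k) (fst x) (snd x) - H' (fst x) (snd x)))\<^sup>2) \<partial>N) \<longlonglongrightarrow> 0"
    "\<And>t. t \<in> {s..T} \<Longrightarrow> (\<lambda>k. \<integral>\<^sup>+\<omega>. ennreal ((norm (simple_integral W (L' k) t \<omega> - I' t \<omega>))\<^sup>2) \<partial>M) \<longlonglongrightarrow> 0"
    by (rule ito_integralE[OF I']) blast
  have sum_bound: "ennreal ((norm (a + b - (c + d)))\<^sup>2) \<le> 2 * ennreal ((norm (a - c))\<^sup>2) + 2 * ennreal ((norm (b - d))\<^sup>2)"
    for a b c d :: 'a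
  proof -
    have "(norm (a + b - (c + d)))\<^sup>2 \<le> (norm (a - c) + norm (b - d))\<^sup>2"
      by (intro power_mono norm_diff_triangle_ineq) auto
    also have "\<dots> \<le> 2 * (norm (a - c))\<^sup>2 + 2 * (norm (b - d))\<^sup>2"
      using sum_squares_bound[of "norm (a - c)" "norm (b - d)"] by (simp add: power2_sum)
    finally have "ennreal ((norm (a + b - (c + d)))\<^sup>2) \<le> ennreal (2 * (norm (a - c))\<^sup>2 + 2 * (norm (b - d))\<^sup>2)"
      by (rule ennreal_leI)
    then show ?thesis by (simp add: ennreal_mult)
  qed
  have lim: "(\<lambda>k. \<integral>\<^sup>+x. ennreal ((norm (F k x + G k x - (f x + g x)))\<^sup>2) \<partial>R) \<longlonglongrightarrow> 0"
    if F: "\<And>k. F k \<in> borel_measurable R" "f \<in> borel_measurable R" "\<And>k. G k \<in> borel_measurable R" "g \<in> borel_measurable R"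
      "(\<lambda>k. \<integral>\<^sup>+x. ennreal ((norm (F k x - f x))\<^sup>2) \<partial>R) \<longlonglongrightarrow> 0"
      "(\<lambda>k. \<integral>\<^sup>+x. ennreal ((norm (G k x - g x))\<^sup>2) \<partial>R) \<longlonglongrightarrow> 0"
    for F G :: "nat \<Rightarrow> 'b \<Rightarrow> 'a" and f g R
  proof (rule tendsto_sandwich[OF _ _ tendsto_const])
    show "(\<lambda>k. 2 * (\<integral>\<^sup>+x. ennreal ((norm (F k x - f x))\<^sup>2) \<partial>R) + 2 * (\<integral>\<^sup>+x. ennreal ((norm (G k x - g x))\<^sup>2) \<partial>R)) \<longlonglongrightarrow> 0"
      using tendsto_add[OF ennreal_tendsto_cmult[OF _ F(5), of 2] ennreal_tendsto_cmult[OF _ F(6), of 2]] by simp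
    have "(\<integral>\<^sup>+x. ennreal ((norm (F k x + G k x - (f x + g x)))\<^sup>2) \<partial>R) \<le>
      2 * (\<integral>\<^sup>+x. ennreal ((norm (F k x - f x))\<^sup>2) \<partial>R) + 2 * (\<integral>\<^sup>+x. ennreal ((norm (G k x - g x))\<^sup>2) \<partial>R)" for k
    proof -
      have "(\<integral>\<^sup>+x. ennreal ((norm (F k x + G k x - (f x + g x)))\<^sup>2) \<partial>R) \<le>
        (\<integral>\<^sup>+x. 2 * ennreal ((norm (F k x - f x))\<^sup>2) + 2 * ennreal ((norm (G k x - g x))\<^sup>2) \<partial>R)"
        by (intro nn_integral_mono sum_bound)
      also have "\<dots> = 2 * (\<integral>\<^sup>+x. ennreal ((norm (F k x - f x))\<^sup>2) \<partial>R) + 2 * (\<integral>\<^sup>+x. ennreal ((norm (G k x - g x))\<^sup>2) \<partial>R)"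
        using F(1)[of k] F(2) F(3)[of k] F(4) by (subst nn_integral_add) (auto simp: nn_integral_cmult)
      finally show ?thesis .
    qed
    then show "\<forall>\<^sub>F k in sequentially. (\<integral>\<^sup>+x. ennreal ((norm (F k x + G k x - (f x + g x)))\<^sup>2) \<partial>R) \<le>
      2 * (\<integral>\<^sup>+x. ennreal ((norm (F k x - f x))\<^sup>2) \<partial>R) + 2 * (\<integral>\<^sup>+x. ennreal ((norm (G k x - g x))\<^sup>2) \<partial>R)"
      by (intro always_eventually allI)
  qed simp
  \<comment> \<open>Concatenating the lists of summands adds both the simple processes and their
    integrals.\<close>
  have SV: "simple_value (L k @ L' k) t \<omega> = simple_value (L k) t \<omega> + simple_value (L' k) t \<omega>" for k t \<omega>
    by (simp add: simple_value_def)
  have SI: "simple_integral W (L k @ L' k) t \<omega> = simple_integral W (L k) t \<omega> + simple_integral W (L' k) t \<omega>" for k t \<omega>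
    by (simp add: simple_integral_def)
  have mI: "I t \<in> borel_measurable M" "I' t \<in> borel_measurable M" if "t \<in> {s..T}" for t
    using I I' that sq_integrable_measurable[OF sq_integrable_ito_integral] by blast+
  have mH: "(\<lambda>p. H (fst p) (snd p)) \<in> borel_measurable N" "(\<lambda>p. H' (fst p) (snd p)) \<in> borel_measurable N"
    using I I' by (auto simp: ito_integral_def L2_process_iff sq_integrable_def)
  have mL: "(\<lambda>p. simple_value (L k) (fst p) (snd p)) \<in> borel_measurable N" "(\<lambda>p. simple_value (L' k) (fst p) (snd p)) \<in> borel_measurable N" for k
    by (rule sq_integrable_measurable[OF sq_integrable_simple_value[OF L(1)]],
        rule sq_integrable_measurable[OF sq_integrable_simple_value[OF L'(1)]])
  have mS: "simple_integral W (L k) t \<in> borel_measurable M" "simple_integral W (L' k) t \<in> borel_measurable M" if "t \<in> {s..T}" for k t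
    by (rule sq_integrable_measurable[OF sq_integrable_simple_integral[OF L(1) that]],
        rule sq_integrable_measurable[OF sq_integrable_simple_integral[OF L'(1) that]])
  show ?thesis
    unfolding ito_integral_def
  proof (intro conjI exI[of _ "\<lambda>k. L k @ L' k"] allI ballI)
    show "(\<lambda>t \<omega>. H t \<omega> + H' t \<omega>) \<in> L2_process M W s T"
      using I I' progressive_add sq_integrable_add by (auto simp: ito_integral_def L2_process_iff)
    show "continuous_paths M s T (\<lambda>t \<omega>. I t \<omega> + I' t \<omega>)"
      using I I' unfolding ito_integral_def continuous_paths_def
      by (auto elim!: eventually_elim2 intro: continuous_on_add)
    show "(\<lambda>\<omega>. I t \<omega> + I' t \<omega>) \<in> borel_measurable (\<F> t)" if "t \<in> {s..T}" for t
      using I I' that unfolding ito_integral_def by (intro borel_measurable_add) auto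
    show "simple_process M W s T (L k @ L' k)" for k
      using L(1)[of k] L'(1)[of k] unfolding simple_process_def set_append ball_Un by blast
    have "(\<integral>\<^sup>+\<omega>. (\<integral>\<^sup>+t\<in>{s..T}. ennreal ((norm (simple_value (L k @ L' k) t \<omega> - (H t \<omega> + H' t \<omega>)))\<^sup>2) \<partial>lborel) \<partial>M) =
      (\<integral>\<^sup>+p. ennreal ((norm (simple_value (L k) (fst p) (snd p) + simple_value (L' k) (fst p) (snd p)
         - (H (fst p) (snd p) + H' (fst p) (snd p))))\<^sup>2) \<partial>N)" for k
      unfolding SV using mL[of k] mH by (intro nn_integral_N) auto
    then show "(\<lambda>k. \<integral>\<^sup>+\<omega>. (\<integral>\<^sup>+t\<in>{s..T}. ennreal ((norm (simple_value (L k @ L' k) t \<omega> - (H t \<omega> + H' t \<omega>)))\<^sup>2) \<partial>lborel) \<partial>M) \<longlonglongrightarrow> 0"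
      using lim[OF mL(1) mH(1) mL(2) mH(2) L(2) L'(2)] by simp
    show "(\<lambda>k. \<integral>\<^sup>+\<omega>. ennreal ((norm (simple_integral W (L k @ L' k) t \<omega> - (I t \<omega> + I' t \<omega>)))\<^sup>2) \<partial>M) \<longlonglongrightarrow> 0" if t: "t \<in> {s..T}" for t
      unfolding SI by (rule lim[OF mS(1)[OF t] mI(1)[OF t] mS(2)[OF t] mI(2)[OF t] L(3)[OF t] L'(3)[OF t]])
  qed
qed

lemma ito_differential_bounded_linear:
  fixes F :: "'a::euclidean_space \<Rightarrow> 'b::euclidean_space"
  assumes F: "bounded_linear F" and bi: "brownian_interval M W s T" and X: "ito_differential M W s T X b \<sigma>"
  shows "ito_differential M W s T (\<lambda>t \<omega>. F (X t \<omega>)) (\<lambda>t \<omega>. F (b t \<omega>)) (\<lambda>t \<omega>. F (\<sigma> t \<omega>))"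
proof -
  interpret F: bounded_linear F by fact
  obtain I where I: "ito_integral M W s T \<sigma> I" and ae: "AE \<omega> in M. set_integrable lborel {s..T} (\<lambda>t. b t \<omega>) \<and>
           (\<forall>t\<in>{s..T}. X t \<omega> = X s \<omega> + (LBINT r:{s..t}. b r \<omega>) + I t \<omega>)"
    using X unfolding ito_differential_def by blast
  show ?thesis
    unfolding ito_differential_def
  proof (intro exI[of _ "\<lambda>t \<omega>. F (I t \<omega>)"] conjI ito_integral_bounded_linear[OF F bi I])
    show "AE \<omega> in M. set_integrable lborel {s..T} (\<lambda>t. F (b t \<omega>)) \<and>
           (\<forall>t\<in>{s..T}. F (X t \<omega>) = F (X s \<omega>) + (LBINT r:{s..t}. F (b r \<omega>)) + F (I t \<omega>))"
      using ae
    proof eventually_elim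
      case (elim \<omega>)
      note bT = conjunct1[OF elim] and eq = bspec[OF conjunct2[OF elim]]
      have int: "set_integrable lborel {s..t} (\<lambda>r. b r \<omega>)" if "t \<le> T" for t
        by (rule set_integrable_subset[OF bT]) (use that in \<open>simp_all\<close>)
      have lin: "set_integrable lborel {s..t} (\<lambda>r. F (b r \<omega>)) \<and> (LBINT r:{s..t}. F (b r \<omega>)) = F (LBINT r:{s..t}. b r \<omega>)" if "t \<le> T" for t
        using integrable_bounded_linear[OF F int[OF that, unfolded set_integrable_def]]
          integral_bounded_linear[OF F int[OF that, unfolded set_integrable_def]]
        unfolding set_integrable_def set_lebesgue_integral_def by (simp add: F.scaleR)
      have "F (X t \<omega>) = F (X s \<omega>) + (LBINT r:{s..t}. F (b r \<omega>)) + F (I t \<omega>)" if "t \<in> {s..T}" for t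
        unfolding eq[OF that] using lin[of t] that by (simp add: F.add)
      with lin[of T] show ?case by blast
    qed
  qed
qed

lemma ito_differential_add:
  fixes X Y :: "('w, 'a::euclidean_space) process"
  assumes bi: "brownian_interval M W s T" and X: "ito_differential M W s T X b \<sigma>" and Y: "ito_differential M W s T Y c \<tau>"
  shows "ito_differential M W s T (\<lambda>t \<omega>. X t \<omega> + Y t \<omega>) (\<lambda>t \<omega>. b t \<omega> + c t \<omega>) (\<lambda>t \<omega>. \<sigma> t \<omega> + \<tau> t \<omega>)"
proof -
  obtain I where I: "ito_integral M W s T \<sigma> I" and aeX: "AE \<omega> in M. set_integrable lborel {s..T} (\<lambda>t. b t \<omega>) \<and>
           (\<forall>t\<in>{s..T}. X t \<omega> = X s \<omega> + (LBINT r:{s..t}. b r \<omega>) + I t \<omega>)"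
    using X unfolding ito_differential_def by blast
  obtain J where J: "ito_integral M W s T \<tau> J" and aeY: "AE \<omega> in M. set_integrable lborel {s..T} (\<lambda>t. c t \<omega>) \<and>
           (\<forall>t\<in>{s..T}. Y t \<omega> = Y s \<omega> + (LBINT r:{s..t}. c r \<omega>) + J t \<omega>)"
    using Y unfolding ito_differential_def by blast
  show ?thesis
    unfolding ito_differential_def
  proof (intro exI[of _ "\<lambda>t \<omega>. I t \<omega> + J t \<omega>"] conjI ito_integral_add[OF bi I J])
    show "AE \<omega> in M. set_integrable lborel {s..T} (\<lambda>t. b t \<omega> + c t \<omega>) \<and>
           (\<forall>t\<in>{s..T}. X t \<omega> + Y t \<omega> = X s \<omega> + Y s \<omega> + (LBINT r:{s..t}. b r \<omega> + c r \<omega>) + (I t \<omega> + J t \<omega>))"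
      using aeX aeY
    proof eventually_elim
      case (elim \<omega>)
      note int = conjunct1[OF elim(1)] conjunct1[OF elim(2)]
      note eq = bspec[OF conjunct2[OF elim(1)]] bspec[OF conjunct2[OF elim(2)]]
      have "set_integrable lborel {s..t} (\<lambda>r. b r \<omega>)" "set_integrable lborel {s..t} (\<lambda>r. c r \<omega>)" if "t \<le> T" for t
        using that by (auto intro!: set_integrable_subset[OF int(1)] set_integrable_subset[OF int(2)])
      then have add: "(LBINT r:{s..t}. b r \<omega> + c r \<omega>) = (LBINT r:{s..t}. b r \<omega>) + (LBINT r:{s..t}. c r \<omega>)" if "t \<le> T" for t
        using that by (intro set_integral_add) auto
      have "X t \<omega> + Y t \<omega> = X s \<omega> + Y s \<omega> + (LBINT r:{s..t}. b r \<omega> + c r \<omega>) + (I t \<omega> + J t \<omega>)"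
        if "t \<in> {s..T}" for t
        unfolding eq[OF that] using add[of t] that by simp
      then show ?case using set_integral_add(1)[OF int] by blast
    qed
  qed
qed

lemma ito_differential_diff:
  fixes X Y :: "('w, 'a::euclidean_space) process"
  assumes bi: "brownian_interval M W s T" and X: "ito_differential M W s T X b \<sigma>" and Y: "ito_differential M W s T Y c \<tau>"
  shows "ito_differential M W s T (\<lambda>t \<omega>. X t \<omega> - Y t \<omega>) (\<lambda>t \<omega>. b t \<omega> - c t \<omega>) (\<lambda>t \<omega>. \<sigma> t \<omega> - \<tau> t \<omega>)"
  using ito_differential_add[OF bi X ito_differential_bounded_linear[OF bounded_linear_minus[OF bounded_linear_ident] bi Y]]
  by simp


section \<open>The expected Ito product rule\<close>

context brownian_interval
begin

section \<open>Drift integrals\<close>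

lemma integral_N_fst:
  fixes f :: "real \<Rightarrow> 'w \<Rightarrow> 'a::euclidean_space"
  assumes "integrable N (\<lambda>p. f (fst p) (snd p))"
  shows "(\<integral>p. f (fst p) (snd p) \<partial>N) = (\<integral>t. expectation (f t) \<partial>TI)"
    and "integrable TI (\<lambda>t. expectation (f t))"
    and "AE t in TI. integrable M (f t)"
  using prod.integral_fst'[OF assms] prod.integrable_fst'[OF assms] prod.AE_integrable_fst'[OF assms] by simp_all

lemma measure_TI: "measure TI (space TI) = T - s"
  using s_less_T by (simp add: measure_restrict_space)

lemma integral_const_TI: "(\<integral>t. (c::real) \<partial>TI) = (T - s) * c"
  using measure_TI by simp

lemma integrable_snd_N:
  fixes g :: "'w \<Rightarrow> 'a::euclidean_space"
  assumes "integrable M g"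
  shows "integrable N (\<lambda>p. g (snd p))"
proof (rule prod.Fubini_integrable)
  have [measurable]: "g \<in> borel_measurable M" using assms by auto
  show "(\<lambda>p. g (snd p)) \<in> borel_measurable N" by measurable
qed (use assms in auto)

lemma sq_integrable_snd_N: "sq_integrable M g \<Longrightarrow> sq_integrable N (\<lambda>p. g (snd p))"
  using integrable_snd_N[of "\<lambda>\<omega>. (norm (g \<omega>))\<^sup>2"] measurable_compose[OF measurable_snd, of g M borel TI]
  by (auto simp: sq_integrable_def)

lemma sq_integrable_sections:
  assumes "sq_integrable N (\<lambda>p. b (fst p) (snd p))"
  shows "AE \<omega> in M. sq_integrable TI (\<lambda>r. b r \<omega>)" and "AE r in TI. sq_integrable M (b r)"
proof -
  have m: "(\<lambda>p. b (fst p) (snd p)) \<in> borel_measurable N" by (rule sq_integrable_measurable[OF assms])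
  have i: "integrable N (\<lambda>p. (norm (b (fst p) (snd p)))\<^sup>2)" by (rule sq_integrable_norm[OF assms])
  then have "integrable N (\<lambda>(r, \<omega>). (norm (b r \<omega>))\<^sup>2)" by (simp add: case_prod_beta')
  from prod.AE_integrable_snd[OF this] AE_space[of M]
  show "AE \<omega> in M. sq_integrable TI (\<lambda>r. b r \<omega>)"
  proof eventually_elim
    case (elim \<omega>)
    then show ?case using measurable_compose[OF measurable_Pair2'[of \<omega> M TI] m] by (simp add: sq_integrable_def)
  qed
  from prod.AE_integrable_fst'[OF i] AE_space[of TI]
  show "AE r in TI. sq_integrable M (b r)"
  proof eventually_elim
    case (elim r)
    then show ?case using measurable_compose[OF measurable_Pair1'[of r TI M] m] by (simp add: sq_integrable_def)
  qed
qed

text \<open>The cut-off stands in the integrand instead of the domain, so that one measure serves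
  all \<open>t\<close> and Fubini on \<open>N\<close> applies. By \<open>LBINT_subinterval\<close>
  this is the drift integral over \<open>{s..t}\<close> for \<open>t \<le> T\<close>.\<close>

definition primitive :: "('w, 'a::euclidean_space) process \<Rightarrow> ('w, 'a) process" where
  "primitive b t \<omega> = (\<integral>r. (if r \<le> t then b r \<omega> else 0) \<partial>TI)"

lemma primitive_bound:
  assumes "sq_integrable TI (\<lambda>r. b r \<omega>)"
  shows "(norm (primitive b t \<omega>))\<^sup>2 \<le> (T - s) * (\<integral>r. (norm (b r \<omega>))\<^sup>2 \<partial>TI)"
proof -
  have "norm (primitive b t \<omega>) \<le> (\<integral>r. norm (if r \<le> t then b r \<omega> else 0) \<partial>TI)"
    unfolding primitive_def by (rule integral_norm_bound)
  also have "\<dots> \<le> (\<integral>r. norm (b r \<omega>) \<partial>TI)"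
  proof (rule integral_mono_AE')
    show "integrable TI (\<lambda>r. norm (b r \<omega>))" by (intro integrable_norm time.sq_integrable_integrable assms)
  qed auto
  finally have "(norm (primitive b t \<omega>))\<^sup>2 \<le> (\<integral>r. norm (b r \<omega>) \<bullet> 1 \<partial>TI)\<^sup>2"
    by (intro power_mono) auto
  \<comment> \<open>Cauchy-Schwarz against the constant one; this is the source of the factor
    \<open>T - s\<close>.\<close>
  also have "\<dots> \<le> (\<integral>r. (norm (norm (b r \<omega>)))\<^sup>2 \<partial>TI) * (\<integral>r. (norm (1::real))\<^sup>2 \<partial>TI)"
    by (intro inner_integral_Cauchy_Schwarz sq_integrable_norm_real assms time.sq_integrable_const)
  finally show ?thesis using measure_TI by (simp add: mult.commute)
qed

lemma primitive_measurable:
  fixes b :: "('w, 'a::euclidean_space) process"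
  assumes "(\<lambda>p. b (fst p) (snd p)) \<in> borel_measurable N"
  shows "(\<lambda>p. primitive b (fst p) (snd p)) \<in> borel_measurable N"
    and "primitive b t \<in> borel_measurable M"
proof -
  have [measurable]: "(\<lambda>p. b (fst p) (snd p)) \<in> borel_measurable N" by fact
  have "(\<lambda>x. (snd x, snd (fst x))) \<in> measurable (N \<Otimes>\<^sub>M TI) N" by measurable
  from measurable_compose[OF this assms]
  have [measurable]: "(\<lambda>x. b (snd x) (snd (fst x))) \<in> borel_measurable (N \<Otimes>\<^sub>M TI)" by simp
  show "(\<lambda>p. primitive b (fst p) (snd p)) \<in> borel_measurable N"
    unfolding primitive_def by (rule time.borel_measurable_lebesgue_integral) (simp add: case_prod_beta')
  have "(\<lambda>x. (snd x, fst x)) \<in> measurable (M \<Otimes>\<^sub>M TI) N" by measurable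
  from measurable_compose[OF this assms]
  have [measurable]: "(\<lambda>x. b (snd x) (fst x)) \<in> borel_measurable (M \<Otimes>\<^sub>M TI)" by simp
  show "primitive b t \<in> borel_measurable M"
    unfolding primitive_def[abs_def] by (rule time.borel_measurable_lebesgue_integral) (simp add: case_prod_beta')
qed

lemma sq_integrable_primitive:
  fixes b :: "('w, 'a::euclidean_space) process"
  assumes b: "sq_integrable N (\<lambda>p. b (fst p) (snd p))"
  shows "sq_integrable M (primitive b t)" and "sq_integrable N (\<lambda>p. primitive b (fst p) (snd p))"
proof -
  note m = sq_integrable_measurable[OF b]
  let ?B = "\<lambda>\<omega>. (T - s) * (\<integral>r. (norm (b r \<omega>))\<^sup>2 \<partial>TI)"
  have "integrable N (\<lambda>(r, \<omega>). (norm (b r \<omega>))\<^sup>2)" using sq_integrable_norm[OF b] by (simp add: case_prod_beta')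
  then have iB: "integrable M ?B" using prod.integrable_snd by auto
  \<comment> \<open>The bound holds for all \<open>t\<close> outside a single null set, so it also
    controls the process on \<open>N\<close>.\<close>
  have bd: "AE \<omega> in M. \<forall>t. norm ((norm (primitive b t \<omega>))\<^sup>2) \<le> norm (?B \<omega>)"
    using sq_integrable_sections(1)[OF b]
  proof eventually_elim
    case (elim \<omega>)
    show ?case using primitive_bound[of b \<omega>, OF elim] s_less_T by simp
  qed
  show "sq_integrable M (primitive b t)"
    unfolding sq_integrable_def
  proof (intro conjI primitive_measurable m Bochner_Integration.integrable_bound[OF iB])
    show "AE \<omega> in M. norm ((norm (primitive b t \<omega>))\<^sup>2) \<le> norm (?B \<omega>)" using bd by eventually_elim auto
    show "(\<lambda>\<omega>. (norm (primitive b t \<omega>))\<^sup>2) \<in> borel_measurable M" using primitive_measurable(2)[OF m] by simp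
  qed
  show "sq_integrable N (\<lambda>p. primitive b (fst p) (snd p))"
    unfolding sq_integrable_def
  proof (intro conjI primitive_measurable m Bochner_Integration.integrable_bound[OF integrable_snd_N[OF iB]])
    show "AE p in N. norm ((norm (primitive b (fst p) (snd p)))\<^sup>2) \<le> norm (?B (snd p))"
      using AE_snd_N[OF bd] by eventually_elim auto
    show "(\<lambda>p. (norm (primitive b (fst p) (snd p)))\<^sup>2) \<in> borel_measurable N" using primitive_measurable(1)[OF m] by simp
  qed
qed

lemma expectation_primitive_inner:
  fixes b :: "('w, 'a::euclidean_space) process"
  assumes b: "sq_integrable N (\<lambda>p. b (fst p) (snd p))" and \<zeta>: "sq_integrable M \<zeta>"
  shows "expectation (\<lambda>\<omega>. primitive b t \<omega> \<bullet> \<zeta> \<omega>) = (\<integral>p. (if fst p \<le> t then b (fst p) (snd p) \<bullet> \<zeta> (snd p) else 0) \<partial>N)"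
proof -
  have i: "integrable N (\<lambda>p. if fst p \<le> t then b (fst p) (snd p) \<bullet> \<zeta> (snd p) else 0)"
    by (intro integrable_if_le integrable_inner b sq_integrable_snd_N \<zeta>)
  then have "integrable N (\<lambda>(r, \<omega>). if r \<le> t then b r \<omega> \<bullet> \<zeta> \<omega> else 0)" by (simp add: case_prod_beta')
  from prod.integral_snd[OF this]
  have "(\<integral>p. (if fst p \<le> t then b (fst p) (snd p) \<bullet> \<zeta> (snd p) else 0) \<partial>N) =
    expectation (\<lambda>\<omega>. \<integral>r. (if r \<le> t then b r \<omega> \<bullet> \<zeta> \<omega> else 0) \<partial>TI)"
    by (simp add: case_prod_beta')
  also have "\<dots> = expectation (\<lambda>\<omega>. primitive b t \<omega> \<bullet> \<zeta> \<omega>)"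
  proof (rule integral_cong_AE)
    show "(\<lambda>\<omega>. \<integral>r. (if r \<le> t then b r \<omega> \<bullet> \<zeta> \<omega> else 0) \<partial>TI) \<in> borel_measurable M"
      using prod.integrable_snd[OF \<open>integrable N (\<lambda>(r, \<omega>). if r \<le> t then b r \<omega> \<bullet> \<zeta> \<omega> else 0)\<close>] by auto
    show "(\<lambda>\<omega>. primitive b t \<omega> \<bullet> \<zeta> \<omega>) \<in> borel_measurable M"
      using sq_integrable_measurable[OF sq_integrable_primitive(1)[OF b]] sq_integrable_measurable[OF \<zeta>] by simp
    show "AE \<omega> in M. (\<integral>r. (if r \<le> t then b r \<omega> \<bullet> \<zeta> \<omega> else 0) \<partial>TI) = primitive b t \<omega> \<bullet> \<zeta> \<omega>"
      using sq_integrable_sections(1)[OF b]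
    proof eventually_elim
      case (elim \<omega>)
      have "integrable TI (\<lambda>r. if r \<le> t then b r \<omega> else 0)"
        by (intro time.sq_integrable_integrable sq_integrable_indicator elim) auto
      from integral_inner_left[OF this, of "\<zeta> \<omega>"]
      show ?case unfolding primitive_def
        by (simp add: if_distrib[where f="\<lambda>x. x \<bullet> \<zeta> \<omega>"] cong: if_cong)
    qed
  qed
  finally show ?thesis by simp
qed

text \<open>The product of the two integrals is an integral over a square, which the diagonal cuts
  into the supports of \<open>?U\<close>, where \<open>q \<le> r\<close>, and of \<open>?V\<close>,
  where \<open>r < q\<close>. Fubini in the respective order gives the two terms.\<close>

lemma integration_by_parts_TI:
  fixes f g :: "real \<Rightarrow> 'a::euclidean_space"
  assumes f: "sq_integrable TI f" and g: "sq_integrable TI g"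
  shows "(\<integral>r. (if r \<le> t then f r else 0) \<partial>TI) \<bullet> (\<integral>q. (if q \<le> t then g q else 0) \<partial>TI) =
    (\<integral>r. (if r \<le> t then f r \<bullet> (\<integral>q. (if q \<le> r then g q else 0) \<partial>TI) else 0) \<partial>TI) +
    (\<integral>q. (if q \<le> t then (\<integral>r. (if r \<le> q then f r else 0) \<partial>TI) \<bullet> g q else 0) \<partial>TI)"
proof -
  interpret TT: pair_sigma_finite TI TI ..
  have [measurable]: "f \<in> borel_measurable TI" "g \<in> borel_measurable TI"
    using f g by (auto simp: sq_integrable_def)
  have int_f: "integrable TI f" and int_g: "integrable TI g"
    using f g by (auto intro: time.sq_integrable_integrable)
  have trunc: "integrable TI (\<lambda>x. if P x then h x else 0)" if "integrable TI h" "Measurable.pred TI P"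
    for h :: "real \<Rightarrow> 'a" and P
    using that by (intro Bochner_Integration.integrable_bound[OF that(1)]) (auto intro!: measurable_If)
  have int: "integrable (TI \<Otimes>\<^sub>M TI) (\<lambda>x. f (fst x) \<bullet> g (snd x))"
  proof (rule TT.Fubini_integrable)
    show "AE r in TI. integrable TI (\<lambda>q. f (fst (r, q)) \<bullet> g (snd (r, q)))" using int_g by auto
    show "integrable TI (\<lambda>r. \<integral>q. norm (f (fst (r, q)) \<bullet> g (snd (r, q))) \<partial>TI)"
    proof (rule Bochner_Integration.integrable_bound)
      show "integrable TI (\<lambda>r. norm (f r) * (\<integral>q. norm (g q) \<partial>TI))" using int_f by simp
      show "AE r in TI. norm (\<integral>q. norm (f (fst (r, q)) \<bullet> g (snd (r, q))) \<partial>TI) \<le> norm (norm (f r) * (\<integral>q. norm (g q) \<partial>TI))"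
      proof (rule AE_I2)
        fix r
        have "(\<integral>q. norm (f r \<bullet> g q) \<partial>TI) \<le> (\<integral>q. norm (f r) * norm (g q) \<partial>TI)"
          using int_g by (intro integral_mono) (auto simp: Cauchy_Schwarz_ineq2)
        then show "norm (\<integral>q. norm (f (fst (r, q)) \<bullet> g (snd (r, q))) \<partial>TI) \<le> norm (norm (f r) * (\<integral>q. norm (g q) \<partial>TI))"
          by (simp add: abs_mult)
      qed
    qed measurable
  qed measurable
  have int': "integrable (TI \<Otimes>\<^sub>M TI) (\<lambda>x. if P x then f (fst x) \<bullet> g (snd x) else 0)"
    if [measurable]: "Measurable.pred (TI \<Otimes>\<^sub>M TI) P" for P
    by (rule Bochner_Integration.integrable_bound[OF int]) auto
  let ?U = "\<lambda>x. if snd x \<le> fst x \<and> fst x \<le> t then f (fst x) \<bullet> g (snd x) else 0"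
  let ?V = "\<lambda>x. if fst x < snd x \<and> snd x \<le> t then f (fst x) \<bullet> g (snd x) else 0"
  have iU: "integrable (TI \<Otimes>\<^sub>M TI) ?U" and iV: "integrable (TI \<Otimes>\<^sub>M TI) ?V"
    by (rule int', measurable)+
  have "(\<integral>r. (if r \<le> t then f r else 0) \<partial>TI) \<bullet> (\<integral>q. (if q \<le> t then g q else 0) \<partial>TI) =
     (\<integral>r. (if r \<le> t then f r else 0) \<bullet> (\<integral>q. (if q \<le> t then g q else 0) \<partial>TI) \<partial>TI)"
    by (rule integral_inner_left[symmetric]) (intro impI trunc int_f, measurable)
  also have "\<dots> = (\<integral>r. (\<integral>q. (if r \<le> t then f r else 0) \<bullet> (if q \<le> t then g q else 0) \<partial>TI) \<partial>TI)"
  proof -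
    have "(\<integral>q. x \<bullet> (if q \<le> t then g q else 0) \<partial>TI) = x \<bullet> (\<integral>q. (if q \<le> t then g q else 0) \<partial>TI)" for x
      by (rule integral_inner_right) (intro impI trunc int_g, measurable)
    then show ?thesis by presburger
  qed
  also have "\<dots> = (\<integral>r. (\<integral>q. ?U (r, q) + ?V (r, q) \<partial>TI) \<partial>TI)"
    by (intro Bochner_Integration.integral_cong refl) auto
  also have "\<dots> = (\<integral>x. ?U x + ?V x \<partial>(TI \<Otimes>\<^sub>M TI))"
    by (rule TT.integral_fst') (intro Bochner_Integration.integrable_add iU iV)
  also have "\<dots> = (\<integral>x. ?U x \<partial>(TI \<Otimes>\<^sub>M TI)) + (\<integral>x. ?V x \<partial>(TI \<Otimes>\<^sub>M TI))"
    by (rule Bochner_Integration.integral_add[OF iU iV])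
  also have "(\<integral>x. ?U x \<partial>(TI \<Otimes>\<^sub>M TI)) = (\<integral>r. (\<integral>q. ?U (r, q) \<partial>TI) \<partial>TI)"
    by (rule TT.integral_fst'[OF iU, symmetric])
  also have "\<dots> = (\<integral>r. (if r \<le> t then f r \<bullet> (\<integral>q. (if q \<le> r then g q else 0) \<partial>TI) else 0) \<partial>TI)"
  proof (intro Bochner_Integration.integral_cong refl)
    fix r
    have "(\<integral>q. f r \<bullet> (if q \<le> r then g q else 0) \<partial>TI) = f r \<bullet> (\<integral>q. (if q \<le> r then g q else 0) \<partial>TI)"
      by (rule integral_inner_right) (intro impI trunc int_g, measurable)
    moreover have "?U (r, q) = (if r \<le> t then f r \<bullet> (if q \<le> r then g q else 0) else 0)" for q by simp
    ultimately show "(\<integral>q. ?U (r, q) \<partial>TI) = (if r \<le> t then f r \<bullet> (\<integral>q. (if q \<le> r then g q else 0) \<partial>TI) else 0)"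
      by (cases "r \<le> t") (simp_all only: if_True if_False integral_zero)
  qed
  also have "(\<integral>x. ?V x \<partial>(TI \<Otimes>\<^sub>M TI)) = (\<integral>q. (\<integral>r. ?V (r, q) \<partial>TI) \<partial>TI)"
    using TT.integral_snd[of "\<lambda>r q. ?V (r, q)"] iV by (simp add: case_prod_beta' cong: if_cong)
  also have "\<dots> = (\<integral>q. (if q \<le> t then (\<integral>r. (if r \<le> q then f r else 0) \<partial>TI) \<bullet> g q else 0) \<partial>TI)"
  proof (intro Bochner_Integration.integral_cong refl)
    fix q
    have "(\<integral>r. (if r \<le> q then f r else 0) \<bullet> g q \<partial>TI) = (\<integral>r. (if r \<le> q then f r else 0) \<partial>TI) \<bullet> g q"
      by (rule integral_inner_left) (intro impI trunc int_f, measurable)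
    moreover have "(\<integral>r. ?V (r, q) \<partial>TI) = (\<integral>r. (if q \<le> t then (if r \<le> q then f r else 0) \<bullet> g q else 0) \<partial>TI)"
    proof (rule integral_cong_AE)
      \<comment> \<open>\<open>?V\<close> omits the diagonal, while the inner integral in the claim
        includes \<open>r = q\<close>; a single time is a null set.\<close>
      have "AE r in lborel. r \<noteq> q" by (rule AE_lborel_singleton)
      then have "AE r in TI. r \<noteq> q" by (subst AE_restrict_space_iff) auto
      then show "AE r in TI. ?V (r, q) = (if q \<le> t then (if r \<le> q then f r else 0) \<bullet> g q else 0)"
        by eventually_elim auto
      show "(\<lambda>r. ?V (r, q)) \<in> borel_measurable TI" unfolding fst_conv snd_conv by measurable
      show "(\<lambda>r. if q \<le> t then (if r \<le> q then f r else 0) \<bullet> g q else 0) \<in> borel_measurable TI"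
        by (cases "q \<le> t") simp_all
    qed
    ultimately show "(\<integral>r. ?V (r, q) \<partial>TI) = (if q \<le> t then (\<integral>r. (if r \<le> q then f r else 0) \<partial>TI) \<bullet> g q else 0)"
      by (cases "q \<le> t") (simp_all only: if_True if_False integral_zero)
  qed
  finally show ?thesis .
qed

lemma expectation_primitive_primitive:
  fixes b c :: "('w, 'a::euclidean_space) process"
  assumes b: "sq_integrable N (\<lambda>p. b (fst p) (snd p))" and c: "sq_integrable N (\<lambda>p. c (fst p) (snd p))"
  shows "expectation (\<lambda>\<omega>. primitive b t \<omega> \<bullet> primitive c t \<omega>) =
    (\<integral>p. (if fst p \<le> t then b (fst p) (snd p) \<bullet> primitive c (fst p) (snd p) else 0) \<partial>N) +
    (\<integral>p. (if fst p \<le> t then primitive b (fst p) (snd p) \<bullet> c (fst p) (snd p) else 0) \<partial>N)"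
proof -
  let ?U = "\<lambda>r \<omega>. if r \<le> t then b r \<omega> \<bullet> primitive c r \<omega> else 0"
  let ?V = "\<lambda>r \<omega>. if r \<le> t then primitive b r \<omega> \<bullet> c r \<omega> else 0"
  have iU: "integrable N (case_prod ?U)" and iV: "integrable N (case_prod ?V)"
    unfolding case_prod_beta' by (intro integrable_if_le integrable_inner b c sq_integrable_primitive)+
  have "expectation (\<lambda>\<omega>. primitive b t \<omega> \<bullet> primitive c t \<omega>) =
    expectation (\<lambda>\<omega>. (\<integral>r. ?U r \<omega> \<partial>TI) + (\<integral>r. ?V r \<omega> \<partial>TI))"
  proof (rule integral_cong_AE)
    show "AE \<omega> in M. primitive b t \<omega> \<bullet> primitive c t \<omega> = (\<integral>r. ?U r \<omega> \<partial>TI) + (\<integral>r. ?V r \<omega> \<partial>TI)"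
      using sq_integrable_sections(1)[OF b] sq_integrable_sections(1)[OF c]
    proof eventually_elim
      case (elim \<omega>)
      show ?case unfolding primitive_def by (rule integration_by_parts_TI[OF elim])
    qed
    show "(\<lambda>\<omega>. primitive b t \<omega> \<bullet> primitive c t \<omega>) \<in> borel_measurable M"
      by (intro borel_measurable_inner sq_integrable_measurable[OF sq_integrable_primitive(1)] b c)
    show "(\<lambda>\<omega>. (\<integral>r. ?U r \<omega> \<partial>TI) + (\<integral>r. ?V r \<omega> \<partial>TI)) \<in> borel_measurable M"
      using prod.integrable_snd[OF iU] prod.integrable_snd[OF iV] by (intro borel_measurable_add) auto
  qed
  also have "\<dots> = expectation (\<lambda>\<omega>. (\<integral>r. ?U r \<omega> \<partial>TI)) + expectation (\<lambda>\<omega>. (\<integral>r. ?V r \<omega> \<partial>TI))"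
    by (rule Bochner_Integration.integral_add[OF prod.integrable_snd[OF iU] prod.integrable_snd[OF iV]])
  also have "\<dots> = integral\<^sup>L N (case_prod ?U) + integral\<^sup>L N (case_prod ?V)"
    using prod.integral_snd[OF iU] prod.integral_snd[OF iV] by simp
  finally show ?thesis by (simp add: case_prod_beta')
qed

text \<open>By Fubini the drift at time \<open>r\<close> meets \<open>J t\<close>; as it is known at
  \<open>r\<close>, the martingale property replaces \<open>J t\<close> by \<open>J r\<close>.
  \<open>ito_integral\<close> demands measurability of \<open>J\<close> at each single time, not
  jointly, so the jointly measurable version \<open>J'\<close> appears in the integral over
  \<open>N\<close>.\<close>

lemma drift_martingale:
  fixes b :: "('w, 'a::euclidean_space) process"
  assumes b: "b \<in> L2_process M W s T" and J: "ito_integral M W s T \<tau> J" and t: "t \<in> {s..T}"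
    and J': "sq_integrable N (\<lambda>p. J' (fst p) (snd p))" "AE \<omega> in M. \<forall>r\<in>{s..T}. J' r \<omega> = J r \<omega>"
  shows "expectation (\<lambda>\<omega>. primitive b t \<omega> \<bullet> J t \<omega>) =
    (\<integral>p. (if fst p \<le> t then b (fst p) (snd p) \<bullet> J' (fst p) (snd p) else 0) \<partial>N)"
proof -
  have bN: "sq_integrable N (\<lambda>p. b (fst p) (snd p))" and bp: "progressive M W s T b" using b by (auto simp: L2_process_iff)
  have Jt: "sq_integrable M (J r)" if "r \<in> {s..T}" for r by (rule sq_integrable_ito_integral[OF J that])
  let ?U = "\<lambda>r \<omega>. if r \<le> t then b r \<omega> \<bullet> J t \<omega> else 0"
  let ?V = "\<lambda>r \<omega>. if r \<le> t then b r \<omega> \<bullet> J' r \<omega> else 0"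
  have iU: "integrable N (\<lambda>p. ?U (fst p) (snd p))" and iV: "integrable N (\<lambda>p. ?V (fst p) (snd p))"
    by (intro integrable_if_le integrable_inner bN J' sq_integrable_snd_N Jt t)+
  have "expectation (\<lambda>\<omega>. primitive b t \<omega> \<bullet> J t \<omega>) = (\<integral>p. ?U (fst p) (snd p) \<partial>N)"
    by (rule expectation_primitive_inner[OF bN Jt[OF t]])
  also have "\<dots> = (\<integral>r. expectation (?U r) \<partial>TI)" by (rule integral_N_fst(1)[OF iU])
  also have "\<dots> = (\<integral>r. expectation (?V r) \<partial>TI)"
  proof (rule integral_cong_AE)
    show "AE r in TI. expectation (?U r) = expectation (?V r)"
      using sq_integrable_sections(2)[OF bN] AE_space
    proof eventually_elim
      case (elim r)
      then have r: "r \<in> {s..T}" by simp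
      show ?case
      proof (cases "r \<le> t")
        case True
        have "expectation (\<lambda>\<omega>. b r \<omega> \<bullet> J t \<omega>) = expectation (\<lambda>\<omega>. b r \<omega> \<bullet> J r \<omega>)"
          using True r t by (intro ito_martingale[OF J] progressive_adapted[OF bp] elim) auto
        also have "\<dots> = expectation (\<lambda>\<omega>. b r \<omega> \<bullet> J' r \<omega>)"
        proof (rule integral_cong_AE)
          show "AE \<omega> in M. b r \<omega> \<bullet> J r \<omega> = b r \<omega> \<bullet> J' r \<omega>"
            using J'(2) by eventually_elim (use r in auto)
          show "(\<lambda>\<omega>. b r \<omega> \<bullet> J r \<omega>) \<in> borel_measurable M"
            by (intro borel_measurable_inner sq_integrable_measurable[OF elim(1)] sq_integrable_measurable[OF Jt[OF r]])
          have "J' r \<in> borel_measurable M"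
            using measurable_compose[OF measurable_Pair1'[of r TI M] sq_integrable_measurable[OF J'(1)]] r by simp
          then show "(\<lambda>\<omega>. b r \<omega> \<bullet> J' r \<omega>) \<in> borel_measurable M"
            by (intro borel_measurable_inner sq_integrable_measurable[OF elim(1)])
        qed
        finally show ?thesis using True by simp
      qed simp
    qed
  qed (use integral_N_fst(2)[OF iU] integral_N_fst(2)[OF iV] in auto)
  also have "\<dots> = (\<integral>p. ?V (fst p) (snd p) \<partial>N)" by (rule integral_N_fst(1)[OF iV, symmetric])
  finally show ?thesis .
qed

lemma ito_differentialE:
  fixes X :: "('w, 'a::euclidean_space) process"
  assumes "X \<in> L2_continuous M W s T" "ito_differential M W s T X b \<sigma>" "b \<in> L2_process M W s T"
  obtains I I' where "ito_integral M W s T \<sigma> I" "sq_integrable N (\<lambda>p. I' (fst p) (snd p))"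
    "AE \<omega> in M. \<forall>r\<in>{s..T}. I' r \<omega> = I r \<omega>"
    "\<And>t \<omega>. X t \<omega> = X s \<omega> + primitive b t \<omega> + I' t \<omega>"
    "AE \<omega> in M. I s \<omega> = 0"
proof -
  obtain I where I: "ito_integral M W s T \<sigma> I" and ae: "AE \<omega> in M. set_integrable lborel {s..T} (\<lambda>t. b t \<omega>) \<and>
           (\<forall>t\<in>{s..T}. X t \<omega> = X s \<omega> + (LBINT r:{s..t}. b r \<omega>) + I t \<omega>)"
    using assms(2) unfolding ito_differential_def by blast
  \<comment> \<open>Solving the equation for the stochastic integral yields a version that is
    jointly measurable and satisfies the equation without exceptional set.\<close>
  define I' where "I' t \<omega> = X t \<omega> - X s \<omega> - primitive b t \<omega>" for t \<omega>
  have "sq_integrable N (\<lambda>p. I' (fst p) (snd p))"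
    unfolding I'_def using assms L2_continuous_L2_process[OF assms(1)] s_less_T
    by (intro sq_integrable_diff sq_integrable_primitive sq_integrable_snd_N L2_continuous_sq_integrable[OF assms(1)])
       (auto simp: L2_process_iff)
  moreover have eq: "AE \<omega> in M. \<forall>r\<in>{s..T}. I' r \<omega> = I r \<omega>"
    using ae
  proof eventually_elim
    case (elim \<omega>)
    show ?case
    proof
      fix r assume r: "r \<in> {s..T}"
      have "X r \<omega> = X s \<omega> + (LBINT u:{s..r}. b u \<omega>) + I r \<omega>" using elim r by blast
      then show "I' r \<omega> = I r \<omega>" using r by (simp add: I'_def primitive_def LBINT_subinterval)
    qed
  qed
  \<comment> \<open>The equation at \<open>t = s\<close> forces the integral to vanish there, as the
    drift over a single time is zero.\<close>
  moreover have "AE \<omega> in M. I s \<omega> = 0"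
    using ae
  proof eventually_elim
    case (elim \<omega>)
    have "X s \<omega> = X s \<omega> + (LBINT u:{s..s}. b u \<omega>) + I s \<omega>" using elim s_less_T by (meson atLeastAtMost_iff less_imp_le order_refl)
    moreover have "(LBINT u:{s..s}. b u \<omega>) = 0"
    proof -
      have "AE u in lborel. indicat_real {s} u *\<^sub>R b u \<omega> = 0"
        using AE_lborel_singleton[of s] by eventually_elim simp
      then show ?thesis by (simp add: set_lebesgue_integral_def integral_eq_zero_AE)
    qed
    ultimately show ?case by simp
  qed
  ultimately show ?thesis using that[OF I] by (simp add: I'_def)
qed

theorem ito_product:
  fixes X Y :: "('w, 'a::euclidean_space) process"
  assumes X: "X \<in> L2_continuous M W s T" "ito_differential M W s T X b \<sigma>" "b \<in> L2_process M W s T"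
    and Y: "Y \<in> L2_continuous M W s T" "ito_differential M W s T Y c \<tau>" "c \<in> L2_process M W s T"
    and t: "t \<in> {s..T}"
  shows "expectation (\<lambda>\<omega>. X t \<omega> \<bullet> Y t \<omega>) = expectation (\<lambda>\<omega>. X s \<omega> \<bullet> Y s \<omega>) +
    (\<integral>p. (if fst p \<le> t then X (fst p) (snd p) \<bullet> c (fst p) (snd p) + b (fst p) (snd p) \<bullet> Y (fst p) (snd p)
        + \<sigma> (fst p) (snd p) \<bullet> \<tau> (fst p) (snd p) else 0) \<partial>N)"
proof -
  obtain I I' where I: "ito_integral M W s T \<sigma> I" "sq_integrable N (\<lambda>p. I' (fst p) (snd p))"
    "AE \<omega> in M. \<forall>r\<in>{s..T}. I' r \<omega> = I r \<omega>" and Xeq: "\<And>t \<omega>. X t \<omega> = X s \<omega> + primitive b t \<omega> + I' t \<omega>"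
    and Is: "AE \<omega> in M. I s \<omega> = 0"
    by (rule ito_differentialE[OF X]) blast
  obtain J J' where J: "ito_integral M W s T \<tau> J" "sq_integrable N (\<lambda>p. J' (fst p) (snd p))"
    "AE \<omega> in M. \<forall>r\<in>{s..T}. J' r \<omega> = J r \<omega>" and Yeq: "\<And>t \<omega>. Y t \<omega> = Y s \<omega> + primitive c t \<omega> + J' t \<omega>"
    and Js: "AE \<omega> in M. J s \<omega> = 0"
    by (rule ito_differentialE[OF Y]) blast
  have s: "s \<in> {s..T}" using s_less_T by simp
  have b: "sq_integrable N (\<lambda>p. b (fst p) (snd p))" and c: "sq_integrable N (\<lambda>p. c (fst p) (snd p))"
    and \<sigma>: "sq_integrable N (\<lambda>p. \<sigma> (fst p) (snd p))" and \<tau>: "sq_integrable N (\<lambda>p. \<tau> (fst p) (snd p))"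
    using X Y I J by (auto simp: L2_process_iff ito_integral_def)
  have XN: "sq_integrable N (\<lambda>p. X (fst p) (snd p))" and YN: "sq_integrable N (\<lambda>p. Y (fst p) (snd p))"
    using L2_continuous_L2_process[OF X(1)] L2_continuous_L2_process[OF Y(1)] by (auto simp: L2_process_iff)
  note Xs = L2_continuous_sq_integrable[OF X(1) s] and Ys = L2_continuous_sq_integrable[OF Y(1) s]
  note It = sq_integrable_ito_integral[OF I(1) t] and Jt = sq_integrable_ito_integral[OF J(1) t]
  note bt = sq_integrable_primitive(1)[OF b, of t] and ct = sq_integrable_primitive(1)[OF c, of t]
  note bN = sq_integrable_primitive(2)[OF b] and cN = sq_integrable_primitive(2)[OF c]
  note sN = sq_integrable_snd_N[OF Xs] sq_integrable_snd_N[OF Ys]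
  \<comment> \<open>The initial value is known at \<open>s\<close>, where the integral vanishes, so
    it is orthogonal to the integral at \<open>t\<close>.\<close>
  have zero: "expectation (\<lambda>\<omega>. \<zeta> \<omega> \<bullet> K t \<omega>) = 0"
    if "ito_integral M W s T \<kappa> K" "AE \<omega> in M. K s \<omega> = 0" "\<zeta> \<in> borel_measurable (\<F> s)" "sq_integrable M \<zeta>"
    for \<kappa> K and \<zeta> :: "'w \<Rightarrow> 'a"
  proof -
    have "expectation (\<lambda>\<omega>. \<zeta> \<omega> \<bullet> K t \<omega>) = expectation (\<lambda>\<omega>. \<zeta> \<omega> \<bullet> K s \<omega>)"
      using t by (intro ito_martingale[OF that(1)] that) auto
    also have "\<dots> = 0" using that(2) by (intro integral_eq_zero_AE) auto
    finally show ?thesis .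
  qed
  have Xsm: "X s \<in> borel_measurable (\<F> s)" and Ysm: "Y s \<in> borel_measurable (\<F> s)"
    using X Y s by (auto simp: L2_continuous_def intro: progressive_adapted)
  \<comment> \<open>Each factor is initial value plus drift integral plus stochastic integral, which
    gives nine products. The two that pair an initial value with a stochastic integral vanish, and
    integration by parts splits the product of the drift integrals in two.\<close>
  have "expectation (\<lambda>\<omega>. X t \<omega> \<bullet> Y t \<omega>) =
    expectation (\<lambda>\<omega>. X s \<omega> \<bullet> Y s \<omega> + primitive c t \<omega> \<bullet> X s \<omega> + X s \<omega> \<bullet> J t \<omega>
      + primitive b t \<omega> \<bullet> Y s \<omega> + primitive b t \<omega> \<bullet> primitive c t \<omega> + primitive b t \<omega> \<bullet> J t \<omega>
      + Y s \<omega> \<bullet> I t \<omega> + primitive c t \<omega> \<bullet> I t \<omega> + I t \<omega> \<bullet> J t \<omega>)"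
  proof (rule integral_cong_AE)
    show "AE \<omega> in M. X t \<omega> \<bullet> Y t \<omega> = X s \<omega> \<bullet> Y s \<omega> + primitive c t \<omega> \<bullet> X s \<omega> + X s \<omega> \<bullet> J t \<omega>
      + primitive b t \<omega> \<bullet> Y s \<omega> + primitive b t \<omega> \<bullet> primitive c t \<omega> + primitive b t \<omega> \<bullet> J t \<omega>
      + Y s \<omega> \<bullet> I t \<omega> + primitive c t \<omega> \<bullet> I t \<omega> + I t \<omega> \<bullet> J t \<omega>"
      using I(3) J(3)
    proof eventually_elim
      case (elim \<omega>)
      have "I' t \<omega> = I t \<omega>" "J' t \<omega> = J t \<omega>" using elim t by auto
      then show ?case unfolding Xeq[of t] Yeq[of t] by (simp add: inner_add_left inner_add_right inner_commute)
    qed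
  qed (intro borel_measurable_add borel_measurable_inner sq_integrable_measurable[OF Xs] sq_integrable_measurable[OF Ys]
      sq_integrable_measurable[OF It] sq_integrable_measurable[OF Jt] sq_integrable_measurable[OF bt] sq_integrable_measurable[OF ct]
      sq_integrable_measurable[OF L2_continuous_sq_integrable[OF X(1) t]] sq_integrable_measurable[OF L2_continuous_sq_integrable[OF Y(1) t]])+
  also have "\<dots> = expectation (\<lambda>\<omega>. X s \<omega> \<bullet> Y s \<omega>) + expectation (\<lambda>\<omega>. primitive c t \<omega> \<bullet> X s \<omega>)
      + expectation (\<lambda>\<omega>. X s \<omega> \<bullet> J t \<omega>) + expectation (\<lambda>\<omega>. primitive b t \<omega> \<bullet> Y s \<omega>)
      + expectation (\<lambda>\<omega>. primitive b t \<omega> \<bullet> primitive c t \<omega>) + expectation (\<lambda>\<omega>. primitive b t \<omega> \<bullet> J t \<omega>)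
      + expectation (\<lambda>\<omega>. Y s \<omega> \<bullet> I t \<omega>) + expectation (\<lambda>\<omega>. primitive c t \<omega> \<bullet> I t \<omega>)
      + expectation (\<lambda>\<omega>. I t \<omega> \<bullet> J t \<omega>)"
    using integrable_inner[OF Xs Ys] integrable_inner[OF ct Xs] integrable_inner[OF Xs Jt] integrable_inner[OF bt Ys]
      integrable_inner[OF bt ct] integrable_inner[OF bt Jt] integrable_inner[OF Ys It] integrable_inner[OF ct It]
      integrable_inner[OF It Jt]
    by simp
  also have "\<dots> = expectation (\<lambda>\<omega>. X s \<omega> \<bullet> Y s \<omega>)
      + (\<integral>p. (if fst p \<le> t then c (fst p) (snd p) \<bullet> X s (snd p) else 0) \<partial>N)
      + (\<integral>p. (if fst p \<le> t then b (fst p) (snd p) \<bullet> Y s (snd p) else 0) \<partial>N)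
      + (\<integral>p. (if fst p \<le> t then b (fst p) (snd p) \<bullet> primitive c (fst p) (snd p) else 0) \<partial>N)
      + (\<integral>p. (if fst p \<le> t then primitive b (fst p) (snd p) \<bullet> c (fst p) (snd p) else 0) \<partial>N)
      + (\<integral>p. (if fst p \<le> t then b (fst p) (snd p) \<bullet> J' (fst p) (snd p) else 0) \<partial>N)
      + (\<integral>p. (if fst p \<le> t then c (fst p) (snd p) \<bullet> I' (fst p) (snd p) else 0) \<partial>N)
      + (\<integral>p. (if fst p \<le> t then \<sigma> (fst p) (snd p) \<bullet> \<tau> (fst p) (snd p) else 0) \<partial>N)"
    unfolding zero[OF J(1) Js Xsm Xs] zero[OF I(1) Is Ysm Ys] expectation_primitive_inner[OF c Xs]
      expectation_primitive_inner[OF b Ys] expectation_primitive_primitive[OF b c]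
      drift_martingale[OF X(3) J(1) t J(2,3)] drift_martingale[OF Y(3) I(1) t I(2,3)] ito_isometry[OF I(1) J(1) t]
    by simp
  also have "\<dots> = expectation (\<lambda>\<omega>. X s \<omega> \<bullet> Y s \<omega>) + (\<integral>p. (if fst p \<le> t then c (fst p) (snd p) \<bullet> X s (snd p) else 0)
      + (if fst p \<le> t then b (fst p) (snd p) \<bullet> Y s (snd p) else 0)
      + (if fst p \<le> t then b (fst p) (snd p) \<bullet> primitive c (fst p) (snd p) else 0)
      + (if fst p \<le> t then primitive b (fst p) (snd p) \<bullet> c (fst p) (snd p) else 0)
      + (if fst p \<le> t then b (fst p) (snd p) \<bullet> J' (fst p) (snd p) else 0)
      + (if fst p \<le> t then c (fst p) (snd p) \<bullet> I' (fst p) (snd p) else 0)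
      + (if fst p \<le> t then \<sigma> (fst p) (snd p) \<bullet> \<tau> (fst p) (snd p) else 0) \<partial>N)"
    using integrable_if_le[OF integrable_inner[OF c sN(1)], of t] integrable_if_le[OF integrable_inner[OF b sN(2)], of t]
      integrable_if_le[OF integrable_inner[OF b cN], of t] integrable_if_le[OF integrable_inner[OF bN c], of t]
      integrable_if_le[OF integrable_inner[OF b J(2)], of t] integrable_if_le[OF integrable_inner[OF c I(2)], of t]
      integrable_if_le[OF integrable_inner[OF \<sigma> \<tau>], of t]
    by simp
  also have "(\<integral>p. (if fst p \<le> t then c (fst p) (snd p) \<bullet> X s (snd p) else 0)
      + (if fst p \<le> t then b (fst p) (snd p) \<bullet> Y s (snd p) else 0)
      + (if fst p \<le> t then b (fst p) (snd p) \<bullet> primitive c (fst p) (snd p) else 0)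
      + (if fst p \<le> t then primitive b (fst p) (snd p) \<bullet> c (fst p) (snd p) else 0)
      + (if fst p \<le> t then b (fst p) (snd p) \<bullet> J' (fst p) (snd p) else 0)
      + (if fst p \<le> t then c (fst p) (snd p) \<bullet> I' (fst p) (snd p) else 0)
      + (if fst p \<le> t then \<sigma> (fst p) (snd p) \<bullet> \<tau> (fst p) (snd p) else 0) \<partial>N) =
    (\<integral>p. (if fst p \<le> t then X (fst p) (snd p) \<bullet> c (fst p) (snd p) + b (fst p) (snd p) \<bullet> Y (fst p) (snd p)
        + \<sigma> (fst p) (snd p) \<bullet> \<tau> (fst p) (snd p) else 0) \<partial>N)"
  \<comment> \<open>The terms with \<open>c\<close> recombine to \<open>X \<bullet> c\<close> and
    those with \<open>b\<close> to \<open>b \<bullet> Y\<close>, by the decompositions of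
    \<open>X\<close> and \<open>Y\<close> at time \<open>fst p\<close>.\<close>
  proof (intro Bochner_Integration.integral_cong refl)
    fix p :: "real \<times> 'w"
    show "(if fst p \<le> t then c (fst p) (snd p) \<bullet> X s (snd p) else 0)
      + (if fst p \<le> t then b (fst p) (snd p) \<bullet> Y s (snd p) else 0)
      + (if fst p \<le> t then b (fst p) (snd p) \<bullet> primitive c (fst p) (snd p) else 0)
      + (if fst p \<le> t then primitive b (fst p) (snd p) \<bullet> c (fst p) (snd p) else 0)
      + (if fst p \<le> t then b (fst p) (snd p) \<bullet> J' (fst p) (snd p) else 0)
      + (if fst p \<le> t then c (fst p) (snd p) \<bullet> I' (fst p) (snd p) else 0)
      + (if fst p \<le> t then \<sigma> (fst p) (snd p) \<bullet> \<tau> (fst p) (snd p) else 0) =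
      (if fst p \<le> t then X (fst p) (snd p) \<bullet> c (fst p) (snd p) + b (fst p) (snd p) \<bullet> Y (fst p) (snd p)
        + \<sigma> (fst p) (snd p) \<bullet> \<tau> (fst p) (snd p) else 0)"
      unfolding Xeq[of "fst p"] Yeq[of "fst p"] by (simp add: inner_add_left inner_add_right inner_commute)
  qed
  finally show ?thesis .
qed

end


section \<open>Gronwall estimates\<close>

lemma bounded_bilinear_matrix_vector_mult:
  "bounded_bilinear ((*v) :: real^'n^'m \<Rightarrow> real^'n \<Rightarrow> real^'m)"
  unfolding bilinear_conv_bounded_bilinear[symmetric] bilinear_def
  by (auto intro!: linearI simp: matrix_vector_right_distrib matrix_vector_mult_add_rdistrib
      scaleR_matrix_vector_assoc matrix_vector_mult_scaleR)

lemma bounded_bilinear_matrix_mult: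
  "bounded_bilinear ((**) :: real^'n^'m \<Rightarrow> real^'k^'n \<Rightarrow> real^'k^'m)"
  unfolding bilinear_conv_bounded_bilinear[symmetric] bilinear_def
  by (auto intro!: linearI simp: vec_eq_iff matrix_matrix_mult_def algebra_simps sum.distrib sum_distrib_left)

lemma bounded_linear_transpose: "bounded_linear (transpose :: real^'n^'m \<Rightarrow> real^'m^'n)"
  unfolding linear_conv_bounded_linear[symmetric]
  by (auto intro!: linearI simp: transpose_def vec_eq_iff)

context brownian_interval
begin

text \<open>Let \<open>m\<close> be the supremum of \<open>e t * g t\<close>. The weight makes the
  kernel so small that the global term contributes at most \<open>m / 4\<close>; the local term is
  an integral over an interval of length at most \<open>h\<close> and contributes at most another
  \<open>m / 4\<close>. Hence \<open>m \<le> m / 2 + R\<close>. The relation \<open>before\<close>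
  covers forward equations (\<open>r \<le> t\<close>) and backward ones (\<open>t < r\<close>)
  alike.\<close>

lemma weighted_gronwall:
  fixes g e :: "real \<Rightarrow> real" and before :: "real \<Rightarrow> real \<Rightarrow> bool"
  assumes g: "\<And>t. t \<in> {s..T} \<Longrightarrow> 0 \<le> g t" "\<And>t. t \<in> {s..T} \<Longrightarrow> g t \<le> B"
    and c: "c > 0" and h: "h > 0" "a' - a \<le> h" "a \<le> a'" and R: "R \<ge> 0"
    and e: "\<And>t. 0 < e t" "\<And>t. t \<in> {s..T} \<Longrightarrow> e t \<le> 1"
    and mono: "\<And>t r. before t r \<Longrightarrow> e t \<le> e r"
    and kernel: "\<And>t. t \<in> {s..T} \<Longrightarrow> integrable TI (\<lambda>r. if before t r then e t / e r else 0)"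
      "\<And>t. t \<in> {s..T} \<Longrightarrow> (\<integral>r. (if before t r then e t / e r else 0) \<partial>TI) \<le> 1 / (4 * c)"
    and ineq: "\<And>t. t \<in> {s..T} \<Longrightarrow> g t \<le> c * (\<integral>r. (if before t r then g r else 0) \<partial>TI)
        + 1 / (4 * h) * (\<integral>r. (if before t r \<and> r \<in> {a..a'} then g r else 0) \<partial>TI) + R"
    and t: "t \<in> {s..T}"
  shows "e t * g t \<le> 2 * R"
proof -
  define m where "m = (SUP t\<in>{s..T}. e t * g t)"
  have bdd: "bdd_above ((\<lambda>t. e t * g t) ` {s..T})"
  proof (rule bdd_aboveI2)
    fix t assume t: "t \<in> {s..T}"
    have "e t * g t \<le> 1 * B" using g[OF t] e(1)[of t] e(2)[OF t] by (intro mult_mono) auto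
    then show "e t * g t \<le> B" by simp
  qed
  have le_m: "e r * g r \<le> m" if "r \<in> {s..T}" for r
    unfolding m_def by (rule cSUP_upper[OF that bdd])
  have m0: "m \<ge> 0" using le_m[OF t] g(1)[OF t] e(1)[of t] by (smt (verit) mult_nonneg_nonneg)
  have step: "e t * g t \<le> m / 2 + R" if t: "t \<in> {s..T}" for t
  proof -
    have 1: "e t * (\<integral>r. (if before t r then g r else 0) \<partial>TI) \<le> m * (1 / (4 * c))"
    proof -
      have "e t * (\<integral>r. (if before t r then g r else 0) \<partial>TI) = (\<integral>r. e t * (if before t r then g r else 0) \<partial>TI)" by simp
      also have "\<dots> \<le> (\<integral>r. (if before t r then e t / e r else 0) * m \<partial>TI)"
      proof (rule integral_mono_AE')
        show "integrable TI (\<lambda>r. (if before t r then e t / e r else 0) * m)" using kernel(1)[OF t] by simp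
        show "AE r in TI. e t * (if before t r then g r else 0) \<le> (if before t r then e t / e r else 0) * m"
        proof (rule AE_I2)
          fix r assume "r \<in> space TI"
          then have "e t / e r * (e r * g r) \<le> e t / e r * m" using le_m[of r] e(1)[of t] e(1)[of r]
            by (intro mult_left_mono) auto
          then show "e t * (if before t r then g r else 0) \<le> (if before t r then e t / e r else 0) * m"
            using e(1)[of r] by auto
        qed
        show "AE r in TI. 0 \<le> (if before t r then e t / e r else 0) * m"
          using m0 e(1) by (auto intro!: AE_I2 mult_nonneg_nonneg divide_nonneg_nonneg simp: less_imp_le)
      qed
      also have "\<dots> = (\<integral>r. (if before t r then e t / e r else 0) \<partial>TI) * m" by simp
      also have "\<dots> \<le> 1 / (4 * c) * m" using kernel(2)[OF t] m0 by (intro mult_right_mono)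
      finally show ?thesis by (simp add: mult.commute)
    qed
    have 2: "e t * (\<integral>r. (if before t r \<and> r \<in> {a..a'} then g r else 0) \<partial>TI) \<le> m * h"
    proof -
      have "e t * (\<integral>r. (if before t r \<and> r \<in> {a..a'} then g r else 0) \<partial>TI)
        = (\<integral>r. e t * (if before t r \<and> r \<in> {a..a'} then g r else 0) \<partial>TI)" by simp
      also have "\<dots> \<le> (\<integral>r. indicat_real {a..a'} r * m \<partial>TI)"
      proof (rule integral_mono_AE')
        show "integrable TI (\<lambda>r. indicat_real {a..a'} r * m)"
          by (intro integrable_mult_left time.integrable_const_bound[where B=1]) (auto simp: indicator_def)
        show "AE r in TI. e t * (if before t r \<and> r \<in> {a..a'} then g r else 0) \<le> indicat_real {a..a'} r * m"
        proof (rule AE_I2)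
          fix r assume r: "r \<in> space TI"
          have "e t * g r \<le> m" if "before t r"
            using mult_right_mono[OF mono[OF that] g(1)[of r]] le_m[of r] r by simp
          then show "e t * (if before t r \<and> r \<in> {a..a'} then g r else 0) \<le> indicat_real {a..a'} r * m"
            using m0 by (auto simp: indicator_def)
        qed
        show "AE r in TI. 0 \<le> indicat_real {a..a'} r * m" using m0 by simp
      qed
      also have "\<dots> = (\<integral>r. indicat_real {a..a'} r \<partial>TI) * m" by simp
      also have "(\<integral>r. indicat_real {a..a'} r \<partial>TI) \<le> h"
      proof -
        have "(\<integral>r. indicat_real {a..a'} r \<partial>TI) = (\<integral>r. indicat_real {s..T} r *\<^sub>R indicat_real {a..a'} r \<partial>lborel)"
          by (subst integral_restrict_space) auto
        also have "\<dots> \<le> (\<integral>r. indicat_real {a..a'} r \<partial>lborel)"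
        proof (rule integral_mono_AE')
          show "integrable lborel (indicat_real {a..a'})" by (rule integrable_real_indicator) (use h in auto)
        qed (auto simp: indicator_def)
        also have "\<dots> \<le> h" using h by simp
        finally show ?thesis .
      qed
      finally show ?thesis using m0 by (simp add: mult.commute mult_right_mono)
    qed
    have "e t * g t \<le> e t * (c * (\<integral>r. (if before t r then g r else 0) \<partial>TI)
        + 1 / (4 * h) * (\<integral>r. (if before t r \<and> r \<in> {a..a'} then g r else 0) \<partial>TI) + R)"
      using ineq[OF t] e(1)[of t] by (intro mult_left_mono) auto
    also have "\<dots> = c * (e t * (\<integral>r. (if before t r then g r else 0) \<partial>TI))
      + 1 / (4 * h) * (e t * (\<integral>r. (if before t r \<and> r \<in> {a..a'} then g r else 0) \<partial>TI)) + e t * R"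
      by (simp add: algebra_simps)
    also have "\<dots> \<le> c * (m * (1 / (4 * c))) + 1 / (4 * h) * (m * h) + 1 * R"
      using 1 2 c h e(2)[OF t] R by (intro add_mono mult_left_mono mult_right_mono) auto
    also have "\<dots> = m / 2 + R" using c h by (simp add: field_simps)
    finally show ?thesis .
  qed
  have "m \<le> m / 2 + R"
    unfolding m_def[symmetric] using step t by (subst m_def) (intro cSUP_least, auto)
  then show ?thesis using le_m[OF t] by linarith
qed

text \<open>The quotient of the weights is \<open>exp (- c * (t - r))\<close>, whose integral over
  \<open>{s..t}\<close> stays below \<open>1 / c\<close>; a large rate makes the kernel
  small.\<close>

lemma exponential_kernel_forward:
  assumes "c > 0" "t \<in> {s..T}"
  shows "integrable TI (\<lambda>r. if r \<le> t then exp (- c * (t - s)) / exp (- c * (r - s)) else 0)"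
    and "(\<integral>r. (if r \<le> t then exp (- c * (t - s)) / exp (- c * (r - s)) else 0) \<partial>TI) \<le> 1 / c"
proof -
  have eq: "indicat_real {s..T} r *\<^sub>R (if r \<le> t then exp (- c * (t - s)) / exp (- c * (r - s)) else 0)
     = exp (- c * (t - r)) * indicat_real {s..t} r" for r
    using assms(2) by (auto simp: indicator_def exp_diff[symmetric] algebra_simps)
  have "has_bochner_integral lborel (\<lambda>r. exp (- c * (t - r)) * indicat_real {s..t} r)
     (exp (- c * (t - t)) / c - exp (- c * (t - s)) / c)"
    using assms by (intro has_bochner_integral_FTC_Icc_real) (auto intro!: derivative_eq_intros continuous_intros)
  note hb = this
  show "integrable TI (\<lambda>r. if r \<le> t then exp (- c * (t - s)) / exp (- c * (r - s)) else 0)"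
    using hb by (subst integrable_restrict_space) (auto simp only: eq has_bochner_integral_iff sets_lborel space_lborel, simp)
  have "(\<integral>r. (if r \<le> t then exp (- c * (t - s)) / exp (- c * (r - s)) else 0) \<partial>TI) = exp (- c * (t - t)) / c - exp (- c * (t - s)) / c"
    using hb by (subst integral_restrict_space) (auto simp only: eq has_bochner_integral_iff, simp)
  also have "\<dots> \<le> 1 / c" using assms(1) by (simp add: divide_right_mono field_simps)
  finally show "(\<integral>r. (if r \<le> t then exp (- c * (t - s)) / exp (- c * (r - s)) else 0) \<partial>TI) \<le> 1 / c" .
qed

text \<open>The inequality is strict because a backward estimate compares the integral over
  \<open>r \<le> t\<close> with the one over the whole horizon; the time \<open>r = t\<close> itself
  is a null set.\<close>

lemma exponential_kernel_backward:
  assumes "c > 0" "t \<in> {s..T}"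
  shows "integrable TI (\<lambda>r. if t < r then exp (- c * (T - t)) / exp (- c * (T - r)) else 0)"
    and "(\<integral>r. (if t < r then exp (- c * (T - t)) / exp (- c * (T - r)) else 0) \<partial>TI) \<le> 1 / c"
proof -
  have eq: "indicat_real {s..T} r *\<^sub>R (if t < r then exp (- c * (T - t)) / exp (- c * (T - r)) else 0)
     = exp (- c * (r - t)) * indicat_real {t<..T} r" for r
    using assms(2) by (auto simp: indicator_def exp_diff[symmetric] algebra_simps)
  have 1: "has_bochner_integral lborel (\<lambda>r. exp (- c * (r - t)) * indicat_real {t..T} r)
     ((- exp (- c * (T - t)) / c) - (- exp (- c * (t - t)) / c))"
    using assms by (intro has_bochner_integral_FTC_Icc_real) (auto intro!: derivative_eq_intros continuous_intros)
  have "AE r in lborel. exp (- c * (r - t)) * indicat_real {t..T} r = exp (- c * (r - t)) * indicat_real {t<..T} r"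
    using AE_lborel_singleton[of t] by eventually_elim (auto simp: indicator_def)
  with 1 have "has_bochner_integral lborel (\<lambda>r. exp (- c * (r - t)) * indicat_real {t<..T} r)
     ((- exp (- c * (T - t)) / c) - (- exp (- c * (t - t)) / c))"
    by (subst (asm) has_bochner_integral_cong_AE) auto
  note hb = this
  show "integrable TI (\<lambda>r. if t < r then exp (- c * (T - t)) / exp (- c * (T - r)) else 0)"
    using hb by (subst integrable_restrict_space) (auto simp only: eq has_bochner_integral_iff sets_lborel space_lborel, simp)
  have "(\<integral>r. (if t < r then exp (- c * (T - t)) / exp (- c * (T - r)) else 0) \<partial>TI) = (- exp (- c * (T - t)) / c) - (- exp (- c * (t - t)) / c)"
    using hb by (subst integral_restrict_space) (auto simp only: eq has_bochner_integral_iff, simp)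
  also have "\<dots> \<le> 1 / c" using assms(1) by (simp add: divide_right_mono field_simps)
  finally show "(\<integral>r. (if t < r then exp (- c * (T - t)) / exp (- c * (T - r)) else 0) \<partial>TI) \<le> 1 / c" .
qed

lemma integrable_if_N:
  assumes "integrable N f" "Measurable.pred N P"
  shows "integrable N (\<lambda>x. if P x then f x else (0::real))"
proof -
  have [measurable]: "f \<in> borel_measurable N" using assms by auto
  note assms(2)[measurable]
  show ?thesis by (rule Bochner_Integration.integrable_bound[OF assms(1)]) auto
qed

text \<open>Two kinds of forcing are distinguished. \<open>f1\<close> acts on the whole horizon and
  enters with a constant; \<open>f2\<close> is supported in an interval of length at most
  \<open>h\<close> and enters with the factor \<open>4 * h\<close>, which the coercivity argument
  exploits.\<close>

lemma second_moment_gronwall: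
  fixes X :: "('w, 'a::euclidean_space) process" and f1 :: "('w, 'b::euclidean_space) process" and f2 :: "('w, 'd::euclidean_space) process"
  assumes X: "X \<in> L2_continuous M W s T"
    and f1: "sq_integrable N (\<lambda>p. f1 (fst p) (snd p))" and f2: "sq_integrable N (\<lambda>p. f2 (fst p) (snd p))"
    and supp: "\<And>r \<omega>. r \<in> {s..T} \<Longrightarrow> r \<notin> {a..a'} \<Longrightarrow> f2 r \<omega> = 0"
    and c: "c \<ge> 0" and h: "h > 0" "a' - a \<le> h" "a \<le> a'"
    and e: "\<And>t. 0 < e t" "\<And>t. t \<in> {s..T} \<Longrightarrow> e t \<le> 1"
    and mono: "\<And>t r. before t r \<Longrightarrow> e t \<le> e r"
    and meas: "\<And>t. Measurable.pred TI (before t)"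
    and kernel: "\<And>t. t \<in> {s..T} \<Longrightarrow> integrable TI (\<lambda>r. if before t r then e t / e r else 0)"
      "\<And>t. t \<in> {s..T} \<Longrightarrow> (\<integral>r. (if before t r then e t / e r else 0) \<partial>TI) \<le> 1 / (4 * (c + 1))"
    and ineq: "\<And>t. t \<in> {s..T} \<Longrightarrow> expectation (\<lambda>\<omega>. (norm (X t \<omega>))\<^sup>2) \<le>
       (\<integral>p. (if before t (fst p) then c * (norm (X (fst p) (snd p)))\<^sup>2
          + 2 * (norm (X (fst p) (snd p)) * norm (f1 (fst p) (snd p)))
          + 2 * (norm (X (fst p) (snd p)) * norm (f2 (fst p) (snd p))) else 0) \<partial>N)"
    and t: "t \<in> {s..T}"
  shows "e t * expectation (\<lambda>\<omega>. (norm (X t \<omega>))\<^sup>2) \<le>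
     2 * ((\<integral>p. (norm (f1 (fst p) (snd p)))\<^sup>2 \<partial>N) + 4 * h * (\<integral>p. (norm (f2 (fst p) (snd p)))\<^sup>2 \<partial>N))"
proof -
  define g where "g t = expectation (\<lambda>\<omega>. (norm (X t \<omega>))\<^sup>2)" for t
  obtain B where B: "\<And>t. t \<in> {s..T} \<Longrightarrow> g t \<le> B" using L2_continuous_bounded[OF X] unfolding g_def by blast
  have XN: "sq_integrable N (\<lambda>p. X (fst p) (snd p))"
    using L2_continuous_L2_process[OF X] by (auto simp: L2_process_iff)
  have iX: "integrable N (\<lambda>p. (norm (X (fst p) (snd p)))\<^sup>2)" by (rule sq_integrable_norm[OF XN])
  have i1: "integrable N (\<lambda>p. (norm (f1 (fst p) (snd p)))\<^sup>2)" by (rule sq_integrable_norm[OF f1])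
  have i2: "integrable N (\<lambda>p. (norm (f2 (fst p) (snd p)))\<^sup>2)" by (rule sq_integrable_norm[OF f2])
  have mb[measurable]: "Measurable.pred N (\<lambda>p. before t (fst p))" for t
    by (rule measurable_compose[OF measurable_fst meas])
  have mi[measurable]: "Measurable.pred N (\<lambda>p. fst p \<in> {a..a'})" by simp
  have bI[measurable]: "Measurable.pred N (\<lambda>p. before t (fst p) \<and> fst p \<in> {a..a'})" for t by measurable
  have moment: "(\<integral>p. (if P (fst p) then (norm (X (fst p) (snd p)))\<^sup>2 else 0) \<partial>N) = (\<integral>r. (if P r then g r else 0) \<partial>TI)"
    if "Measurable.pred N (\<lambda>p. P (fst p))" for P
  proof -
    have "(\<integral>p. (if P (fst p) then (norm (X (fst p) (snd p)))\<^sup>2 else 0) \<partial>N)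
      = (\<integral>r. expectation (\<lambda>\<omega>. if P r then (norm (X r \<omega>))\<^sup>2 else 0) \<partial>TI)"
      by (rule integral_N_fst(1)[where f="\<lambda>r \<omega>. if P r then (norm (X r \<omega>))\<^sup>2 else 0"])
         (rule integrable_if_N[OF iX that])
    also have "\<dots> = (\<integral>r. (if P r then g r else 0) \<partial>TI)"
      unfolding g_def by (intro Bochner_Integration.integral_cong refl) simp
    finally show ?thesis .
  qed
  let ?R = "(\<integral>p. (norm (f1 (fst p) (snd p)))\<^sup>2 \<partial>N) + 4 * h * (\<integral>p. (norm (f2 (fst p) (snd p)))\<^sup>2 \<partial>N)"
  have "e t * g t \<le> 2 * ?R"
  proof (rule weighted_gronwall[where g=g and c="c + 1" and h=h and before=before and B=B and a=a and a'=a' and R="?R"])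
    show "0 \<le> ?R" using h by simp
    fix t assume t: "t \<in> {s..T}"
    have "g t \<le> (\<integral>p. (if before t (fst p) then c * (norm (X (fst p) (snd p)))\<^sup>2
          + 2 * (norm (X (fst p) (snd p)) * norm (f1 (fst p) (snd p)))
          + 2 * (norm (X (fst p) (snd p)) * norm (f2 (fst p) (snd p))) else 0) \<partial>N)"
      unfolding g_def by (rule ineq[OF t])
    also have "\<dots> \<le> (\<integral>p. (c + 1) * (if before t (fst p) then (norm (X (fst p) (snd p)))\<^sup>2 else 0)
         + 1 / (4 * h) * (if before t (fst p) \<and> fst p \<in> {a..a'} then (norm (X (fst p) (snd p)))\<^sup>2 else 0)
         + ((norm (f1 (fst p) (snd p)))\<^sup>2 + 4 * h * (norm (f2 (fst p) (snd p)))\<^sup>2) \<partial>N)"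
    proof (rule integral_mono_AE')
      show "integrable N (\<lambda>p. (c + 1) * (if before t (fst p) then (norm (X (fst p) (snd p)))\<^sup>2 else 0)
         + 1 / (4 * h) * (if before t (fst p) \<and> fst p \<in> {a..a'} then (norm (X (fst p) (snd p)))\<^sup>2 else 0)
         + ((norm (f1 (fst p) (snd p)))\<^sup>2 + 4 * h * (norm (f2 (fst p) (snd p)))\<^sup>2))"
        by (intro Bochner_Integration.integrable_add integrable_mult_right integrable_if_N iX i1 i2 mb bI)
      \<comment> \<open>Young's inequality, with weight one for \<open>y\<close> and weight
        \<open>4 * h\<close> for the localized forcing \<open>z\<close>. The former raises
        \<open>c\<close> to \<open>c + 1\<close>; the latter costs \<open>x^2 / (4 * h)\<close>, but
        only on the short interval.\<close>
      have key: "c * x\<^sup>2 + 2 * (x * y) + 2 * (x * z) \<le> (c + 1) * x\<^sup>2 + 1 / (4 * h) * (if I then x\<^sup>2 else 0) + (y\<^sup>2 + 4 * h * z\<^sup>2)"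
        if "\<not> I \<Longrightarrow> z = 0" for x y z :: real and I
      proof -
        have "2 * (x * y) \<le> x\<^sup>2 + y\<^sup>2" using sum_squares_bound[of x y] by simp
        moreover have "2 * (x * z) \<le> 1 / (4 * h) * x\<^sup>2 + 4 * h * z\<^sup>2"
        proof -
          have "0 \<le> (x - 4 * h * z)\<^sup>2 / (4 * h)" using h by simp
          also have "\<dots> = 1 / (4 * h) * x\<^sup>2 + 4 * h * z\<^sup>2 - 2 * (x * z)"
            using h by (simp add: power2_eq_square field_simps)
          finally show ?thesis by simp
        qed
        ultimately show ?thesis using that by (cases I) (auto simp: algebra_simps)
      qed
      show "AE p in N. (if before t (fst p) then c * (norm (X (fst p) (snd p)))\<^sup>2
          + 2 * (norm (X (fst p) (snd p)) * norm (f1 (fst p) (snd p)))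
          + 2 * (norm (X (fst p) (snd p)) * norm (f2 (fst p) (snd p))) else 0)
         \<le> (c + 1) * (if before t (fst p) then (norm (X (fst p) (snd p)))\<^sup>2 else 0)
         + 1 / (4 * h) * (if before t (fst p) \<and> fst p \<in> {a..a'} then (norm (X (fst p) (snd p)))\<^sup>2 else 0)
         + ((norm (f1 (fst p) (snd p)))\<^sup>2 + 4 * h * (norm (f2 (fst p) (snd p)))\<^sup>2)"
      proof (rule AE_I2)
        fix p :: "real \<times> 'w" assume "p \<in> space N"
        then have "fst p \<in> {s..T}" by (auto simp: space_N)
        then show "(if before t (fst p) then c * (norm (X (fst p) (snd p)))\<^sup>2
          + 2 * (norm (X (fst p) (snd p)) * norm (f1 (fst p) (snd p)))
          + 2 * (norm (X (fst p) (snd p)) * norm (f2 (fst p) (snd p))) else 0)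
         \<le> (c + 1) * (if before t (fst p) then (norm (X (fst p) (snd p)))\<^sup>2 else 0)
         + 1 / (4 * h) * (if before t (fst p) \<and> fst p \<in> {a..a'} then (norm (X (fst p) (snd p)))\<^sup>2 else 0)
         + ((norm (f1 (fst p) (snd p)))\<^sup>2 + 4 * h * (norm (f2 (fst p) (snd p)))\<^sup>2)"
          using key[of "fst p \<in> {a..a'}" "norm (f2 (fst p) (snd p))" "norm (X (fst p) (snd p))" "norm (f1 (fst p) (snd p))"] supp h
          by (cases "before t (fst p)") auto
      qed
      show "AE p in N. 0 \<le> (c + 1) * (if before t (fst p) then (norm (X (fst p) (snd p)))\<^sup>2 else 0)
         + 1 / (4 * h) * (if before t (fst p) \<and> fst p \<in> {a..a'} then (norm (X (fst p) (snd p)))\<^sup>2 else 0)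
         + ((norm (f1 (fst p) (snd p)))\<^sup>2 + 4 * h * (norm (f2 (fst p) (snd p)))\<^sup>2)"
        using c h by (intro AE_I2 add_nonneg_nonneg mult_nonneg_nonneg) auto
    qed
    also have "\<dots> = (c + 1) * (\<integral>p. (if before t (fst p) then (norm (X (fst p) (snd p)))\<^sup>2 else 0) \<partial>N)
         + 1 / (4 * h) * (\<integral>p. (if before t (fst p) \<and> fst p \<in> {a..a'} then (norm (X (fst p) (snd p)))\<^sup>2 else 0) \<partial>N)
         + ?R"
      using integrable_if_N[OF iX mb[of t]] integrable_if_N[OF iX bI[of t]] i1 i2 by simp
    finally show "g t \<le> (c + 1) * (\<integral>r. (if before t r then g r else 0) \<partial>TI)
        + 1 / (4 * h) * (\<integral>r. (if before t r \<and> r \<in> {a..a'} then g r else 0) \<partial>TI) + ?R"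
      by (simp only: moment[OF mb] moment[OF bI])
  qed (use B c h e mono kernel t in \<open>auto simp: g_def\<close>)
  then show ?thesis by (simp add: g_def)
qed

end


section \<open>Forward and backward estimates; consequences of localized coercivity\<close>

context brownian_interval
begin

lemma integrable_norm_times:
  assumes "sq_integrable R f" "sq_integrable R g"
  shows "integrable R (\<lambda>x. norm (f x) * norm (g x))"
  using integrable_inner[OF sq_integrable_norm_real[OF assms(1)] sq_integrable_norm_real[OF assms(2)]] by simp

lemma energy_identity:
  fixes X :: "('w, 'a::euclidean_space) process"
  assumes X: "X \<in> L2_continuous M W s T" "ito_differential M W s T X b \<sigma>" "b \<in> L2_process M W s T" and t: "t \<in> {s..T}"
  shows "expectation (\<lambda>\<omega>. (norm (X t \<omega>))\<^sup>2) = expectation (\<lambda>\<omega>. (norm (X s \<omega>))\<^sup>2) +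
    (\<integral>p. (if fst p \<le> t then 2 * (X (fst p) (snd p) \<bullet> b (fst p) (snd p)) + (norm (\<sigma> (fst p) (snd p)))\<^sup>2 else 0) \<partial>N)"
  using ito_product[OF X X t] by (simp add: power2_norm_eq_inner inner_commute cong: if_cong)

lemma ito_differential_diffusion_L2:
  "ito_differential M W s T X b \<sigma> \<Longrightarrow> \<sigma> \<in> L2_process M W s T"
  by (auto simp: ito_differential_def ito_integral_def)

text \<open>In the energy identity the drift adds \<open>2 * K\<close> and the diffusion
  \<open>K^2\<close> to the factor of \<open>|X|^2\<close>. The exponential is the price for
  removing the weight at the end.\<close>

lemma sde_estimate:
  fixes X :: "('w, 'a::euclidean_space) process" and f1 :: "('w, 'b::euclidean_space) process" and f2 :: "('w, 'd::euclidean_space) process"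
  assumes X: "X \<in> L2_continuous M W s T" "ito_differential M W s T X b \<sigma>" "b \<in> L2_process M W s T"
    and init: "AE \<omega> in M. X s \<omega> = 0"
    and f1: "sq_integrable N (\<lambda>p. f1 (fst p) (snd p))" and f2: "sq_integrable N (\<lambda>p. f2 (fst p) (snd p))"
    and supp: "\<And>r \<omega>. r \<in> {s..T} \<Longrightarrow> r \<notin> {a..a'} \<Longrightarrow> f2 r \<omega> = 0"
    and K: "K \<ge> 0" and h: "h > 0" "a' - a \<le> h" "a \<le> a'"
    and drift: "AE p in N. norm (b (fst p) (snd p)) \<le> K * norm (X (fst p) (snd p)) + norm (f1 (fst p) (snd p)) + norm (f2 (fst p) (snd p))"
    and diffusion: "AE p in N. norm (\<sigma> (fst p) (snd p)) \<le> K * norm (X (fst p) (snd p))"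
    and t: "t \<in> {s..T}"
  shows "expectation (\<lambda>\<omega>. (norm (X t \<omega>))\<^sup>2) \<le> 2 * exp (4 * (2 * K + K\<^sup>2 + 1) * (T - s)) *
     ((\<integral>p. (norm (f1 (fst p) (snd p)))\<^sup>2 \<partial>N) + 4 * h * (\<integral>p. (norm (f2 (fst p) (snd p)))\<^sup>2 \<partial>N))"
proof -
  let ?c = "2 * K + K\<^sup>2"
  \<comment> \<open>The rate for which the exponential kernel has integral at most
    \<open>1 / (4 * (?c + 1))\<close>.\<close>
  let ?L = "4 * (?c + 1)"
  let ?R = "(\<integral>p. (norm (f1 (fst p) (snd p)))\<^sup>2 \<partial>N) + 4 * h * (\<integral>p. (norm (f2 (fst p) (snd p)))\<^sup>2 \<partial>N)"
  have c: "?c \<ge> 0" using K by simp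
  have XN: "sq_integrable N (\<lambda>p. X (fst p) (snd p))"
    using L2_continuous_L2_process[OF X(1)] by (auto simp: L2_process_iff)
  have "exp (- ?L * (t - s)) * expectation (\<lambda>\<omega>. (norm (X t \<omega>))\<^sup>2) \<le> 2 * ?R"
  proof (rule second_moment_gronwall[OF X(1) f1 f2 supp c h, where e="\<lambda>t. exp (- ?L * (t - s))" and before="\<lambda>t r. r \<le> t"])
    show "exp (- ?L * (t - s)) \<le> exp (- ?L * (r - s))" if "r \<le> t" for t r
      using that c by (auto intro!: mult_left_mono)
    show "exp (- ?L * (t - s)) \<le> 1" if "t \<in> {s..T}" for t
    proof -
      have "0 \<le> ?L * (t - s)" using that c by (intro mult_nonneg_nonneg) auto
      then show ?thesis by (simp only: mult_minus_left exp_le_one_iff neg_le_0_iff_le)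
    qed
    show "integrable TI (\<lambda>r. if r \<le> t then exp (- ?L * (t - s)) / exp (- ?L * (r - s)) else 0)"
      "(\<integral>r. (if r \<le> t then exp (- ?L * (t - s)) / exp (- ?L * (r - s)) else 0) \<partial>TI) \<le> 1 / ?L" if "t \<in> {s..T}" for t
      using exponential_kernel_forward[OF _ that, of ?L] c by auto
    fix t assume t: "t \<in> {s..T}"
    have "expectation (\<lambda>\<omega>. (norm (X s \<omega>))\<^sup>2) = 0" using init by (intro integral_eq_zero_AE) auto
    then have "expectation (\<lambda>\<omega>. (norm (X t \<omega>))\<^sup>2) =
      (\<integral>p. (if fst p \<le> t then 2 * (X (fst p) (snd p) \<bullet> b (fst p) (snd p)) + (norm (\<sigma> (fst p) (snd p)))\<^sup>2 else 0) \<partial>N)"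
      using energy_identity[OF X t] by simp
    also have "\<dots> \<le> (\<integral>p. (if fst p \<le> t then ?c * (norm (X (fst p) (snd p)))\<^sup>2
          + 2 * (norm (X (fst p) (snd p)) * norm (f1 (fst p) (snd p)))
          + 2 * (norm (X (fst p) (snd p)) * norm (f2 (fst p) (snd p))) else 0) \<partial>N)"
    proof (rule integral_mono_AE')
      show "integrable N (\<lambda>p. if fst p \<le> t then ?c * (norm (X (fst p) (snd p)))\<^sup>2
          + 2 * (norm (X (fst p) (snd p)) * norm (f1 (fst p) (snd p)))
          + 2 * (norm (X (fst p) (snd p)) * norm (f2 (fst p) (snd p))) else 0)"
        by (intro integrable_if_le Bochner_Integration.integrable_add integrable_mult_right
            sq_integrable_norm[OF XN] integrable_norm_times XN f1 f2)
      show "AE p in N. (if fst p \<le> t then 2 * (X (fst p) (snd p) \<bullet> b (fst p) (snd p)) + (norm (\<sigma> (fst p) (snd p)))\<^sup>2 else 0) \<le>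
        (if fst p \<le> t then ?c * (norm (X (fst p) (snd p)))\<^sup>2
          + 2 * (norm (X (fst p) (snd p)) * norm (f1 (fst p) (snd p)))
          + 2 * (norm (X (fst p) (snd p)) * norm (f2 (fst p) (snd p))) else 0)"
        using drift diffusion
      proof eventually_elim
        case (elim p)
        have "X (fst p) (snd p) \<bullet> b (fst p) (snd p) \<le> norm (X (fst p) (snd p)) * norm (b (fst p) (snd p))"
          by (rule norm_cauchy_schwarz)
        also have "\<dots> \<le> norm (X (fst p) (snd p)) * (K * norm (X (fst p) (snd p)) + norm (f1 (fst p) (snd p)) + norm (f2 (fst p) (snd p)))"
          using elim by (intro mult_left_mono) auto
        finally have "2 * (X (fst p) (snd p) \<bullet> b (fst p) (snd p)) \<le> 2 * K * (norm (X (fst p) (snd p)))\<^sup>2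
          + 2 * (norm (X (fst p) (snd p)) * norm (f1 (fst p) (snd p)))
          + 2 * (norm (X (fst p) (snd p)) * norm (f2 (fst p) (snd p)))"
          by (simp add: algebra_simps power2_eq_square)
        moreover have "(norm (\<sigma> (fst p) (snd p)))\<^sup>2 \<le> K\<^sup>2 * (norm (X (fst p) (snd p)))\<^sup>2"
          using power_mono[OF elim(2), of 2] by (simp add: power_mult_distrib)
        ultimately show ?case by (simp add: algebra_simps)
      qed
      show "AE p in N. 0 \<le> (if fst p \<le> t then ?c * (norm (X (fst p) (snd p)))\<^sup>2
          + 2 * (norm (X (fst p) (snd p)) * norm (f1 (fst p) (snd p)))
          + 2 * (norm (X (fst p) (snd p)) * norm (f2 (fst p) (snd p))) else 0)"
        using c by (intro AE_I2) (auto intro!: add_nonneg_nonneg mult_nonneg_nonneg)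
    qed
    finally show "expectation (\<lambda>\<omega>. (norm (X t \<omega>))\<^sup>2) \<le> (\<integral>p. (if fst p \<le> t then ?c * (norm (X (fst p) (snd p)))\<^sup>2
          + 2 * (norm (X (fst p) (snd p)) * norm (f1 (fst p) (snd p)))
          + 2 * (norm (X (fst p) (snd p)) * norm (f2 (fst p) (snd p))) else 0) \<partial>N)" .
  qed (use t in auto)
  then have "exp (?L * (t - s)) * (exp (- ?L * (t - s)) * expectation (\<lambda>\<omega>. (norm (X t \<omega>))\<^sup>2)) \<le> exp (?L * (t - s)) * (2 * ?R)"
    by (intro mult_left_mono) auto
  moreover have "exp x * (exp (- x) * y) = y" for x y :: real by (simp add: exp_minus)
  from this[of "?L * (t - s)"] have "exp (?L * (t - s)) * (exp (- ?L * (t - s)) * y) = y" for y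
    by (simp only: mult_minus_left)
  ultimately have "expectation (\<lambda>\<omega>. (norm (X t \<omega>))\<^sup>2) \<le> exp (?L * (t - s)) * (2 * ?R)" by (simp only:)
  also have "\<dots> \<le> exp (?L * (T - s)) * (2 * ?R)"
    using t c h by (intro mult_right_mono) (auto intro!: mult_left_mono)
  also have "\<dots> = 2 * exp (?L * (T - s)) * ?R" by (simp only: mult.assoc mult.left_commute)
  finally show ?thesis .
qed

text \<open>Subtracting the energy identity at \<open>T\<close> from the one at \<open>t\<close>
  gives \<open>|\<sigma>|^2\<close> after time \<open>t\<close> a negative sign. It absorbs the part
  of the drift that is linear in \<open>\<sigma>\<close>, for which no separate bound is
  available.\<close>

lemma bsde_estimate:
  fixes X :: "('w, 'a::euclidean_space) process" and f1 :: "('w, 'b::euclidean_space) process" and f2 :: "('w, 'd::euclidean_space) process"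
  assumes X: "X \<in> L2_continuous M W s T" "ito_differential M W s T X b \<sigma>" "b \<in> L2_process M W s T"
    and final: "AE \<omega> in M. X T \<omega> = 0"
    and f2: "sq_integrable N (\<lambda>p. f2 (fst p) (snd p))"
    and supp: "\<And>r \<omega>. r \<in> {s..T} \<Longrightarrow> r \<notin> {a..a'} \<Longrightarrow> f2 r \<omega> = 0"
    and K: "K \<ge> 0" and h: "h > 0" "a' - a \<le> h" "a \<le> a'"
    and drift: "AE p in N. norm (b (fst p) (snd p)) \<le> K * norm (X (fst p) (snd p)) + K * norm (\<sigma> (fst p) (snd p)) + norm (f2 (fst p) (snd p))"
    and t: "t \<in> {s..T}"
  shows "expectation (\<lambda>\<omega>. (norm (X t \<omega>))\<^sup>2) \<le> 2 * exp (4 * (2 * K + K\<^sup>2 + 1) * (T - s)) *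
     (4 * h * (\<integral>p. (norm (f2 (fst p) (snd p)))\<^sup>2 \<partial>N))"
proof -
  let ?c = "2 * K + K\<^sup>2"
  let ?L = "4 * (?c + 1)"
  let ?R = "4 * h * (\<integral>p. (norm (f2 (fst p) (snd p)))\<^sup>2 \<partial>N)"
  have c: "?c \<ge> 0" using K by simp
  have XN: "sq_integrable N (\<lambda>p. X (fst p) (snd p))"
    using L2_continuous_L2_process[OF X(1)] by (auto simp: L2_process_iff)
  have bN: "sq_integrable N (\<lambda>p. b (fst p) (snd p))" and \<sigma>N: "sq_integrable N (\<lambda>p. \<sigma> (fst p) (snd p))"
    using X ito_differential_diffusion_L2[OF X(2)] by (auto simp: L2_process_iff)
  have iE: "integrable N (\<lambda>p. 2 * (X (fst p) (snd p) \<bullet> b (fst p) (snd p)) + (norm (\<sigma> (fst p) (snd p)))\<^sup>2)"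
    by (intro Bochner_Integration.integrable_add integrable_mult_right integrable_inner XN bN sq_integrable_norm[OF \<sigma>N])
  have "exp (- ?L * (T - t)) * expectation (\<lambda>\<omega>. (norm (X t \<omega>))\<^sup>2) \<le>
      2 * ((\<integral>p. (norm (0::real))\<^sup>2 \<partial>N) + ?R)"
  proof (rule second_moment_gronwall[where ?f1.0="\<lambda>_ _. 0::real" and e="\<lambda>t. exp (- ?L * (T - t))" and before="\<lambda>t r. t < r",
      OF X(1) _ f2 supp c h])
    show "sq_integrable N (\<lambda>p. 0::real)" by (rule sq_integrable_zero)
    show "exp (- ?L * (T - t)) \<le> exp (- ?L * (T - r))" if "t < r" for t r
      using that c by (auto intro!: mult_left_mono)
    show "exp (- ?L * (T - t)) \<le> 1" if "t \<in> {s..T}" for t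
    proof -
      have "0 \<le> ?L * (T - t)" using that c by (intro mult_nonneg_nonneg) auto
      then show ?thesis by (simp only: mult_minus_left exp_le_one_iff neg_le_0_iff_le)
    qed
    show "integrable TI (\<lambda>r. if t < r then exp (- ?L * (T - t)) / exp (- ?L * (T - r)) else 0)"
      "(\<integral>r. (if t < r then exp (- ?L * (T - t)) / exp (- ?L * (T - r)) else 0) \<partial>TI) \<le> 1 / ?L" if "t \<in> {s..T}" for t
      using exponential_kernel_backward[OF _ that, of ?L] c by auto
    fix t assume t: "t \<in> {s..T}"
    let ?E = "\<lambda>p. 2 * (X (fst p) (snd p) \<bullet> b (fst p) (snd p)) + (norm (\<sigma> (fst p) (snd p)))\<^sup>2"
    have "expectation (\<lambda>\<omega>. (norm (X T \<omega>))\<^sup>2) = 0" using final by (intro integral_eq_zero_AE) auto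
    then have "expectation (\<lambda>\<omega>. (norm (X t \<omega>))\<^sup>2) =
      (\<integral>p. (if fst p \<le> t then ?E p else 0) \<partial>N) - (\<integral>p. (if fst p \<le> T then ?E p else 0) \<partial>N)"
      using energy_identity[OF X t] energy_identity[OF X, of T] s_less_T by simp
    also have "\<dots> = (\<integral>p. (if fst p \<le> t then ?E p else 0) - (if fst p \<le> T then ?E p else 0) \<partial>N)"
      by (intro Bochner_Integration.integral_diff[symmetric] integrable_if_le iE)
    also have "\<dots> \<le> (\<integral>p. (if t < fst p then ?c * (norm (X (fst p) (snd p)))\<^sup>2
          + 2 * (norm (X (fst p) (snd p)) * norm (0::real))
          + 2 * (norm (X (fst p) (snd p)) * norm (f2 (fst p) (snd p))) else 0) \<partial>N)"
    proof (rule integral_mono_AE')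
      show "integrable N (\<lambda>p. if t < fst p then ?c * (norm (X (fst p) (snd p)))\<^sup>2
          + 2 * (norm (X (fst p) (snd p)) * norm (0::real))
          + 2 * (norm (X (fst p) (snd p)) * norm (f2 (fst p) (snd p))) else 0)"
        by (intro integrable_if_N Bochner_Integration.integrable_add integrable_mult_right
            sq_integrable_norm[OF XN] integrable_norm_times XN f2 sq_integrable_zero) simp
      show "AE p in N. (if fst p \<le> t then ?E p else 0) - (if fst p \<le> T then ?E p else 0) \<le>
        (if t < fst p then ?c * (norm (X (fst p) (snd p)))\<^sup>2
          + 2 * (norm (X (fst p) (snd p)) * norm (0::real))
          + 2 * (norm (X (fst p) (snd p)) * norm (f2 (fst p) (snd p))) else 0)"
        using drift AE_space
      proof eventually_elim
        case (elim p)
        let ?x = "norm (X (fst p) (snd p))" and ?y = "norm (\<sigma> (fst p) (snd p))" and ?z = "norm (f2 (fst p) (snd p))"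
        have "- (X (fst p) (snd p) \<bullet> b (fst p) (snd p)) \<le> ?x * norm (b (fst p) (snd p))"
          using norm_cauchy_schwarz[of "X (fst p) (snd p)" "- b (fst p) (snd p)"] by simp
        also have "\<dots> \<le> ?x * (K * ?x + K * ?y + ?z)"
          using elim by (intro mult_left_mono) auto
        finally have 1: "- (X (fst p) (snd p) \<bullet> b (fst p) (snd p)) \<le> K * ?x\<^sup>2 + K * ?x * ?y + ?x * ?z"
          by (simp add: algebra_simps power2_eq_square)
        \<comment> \<open>The cross term is split so that exactly \<open>?y^2\<close> is needed,
          which is what the energy identity provides.\<close>
        have 2: "2 * ((K * ?x) * ?y) \<le> (K * ?x)\<^sup>2 + ?y\<^sup>2" using sum_squares_bound[of "K * ?x" ?y] by simp
        have "- ?E p \<le> ?c * ?x\<^sup>2 + 2 * (?x * ?z)" using 1 2 by (simp add: algebra_simps power2_eq_square)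
        moreover have "fst p \<le> T" using elim(2) by (auto simp: space_N)
        ultimately show ?case by auto
      qed
      show "AE p in N. 0 \<le> (if t < fst p then ?c * (norm (X (fst p) (snd p)))\<^sup>2
          + 2 * (norm (X (fst p) (snd p)) * norm (0::real))
          + 2 * (norm (X (fst p) (snd p)) * norm (f2 (fst p) (snd p))) else 0)"
        using c by (intro AE_I2) (auto intro!: add_nonneg_nonneg mult_nonneg_nonneg)
    qed
    finally show "expectation (\<lambda>\<omega>. (norm (X t \<omega>))\<^sup>2) \<le> (\<integral>p. (if t < fst p then ?c * (norm (X (fst p) (snd p)))\<^sup>2
          + 2 * (norm (X (fst p) (snd p)) * norm (0::real))
          + 2 * (norm (X (fst p) (snd p)) * norm (f2 (fst p) (snd p))) else 0) \<partial>N)" .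
  qed (use t in auto)
  then have "exp (- ?L * (T - t)) * expectation (\<lambda>\<omega>. (norm (X t \<omega>))\<^sup>2) \<le> 2 * ?R" by simp
  then have "exp (?L * (T - t)) * (exp (- ?L * (T - t)) * expectation (\<lambda>\<omega>. (norm (X t \<omega>))\<^sup>2)) \<le> exp (?L * (T - t)) * (2 * ?R)"
    by (intro mult_left_mono) auto
  moreover have "exp x * (exp (- x) * y) = y" for x y :: real by (simp add: exp_minus)
  from this[of "?L * (T - t)"] have "exp (?L * (T - t)) * (exp (- ?L * (T - t)) * y) = y" for y
    by (simp only: mult_minus_left)
  ultimately have "expectation (\<lambda>\<omega>. (norm (X t \<omega>))\<^sup>2) \<le> exp (?L * (T - t)) * (2 * ?R)" by (simp only:)
  also have "\<dots> \<le> exp (?L * (T - s)) * (2 * ?R)"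
    using t c h by (intro mult_right_mono) (auto intro!: mult_left_mono)
  also have "\<dots> = 2 * exp (?L * (T - s)) * ?R" by (simp only: mult.assoc mult.left_commute)
  finally show ?thesis .
qed

lemma integral_norm_le_time:
  assumes X: "X \<in> L2_continuous M W s T" and B: "\<And>t. t \<in> {s..T} \<Longrightarrow> expectation (\<lambda>\<omega>. (norm (X t \<omega>))\<^sup>2) \<le> B"
  shows "(\<integral>p. (norm (X (fst p) (snd p)))\<^sup>2 \<partial>N) \<le> (T - s) * B"
proof -
  have i: "integrable N (\<lambda>p. (norm (X (fst p) (snd p)))\<^sup>2)"
    using L2_continuous_L2_process[OF X] sq_integrable_norm by (auto simp: L2_process_iff)
  have "(\<integral>p. (norm (X (fst p) (snd p)))\<^sup>2 \<partial>N) = (\<integral>t. expectation (\<lambda>\<omega>. (norm (X t \<omega>))\<^sup>2) \<partial>TI)"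
    by (rule integral_N_fst(1)[OF i])
  also have "\<dots> \<le> (\<integral>t. B \<partial>TI)"
    using integral_N_fst(2)[OF i] B by (intro integral_mono) auto
  also have "\<dots> = (T - s) * B" by (rule integral_const_TI)
  finally show ?thesis .
qed

text \<open>If the bound failed for a vector \<open>x\<close> on a set of positive measure, the
  control equal to \<open>x\<close> on the part of this set within a suitable time interval of
  length \<open>h\<close> would violate coercivity, because the error \<open>\<kappa> * h\<close>
  takes up at most half of \<open>\<epsilon>\<close>.\<close>

lemma coercive_imp_positive_definite:
  fixes E :: "('w, real^'m^'m) process"
  assumes E: "progressive M W s T E" "AE p in N. norm (E (fst p) (snd p)) \<le> K"
    and \<epsilon>: "\<epsilon> > 0" and \<kappa>: "\<kappa> \<ge> 0"
    and coercive: "\<And>a a' u. a < a' \<Longrightarrow> u \<in> L2_process M W s T \<Longrightarrow> (\<And>t \<omega>. t \<notin> {a..a'} \<Longrightarrow> u t \<omega> = 0) \<Longrightarrow>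
      \<epsilon> * (\<integral>p. (norm (u (fst p) (snd p)))\<^sup>2 \<partial>N) \<le>
      (\<integral>p. (E (fst p) (snd p) *v u (fst p) (snd p)) \<bullet> u (fst p) (snd p) \<partial>N) + \<kappa> * (a' - a) * (\<integral>p. (norm (u (fst p) (snd p)))\<^sup>2 \<partial>N)"
  shows "AE p in N. \<forall>x. \<epsilon> / 2 * (norm x)\<^sup>2 \<le> (E (fst p) (snd p) *v x) \<bullet> x"
proof -
  \<comment> \<open>Chosen to make \<open>\<kappa> * h \<le> \<epsilon> / 2\<close>; the added one
    covers \<open>\<kappa> = 0\<close>.\<close>
  define h where "h = \<epsilon> / (2 * (\<kappa> + 1))"
  have h: "h > 0" "\<kappa> * h \<le> \<epsilon> / 2" using \<epsilon> \<kappa> by (auto simp: h_def field_simps)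
  note Em = progressive_measurable_N[OF E(1)]
  have fixed: "AE p in N. \<epsilon> / 2 * (norm x)\<^sup>2 \<le> (E (fst p) (snd p) *v x) \<bullet> x" for x :: "real^'m"
  proof -
    have piece: "AE p in N. fst p \<in> {s + real i * h..s + real (Suc i) * h} \<longrightarrow> \<epsilon> / 2 * (norm x)\<^sup>2 \<le> (E (fst p) (snd p) *v x) \<bullet> x" for i :: nat
    proof -
      let ?a = "s + real i * h" and ?a' = "s + real (Suc i) * h"
      \<comment> \<open>The control lives where the bound fails for \<open>x\<close>, which makes
        \<open>\<epsilon> / 2 * |u|^2 - (E u) \<bullet> u\<close> nonnegative; coercivity bounds its
        integral by zero. Progressivity of \<open>E\<close> makes the control admissible.\<close>
      define u where "u t \<omega> = (if (E t \<omega> *v x) \<bullet> x < \<epsilon> / 2 * (norm x)\<^sup>2 \<and> t \<in> {?a..?a'} then x else 0)" for t \<omega>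
      have up: "progressive M W s T u"
        unfolding progressive_def
      proof
        fix t assume t: "t \<in> {s..T}"
        let ?P = "restrict_space borel {s..t} \<Otimes>\<^sub>M \<F> t"
        have q: "continuous_on UNIV (\<lambda>A::real^'m^'m. (A *v x) \<bullet> x)"
          by (intro continuous_intros bounded_bilinear.continuous_on[OF bounded_bilinear_matrix_vector_mult])
        have "(\<lambda>p. E (fst p) (snd p)) \<in> borel_measurable ?P" using E(1) t by (auto simp: progressive_def)
        then have [measurable]: "(\<lambda>p. (E (fst p) (snd p) *v x) \<bullet> x) \<in> borel_measurable ?P"
          using measurable_compose[OF _ borel_measurable_continuous_onI[OF q]] by blast
        have [measurable]: "(\<lambda>p. fst p) \<in> borel_measurable ?P"
          by (rule measurable_compose[OF measurable_fst]) (auto intro: measurable_restrict_space1)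
        show "(\<lambda>p. u (fst p) (snd p)) \<in> borel_measurable ?P" unfolding u_def by measurable
      qed
      have uN: "sq_integrable N (\<lambda>p. u (fst p) (snd p))"
        by (rule sq_integrable_bound[OF N.sq_integrable_const[of x] progressive_measurable_N[OF up], of 1]) (auto simp: u_def)
      have iu: "integrable N (\<lambda>p. (norm (u (fst p) (snd p)))\<^sup>2)" by (rule sq_integrable_norm[OF uN])
      obtain K' where K': "K' > 0" "\<And>(A::real^'m^'m) y. norm (A *v y) \<le> norm A * norm y * K'"
        using bounded_bilinear.pos_bounded[OF bounded_bilinear_matrix_vector_mult] by blast
      have "sq_integrable N (\<lambda>p. E (fst p) (snd p) *v u (fst p) (snd p))"
      proof (rule sq_integrable_bound[OF uN, of _ "K * K'"])
        show "(\<lambda>p. E (fst p) (snd p) *v u (fst p) (snd p)) \<in> borel_measurable N"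
          by (rule progressive_measurable_N[OF progressive_bounded_bilinear[OF bounded_bilinear_matrix_vector_mult E(1) up]])
        show "AE p in N. norm (E (fst p) (snd p) *v u (fst p) (snd p)) \<le> K * K' * norm (u (fst p) (snd p))"
          using E(2)
        proof eventually_elim
          case (elim p)
          have "norm (E (fst p) (snd p) *v u (fst p) (snd p)) \<le> norm (E (fst p) (snd p)) * norm (u (fst p) (snd p)) * K'" by (rule K')
          also have "\<dots> \<le> K * norm (u (fst p) (snd p)) * K'" using elim K' by (intro mult_right_mono) auto
          finally show ?case by (simp add: mult_ac)
        qed
      qed
      from integrable_inner[OF this uN]
      have iE: "integrable N (\<lambda>p. (E (fst p) (snd p) *v u (fst p) (snd p)) \<bullet> u (fst p) (snd p))" .
      let ?n = "\<integral>p. (norm (u (fst p) (snd p)))\<^sup>2 \<partial>N"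
      have "\<epsilon> * ?n \<le> (\<integral>p. (E (fst p) (snd p) *v u (fst p) (snd p)) \<bullet> u (fst p) (snd p) \<partial>N) + \<kappa> * (?a' - ?a) * ?n"
      proof (rule coercive)
        show "u \<in> L2_process M W s T" using up uN by (simp add: L2_process_iff)
        show "?a < ?a'" using h by (simp add: algebra_simps)
      qed (auto simp: u_def)
      also have "\<kappa> * (?a' - ?a) * ?n \<le> \<epsilon> / 2 * ?n" using h by (intro mult_right_mono) (auto simp: algebra_simps)
      finally have "(\<integral>p. \<epsilon> / 2 * (norm (u (fst p) (snd p)))\<^sup>2 - (E (fst p) (snd p) *v u (fst p) (snd p)) \<bullet> u (fst p) (snd p) \<partial>N) \<le> 0"
        using iu iE by simp
      moreover have nn: "0 \<le> \<epsilon> / 2 * (norm (u (fst p) (snd p)))\<^sup>2 - (E (fst p) (snd p) *v u (fst p) (snd p)) \<bullet> u (fst p) (snd p)" for p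
        by (auto simp: u_def)
      ultimately have "(\<integral>p. \<epsilon> / 2 * (norm (u (fst p) (snd p)))\<^sup>2 - (E (fst p) (snd p) *v u (fst p) (snd p)) \<bullet> u (fst p) (snd p) \<partial>N) = 0"
        by (intro antisym integral_nonneg_AE AE_I2) auto
      then have "AE p in N. \<epsilon> / 2 * (norm (u (fst p) (snd p)))\<^sup>2 - (E (fst p) (snd p) *v u (fst p) (snd p)) \<bullet> u (fst p) (snd p) = 0"
        using iu iE nn by (subst (asm) integral_nonneg_eq_0_iff_AE) auto
      then show ?thesis by eventually_elim (auto simp: u_def split: if_splits)
    qed
    have "AE p in N. \<forall>i::nat. fst p \<in> {s + real i * h..s + real (Suc i) * h} \<longrightarrow> \<epsilon> / 2 * (norm x)\<^sup>2 \<le> (E (fst p) (snd p) *v x) \<bullet> x"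
      unfolding AE_all_countable using piece by blast
    then show ?thesis
      using AE_space
    proof eventually_elim
      case (elim p)
      then have "s \<le> fst p" by (auto simp: space_N)
      define i where "i = nat \<lfloor>(fst p - s) / h\<rfloor>"
      have "real i \<le> (fst p - s) / h" "(fst p - s) / h \<le> real (Suc i)"
        using \<open>s \<le> fst p\<close> h unfolding i_def by (auto simp: of_nat_nat) linarith+
      then have "fst p \<in> {s + real i * h..s + real (Suc i) * h}"
        using h by (simp add: field_simps)
      with elim show ?case by blast
    qed
  qed
  \<comment> \<open>The null set depends on \<open>x\<close>. A countable dense set of vectors
    admits a common one, and the inequality is closed in \<open>x\<close>.\<close>
  obtain D :: "(real^'m) set" where D: "countable D" "\<And>X. open X \<Longrightarrow> X \<noteq> {} \<Longrightarrow> \<exists>d\<in>D. d \<in> X"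
    by (rule countable_dense_setE) blast
  have "AE p in N. \<forall>x\<in>D. \<epsilon> / 2 * (norm x)\<^sup>2 \<le> (E (fst p) (snd p) *v x) \<bullet> x"
    using fixed by (simp add: AE_ball_countable[OF D(1)])
  then show ?thesis
  proof eventually_elim
    case (elim p)
    have "closed {x. \<epsilon> / 2 * (norm x)\<^sup>2 \<le> (E (fst p) (snd p) *v x) \<bullet> x}"
      by (intro closed_Collect_le continuous_intros)
    then have "open (- {x. \<epsilon> / 2 * (norm x)\<^sup>2 \<le> (E (fst p) (snd p) *v x) \<bullet> x})" by (simp add: closed_def)
    then have "- {x. \<epsilon> / 2 * (norm x)\<^sup>2 \<le> (E (fst p) (snd p) *v x) \<bullet> x} = {}" using D(2) elim by blast
    then show ?case by blast
  qed
qed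

end

section \<open>Inverse matrices: measurability and bounds\<close>

lemma invertible_matrix_inv_right:
  fixes A :: "real^'n^'n"
  assumes "invertible A"
  shows "A ** matrix_inv A = mat 1" and "matrix_inv A ** A = mat 1"
  using someI_ex[OF assms[unfolded invertible_def]] by (auto simp: matrix_inv_def)

text \<open>Cramer's rule turns \<open>matrix_inv\<close>, which is defined by choice, into a
  quotient of polynomials in the entries, and measurability follows.\<close>

lemma matrix_inv_component:
  fixes A :: "real^'n^'n"
  assumes "invertible A"
  shows "matrix_inv A $ k $ j = det (\<chi> i l. if l = k then axis j 1 $ i else A $ i $ l) / det A"
proof -
  have A: "A ** matrix_inv A = mat 1" by (rule invertible_matrix_inv_right(1)[OF assms])
  let ?x = "matrix_inv A *v axis j 1"
  have "A *v ?x = axis j 1" by (simp add: matrix_vector_mul_assoc A)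
  moreover have "det A \<noteq> 0" using assms invertible_det_nz by blast
  ultimately have "?x = (\<chi> k. det (\<chi> i l. if l = k then axis j 1 $ i else A $ i $ l) / det A)"
    by (subst (asm) cramer)
  then have "?x $ k = det (\<chi> i l. if l = k then axis j 1 $ i else A $ i $ l) / det A" by simp
  moreover have "?x $ k = matrix_inv A $ k $ j"
    by (simp add: matrix_vector_mult_def axis_def if_distrib[where f="\<lambda>x. _ * x"] cong: if_cong)
  ultimately show ?thesis by simp
qed

lemma borel_measurable_matrixI:
  fixes f :: "'a \<Rightarrow> real^'n^'m"
  assumes "\<And>i j. (\<lambda>x. f x $ i $ j) \<in> borel_measurable M"
  shows "f \<in> borel_measurable M"
proof (subst borel_measurable_euclidean_space, intro ballI)
  fix b :: "real^'n^'m" assume "b \<in> Basis"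
  then obtain i j where "b = axis i (axis j 1)" by (auto simp: Basis_vec_def)
  then have "(\<lambda>x. f x \<bullet> b) = (\<lambda>x. f x $ i $ j)" by (auto simp: inner_axis)
  then show "(\<lambda>x. f x \<bullet> b) \<in> borel_measurable M" using assms by simp
qed

lemma borel_measurable_matrix_component:
  fixes f :: "'a \<Rightarrow> real^'n^'m"
  assumes "f \<in> borel_measurable M"
  shows "(\<lambda>x. f x $ i $ j) \<in> borel_measurable M"
proof -
  have "f x \<bullet> axis i (axis j 1) = f x $ i $ j" for x by (simp add: inner_axis)
  moreover have "(\<lambda>x. f x \<bullet> axis i (axis j 1)) \<in> borel_measurable M" using assms by simp
  ultimately show ?thesis by simp
qed

lemma borel_measurable_matrix_inv:
  fixes f :: "'a \<Rightarrow> real^'n^'n"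
  assumes f: "f \<in> borel_measurable M" and inv: "\<And>x. x \<in> space M \<Longrightarrow> invertible (f x)"
  shows "(\<lambda>x. matrix_inv (f x)) \<in> borel_measurable M"
proof (rule borel_measurable_matrixI)
  fix k j
  note [measurable] = borel_measurable_matrix_component[OF f]
  have det: "(\<lambda>x. det (g x)) \<in> borel_measurable M"
    if [measurable]: "\<And>i j. (\<lambda>x. g x $ i $ j) \<in> borel_measurable M" for g :: "'a \<Rightarrow> real^'n^'n"
    unfolding det_def by measurable
  have "(\<lambda>x. det (\<chi> i l. if l = k then axis j 1 $ i else f x $ i $ l) / det (f x)) \<in> borel_measurable M"
  proof (intro borel_measurable_divide det)
    fix i l
    show "(\<lambda>x. (\<chi> i l. if l = k then axis j 1 $ i else f x $ i $ l) $ i $ l) \<in> borel_measurable M"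
      by (cases "l = k") auto
  qed measurable
  then show "(\<lambda>x. matrix_inv (f x) $ k $ j) \<in> borel_measurable M"
    by (subst measurable_cong[OF matrix_inv_component[OF inv]])
qed

text \<open>The lower bound is tested with the vector \<open>matrix_inv A *v y\<close> itself,
  followed by Cauchy-Schwarz.\<close>

lemma norm_matrix_inv_bound:
  fixes A :: "real^'n^'n"
  assumes "invertible A" "\<epsilon> > 0" "\<And>x. \<epsilon> * (norm x)\<^sup>2 \<le> (A *v x) \<bullet> x"
  shows "norm (matrix_inv A *v y) \<le> norm y / \<epsilon>"
proof -
  let ?x = "matrix_inv A *v y"
  have "A *v ?x = y" by (simp add: matrix_vector_mul_assoc invertible_matrix_inv_right(1)[OF assms(1)])
  then have "\<epsilon> * (norm ?x)\<^sup>2 \<le> y \<bullet> ?x" using assms(3)[of ?x] by simp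
  also have "\<dots> \<le> norm y * norm ?x" by (rule norm_cauchy_schwarz)
  finally have "(\<epsilon> * norm ?x) * norm ?x \<le> norm y * norm ?x" by (simp add: power2_eq_square mult_ac)
  then have "\<epsilon> * norm ?x \<le> norm y" by (cases "norm ?x = 0") (auto simp: mult_le_cancel_right)
  then show ?thesis using assms(2) by (simp add: field_simps)
qed


section \<open>Path spaces and essentially bounded coefficients\<close>

text \<open>The supremum over an uncountable set of times need not be measurable, yet additivity of
  the nonnegative integral requires measurability. On continuous paths rational times suffice; they
  are taken from the open interval, whose rational points are dense in
  \<open>{s..T}\<close>.\<close>

lemma SUP_interval_eq_dense:
  fixes f :: "real \<Rightarrow> real"
  assumes "s < T" "continuous_on {s..T} f" "\<And>t. 0 \<le> f t"
  shows "(SUP t\<in>{s..T}. ennreal (f t)) = (SUP t\<in>{s<..<T} \<inter> \<rat>. ennreal (f t))"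
proof (rule antisym)
  have cl: "closure ({s<..<T} \<inter> \<rat>) = {s..T}"
    using closure_open_Int_superset[of "{s<..<T}" \<rat>] assms(1) by (simp add: Rats_closure_real)
  show "(SUP t\<in>{s..T}. ennreal (f t)) \<le> (SUP t\<in>{s<..<T} \<inter> \<rat>. ennreal (f t))"
  proof (rule SUP_least)
    fix t assume t: "t \<in> {s..T}"
    show "ennreal (f t) \<le> (SUP t\<in>{s<..<T} \<inter> \<rat>. ennreal (f t))" (is "_ \<le> ?S")
    proof (cases "?S = \<infinity>")
      case False
      then obtain a where a: "?S = ennreal a" "a \<ge> 0" by (cases ?S) auto
      have "f x \<le> a" if "x \<in> {s<..<T} \<inter> \<rat>" for x
      proof -
        have "ennreal (f x) \<le> ?S" using that by (rule SUP_upper)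
        then show ?thesis using a by (simp add: ennreal_le_iff)
      qed
      then have "f t \<le> a"
        using continuous_le_on_closure[of "{s<..<T} \<inter> \<rat>" f t a] assms(2) t unfolding cl by blast
      then show ?thesis using a by (simp add: ennreal_leI)
    next
      case True
      then show ?thesis by (metis infinity_ennreal_def top_greatest)
    qed
  qed
  show "(SUP t\<in>{s<..<T} \<inter> \<rat>. ennreal (f t)) \<le> (SUP t\<in>{s..T}. ennreal (f t))"
    by (rule SUP_subset_mono) auto
qed

context brownian_interval
begin

lemma L2_continuousD:
  assumes "X \<in> L2_continuous M W s T"
  shows "progressive M W s T X" "continuous_paths M s T X"
  using assms by (auto simp: L2_continuous_def)

lemma nn_integral_SUP_dense:
  assumes "continuous_paths M s T X"
  shows "(\<integral>\<^sup>+\<omega>. (SUP t\<in>{s..T}. ennreal ((norm (X t \<omega>))\<^sup>2)) \<partial>M) =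
    (\<integral>\<^sup>+\<omega>. (SUP t\<in>{s<..<T} \<inter> \<rat>. ennreal ((norm (X t \<omega>))\<^sup>2)) \<partial>M)"
proof (rule nn_integral_cong_AE)
  show "AE \<omega> in M. (SUP t\<in>{s..T}. ennreal ((norm (X t \<omega>))\<^sup>2)) = (SUP t\<in>{s<..<T} \<inter> \<rat>. ennreal ((norm (X t \<omega>))\<^sup>2))"
    using assms unfolding continuous_paths_def
  proof eventually_elim
    case (elim \<omega>)
    then show ?case
      by (intro SUP_interval_eq_dense s_less_T continuous_intros) auto
  qed
qed

lemma SUP_dense_measurable:
  fixes X :: "('w, 'a::euclidean_space) process"
  assumes "progressive M W s T X"
  shows "(\<lambda>\<omega>. SUP t\<in>{s<..<T} \<inter> \<rat>. ennreal ((norm (X t \<omega>))\<^sup>2)) \<in> borel_measurable M"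
proof (rule borel_measurable_SUP)
  show "countable ({s<..<T} \<inter> \<rat>)" by (intro countable_Int2 countable_rat)
  fix t assume "t \<in> {s<..<T} \<inter> \<rat>"
  then have "X t \<in> borel_measurable M"
    by (intro measurable_filtration_M[OF progressive_adapted[OF assms]]) auto
  then show "(\<lambda>\<omega>. ennreal ((norm (X t \<omega>))\<^sup>2)) \<in> borel_measurable M" by simp
qed

lemma L2_continuous_add:
  fixes X Y :: "('w, 'a::euclidean_space) process"
  assumes X: "X \<in> L2_continuous M W s T" and Y: "Y \<in> L2_continuous M W s T"
  shows "(\<lambda>t \<omega>. X t \<omega> + Y t \<omega>) \<in> L2_continuous M W s T"
proof -
  note p = L2_continuousD[OF X] L2_continuousD[OF Y]
  have c: "continuous_paths M s T (\<lambda>t \<omega>. X t \<omega> + Y t \<omega>)"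
    using p(2,4) unfolding continuous_paths_def by eventually_elim (rule continuous_on_add)
  let ?D = "{s<..<T} \<inter> \<rat>"
  have "(\<integral>\<^sup>+\<omega>. (SUP t\<in>{s..T}. ennreal ((norm (X t \<omega> + Y t \<omega>))\<^sup>2)) \<partial>M) =
    (\<integral>\<^sup>+\<omega>. (SUP t\<in>?D. ennreal ((norm (X t \<omega> + Y t \<omega>))\<^sup>2)) \<partial>M)"
    by (rule nn_integral_SUP_dense[OF c])
  also have "\<dots> \<le> (\<integral>\<^sup>+\<omega>. 2 * (SUP t\<in>?D. ennreal ((norm (X t \<omega>))\<^sup>2)) + 2 * (SUP t\<in>?D. ennreal ((norm (Y t \<omega>))\<^sup>2)) \<partial>M)"
  proof (intro nn_integral_mono SUP_least)
    fix \<omega> t assume t: "t \<in> ?D"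
    have "(norm (X t \<omega> + Y t \<omega>))\<^sup>2 \<le> (norm (X t \<omega>) + norm (Y t \<omega>))\<^sup>2" by (intro power_mono norm_triangle_ineq) auto
    also have "\<dots> \<le> 2 * (norm (X t \<omega>))\<^sup>2 + 2 * (norm (Y t \<omega>))\<^sup>2"
      using sum_squares_bound[of "norm (X t \<omega>)" "norm (Y t \<omega>)"] by (simp add: power2_sum)
    finally have "ennreal ((norm (X t \<omega> + Y t \<omega>))\<^sup>2) \<le> 2 * ennreal ((norm (X t \<omega>))\<^sup>2) + 2 * ennreal ((norm (Y t \<omega>))\<^sup>2)"
      using ennreal_leI by (fastforce simp: ennreal_mult)
    also have "\<dots> \<le> 2 * (SUP t\<in>?D. ennreal ((norm (X t \<omega>))\<^sup>2)) + 2 * (SUP t\<in>?D. ennreal ((norm (Y t \<omega>))\<^sup>2))"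
      by (intro add_mono mult_left_mono SUP_upper t) auto
    finally show "ennreal ((norm (X t \<omega> + Y t \<omega>))\<^sup>2) \<le> 2 * (SUP t\<in>?D. ennreal ((norm (X t \<omega>))\<^sup>2)) + 2 * (SUP t\<in>?D. ennreal ((norm (Y t \<omega>))\<^sup>2))" .
  qed
  also have "\<dots> = 2 * (\<integral>\<^sup>+\<omega>. (SUP t\<in>?D. ennreal ((norm (X t \<omega>))\<^sup>2)) \<partial>M) + 2 * (\<integral>\<^sup>+\<omega>. (SUP t\<in>?D. ennreal ((norm (Y t \<omega>))\<^sup>2)) \<partial>M)"
    using SUP_dense_measurable[OF p(1)] SUP_dense_measurable[OF p(3)]
    by (subst nn_integral_add) (auto simp: nn_integral_cmult)
  also have "\<dots> < \<infinity>"
    using X Y nn_integral_SUP_dense[OF p(2)] nn_integral_SUP_dense[OF p(4)]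
    by (auto simp: L2_continuous_def ennreal_mult_less_top)
  finally show ?thesis using c progressive_add[OF p(1,3)] by (auto simp: L2_continuous_def)
qed

lemma L2_continuous_bounded_linear:
  fixes F :: "'a::euclidean_space \<Rightarrow> 'b::euclidean_space"
  assumes F: "bounded_linear F" and X: "X \<in> L2_continuous M W s T"
  shows "(\<lambda>t \<omega>. F (X t \<omega>)) \<in> L2_continuous M W s T"
proof -
  interpret F: bounded_linear F by fact
  note p = L2_continuousD[OF X]
  have c: "continuous_paths M s T (\<lambda>t \<omega>. F (X t \<omega>))"
    using p(2) unfolding continuous_paths_def by eventually_elim (rule F.continuous_on)
  obtain K where K: "K > 0" "\<And>x. norm (F x) \<le> norm x * K" using F.pos_bounded by blast
  let ?D = "{s<..<T} \<inter> \<rat>"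
  have "(\<integral>\<^sup>+\<omega>. (SUP t\<in>{s..T}. ennreal ((norm (F (X t \<omega>)))\<^sup>2)) \<partial>M) =
    (\<integral>\<^sup>+\<omega>. (SUP t\<in>?D. ennreal ((norm (F (X t \<omega>)))\<^sup>2)) \<partial>M)"
    by (rule nn_integral_SUP_dense[OF c])
  also have "\<dots> \<le> (\<integral>\<^sup>+\<omega>. ennreal (K\<^sup>2) * (SUP t\<in>?D. ennreal ((norm (X t \<omega>))\<^sup>2)) \<partial>M)"
  proof (intro nn_integral_mono SUP_least)
    fix \<omega> t assume t: "t \<in> ?D"
    have "(norm (F (X t \<omega>)))\<^sup>2 \<le> (norm (X t \<omega>) * K)\<^sup>2" by (intro power_mono K) auto
    then have "ennreal ((norm (F (X t \<omega>)))\<^sup>2) \<le> ennreal (K\<^sup>2) * ennreal ((norm (X t \<omega>))\<^sup>2)"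
      by (simp add: ennreal_mult[symmetric] power_mult_distrib mult.commute ennreal_leI)
    also have "\<dots> \<le> ennreal (K\<^sup>2) * (SUP t\<in>?D. ennreal ((norm (X t \<omega>))\<^sup>2))"
      by (intro mult_left_mono SUP_upper t) auto
    finally show "ennreal ((norm (F (X t \<omega>)))\<^sup>2) \<le> ennreal (K\<^sup>2) * (SUP t\<in>?D. ennreal ((norm (X t \<omega>))\<^sup>2))" .
  qed
  also have "\<dots> = ennreal (K\<^sup>2) * (\<integral>\<^sup>+\<omega>. (SUP t\<in>?D. ennreal ((norm (X t \<omega>))\<^sup>2)) \<partial>M)"
    by (rule nn_integral_cmult[OF SUP_dense_measurable[OF p(1)]])
  also have "\<dots> < \<infinity>"
    using X nn_integral_SUP_dense[OF p(2)] by (auto simp: L2_continuous_def ennreal_mult_less_top)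
  finally show ?thesis using c progressive_bounded_linear[OF F p(1)] by (auto simp: L2_continuous_def)
qed

lemma L2_continuous_diff:
  fixes X Y :: "('w, 'a::euclidean_space) process"
  assumes X: "X \<in> L2_continuous M W s T" and Y: "Y \<in> L2_continuous M W s T"
  shows "(\<lambda>t \<omega>. X t \<omega> - Y t \<omega>) \<in> L2_continuous M W s T"
  using L2_continuous_add[OF X L2_continuous_bounded_linear[OF bounded_linear_minus[OF bounded_linear_ident] Y]] by simp

text \<open>The bounds available for inverses of the control weights and for Riccati solutions come
  with exceptional sets, so boundedness is required only almost everywhere on
  \<open>N\<close>.\<close>

definition ess_bounded :: "('w, 'a::euclidean_space) process \<Rightarrow> bool" where
  "ess_bounded X \<longleftrightarrow> progressive M W s T X \<and> (\<exists>K. AE p in N. norm (X (fst p) (snd p)) \<le> K)"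

lemma ess_bounded_bounded_process:
  assumes "bounded_process M W s T X"
  shows "ess_bounded X"
proof -
  obtain K where "\<forall>t\<in>{s..T}. \<forall>\<omega>\<in>space M. norm (X t \<omega>) \<le> K" using assms by (auto simp: bounded_process_def)
  then have "AE p in N. norm (X (fst p) (snd p)) \<le> K" by (intro AE_I2) (auto simp: space_N)
  then show ?thesis using assms by (auto simp: ess_bounded_def bounded_process_def)
qed

lemma ess_bounded_Linf:
  assumes "X \<in> Linf_continuous M W s T"
  shows "ess_bounded X"
proof -
  obtain K where "AE \<omega> in M. \<forall>t\<in>{s..T}. norm (X t \<omega>) \<le> K" using assms by (auto simp: Linf_continuous_def)
  then have "AE p in N. norm (X (fst p) (snd p)) \<le> K" by (rule AE_paths_N)
  then show ?thesis using assms by (auto simp: ess_bounded_def Linf_continuous_def)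
qed

lemma ess_bounded_bounded_linear:
  assumes F: "bounded_linear F" and X: "ess_bounded X"
  shows "ess_bounded (\<lambda>t \<omega>. F (X t \<omega>))"
proof -
  obtain C where C: "C > 0" "\<And>x. norm (F x) \<le> norm x * C" using bounded_linear.pos_bounded[OF F] by blast
  obtain K where K: "AE p in N. norm (X (fst p) (snd p)) \<le> K" using X by (auto simp: ess_bounded_def)
  have "AE p in N. norm (F (X (fst p) (snd p))) \<le> K * C"
    using K by eventually_elim (rule order_trans[OF C(2)], use C(1) in \<open>auto intro: mult_right_mono\<close>)
  then show ?thesis using X unfolding ess_bounded_def by (intro conjI progressive_bounded_linear[OF F] exI) auto
qed

lemma ess_bounded_bounded_bilinear:
  assumes F: "bounded_bilinear F" and X: "ess_bounded X" and Y: "ess_bounded Y"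
  shows "ess_bounded (\<lambda>t \<omega>. F (X t \<omega>) (Y t \<omega>))"
proof -
  obtain C where C: "C > 0" "\<And>x y. norm (F x y) \<le> norm x * norm y * C" using bounded_bilinear.pos_bounded[OF F] by blast
  obtain K where K: "AE p in N. norm (X (fst p) (snd p)) \<le> K" using X by (auto simp: ess_bounded_def)
  obtain L where L: "AE p in N. norm (Y (fst p) (snd p)) \<le> L" using Y by (auto simp: ess_bounded_def)
  have "AE p in N. norm (F (X (fst p) (snd p)) (Y (fst p) (snd p))) \<le> \<bar>K\<bar> * \<bar>L\<bar> * C"
    using K L
  proof eventually_elim
    case (elim p)
    have "norm (X (fst p) (snd p)) * norm (Y (fst p) (snd p)) * C \<le> \<bar>K\<bar> * \<bar>L\<bar> * C"
      using elim C(1) by (intro mult_right_mono mult_mono) auto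
    then show ?case using C(2) order_trans by blast
  qed
  then show ?thesis using X Y unfolding ess_bounded_def by (intro conjI progressive_bounded_bilinear[OF F] exI) auto
qed

lemma ess_bounded_add:
  assumes X: "ess_bounded X" and Y: "ess_bounded Y"
  shows "ess_bounded (\<lambda>t \<omega>. X t \<omega> + Y t \<omega>)"
proof -
  obtain K where K: "AE p in N. norm (X (fst p) (snd p)) \<le> K" using X by (auto simp: ess_bounded_def)
  obtain L where L: "AE p in N. norm (Y (fst p) (snd p)) \<le> L" using Y by (auto simp: ess_bounded_def)
  have "AE p in N. norm (X (fst p) (snd p) + Y (fst p) (snd p)) \<le> K + L"
    using K L by eventually_elim (rule norm_triangle_mono)
  then show ?thesis using X Y unfolding ess_bounded_def by (intro conjI progressive_add exI) auto
qed

lemma ess_bounded_uminus: "ess_bounded X \<Longrightarrow> ess_bounded (\<lambda>t \<omega>. - X t \<omega>)"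
  unfolding ess_bounded_def norm_minus_cancel by (auto intro: progressive_uminus)

lemma ess_bounded_diff: "ess_bounded X \<Longrightarrow> ess_bounded Y \<Longrightarrow> ess_bounded (\<lambda>t \<omega>. X t \<omega> - Y t \<omega>)"
  using ess_bounded_add[OF _ ess_bounded_uminus, of X Y] by simp

lemmas ess_bounded_matrix_mult = ess_bounded_bounded_bilinear[OF bounded_bilinear_matrix_mult]
lemmas ess_bounded_transpose = ess_bounded_bounded_linear[OF bounded_linear_transpose]

lemma L2_process_bounded_bilinear:
  assumes F: "bounded_bilinear F" and X: "ess_bounded X" and Y: "Y \<in> L2_process M W s T"
  shows "(\<lambda>t \<omega>. F (X t \<omega>) (Y t \<omega>)) \<in> L2_process M W s T"
proof -
  obtain C where C: "C > 0" "\<And>x y. norm (F x y) \<le> norm x * norm y * C" using bounded_bilinear.pos_bounded[OF F] by blast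
  obtain K where K: "AE p in N. norm (X (fst p) (snd p)) \<le> K" using X by (auto simp: ess_bounded_def)
  have p: "progressive M W s T (\<lambda>t \<omega>. F (X t \<omega>) (Y t \<omega>))"
    using X Y by (intro progressive_bounded_bilinear[OF F]) (auto simp: ess_bounded_def L2_process_iff)
  have "AE p in N. norm (F (X (fst p) (snd p)) (Y (fst p) (snd p))) \<le> (K * C) * norm (Y (fst p) (snd p))"
    using K
  proof eventually_elim
    case (elim p)
    have "norm (X (fst p) (snd p)) * norm (Y (fst p) (snd p)) * C \<le> K * norm (Y (fst p) (snd p)) * C"
      using elim C(1) by (intro mult_right_mono) auto
    then show ?case using C(2)[of "X (fst p) (snd p)" "Y (fst p) (snd p)"] by (simp add: mult_ac)
  qed
  then show ?thesis
    using sq_integrable_bound[of N "\<lambda>p. Y (fst p) (snd p)" "\<lambda>p. F (X (fst p) (snd p)) (Y (fst p) (snd p))" "K * C"]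
      progressive_measurable_N[OF p] p Y by (auto simp: L2_process_iff)
qed

lemmas L2_process_matrix_mult = L2_process_bounded_bilinear[OF bounded_bilinear_matrix_mult]
lemmas L2_process_matrix_vector_mult = L2_process_bounded_bilinear[OF bounded_bilinear_matrix_vector_mult]

lemma L2_process_bounded_linear:
  assumes F: "bounded_linear F" and X: "X \<in> L2_process M W s T"
  shows "(\<lambda>t \<omega>. F (X t \<omega>)) \<in> L2_process M W s T"
  using X unfolding L2_process_iff
  by (intro conjI progressive_bounded_linear[OF F] sq_integrable_bounded_linear[OF F]) auto

lemma L2_process_add:
  "X \<in> L2_process M W s T \<Longrightarrow> Y \<in> L2_process M W s T \<Longrightarrow> (\<lambda>t \<omega>. X t \<omega> + Y t \<omega>) \<in> L2_process M W s T"
  unfolding L2_process_iff by (intro conjI progressive_add sq_integrable_add) auto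

lemma L2_process_diff:
  "X \<in> L2_process M W s T \<Longrightarrow> Y \<in> L2_process M W s T \<Longrightarrow> (\<lambda>t \<omega>. X t \<omega> - Y t \<omega>) \<in> L2_process M W s T"
  unfolding L2_process_iff by (intro conjI progressive_diff sq_integrable_diff) auto

lemma L2_process_uminus:
  "X \<in> L2_process M W s T \<Longrightarrow> (\<lambda>t \<omega>. - X t \<omega>) \<in> L2_process M W s T"
  unfolding L2_process_iff by (intro conjI progressive_uminus sq_integrable_uminus) auto

lemma L2_process_zero: "(\<lambda>t \<omega>. 0) \<in> L2_process M W s T"
  unfolding L2_process_iff by (intro conjI progressive_const sq_integrable_zero)

text \<open>One exceptional set serves all vectors, so that the bound may be applied to the values
  of a process.\<close>

lemma ess_bounded_operator_bound:
  fixes A :: "('w, real^'n^'m) process"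
  assumes "ess_bounded A"
  obtains K where "K \<ge> 0" "AE p in N. \<forall>x. norm (A (fst p) (snd p) *v x) \<le> K * norm x"
proof -
  obtain C where C: "C > 0" "\<And>(x::real^'n^'m) y. norm (x *v y) \<le> norm x * norm y * C"
    using bounded_bilinear.pos_bounded[OF bounded_bilinear_matrix_vector_mult] by blast
  obtain K where K: "AE p in N. norm (A (fst p) (snd p)) \<le> K" using assms by (auto simp: ess_bounded_def)
  have "AE p in N. \<forall>x. norm (A (fst p) (snd p) *v x) \<le> (\<bar>K\<bar> * C) * norm x"
    using K
  proof eventually_elim
    case (elim p)
    show ?case
    proof
      fix x :: "real^'n"
      have "norm (A (fst p) (snd p)) * norm x * C \<le> \<bar>K\<bar> * norm x * C" using elim C(1) by (intro mult_right_mono) auto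
      then show "norm (A (fst p) (snd p) *v x) \<le> (\<bar>K\<bar> * C) * norm x"
        using C(2)[of "A (fst p) (snd p)" x] by (simp add: mult_ac)
    qed
  qed
  then show ?thesis using that[of "\<bar>K\<bar> * C"] C(1) by simp
qed

lemma ess_bounded_matrix_inv:
  fixes E :: "('w, real^'m^'m) process"
  assumes E: "progressive M W s T E" "\<And>t \<omega>. t \<in> {s..T} \<Longrightarrow> \<omega> \<in> space M \<Longrightarrow> invertible (E t \<omega>)"
    and \<epsilon>: "\<epsilon> > 0" and pos: "AE p in N. \<forall>x. \<epsilon> * (norm x)\<^sup>2 \<le> (E (fst p) (snd p) *v x) \<bullet> x"
  shows "ess_bounded (\<lambda>t \<omega>. matrix_inv (E t \<omega>))"
  unfolding ess_bounded_def
proof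
  show "progressive M W s T (\<lambda>t \<omega>. matrix_inv (E t \<omega>))"
    unfolding progressive_def
  proof
    fix t assume t: "t \<in> {s..T}"
    show "(\<lambda>p. matrix_inv (E (fst p) (snd p))) \<in> borel_measurable (restrict_space borel {s..t} \<Otimes>\<^sub>M \<F> t)"
    proof (rule borel_measurable_matrix_inv)
      show "(\<lambda>p. E (fst p) (snd p)) \<in> borel_measurable (restrict_space borel {s..t} \<Otimes>\<^sub>M \<F> t)"
        using E(1) t by (auto simp: progressive_def)
      fix p assume "p \<in> space (restrict_space borel {s..t} \<Otimes>\<^sub>M \<F> t)"
      then show "invertible (E (fst p) (snd p))"
        using t by (intro E(2)) (auto simp: space_pair_measure space_restrict_space)
    qed
  qed
  have "AE p in N. norm (matrix_inv (E (fst p) (snd p))) \<le> (\<Sum>i\<in>(UNIV::'m set). \<Sum>j\<in>(UNIV::'m set). 1 / \<epsilon>)"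
    using pos AE_space
  proof eventually_elim
    case (elim p)
    let ?B = "matrix_inv (E (fst p) (snd p))"
    have inv: "invertible (E (fst p) (snd p))" using elim(2) by (intro E(2)) (auto simp: space_N)
    \<comment> \<open>An entry is a component of the image of a unit vector; summing over all
      entries gives a crude bound for the norm.\<close>
    have comp: "norm (?B $ i $ j) \<le> 1 / \<epsilon>" for i j
    proof -
      have "?B $ i $ j = (?B *v axis j 1) $ i"
        by (simp add: matrix_vector_mult_def axis_def if_distrib[where f="\<lambda>x. _ * x"] cong: if_cong)
      then have "norm (?B $ i $ j) \<le> norm (?B *v axis j 1)" using component_le_norm_cart by (metis real_norm_def)
      also have "\<dots> \<le> norm (axis j (1::real) :: real^'m) / \<epsilon>"
        using elim(1) by (intro norm_matrix_inv_bound[OF inv \<epsilon>]) auto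
      finally show ?thesis by simp
    qed
    have "norm ?B \<le> (\<Sum>i\<in>UNIV. norm (?B $ i))" unfolding norm_vec_def[of ?B] by (rule L2_set_le_sum) auto
    also have "\<dots> \<le> (\<Sum>i\<in>(UNIV::'m set). \<Sum>j\<in>(UNIV::'m set). 1 / \<epsilon>)"
    proof (rule sum_mono)
      fix i
      have "norm (?B $ i) \<le> (\<Sum>j\<in>UNIV. norm (?B $ i $ j))" unfolding norm_vec_def[of "?B $ i"] by (rule L2_set_le_sum) auto
      also have "\<dots> \<le> (\<Sum>j\<in>(UNIV::'m set). 1 / \<epsilon>)" by (intro sum_mono comp)
      finally show "norm (?B $ i) \<le> (\<Sum>j\<in>(UNIV::'m set). 1 / \<epsilon>)" .
    qed
    finally show ?case .
  qed
  then show "\<exists>K. AE p in N. norm (matrix_inv (E (fst p) (snd p))) \<le> K" by blast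
qed

end


section \<open>The game and its a priori estimates\<close>

lemma (in brownian_interval) integral_norm_operator_le:
  fixes A :: "('w, real^'n^'m) process"
  assumes A: "K \<ge> 0" "AE p in N. \<forall>x. norm (A (fst p) (snd p) *v x) \<le> K * norm x"
    and u: "sq_integrable N (\<lambda>p. u (fst p) (snd p))"
  shows "(\<integral>p. (norm (A (fst p) (snd p) *v u (fst p) (snd p)))\<^sup>2 \<partial>N) \<le> K\<^sup>2 * (\<integral>p. (norm (u (fst p) (snd p)))\<^sup>2 \<partial>N)"
proof -
  have "(\<integral>p. (norm (A (fst p) (snd p) *v u (fst p) (snd p)))\<^sup>2 \<partial>N) \<le> (\<integral>p. K\<^sup>2 * (norm (u (fst p) (snd p)))\<^sup>2 \<partial>N)"
  proof (rule integral_mono_AE')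
    show "integrable N (\<lambda>p. K\<^sup>2 * (norm (u (fst p) (snd p)))\<^sup>2)" using sq_integrable_norm[OF u] by simp
    show "AE p in N. (norm (A (fst p) (snd p) *v u (fst p) (snd p)))\<^sup>2 \<le> K\<^sup>2 * (norm (u (fst p) (snd p)))\<^sup>2"
      using A(2)
    proof eventually_elim
      case (elim p)
      then have "norm (A (fst p) (snd p) *v u (fst p) (snd p)) \<le> K * norm (u (fst p) (snd p))" by blast
      from power_mono[OF this, of 2] show ?case by (simp add: power_mult_distrib)
    qed
  qed simp
  then show ?thesis by simp
qed

lemma (in brownian_interval) integral_inner_operator_le:
  fixes A :: "('w, real^'n^'n) process"
  assumes A: "AE p in N. \<forall>x. norm (A (fst p) (snd p) *v x) \<le> K * norm x" "K \<ge> 0"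
    and u: "sq_integrable N (\<lambda>p. u (fst p) (snd p))"
  shows "(\<integral>p. (A (fst p) (snd p) *v u (fst p) (snd p)) \<bullet> u (fst p) (snd p) \<partial>N) \<le> K * (\<integral>p. (norm (u (fst p) (snd p)))\<^sup>2 \<partial>N)"
proof -
  have "(\<integral>p. (A (fst p) (snd p) *v u (fst p) (snd p)) \<bullet> u (fst p) (snd p) \<partial>N) \<le> (\<integral>p. K * (norm (u (fst p) (snd p)))\<^sup>2 \<partial>N)"
  proof (rule integral_mono_AE')
    show "integrable N (\<lambda>p. K * (norm (u (fst p) (snd p)))\<^sup>2)" using sq_integrable_norm[OF u] by simp
    show "AE p in N. (A (fst p) (snd p) *v u (fst p) (snd p)) \<bullet> u (fst p) (snd p) \<le> K * (norm (u (fst p) (snd p)))\<^sup>2"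
      using A(1)
    proof eventually_elim
      case (elim p)
      have "(A (fst p) (snd p) *v u (fst p) (snd p)) \<bullet> u (fst p) (snd p) \<le> norm (A (fst p) (snd p) *v u (fst p) (snd p)) * norm (u (fst p) (snd p))"
        by (rule norm_cauchy_schwarz)
      also have "\<dots> \<le> K * norm (u (fst p) (snd p)) * norm (u (fst p) (snd p))"
        using elim by (intro mult_right_mono) auto
      finally show ?case by (simp add: power2_eq_square mult_ac)
    qed
  qed (use A in simp)
  then show ?thesis by simp
qed

locale lq =
  fixes G :: "('w, 'n::finite, 'm::finite, 'l::finite) game"
  assumes game: "lq_game G"

sublocale lq \<subseteq> brownian_interval "Om G" "BM G" "t0 G" "t1 G"
proof -
  have "prob_space (Om G)" using lq_axioms by (auto simp: lq_def lq_game_def brownian_motion_def)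
  then show "brownian_interval (Om G) (BM G) (t0 G) (t1 G)"
    using lq_axioms by (auto simp: brownian_interval_def brownian_interval_axioms_def lq_def lq_game_def)
qed

context lq
begin

lemma ess_bounded_coefficients:
  "ess_bounded (cA G)" "ess_bounded (cC G)" "ess_bounded (cB1 G)" "ess_bounded (cB2 G)"
  "ess_bounded (cD1 G)" "ess_bounded (cD2 G)" "ess_bounded (cE1 G)" "ess_bounded (cE2 G)"
  using game by (auto simp: lq_game_def intro: ess_bounded_bounded_process)

lemma terminal_coeff_operator:
  fixes H :: "'w \<Rightarrow> real^'k^'k"
  assumes "terminal_coeff G H"
  obtains K where "K \<ge> 0" "\<And>\<omega> x. \<omega> \<in> space (Om G) \<Longrightarrow> norm (H \<omega> *v x) \<le> K * norm x"
proof -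
  obtain C where C: "C > 0" "\<And>(x::real^'k^'k) y. norm (x *v y) \<le> norm x * norm y * C"
    using bounded_bilinear.pos_bounded[OF bounded_bilinear_matrix_vector_mult] by blast
  obtain K where K: "\<forall>\<omega>\<in>space (Om G). norm (H \<omega>) \<le> K" using assms by (auto simp: terminal_coeff_def)
  have "norm (H \<omega> *v x) \<le> (\<bar>K\<bar> * C) * norm x" if "\<omega> \<in> space (Om G)" for \<omega> x
  proof -
    have "norm (H \<omega>) * norm x * C \<le> \<bar>K\<bar> * norm x * C" using K that C(1) by (intro mult_right_mono) force+
    then show ?thesis using C(2)[of "H \<omega>" x] by (simp add: mult_ac)
  qed
  then show ?thesis using that[of "\<bar>K\<bar> * C"] C(1) by simp
qed

lemma sq_integrable_terminal:
  assumes H: "terminal_coeff G H" and Y: "sq_integrable (Om G) Y"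
  shows "sq_integrable (Om G) (\<lambda>\<omega>. H \<omega> *v Y \<omega>)"
proof -
  obtain K where K: "K \<ge> 0" "\<And>\<omega> x. \<omega> \<in> space (Om G) \<Longrightarrow> norm (H \<omega> *v x) \<le> K * norm x"
    by (rule terminal_coeff_operator[OF H]) blast
  have "H \<in> borel_measurable (Om G)" using H by (auto simp: terminal_coeff_def intro: measurable_filtration_M)
  then have "(\<lambda>\<omega>. H \<omega> *v Y \<omega>) \<in> borel_measurable (Om G)"
    by (rule borel_measurable_continuous_Pair[OF _ sq_integrable_measurable[OF Y]])
       (intro bounded_bilinear.continuous_on[OF bounded_bilinear_matrix_vector_mult] continuous_intros)
  then show ?thesis using K by (intro sq_integrable_bound[OF Y, of _ K] AE_I2)
qed

lemma L2C_N: "X \<in> L2C G \<Longrightarrow> sq_integrable N (\<lambda>p. X (fst p) (snd p))"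
  using L2_continuous_L2_process by (auto simp: L2_process_iff)

lemma L2F_N: "X \<in> L2F G \<Longrightarrow> sq_integrable N (\<lambda>p. X (fst p) (snd p))"
  by (auto simp: L2_process_iff)

lemma t1_mem: "t1 G \<in> {t0 G..t1 G}" and t0_mem: "t0 G \<in> {t0 G..t1 G}"
  using s_less_T by auto

lemma quadratic_cost_eq:
  assumes D: "ess_bounded D" and E: "ess_bounded E" and H: "terminal_coeff G H" and X: "X \<in> L2C G" and u: "u \<in> L2F G"
  shows "quadratic_cost G D E H X u = (\<integral>p. (D (fst p) (snd p) *v X (fst p) (snd p)) \<bullet> X (fst p) (snd p) \<partial>N)
    + (\<integral>p. (E (fst p) (snd p) *v u (fst p) (snd p)) \<bullet> u (fst p) (snd p) \<partial>N)
    + expectation (\<lambda>\<omega>. (H \<omega> *v X (t1 G) \<omega>) \<bullet> X (t1 G) \<omega>)"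
proof -
  have 1: "integrable N (\<lambda>p. (D (fst p) (snd p) *v X (fst p) (snd p)) \<bullet> X (fst p) (snd p))"
    by (intro integrable_inner L2C_N X L2F_N L2_process_matrix_vector_mult D L2_continuous_L2_process)
  have 2: "integrable N (\<lambda>p. (E (fst p) (snd p) *v u (fst p) (snd p)) \<bullet> u (fst p) (snd p))"
    by (intro integrable_inner L2F_N u L2_process_matrix_vector_mult E)
  have 3: "integrable (Om G) (\<lambda>\<omega>. (H \<omega> *v X (t1 G) \<omega>) \<bullet> X (t1 G) \<omega>)"
    by (intro integrable_inner sq_integrable_terminal H L2_continuous_sq_integrable[OF X t1_mem])
  let ?f = "\<lambda>t \<omega>. (D t \<omega> *v X t \<omega>) \<bullet> X t \<omega> + (E t \<omega> *v u t \<omega>) \<bullet> u t \<omega>"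
  have i: "integrable N (\<lambda>p. ?f (fst p) (snd p))" using 1 2 by (rule Bochner_Integration.integrable_add)
  have "quadratic_cost G D E H X u = expectation (\<lambda>\<omega>. LBINT t:{t0 G..t1 G}. ?f t \<omega>) + expectation (\<lambda>\<omega>. (H \<omega> *v X (t1 G) \<omega>) \<bullet> X (t1 G) \<omega>)"
    unfolding quadratic_cost_def by (rule Bochner_Integration.integral_add[OF integral_N(2)[OF i] 3])
  also have "expectation (\<lambda>\<omega>. LBINT t:{t0 G..t1 G}. ?f t \<omega>) = (\<integral>p. ?f (fst p) (snd p) \<partial>N)" by (rule integral_N(1)[OF i])
  also have "\<dots> = (\<integral>p. (D (fst p) (snd p) *v X (fst p) (snd p)) \<bullet> X (fst p) (snd p) \<partial>N)
    + (\<integral>p. (E (fst p) (snd p) *v u (fst p) (snd p)) \<bullet> u (fst p) (snd p) \<partial>N)"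
    by (rule Bochner_Integration.integral_add[OF 1 2])
  finally show ?thesis .
qed

lemma L2_inner_eq:
  assumes "u \<in> L2F G" "v \<in> L2F G"
  shows "L2_inner (Om G) (t0 G) (t1 G) u v = (\<integral>p. u (fst p) (snd p) \<bullet> v (fst p) (snd p) \<partial>N)"
  unfolding L2_inner_def by (rule integral_N(1)) (intro integrable_inner L2F_N assms)

lemma L2_inner_self:
  assumes "u \<in> L2F G"
  shows "L2_inner (Om G) (t0 G) (t1 G) u u = (\<integral>p. (norm (u (fst p) (snd p)))\<^sup>2 \<partial>N)"
  by (simp add: L2_inner_eq[OF assms assms] power2_norm_eq_inner)

text \<open>A coercive cost forces the control weight to be uniformly positive: a control acting only on
  a time interval of length \<open>h\<close> moves the state by \<open>O(h)\<close> in mean square, so for small \<open>h\<close> the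
  coercivity has to be provided by the control term alone.\<close>

lemma coercive_cost_positive_definite:
  assumes D: "ess_bounded D" and E: "ess_bounded E" and H: "terminal_coeff G H" and \<epsilon>: "\<epsilon> > 0" and C: "C \<ge> 0"
    and sol: "\<And>a a' u. a < a' \<Longrightarrow> u \<in> L2F G \<Longrightarrow> (\<And>t \<omega>. t \<notin> {a..a'} \<Longrightarrow> u t \<omega> = 0) \<Longrightarrow>
      \<exists>X\<in>L2C G. (\<forall>t\<in>{t0 G..t1 G}. expectation (\<lambda>\<omega>. (norm (X t \<omega>))\<^sup>2) \<le> C * (a' - a) * (\<integral>p. (norm (u (fst p) (snd p)))\<^sup>2 \<partial>N)) \<and>
        \<epsilon> * L2_inner (Om G) (t0 G) (t1 G) u u \<le> quadratic_cost G D E H X u"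
  shows "AE p in N. \<forall>x. \<epsilon> / 2 * (norm x)\<^sup>2 \<le> (E (fst p) (snd p) *v x) \<bullet> x"
proof -
  obtain KD where KD: "KD \<ge> 0" "AE p in N. \<forall>x. norm (D (fst p) (snd p) *v x) \<le> KD * norm x"
    by (rule ess_bounded_operator_bound[OF D]) blast
  obtain KH where KH: "KH \<ge> 0" "\<And>\<omega> x. \<omega> \<in> space (Om G) \<Longrightarrow> norm (H \<omega> *v x) \<le> KH * norm x"
    by (rule terminal_coeff_operator[OF H]) blast
  obtain KE where KE: "AE p in N. norm (E (fst p) (snd p)) \<le> KE" using E by (auto simp: ess_bounded_def)
  \<comment> \<open>The running cost of the state accumulates over the horizon, the terminal cost
    counts once; both carry the factor \<open>C * (a' - a)\<close> from the estimate of the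
    state.\<close>
  let ?\<kappa> = "(KD * (t1 G - t0 G) + KH) * C"
  show ?thesis
  proof (rule coercive_imp_positive_definite[OF _ KE \<epsilon>, of ?\<kappa>])
    show "progressive (Om G) (BM G) (t0 G) (t1 G) E" using E by (simp add: ess_bounded_def)
    show "0 \<le> ?\<kappa>" using KD KH C s_less_T by (intro mult_nonneg_nonneg add_nonneg_nonneg) auto
    fix a a' :: real and u :: "('w, 'm) control"
    assume a: "a < a'" and u: "u \<in> L2F G" and supp: "\<And>t \<omega>. t \<notin> {a..a'} \<Longrightarrow> u t \<omega> = 0"
    let ?n = "\<integral>p. (norm (u (fst p) (snd p)))\<^sup>2 \<partial>N"
    obtain X where X: "X \<in> L2C G" and bound: "\<And>t. t\<in>{t0 G..t1 G} \<Longrightarrow> expectation (\<lambda>\<omega>. (norm (X t \<omega>))\<^sup>2) \<le> C * (a' - a) * ?n"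
      and cost: "\<epsilon> * L2_inner (Om G) (t0 G) (t1 G) u u \<le> quadratic_cost G D E H X u"
      using sol[OF a u supp] by blast
    have "(\<integral>p. (D (fst p) (snd p) *v X (fst p) (snd p)) \<bullet> X (fst p) (snd p) \<partial>N) \<le> KD * (\<integral>p. (norm (X (fst p) (snd p)))\<^sup>2 \<partial>N)"
      by (rule integral_inner_operator_le[OF KD(2,1) L2C_N[OF X]])
    also have "\<dots> \<le> KD * ((t1 G - t0 G) * (C * (a' - a) * ?n))"
      by (intro mult_left_mono KD integral_norm_le_time[OF X] bound)
    finally have 1: "(\<integral>p. (D (fst p) (snd p) *v X (fst p) (snd p)) \<bullet> X (fst p) (snd p) \<partial>N) \<le> KD * ((t1 G - t0 G) * (C * (a' - a) * ?n))" .
    have "expectation (\<lambda>\<omega>. (H \<omega> *v X (t1 G) \<omega>) \<bullet> X (t1 G) \<omega>) \<le> expectation (\<lambda>\<omega>. KH * (norm (X (t1 G) \<omega>))\<^sup>2)"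
    proof (rule integral_mono)
      show "integrable (Om G) (\<lambda>\<omega>. KH * (norm (X (t1 G) \<omega>))\<^sup>2)"
        using sq_integrable_norm[OF L2_continuous_sq_integrable[OF X t1_mem]] by simp
      show "integrable (Om G) (\<lambda>\<omega>. (H \<omega> *v X (t1 G) \<omega>) \<bullet> X (t1 G) \<omega>)"
        by (intro integrable_inner sq_integrable_terminal H L2_continuous_sq_integrable[OF X t1_mem])
      fix \<omega> assume "\<omega> \<in> space (Om G)"
      have "(H \<omega> *v X (t1 G) \<omega>) \<bullet> X (t1 G) \<omega> \<le> norm (H \<omega> *v X (t1 G) \<omega>) * norm (X (t1 G) \<omega>)" by (rule norm_cauchy_schwarz)
      also have "\<dots> \<le> KH * norm (X (t1 G) \<omega>) * norm (X (t1 G) \<omega>)"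
        using KH(2)[OF \<open>\<omega> \<in> space (Om G)\<close>] by (intro mult_right_mono) auto
      finally show "(H \<omega> *v X (t1 G) \<omega>) \<bullet> X (t1 G) \<omega> \<le> KH * (norm (X (t1 G) \<omega>))\<^sup>2" by (simp add: power2_eq_square mult_ac)
    qed
    also have "\<dots> = KH * expectation (\<lambda>\<omega>. (norm (X (t1 G) \<omega>))\<^sup>2)" by simp
    also have "\<dots> \<le> KH * (C * (a' - a) * ?n)" by (intro mult_left_mono KH bound t1_mem)
    finally have 2: "expectation (\<lambda>\<omega>. (H \<omega> *v X (t1 G) \<omega>) \<bullet> X (t1 G) \<omega>) \<le> KH * (C * (a' - a) * ?n)" .
    have "\<epsilon> * ?n \<le> (\<integral>p. (D (fst p) (snd p) *v X (fst p) (snd p)) \<bullet> X (fst p) (snd p) \<partial>N)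
      + (\<integral>p. (E (fst p) (snd p) *v u (fst p) (snd p)) \<bullet> u (fst p) (snd p) \<partial>N)
      + expectation (\<lambda>\<omega>. (H \<omega> *v X (t1 G) \<omega>) \<bullet> X (t1 G) \<omega>)"
      using cost unfolding L2_inner_self[OF u] quadratic_cost_eq[OF D E H X u] .
    also have "\<dots> \<le> KD * ((t1 G - t0 G) * (C * (a' - a) * ?n))
      + (\<integral>p. (E (fst p) (snd p) *v u (fst p) (snd p)) \<bullet> u (fst p) (snd p) \<partial>N) + KH * (C * (a' - a) * ?n)"
      using 1 2 by (intro add_mono) auto
    also have "\<dots> = (\<integral>p. (E (fst p) (snd p) *v u (fst p) (snd p)) \<bullet> u (fst p) (snd p) \<partial>N) + ?\<kappa> * (a' - a) * ?n"
    proof -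
      have "KD * (d * (C * e * n)) + i + KH * (C * e * n) = i + (KD * d + KH) * C * e * n" for d e n i :: real
        by (simp add: algebra_simps)
      then show ?thesis .
    qed
    finally show "\<epsilon> * ?n \<le> (\<integral>p. (E (fst p) (snd p) *v u (fst p) (snd p)) \<bullet> u (fst p) (snd p) \<partial>N) + ?\<kappa> * (a' - a) * ?n" .
  qed
qed

text \<open>The whole control term counts as localized forcing, so the length of the interval
  appears as a factor; \<open>C\<close> depends neither on the interval nor on the control.\<close>

lemma state_solution_estimate:
  obtains C where "C \<ge> 0" "\<And>a a' u X t. a < a' \<Longrightarrow> u \<in> L2F G \<Longrightarrow> (\<And>t \<omega>. t \<notin> {a..a'} \<Longrightarrow> u t \<omega> = 0) \<Longrightarrow>
    state_solution G 0 u (\<lambda>_ _. 0) X \<Longrightarrow> t \<in> {t0 G..t1 G} \<Longrightarrow>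
    expectation (\<lambda>\<omega>. (norm (X t \<omega>))\<^sup>2) \<le> C * (a' - a) * (\<integral>p. (norm (u (fst p) (snd p)))\<^sup>2 \<partial>N)"
proof -
  note EB = ess_bounded_coefficients
  obtain KA where KA: "KA \<ge> 0" "AE p in N. \<forall>x. norm (cA G (fst p) (snd p) *v x) \<le> KA * norm x"
    by (rule ess_bounded_operator_bound[OF EB(1)]) blast
  obtain KC where KC: "KC \<ge> 0" "AE p in N. \<forall>x. norm (cC G (fst p) (snd p) *v x) \<le> KC * norm x"
    by (rule ess_bounded_operator_bound[OF EB(2)]) blast
  obtain KB where KB: "KB \<ge> 0" "AE p in N. \<forall>x. norm (cB1 G (fst p) (snd p) *v x) \<le> KB * norm x"
    by (rule ess_bounded_operator_bound[OF EB(3)]) blast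
  define K where "K = max KA KC"
  define E where "E = 2 * exp (4 * (2 * K + K\<^sup>2 + 1) * (t1 G - t0 G))"
  have K: "K \<ge> 0" "KA \<le> K" "KC \<le> K" using KA KC by (auto simp: K_def)
  have E0: "E \<ge> 0" by (simp add: E_def)
  show ?thesis
  proof (rule that[of "E * (4 * KB\<^sup>2)"])
    show "0 \<le> E * (4 * KB\<^sup>2)" using E0 by simp
    fix a a' u X t assume a: "a < a'" and u: "u \<in> L2F G" and supp: "\<And>t \<omega>. t \<notin> {a..a'} \<Longrightarrow> u t \<omega> = 0"
      and sol: "state_solution G 0 u (\<lambda>_ _. 0) X" and t: "t \<in> {t0 G..t1 G}"
    have X: "X \<in> L2C G" "AE \<omega> in Om G. X (t0 G) \<omega> = 0"
      "itod G X (\<lambda>t \<omega>. cA G t \<omega> *v X t \<omega> + cB1 G t \<omega> *v u t \<omega> + cB2 G t \<omega> *v 0) (\<lambda>t \<omega>. cC G t \<omega> *v X t \<omega>)"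
      using sol by (auto simp: state_solution_def)
    have b: "(\<lambda>t \<omega>. cA G t \<omega> *v X t \<omega> + cB1 G t \<omega> *v u t \<omega> + cB2 G t \<omega> *v 0) \<in> L2F G"
      by (intro L2_process_add L2_process_matrix_vector_mult EB L2_continuous_L2_process X u L2_process_zero)
    have Bu: "sq_integrable N (\<lambda>p. cB1 G (fst p) (snd p) *v u (fst p) (snd p))"
      by (intro L2F_N L2_process_matrix_vector_mult EB u)
    let ?n = "\<integral>p. (norm (u (fst p) (snd p)))\<^sup>2 \<partial>N"
    have "expectation (\<lambda>\<omega>. (norm (X t \<omega>))\<^sup>2) \<le> E * ((\<integral>p. (norm (0::real))\<^sup>2 \<partial>N)
       + 4 * (a' - a) * (\<integral>p. (norm (cB1 G (fst p) (snd p) *v u (fst p) (snd p)))\<^sup>2 \<partial>N))"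
      unfolding E_def
    proof (rule sde_estimate[where ?f1.0="\<lambda>_ _. 0::real" and ?f2.0="\<lambda>t \<omega>. cB1 G t \<omega> *v u t \<omega>" and a=a and a'=a', OF X(1,3) b X(2) _ Bu _ K(1)])
      show "sq_integrable N (\<lambda>p. 0::real)" by (rule sq_integrable_zero)
      show "AE p in N. norm (cA G (fst p) (snd p) *v X (fst p) (snd p) + cB1 G (fst p) (snd p) *v u (fst p) (snd p) + cB2 G (fst p) (snd p) *v 0)
         \<le> K * norm (X (fst p) (snd p)) + norm (0::real) + norm (cB1 G (fst p) (snd p) *v u (fst p) (snd p))"
        using KA(2)
      proof eventually_elim
        case (elim p)
        have "norm (cA G (fst p) (snd p) *v X (fst p) (snd p)) \<le> K * norm (X (fst p) (snd p))"
          using elim K(2) by (meson mult_right_mono norm_ge_zero order_trans)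
        then show ?case
          using norm_triangle_ineq[of "cA G (fst p) (snd p) *v X (fst p) (snd p)" "cB1 G (fst p) (snd p) *v u (fst p) (snd p)"] by simp
      qed
      show "AE p in N. norm (cC G (fst p) (snd p) *v X (fst p) (snd p)) \<le> K * norm (X (fst p) (snd p))"
        using KC(2)
      proof eventually_elim
        case (elim p)
        then show ?case using K(3) by (meson mult_right_mono norm_ge_zero order_trans)
      qed
    qed (use a supp t in auto)
    also have "\<dots> \<le> E * (0 + 4 * (a' - a) * (KB\<^sup>2 * ?n))"
      using integral_norm_operator_le[OF KB L2F_N[OF u]] a E0 by (intro mult_left_mono add_mono) auto
    finally show "expectation (\<lambda>\<omega>. (norm (X t \<omega>))\<^sup>2) \<le> E * (4 * KB\<^sup>2) * (a' - a) * ?n" by (simp only: add_0 mult_ac)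
  qed
qed

text \<open>The state map starts at \<open>xi G\<close>, while coercivity and estimates concern the
  initial value zero. Differences of solutions bridge the gap.\<close>

lemma state_solution_diff:
  assumes "state_solution G x u1 u2 X" "state_solution G x' v1 v2 Y"
  shows "state_solution G (x - x') (\<lambda>t \<omega>. u1 t \<omega> - v1 t \<omega>) (\<lambda>t \<omega>. u2 t \<omega> - v2 t \<omega>) (\<lambda>t \<omega>. X t \<omega> - Y t \<omega>)"
  unfolding state_solution_def
proof (intro conjI)
  show "(\<lambda>t \<omega>. X t \<omega> - Y t \<omega>) \<in> L2C G"
    using assms by (intro L2_continuous_diff) (auto simp: state_solution_def)
  show "AE \<omega> in Om G. X (t0 G) \<omega> - Y (t0 G) \<omega> = x - x'"
    using assms unfolding state_solution_def by (auto elim: eventually_elim2)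
  have "itod G (\<lambda>t \<omega>. X t \<omega> - Y t \<omega>)
     (\<lambda>t \<omega>. (cA G t \<omega> *v X t \<omega> + cB1 G t \<omega> *v u1 t \<omega> + cB2 G t \<omega> *v u2 t \<omega>) - (cA G t \<omega> *v Y t \<omega> + cB1 G t \<omega> *v v1 t \<omega> + cB2 G t \<omega> *v v2 t \<omega>))
     (\<lambda>t \<omega>. cC G t \<omega> *v X t \<omega> - cC G t \<omega> *v Y t \<omega>)"
    using assms by (intro ito_differential_diff brownian_interval_axioms) (auto simp: state_solution_def)
  then show "itod G (\<lambda>t \<omega>. X t \<omega> - Y t \<omega>)
     (\<lambda>t \<omega>. cA G t \<omega> *v (X t \<omega> - Y t \<omega>) + cB1 G t \<omega> *v (u1 t \<omega> - v1 t \<omega>) + cB2 G t \<omega> *v (u2 t \<omega> - v2 t \<omega>))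
     (\<lambda>t \<omega>. cC G t \<omega> *v (X t \<omega> - Y t \<omega>))"
    by (simp add: matrix_vector_mult_diff_distrib algebra_simps)
qed

lemma follower_system_diff:
  assumes "follower_system G \<phi>1 x u X \<psi> \<psi>'" "follower_system G \<phi>1 x' v Y \<theta> \<theta>'"
  shows "follower_system G \<phi>1 (x - x') (\<lambda>t \<omega>. u t \<omega> - v t \<omega>) (\<lambda>t \<omega>. X t \<omega> - Y t \<omega>) (\<lambda>t \<omega>. \<psi> t \<omega> - \<theta> t \<omega>) (\<lambda>t \<omega>. \<psi>' t \<omega> - \<theta>' t \<omega>)"
  unfolding follower_system_def
proof (intro conjI)
  show "(\<lambda>t \<omega>. X t \<omega> - Y t \<omega>) \<in> L2C G" "(\<lambda>t \<omega>. \<psi> t \<omega> - \<theta> t \<omega>) \<in> L2C G"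
    using assms by (auto simp: follower_system_def intro: L2_continuous_diff)
  show "(\<lambda>t \<omega>. \<psi>' t \<omega> - \<theta>' t \<omega>) \<in> L2F G"
    using assms by (auto simp: follower_system_def intro: L2_process_diff)
  have "AE \<omega> in Om G. X (t0 G) \<omega> = x \<and> \<psi> (t1 G) \<omega> = 0" "AE \<omega> in Om G. Y (t0 G) \<omega> = x' \<and> \<theta> (t1 G) \<omega> = 0"
    using assms by (auto simp: follower_system_def)
  then show "AE \<omega> in Om G. X (t0 G) \<omega> - Y (t0 G) \<omega> = x - x' \<and> \<psi> (t1 G) \<omega> - \<theta> (t1 G) \<omega> = 0"
    by eventually_elim auto
  have "itod G (\<lambda>t \<omega>. X t \<omega> - Y t \<omega>)
     (\<lambda>t \<omega>. ((cA G t \<omega> - S1 G t \<omega> ** \<phi>1 t \<omega>) *v X t \<omega> - S1 G t \<omega> *v \<psi> t \<omega> + cB2 G t \<omega> *v u t \<omega>)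
       - ((cA G t \<omega> - S1 G t \<omega> ** \<phi>1 t \<omega>) *v Y t \<omega> - S1 G t \<omega> *v \<theta> t \<omega> + cB2 G t \<omega> *v v t \<omega>))
     (\<lambda>t \<omega>. cC G t \<omega> *v X t \<omega> - cC G t \<omega> *v Y t \<omega>)"
    using assms by (intro ito_differential_diff brownian_interval_axioms) (auto simp: follower_system_def)
  moreover have "((cA G t \<omega> - S1 G t \<omega> ** \<phi>1 t \<omega>) *v X t \<omega> - S1 G t \<omega> *v \<psi> t \<omega> + cB2 G t \<omega> *v u t \<omega>)
       - ((cA G t \<omega> - S1 G t \<omega> ** \<phi>1 t \<omega>) *v Y t \<omega> - S1 G t \<omega> *v \<theta> t \<omega> + cB2 G t \<omega> *v v t \<omega>) =
     (cA G t \<omega> - S1 G t \<omega> ** \<phi>1 t \<omega>) *v (X t \<omega> - Y t \<omega>) - S1 G t \<omega> *v (\<psi> t \<omega> - \<theta> t \<omega>) + cB2 G t \<omega> *v (u t \<omega> - v t \<omega>)" for t \<omega>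
    unfolding matrix_vector_mult_diff_distrib by simp
  ultimately show "itod G (\<lambda>t \<omega>. X t \<omega> - Y t \<omega>)
     (\<lambda>t \<omega>. (cA G t \<omega> - S1 G t \<omega> ** \<phi>1 t \<omega>) *v (X t \<omega> - Y t \<omega>) - S1 G t \<omega> *v (\<psi> t \<omega> - \<theta> t \<omega>) + cB2 G t \<omega> *v (u t \<omega> - v t \<omega>))
     (\<lambda>t \<omega>. cC G t \<omega> *v (X t \<omega> - Y t \<omega>))"
    by (simp only: matrix_vector_mult_diff_distrib[of "cC G _ _"])
  have "itod G (\<lambda>t \<omega>. \<psi> t \<omega> - \<theta> t \<omega>)
     (\<lambda>t \<omega>. - ((transpose (cA G t \<omega>) - \<phi>1 t \<omega> ** S1 G t \<omega>) *v \<psi> t \<omega>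
                + transpose (cC G t \<omega>) *v \<psi>' t \<omega> + \<phi>1 t \<omega> *v (cB2 G t \<omega> *v u t \<omega>))
       - - ((transpose (cA G t \<omega>) - \<phi>1 t \<omega> ** S1 G t \<omega>) *v \<theta> t \<omega>
                + transpose (cC G t \<omega>) *v \<theta>' t \<omega> + \<phi>1 t \<omega> *v (cB2 G t \<omega> *v v t \<omega>)))
     (\<lambda>t \<omega>. \<psi>' t \<omega> - \<theta>' t \<omega>)"
    using assms by (intro ito_differential_diff brownian_interval_axioms) (auto simp: follower_system_def)
  moreover have "- ((transpose (cA G t \<omega>) - \<phi>1 t \<omega> ** S1 G t \<omega>) *v \<psi> t \<omega>
                + transpose (cC G t \<omega>) *v \<psi>' t \<omega> + \<phi>1 t \<omega> *v (cB2 G t \<omega> *v u t \<omega>))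
       - - ((transpose (cA G t \<omega>) - \<phi>1 t \<omega> ** S1 G t \<omega>) *v \<theta> t \<omega>
                + transpose (cC G t \<omega>) *v \<theta>' t \<omega> + \<phi>1 t \<omega> *v (cB2 G t \<omega> *v v t \<omega>)) =
      - ((transpose (cA G t \<omega>) - \<phi>1 t \<omega> ** S1 G t \<omega>) *v (\<psi> t \<omega> - \<theta> t \<omega>)
                + transpose (cC G t \<omega>) *v (\<psi>' t \<omega> - \<theta>' t \<omega>) + \<phi>1 t \<omega> *v (cB2 G t \<omega> *v (u t \<omega> - v t \<omega>)))" for t \<omega>
    unfolding matrix_vector_mult_diff_distrib by simp
  ultimately show "itod G (\<lambda>t \<omega>. \<psi> t \<omega> - \<theta> t \<omega>)
     (\<lambda>t \<omega>. - ((transpose (cA G t \<omega>) - \<phi>1 t \<omega> ** S1 G t \<omega>) *v (\<psi> t \<omega> - \<theta> t \<omega>)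
                + transpose (cC G t \<omega>) *v (\<psi>' t \<omega> - \<theta>' t \<omega>) + \<phi>1 t \<omega> *v (cB2 G t \<omega> *v (u t \<omega> - v t \<omega>))))
     (\<lambda>t \<omega>. \<psi>' t \<omega> - \<theta>' t \<omega>)"
    by (simp only:)
qed

lemma invertible_E: "t \<in> {t0 G..t1 G} \<Longrightarrow> \<omega> \<in> space (Om G) \<Longrightarrow> invertible (cE1 G t \<omega>)"
  "t \<in> {t0 G..t1 G} \<Longrightarrow> \<omega> \<in> space (Om G) \<Longrightarrow> invertible (cE2 G t \<omega>)"
  using game by (auto simp: lq_game_def)

text \<open>Coercivity says nothing about a control without a state, hence the explicit hypothesis
  of solvability from the initial value zero.\<close>

lemma ess_bounded_invE1:
  assumes sol: "\<And>u. u \<in> L2F G \<Longrightarrow> \<exists>X. state_solution G 0 u (\<lambda>_ _. 0) X" and coercive: "coercivity1 G"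
  shows "ess_bounded (invE1 G)"
proof -
  note EB = ess_bounded_coefficients
  obtain C where C: "C \<ge> 0" "\<And>a a' u X t. a < a' \<Longrightarrow> u \<in> L2F G \<Longrightarrow> (\<And>t \<omega>. t \<notin> {a..a'} \<Longrightarrow> u t \<omega> = 0) \<Longrightarrow>
    state_solution G 0 u (\<lambda>_ _. 0) X \<Longrightarrow> t \<in> {t0 G..t1 G} \<Longrightarrow>
    expectation (\<lambda>\<omega>. (norm (X t \<omega>))\<^sup>2) \<le> C * (a' - a) * (\<integral>p. (norm (u (fst p) (snd p)))\<^sup>2 \<partial>N)"
    by (rule state_solution_estimate) blast
  obtain \<epsilon> where \<epsilon>: "\<epsilon> > 0" "\<And>u X. u \<in> L2F G \<Longrightarrow> state_solution G 0 u (\<lambda>_ _. 0) X \<Longrightarrow>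
        quadratic_cost G (cD1 G) (cE1 G) (cG1 G) X u \<ge> \<epsilon> * L2_inner (Om G) (t0 G) (t1 G) u u"
    using coercive unfolding coercivity1_def by blast
  have "terminal_coeff G (cG1 G)" using game by (simp add: lq_game_def)
  then have "AE p in N. \<forall>x. \<epsilon> / 2 * (norm x)\<^sup>2 \<le> (cE1 G (fst p) (snd p) *v x) \<bullet> x"
  proof (rule coercive_cost_positive_definite[OF EB(5,7) _ \<epsilon>(1) C(1)])
    fix a a' :: real and u :: "('w, 'm) control"
    assume a: "a < a'" and u: "u \<in> L2F G" and supp: "\<And>t \<omega>. t \<notin> {a..a'} \<Longrightarrow> u t \<omega> = 0"
    obtain X where X: "state_solution G 0 u (\<lambda>_ _. 0) X" using sol[OF u] by blast
    show "\<exists>X\<in>L2C G. (\<forall>t\<in>{t0 G..t1 G}. expectation (\<lambda>\<omega>. (norm (X t \<omega>))\<^sup>2) \<le> C * (a' - a) * (\<integral>p. (norm (u (fst p) (snd p)))\<^sup>2 \<partial>N)) \<and>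
        \<epsilon> * L2_inner (Om G) (t0 G) (t1 G) u u \<le> quadratic_cost G (cD1 G) (cE1 G) (cG1 G) X u"
    proof (intro bexI[of _ X] conjI ballI)
      show "X \<in> L2C G" using X by (simp add: state_solution_def)
      show "\<epsilon> * L2_inner (Om G) (t0 G) (t1 G) u u \<le> quadratic_cost G (cD1 G) (cE1 G) (cG1 G) X u" by (rule \<epsilon>(2)[OF u X])
    qed (rule C(2)[OF a u supp X])
  qed
  then show ?thesis
    using EB(7) \<epsilon>(1) by (intro ess_bounded_matrix_inv[where \<epsilon>="\<epsilon> / 2"] invertible_E) (auto simp: ess_bounded_def)
qed

end


section \<open>Block matrices and the follower's system\<close>

definition upper :: "'x^('p::finite + 'q::finite) \<Rightarrow> 'x^'p" where "upper z = (\<chi> i. z $ Inl i)"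
definition lower :: "'x^('p::finite + 'q::finite) \<Rightarrow> 'x^'q" where "lower z = (\<chi> i. z $ Inr i)"

lemma sum_UNIV_Plus:
  fixes f :: "'p::finite + 'q::finite \<Rightarrow> 'a::comm_monoid_add"
  shows "sum f UNIV = (\<Sum>i\<in>UNIV. f (Inl i)) + (\<Sum>j\<in>UNIV. f (Inr j))"
  by (simp add: UNIV_Plus_UNIV[symmetric] sum.Plus del: UNIV_Plus_UNIV)

lemma upper_vstack [simp]: "upper (vstack a b) = a" and lower_vstack [simp]: "lower (vstack a b) = b"
  by (simp_all add: upper_def lower_def vstack_def vec_eq_iff)

lemma inner_upper_lower:
  fixes x y :: "real^('p::finite + 'q::finite)"
  shows "x \<bullet> y = upper x \<bullet> upper y + lower x \<bullet> lower y"
  by (simp add: inner_vec_def sum_UNIV_Plus upper_def lower_def)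

lemma upper_vstack_mult: "upper (vstack U V *v x) = U *v x" and lower_vstack_mult: "lower (vstack U V *v x) = V *v x"
  by (simp_all add: upper_def lower_def vstack_def matrix_vector_mult_def vec_eq_iff)

lemma hstack_mult: "hstack U V *v z = U *v upper z + V *v lower z"
  for U :: "real^'p::finite^'r::finite" and V :: "real^'q::finite^'r"
  by (simp add: hstack_def vstack_def upper_def lower_def matrix_vector_mult_def vec_eq_iff sum_UNIV_Plus)

lemma upper_block_mult: "upper (block U V U' V' *v z) = U *v upper z + V *v lower z"
  and lower_block_mult: "lower (block U V U' V' *v z) = U' *v upper z + V' *v lower z"
  for U :: "real^'p::finite^'r::finite" and V :: "real^'q::finite^'r" and U' :: "real^'p^'k::finite"
  by (simp_all add: block_def upper_vstack_mult lower_vstack_mult hstack_mult)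

lemma transpose_block:
  "transpose (block U V U' V') = block (transpose U) (transpose U') (transpose V) (transpose V')"
  for U :: "real^'p::finite^'r::finite" and V :: "real^'q::finite^'r" and U' :: "real^'p^'k::finite"
  by (auto simp: vec_eq_iff transpose_def block_def hstack_def vstack_def split: sum.splits)

lemma bounded_linear_upper: "bounded_linear (upper :: real^('p::finite + 'q::finite) \<Rightarrow> real^'p)"
  and bounded_linear_lower: "bounded_linear (lower :: real^('p::finite + 'q::finite) \<Rightarrow> real^'q)"
  unfolding linear_conv_bounded_linear[symmetric] by (auto intro!: linearI simp: upper_def lower_def vec_eq_iff)

lemmas upper_simps = bounded_linear.linear[OF bounded_linear_upper, THEN linear_add]
  bounded_linear.linear[OF bounded_linear_upper, THEN linear_diff]
  bounded_linear.linear[OF bounded_linear_upper, THEN linear_neg]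
lemmas lower_simps = bounded_linear.linear[OF bounded_linear_lower, THEN linear_add]
  bounded_linear.linear[OF bounded_linear_lower, THEN linear_diff]
  bounded_linear.linear[OF bounded_linear_lower, THEN linear_neg]

lemma inner_matrix_adjoint: "(A *v x) \<bullet> y = x \<bullet> (transpose A *v y)" for A :: "real^'n::finite^'m::finite"
  by (metis dot_lmul_matrix transpose_matrix_vector inner_commute vector_transpose_matrix transpose_transpose)

lemma transpose_diff: "transpose (A - B) = transpose A - transpose B" for A B :: "real^'n^'m"
  by (simp add: transpose_def vec_eq_iff)

lemma transpose_matrix_inv:
  fixes A :: "real^'n^'n"
  assumes "transpose A = A" "invertible A"
  shows "transpose (matrix_inv A) = matrix_inv A"
proof -
  have "transpose (matrix_inv A) ** A = mat 1"
    using invertible_matrix_inv_right(1)[OF assms(2)] assms(1) by (metis matrix_transpose_mul transpose_mat)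
  then have "transpose (matrix_inv A) ** A ** matrix_inv A = matrix_inv A" by simp
  then show ?thesis using invertible_matrix_inv_right(1)[OF assms(2)] by (simp add: matrix_mul_assoc[symmetric])
qed

text \<open>The feedback formula for the control holds almost everywhere only. Inserting it changes
  a drift on a null set of \<open>N\<close>, hence on almost every path only on a null set of
  times.\<close>

lemma (in brownian_interval) ito_differential_cong_drift:
  fixes b b' :: "('w, 'a::euclidean_space) process"
  assumes X: "ito_differential M W s T X b \<sigma>" and b: "b \<in> L2_process M W s T" "b' \<in> L2_process M W s T"
    and eq: "AE p in N. b (fst p) (snd p) = b' (fst p) (snd p)"
  shows "ito_differential M W s T X b' \<sigma>"
proof -
  obtain I where I: "ito_integral M W s T \<sigma> I" and ae: "AE \<omega> in M. set_integrable lborel {s..T} (\<lambda>t. b t \<omega>) \<and>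
           (\<forall>t\<in>{s..T}. X t \<omega> = X s \<omega> + (LBINT r:{s..t}. b r \<omega>) + I t \<omega>)"
    using X unfolding ito_differential_def by blast
  have "process_eq M s T b b'" using b eq by (simp add: process_eq_iff L2_process_iff)
  then have e: "AE \<omega> in M. AE t in lborel. t \<in> {s..T} \<longrightarrow> b t \<omega> = b' t \<omega>" unfolding process_eq_def .
  have sec: "AE \<omega> in M. sq_integrable TI (\<lambda>r. b r \<omega>)" "AE \<omega> in M. sq_integrable TI (\<lambda>r. b' r \<omega>)"
    using b sq_integrable_sections(1) by (auto simp: L2_process_iff)
  have "AE \<omega> in M. set_integrable lborel {s..T} (\<lambda>t. b' t \<omega>) \<and>
           (\<forall>t\<in>{s..T}. X t \<omega> = X s \<omega> + (LBINT r:{s..t}. b' r \<omega>) + I t \<omega>)"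
    using ae e sec
  proof eventually_elim
    case (elim \<omega>)
    note path = bspec[OF conjunct2[OF elim(1)]]
    have m: "(\<lambda>r. b r \<omega>) \<in> borel_measurable TI" "(\<lambda>r. b' r \<omega>) \<in> borel_measurable TI"
      using elim(3,4) by (auto simp: sq_integrable_def)
    have aeTI: "AE r in TI. b r \<omega> = b' r \<omega>" using elim(2) by (subst AE_restrict_space_iff) auto
    have eqn: "(LBINT r:{s..t}. b r \<omega>) = (LBINT r:{s..t}. b' r \<omega>)" if "t \<in> {s..T}" for t
    proof -
      have tT: "t \<le> T" using that by simp
      show ?thesis
        unfolding LBINT_subinterval[OF tT]
      proof (rule integral_cong_AE)
        show "AE r in TI. (if r \<le> t then b r \<omega> else 0) = (if r \<le> t then b' r \<omega> else 0)"
          using aeTI by eventually_elim simp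
      qed (use m in \<open>auto intro!: measurable_If\<close>)
    qed
    have "X t \<omega> = X s \<omega> + (LBINT r:{s..t}. b' r \<omega>) + I t \<omega>" if "t \<in> {s..T}" for t
      by (rule trans[OF path[OF that]]) (simp only: eqn[OF that])
    moreover have "set_integrable lborel {s..T} (\<lambda>t. b' t \<omega>)"
      unfolding set_integrable_interval by (rule time.sq_integrable_integrable[OF elim(4)])
    ultimately show ?case by blast
  qed
  then show ?thesis unfolding ito_differential_def using I by blast
qed

section \<open>Bounds for the follower's response\<close>

locale leader_problem = lq G for G :: "('w, 'n::finite, 'm::finite, 'l::finite) game" +
  fixes X :: "('w, 'n, 'm) state_map"
    and u1s :: "('w, 'm) control \<Rightarrow> ('w, 'm) control"
    and \<psi>1 \<psi>1' :: "('w, 'm) control \<Rightarrow> ('w, real^'n) process"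
    and \<phi>1 \<phi>1' :: "('w, real^'n^'n) process"
  assumes state: "\<And>u1 u2. u1 \<in> L2F G \<Longrightarrow> u2 \<in> L2F G \<Longrightarrow> state_solution G (xi G) u1 u2 (X u1 u2)"
    and coercivity1: "coercivity1 G"
    and phi1: "riccati1 G \<phi>1 \<phi>1'"
    and response: "follower_response G X \<phi>1 u1s \<psi>1 \<psi>1'"
    and coercivity2: "coercivity2 G \<phi>1"
begin

lemma ess_bounded_phi1: "ess_bounded \<phi>1"
  using phi1 by (auto simp: riccati1_def intro: ess_bounded_Linf)

lemma ess_bounded_inv_E1: "ess_bounded (invE1 G)"
proof (rule ess_bounded_invE1[OF _ coercivity1])
  fix u :: "('w, 'm) control" assume u: "u \<in> L2F G"
  \<comment> \<open>Subtracting the state for zero controls leaves a solution that starts at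
    zero.\<close>
  have "state_solution G (xi G - xi G) (\<lambda>t \<omega>. u t \<omega> - 0) (\<lambda>t \<omega>. 0 - 0) (\<lambda>t \<omega>. X u (\<lambda>_ _. 0) t \<omega> - X (\<lambda>_ _. 0) (\<lambda>_ _. 0) t \<omega>)"
    by (intro state_solution_diff state u L2_process_zero)
  then show "\<exists>Y. state_solution G 0 u (\<lambda>_ _. 0) Y" by auto
qed

lemma ess_bounded_S1: "ess_bounded (S1 G)"
  unfolding S1_def[abs_def]
  by (intro ess_bounded_matrix_mult ess_bounded_transpose ess_bounded_coefficients ess_bounded_inv_E1)

text \<open>The backward equation does not contain the state, so it is estimated first. In the
  forward equation \<open>S1 \<psi>\<close> acts on the whole horizon but is already of order
  \<open>a' - a\<close> in mean square; only \<open>cB2 u\<close> is localized. The support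
  condition is restricted to the horizon, so that it is void for \<open>a = t0 G\<close> and
  \<open>a' = t1 G\<close>.\<close>

lemma follower_estimate:
  obtains C where "C \<ge> 0" "\<And>a a' u Y \<psi> \<psi>' t. a < a' \<Longrightarrow> u \<in> L2F G \<Longrightarrow>
    (\<And>t \<omega>. t \<in> {t0 G..t1 G} \<Longrightarrow> t \<notin> {a..a'} \<Longrightarrow> u t \<omega> = 0) \<Longrightarrow>
    follower_system G \<phi>1 0 u Y \<psi> \<psi>' \<Longrightarrow> t \<in> {t0 G..t1 G} \<Longrightarrow>
    expectation (\<lambda>\<omega>. (norm (Y t \<omega>))\<^sup>2) \<le> C * (a' - a) * (\<integral>p. (norm (u (fst p) (snd p)))\<^sup>2 \<partial>N) \<and>
    expectation (\<lambda>\<omega>. (norm (\<psi> t \<omega>))\<^sup>2) \<le> C * (a' - a) * (\<integral>p. (norm (u (fst p) (snd p)))\<^sup>2 \<partial>N)"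
proof -
  note EB = ess_bounded_coefficients
  have EF: "ess_bounded (\<lambda>t \<omega>. cA G t \<omega> - S1 G t \<omega> ** \<phi>1 t \<omega>)"
    by (intro ess_bounded_diff ess_bounded_matrix_mult EB ess_bounded_S1 ess_bounded_phi1)
  have EF': "ess_bounded (\<lambda>t \<omega>. transpose (cA G t \<omega>) - \<phi>1 t \<omega> ** S1 G t \<omega>)"
    by (intro ess_bounded_diff ess_bounded_matrix_mult ess_bounded_transpose EB ess_bounded_S1 ess_bounded_phi1)
  have EC': "ess_bounded (\<lambda>t \<omega>. transpose (cC G t \<omega>))" by (intro ess_bounded_transpose EB)
  have EPB: "ess_bounded (\<lambda>t \<omega>. \<phi>1 t \<omega> ** cB2 G t \<omega>)" by (intro ess_bounded_matrix_mult EB ess_bounded_phi1)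
  obtain KF where KF: "KF \<ge> 0" "AE p in N. \<forall>x. norm ((cA G (fst p) (snd p) - S1 G (fst p) (snd p) ** \<phi>1 (fst p) (snd p)) *v x) \<le> KF * norm x"
    by (rule ess_bounded_operator_bound[OF EF]) blast
  obtain KF' where KF': "KF' \<ge> 0" "AE p in N. \<forall>x. norm ((transpose (cA G (fst p) (snd p)) - \<phi>1 (fst p) (snd p) ** S1 G (fst p) (snd p)) *v x) \<le> KF' * norm x"
    by (rule ess_bounded_operator_bound[OF EF']) blast
  obtain KC where KC: "KC \<ge> 0" "AE p in N. \<forall>x. norm (cC G (fst p) (snd p) *v x) \<le> KC * norm x"
    by (rule ess_bounded_operator_bound[OF EB(2)]) blast
  obtain KC' where KC': "KC' \<ge> 0" "AE p in N. \<forall>x. norm (transpose (cC G (fst p) (snd p)) *v x) \<le> KC' * norm x"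
    by (rule ess_bounded_operator_bound[OF EC']) blast
  obtain KB where KB: "KB \<ge> 0" "AE p in N. \<forall>x. norm (cB2 G (fst p) (snd p) *v x) \<le> KB * norm x"
    by (rule ess_bounded_operator_bound[OF EB(4)]) blast
  obtain KP where KP: "KP \<ge> 0" "AE p in N. \<forall>x. norm ((\<phi>1 (fst p) (snd p) ** cB2 G (fst p) (snd p)) *v x) \<le> KP * norm x"
    by (rule ess_bounded_operator_bound[OF EPB]) blast
  obtain KS where KS: "KS \<ge> 0" "AE p in N. \<forall>x. norm (S1 G (fst p) (snd p) *v x) \<le> KS * norm x"
    by (rule ess_bounded_operator_bound[OF ess_bounded_S1]) blast
  define K where "K = KF + KF' + KC + KC'"
  define E where "E = 2 * exp (4 * (2 * K + K\<^sup>2 + 1) * (t1 G - t0 G))"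
  have K: "K \<ge> 0" "KF \<le> K" "KF' \<le> K" "KC \<le> K" "KC' \<le> K" using KF KF' KC KC' by (auto simp: K_def)
  have E0: "E \<ge> 0" by (simp add: E_def)
  define C1 where "C1 = E * (4 * KP\<^sup>2)"
  \<comment> \<open>The first summand stems from the forcing by \<open>\<psi>\<close>, integrated
    over the horizon, the second from the localized control.\<close>
  define C2 where "C2 = E * (KS\<^sup>2 * ((t1 G - t0 G) * C1) + 4 * KB\<^sup>2)"
  have C: "C1 \<ge> 0" "C2 \<ge> 0" using E0 s_less_T by (auto simp: C1_def C2_def)
  have up: "y \<le> L * z \<Longrightarrow> L \<le> K \<Longrightarrow> 0 \<le> z \<Longrightarrow> y \<le> K * z" for y L z :: real
    by (meson mult_right_mono order_trans)
  show ?thesis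
  proof (rule that[of "max C1 C2"])
    show "0 \<le> max C1 C2" using C by simp
    fix a a' :: real and u :: "('w, 'm) control" and Y \<psi> \<psi>' :: "('w, real^'n) process" and t
    assume a: "a < a'" and u: "u \<in> L2F G" and supp: "\<And>t \<omega>. t \<in> {t0 G..t1 G} \<Longrightarrow> t \<notin> {a..a'} \<Longrightarrow> u t \<omega> = 0"
      and sol: "follower_system G \<phi>1 0 u Y \<psi> \<psi>'" and t: "t \<in> {t0 G..t1 G}"
    let ?n = "\<integral>p. (norm (u (fst p) (snd p)))\<^sup>2 \<partial>N"
    let ?bY = "\<lambda>t \<omega>. (cA G t \<omega> - S1 G t \<omega> ** \<phi>1 t \<omega>) *v Y t \<omega> - S1 G t \<omega> *v \<psi> t \<omega> + cB2 G t \<omega> *v u t \<omega>"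
    let ?b\<psi> = "\<lambda>t \<omega>. - ((transpose (cA G t \<omega>) - \<phi>1 t \<omega> ** S1 G t \<omega>) *v \<psi> t \<omega>
                + transpose (cC G t \<omega>) *v \<psi>' t \<omega> + \<phi>1 t \<omega> *v (cB2 G t \<omega> *v u t \<omega>))"
    have S: "Y \<in> L2C G" "\<psi> \<in> L2C G" "\<psi>' \<in> L2F G" "AE \<omega> in Om G. Y (t0 G) \<omega> = 0" "AE \<omega> in Om G. \<psi> (t1 G) \<omega> = 0"
      "itod G Y ?bY (\<lambda>t \<omega>. cC G t \<omega> *v Y t \<omega>)" "itod G \<psi> ?b\<psi> \<psi>'"
      using sol by (auto simp: follower_system_def)
    have bY: "?bY \<in> L2F G"
      by (intro L2_process_add L2_process_diff L2_process_matrix_vector_mult EF ess_bounded_S1 EB u L2_continuous_L2_process S)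
    have b\<psi>: "?b\<psi> \<in> L2F G"
      by (intro L2_process_uminus L2_process_add L2_process_matrix_vector_mult EF' EC' ess_bounded_phi1 EB u S L2_continuous_L2_process)
    have PB: "sq_integrable N (\<lambda>p. (\<phi>1 (fst p) (snd p) ** cB2 G (fst p) (snd p)) *v u (fst p) (snd p))"
      by (intro L2F_N[of "\<lambda>t \<omega>. (\<phi>1 t \<omega> ** cB2 G t \<omega>) *v u t \<omega>"] L2_process_matrix_vector_mult EPB u)
    have Bu: "sq_integrable N (\<lambda>p. cB2 G (fst p) (snd p) *v u (fst p) (snd p))"
      by (intro L2F_N L2_process_matrix_vector_mult EB u)
    have S\<psi>: "sq_integrable N (\<lambda>p. S1 G (fst p) (snd p) *v \<psi> (fst p) (snd p))"
      by (intro L2F_N L2_process_matrix_vector_mult ess_bounded_S1 S L2_continuous_L2_process)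
    have \<psi>_bound: "expectation (\<lambda>\<omega>. (norm (\<psi> t \<omega>))\<^sup>2) \<le> C1 * (a' - a) * ?n" if t: "t \<in> {t0 G..t1 G}" for t
    proof -
      have "expectation (\<lambda>\<omega>. (norm (\<psi> t \<omega>))\<^sup>2) \<le> E * (4 * (a' - a) *
         (\<integral>p. (norm ((\<phi>1 (fst p) (snd p) ** cB2 G (fst p) (snd p)) *v u (fst p) (snd p)))\<^sup>2 \<partial>N))"
        unfolding E_def
      proof (rule bsde_estimate[where ?f2.0="\<lambda>t \<omega>. (\<phi>1 t \<omega> ** cB2 G t \<omega>) *v u t \<omega>" and a=a and a'=a', OF S(2,7) b\<psi> S(5) PB _ K(1)])
        show "AE p in N. norm (?b\<psi> (fst p) (snd p)) \<le> K * norm (\<psi> (fst p) (snd p)) + K * norm (\<psi>' (fst p) (snd p))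
          + norm ((\<phi>1 (fst p) (snd p) ** cB2 G (fst p) (snd p)) *v u (fst p) (snd p))"
          using KF'(2) KC'(2)
        proof eventually_elim
          case (elim p)
          have 1: "norm ((transpose (cA G (fst p) (snd p)) - \<phi>1 (fst p) (snd p) ** S1 G (fst p) (snd p)) *v \<psi> (fst p) (snd p)) \<le> K * norm (\<psi> (fst p) (snd p))"
            by (rule up[OF elim(1)[rule_format] K(3)]) simp
          have 2: "norm (transpose (cC G (fst p) (snd p)) *v \<psi>' (fst p) (snd p)) \<le> K * norm (\<psi>' (fst p) (snd p))"
            by (rule up[OF elim(2)[rule_format] K(5)]) simp
          show ?case
            unfolding norm_minus_cancel matrix_vector_mul_assoc[symmetric]
            by (intro norm_triangle_le add_mono 1 2 order_refl)
        qed
      qed (use a supp t in auto)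
      also have "\<dots> \<le> E * (4 * (a' - a) * (KP\<^sup>2 * ?n))"
        using integral_norm_operator_le[OF KP(1) _ L2F_N[OF u], of "\<lambda>t \<omega>. \<phi>1 t \<omega> ** cB2 G t \<omega>"] KP(2) a E0
        by (intro mult_left_mono) auto
      finally show ?thesis unfolding C1_def by (simp only: mult_ac)
    qed
    have "expectation (\<lambda>\<omega>. (norm (Y t \<omega>))\<^sup>2) \<le> E * ((\<integral>p. (norm (S1 G (fst p) (snd p) *v \<psi> (fst p) (snd p)))\<^sup>2 \<partial>N)
       + 4 * (a' - a) * (\<integral>p. (norm (cB2 G (fst p) (snd p) *v u (fst p) (snd p)))\<^sup>2 \<partial>N))"
      unfolding E_def
    proof (rule sde_estimate[where ?f1.0="\<lambda>t \<omega>. S1 G t \<omega> *v \<psi> t \<omega>" and ?f2.0="\<lambda>t \<omega>. cB2 G t \<omega> *v u t \<omega>" and a=a and a'=a', OF S(1,6) bY S(4) S\<psi> Bu _ K(1)])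
      show "AE p in N. norm (?bY (fst p) (snd p)) \<le> K * norm (Y (fst p) (snd p)) + norm (S1 G (fst p) (snd p) *v \<psi> (fst p) (snd p))
         + norm (cB2 G (fst p) (snd p) *v u (fst p) (snd p))"
        using KF(2)
      proof eventually_elim
        case (elim p)
        have 1: "norm ((cA G (fst p) (snd p) - S1 G (fst p) (snd p) ** \<phi>1 (fst p) (snd p)) *v Y (fst p) (snd p)) \<le> K * norm (Y (fst p) (snd p))"
          by (rule up[OF elim[rule_format] K(2)]) simp
        show ?case
          by (intro norm_triangle_le order_trans[OF norm_triangle_ineq4] add_mono 1 order_refl)
      qed
      show "AE p in N. norm (cC G (fst p) (snd p) *v Y (fst p) (snd p)) \<le> K * norm (Y (fst p) (snd p))"
        using KC(2)
      proof eventually_elim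
        case (elim p)
        show ?case by (rule up[OF elim[rule_format] K(4)]) simp
      qed
    qed (use a supp t in auto)
    also have "\<dots> \<le> E * (KS\<^sup>2 * ((t1 G - t0 G) * (C1 * (a' - a) * ?n)) + 4 * (a' - a) * (KB\<^sup>2 * ?n))"
    proof (intro mult_left_mono add_mono E0)
      have "(\<integral>p. (norm (S1 G (fst p) (snd p) *v \<psi> (fst p) (snd p)))\<^sup>2 \<partial>N) \<le> KS\<^sup>2 * (\<integral>p. (norm (\<psi> (fst p) (snd p)))\<^sup>2 \<partial>N)"
        by (rule integral_norm_operator_le[OF KS L2C_N[OF S(2)]])
      also have "\<dots> \<le> KS\<^sup>2 * ((t1 G - t0 G) * (C1 * (a' - a) * ?n))"
        by (intro mult_left_mono integral_norm_le_time[OF S(2)] \<psi>_bound) auto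
      finally show "(\<integral>p. (norm (S1 G (fst p) (snd p) *v \<psi> (fst p) (snd p)))\<^sup>2 \<partial>N) \<le> KS\<^sup>2 * ((t1 G - t0 G) * (C1 * (a' - a) * ?n))" .
      show "(\<integral>p. (norm (cB2 G (fst p) (snd p) *v u (fst p) (snd p)))\<^sup>2 \<partial>N) \<le> KB\<^sup>2 * ?n"
        by (rule integral_norm_operator_le[OF KB L2F_N[OF u]])
    qed (use a in auto)
    also have "\<dots> = C2 * (a' - a) * ?n"
    proof -
      have "E * (k * (d * (C1 * e * n)) + 4 * e * (l * n)) = E * (k * (d * C1) + 4 * l) * e * n" for k d e l n :: real
        by (simp add: algebra_simps)
      then show ?thesis unfolding C2_def .
    qed
    finally have Y_bound: "expectation (\<lambda>\<omega>. (norm (Y t \<omega>))\<^sup>2) \<le> C2 * (a' - a) * ?n" .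
    have mx: "D * (a' - a) * ?n \<le> max C1 C2 * (a' - a) * ?n" if "D \<le> max C1 C2" for D
      using that a by (intro mult_right_mono) auto
    show "expectation (\<lambda>\<omega>. (norm (Y t \<omega>))\<^sup>2) \<le> max C1 C2 * (a' - a) * ?n \<and>
      expectation (\<lambda>\<omega>. (norm (\<psi> t \<omega>))\<^sup>2) \<le> max C1 C2 * (a' - a) * ?n"
      using order_trans[OF Y_bound mx[of C2]] order_trans[OF \<psi>_bound[OF t] mx[of C1]] by simp
  qed
qed

lemma responseD:
  assumes "u \<in> L2F G"
  shows "u1s u \<in> L2F G" "follower_system G \<phi>1 (xi G) u (X (u1s u) u) (\<psi>1 u) (\<psi>1' u)"
    "process_eq (Om G) (t0 G) (t1 G) (u1s u) (\<lambda>t \<omega>. - ((invE1 G t \<omega> ** transpose (cB1 G t \<omega>)) *v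
                      (\<phi>1 t \<omega> *v X (u1s u) u t \<omega> + \<psi>1 u t \<omega>)))"
  using response assms by (auto simp: follower_response_def follower_optimal_def)

lemma ess_bounded_inv_E2: "ess_bounded (invE2 G)"
proof -
  note EB = ess_bounded_coefficients
  obtain C where C: "C \<ge> 0" "\<And>a a' u Y \<psi> \<psi>' t. a < a' \<Longrightarrow> u \<in> L2F G \<Longrightarrow>
    (\<And>t \<omega>. t \<in> {t0 G..t1 G} \<Longrightarrow> t \<notin> {a..a'} \<Longrightarrow> u t \<omega> = 0) \<Longrightarrow>
    follower_system G \<phi>1 0 u Y \<psi> \<psi>' \<Longrightarrow> t \<in> {t0 G..t1 G} \<Longrightarrow>
    expectation (\<lambda>\<omega>. (norm (Y t \<omega>))\<^sup>2) \<le> C * (a' - a) * (\<integral>p. (norm (u (fst p) (snd p)))\<^sup>2 \<partial>N) \<and>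
    expectation (\<lambda>\<omega>. (norm (\<psi> t \<omega>))\<^sup>2) \<le> C * (a' - a) * (\<integral>p. (norm (u (fst p) (snd p)))\<^sup>2 \<partial>N)"
    by (rule follower_estimate) blast
  obtain \<epsilon> where \<epsilon>: "\<epsilon> > 0" "\<And>u Y \<psi> \<psi>'. u \<in> L2F G \<Longrightarrow> follower_system G \<phi>1 0 u Y \<psi> \<psi>' \<Longrightarrow>
        quadratic_cost G (cD2 G) (cE2 G) (cG2 G) Y u \<ge> \<epsilon> * L2_inner (Om G) (t0 G) (t1 G) u u"
    using coercivity2 unfolding coercivity2_def by blast
  have "terminal_coeff G (cG2 G)" using game by (simp add: lq_game_def)
  then have "AE p in N. \<forall>x. \<epsilon> / 2 * (norm x)\<^sup>2 \<le> (cE2 G (fst p) (snd p) *v x) \<bullet> x"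
  proof (rule coercive_cost_positive_definite[OF EB(6,8) _ \<epsilon>(1) C(1)])
    fix a a' :: real and u :: "('w, 'm) control"
    assume a: "a < a'" and u: "u \<in> L2F G" and supp: "\<And>t \<omega>. t \<notin> {a..a'} \<Longrightarrow> u t \<omega> = 0"
    \<comment> \<open>The responses to \<open>u\<close> and to the zero control differ by a solution
      with initial value zero.\<close>
    have "follower_system G \<phi>1 (xi G - xi G) (\<lambda>t \<omega>. u t \<omega> - 0)
      (\<lambda>t \<omega>. X (u1s u) u t \<omega> - X (u1s (\<lambda>_ _. 0)) (\<lambda>_ _. 0) t \<omega>) (\<lambda>t \<omega>. \<psi>1 u t \<omega> - \<psi>1 (\<lambda>_ _. 0) t \<omega>)
      (\<lambda>t \<omega>. \<psi>1' u t \<omega> - \<psi>1' (\<lambda>_ _. 0) t \<omega>)"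
      by (intro follower_system_diff responseD u L2_process_zero)
    then obtain Y \<psi> \<psi>' where Y: "follower_system G \<phi>1 0 u Y \<psi> \<psi>'" by auto
    show "\<exists>Y\<in>L2C G. (\<forall>t\<in>{t0 G..t1 G}. expectation (\<lambda>\<omega>. (norm (Y t \<omega>))\<^sup>2) \<le> C * (a' - a) * (\<integral>p. (norm (u (fst p) (snd p)))\<^sup>2 \<partial>N)) \<and>
        \<epsilon> * L2_inner (Om G) (t0 G) (t1 G) u u \<le> quadratic_cost G (cD2 G) (cE2 G) (cG2 G) Y u"
    proof (intro bexI[of _ Y] conjI ballI)
      show "Y \<in> L2C G" using Y by (simp add: follower_system_def)
      show "\<epsilon> * L2_inner (Om G) (t0 G) (t1 G) u u \<le> quadratic_cost G (cD2 G) (cE2 G) (cG2 G) Y u" by (rule \<epsilon>(2)[OF u Y])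
    qed (use C(2)[OF a u supp Y] in blast)
  qed
  then show ?thesis
    using EB(8) \<epsilon>(1) by (intro ess_bounded_matrix_inv[where \<epsilon>="\<epsilon> / 2"] invertible_E) (auto simp: ess_bounded_def)
qed

lemma ess_bounded_S2: "ess_bounded (S2 G)"
  unfolding S2_def[abs_def]
  by (intro ess_bounded_matrix_mult ess_bounded_transpose ess_bounded_coefficients ess_bounded_inv_E2)

end


section \<open>Constraints and duality densities\<close>

lemma transpose_zero [simp]: "transpose (0 :: real^'n^'m) = 0"
  by (simp add: transpose_def vec_eq_iff)

lemma matrix_vector_mult_uminus: "(- A) *v x = - (A *v x)" for A :: "real^'n^'m"
  by (simp add: matrix_vector_mult_def vec_eq_iff sum_negf)

lemma inner_transpose_matrix: "(transpose A *v x) \<bullet> y = (A *v y) \<bullet> x" for A :: "real^'n^'m"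
  unfolding inner_matrix_adjoint[of A] by (rule inner_commute)

lemma bounded_linear_matrix_apply: "bounded_linear (\<lambda>A :: real^'n^'m. A *v x)"
  using bounded_bilinear.bounded_linear_left[OF bounded_bilinear_matrix_vector_mult] .

text \<open>Products of two square integrable matrix processes are in general no more than
  integrable; this suffices for the vector-valued \<open>\<rho>\<close> and the matrix-valued
  \<open>S0\<close>.\<close>

lemma integrable_bounded_bilinear:
  fixes f :: "'x \<Rightarrow> 'a::euclidean_space" and g :: "'x \<Rightarrow> 'b::euclidean_space" and F :: "'a \<Rightarrow> 'b \<Rightarrow> 'c::euclidean_space"
  assumes F: "bounded_bilinear F" and f: "sq_integrable M f" and g: "sq_integrable M g"
  shows "integrable M (\<lambda>x. F (f x) (g x))"
proof -
  obtain C where C: "C > 0" "\<And>x y. norm (F x y) \<le> norm x * norm y * C" using bounded_bilinear.pos_bounded[OF F] by blast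
  have "integrable M (\<lambda>x. norm (f x) \<bullet> norm (g x))"
    by (intro integrable_inner sq_integrable_norm_real f g)
  then have "integrable M (\<lambda>x. norm (f x) * norm (g x) * C)" by simp
  then show ?thesis
  proof (rule Bochner_Integration.integrable_bound)
    show "(\<lambda>x. F (f x) (g x)) \<in> borel_measurable M"
      by (rule borel_measurable_continuous_Pair[OF sq_integrable_measurable[OF f] sq_integrable_measurable[OF g]])
         (intro bounded_bilinear.continuous_on[OF F] continuous_intros)
    show "AE x in M. norm (F (f x) (g x)) \<le> norm (norm (f x) * norm (g x) * C)"
      using C by (intro AE_I2) auto
  qed
qed

section \<open>Null controls and the constraint functional\<close>

context leader_problem
begin

lemma AE_zero_of_second_moment:
  fixes Y :: "('w, real^'k) process"
  assumes Y: "Y \<in> L2C G" and zero: "\<And>t. t \<in> {t0 G..t1 G} \<Longrightarrow> expectation (\<lambda>\<omega>. (norm (Y t \<omega>))\<^sup>2) \<le> 0"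
  shows "AE p in N. Y (fst p) (snd p) = 0" and "AE \<omega> in Om G. Y (t1 G) \<omega> = 0"
proof -
  have "(\<integral>p. (norm (Y (fst p) (snd p)))\<^sup>2 \<partial>N) \<le> (t1 G - t0 G) * 0"
    by (rule integral_norm_le_time[OF Y zero])
  moreover have "0 \<le> (\<integral>p. (norm (Y (fst p) (snd p)))\<^sup>2 \<partial>N)" by simp
  ultimately have "(\<integral>p. (norm (Y (fst p) (snd p)))\<^sup>2 \<partial>N) = 0" by simp
  then show "AE p in N. Y (fst p) (snd p) = 0"
    using sq_integrable_norm[OF L2C_N[OF Y]] by (subst (asm) integral_nonneg_eq_0_iff_AE) auto
  have "0 \<le> expectation (\<lambda>\<omega>. (norm (Y (t1 G) \<omega>))\<^sup>2)" by simp
  with zero[OF t1_mem] have "expectation (\<lambda>\<omega>. (norm (Y (t1 G) \<omega>))\<^sup>2) = 0" by simp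
  then show "AE \<omega> in Om G. Y (t1 G) \<omega> = 0"
    using sq_integrable_norm[OF L2_continuous_sq_integrable[OF Y t1_mem]] by (subst (asm) integral_nonneg_eq_0_iff_AE) auto
qed

text \<open>Uniqueness for the follower's system: applied to a difference of solutions, it shows
  that controls equal almost everywhere have the same response. It is the estimate on the full
  horizon with vanishing right-hand side.\<close>

lemma follower_system_zero:
  assumes sol: "follower_system G \<phi>1 0 w Y \<eta> \<eta>'" and w: "w \<in> L2F G" "AE p in N. w (fst p) (snd p) = 0"
  shows "AE p in N. Y (fst p) (snd p) = 0" "AE \<omega> in Om G. Y (t1 G) \<omega> = 0" "AE p in N. \<eta> (fst p) (snd p) = 0"
proof -
  obtain C where C: "\<And>a a' u Y \<psi> \<psi>' t. a < a' \<Longrightarrow> u \<in> L2F G \<Longrightarrow>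
    (\<And>t \<omega>. t \<in> {t0 G..t1 G} \<Longrightarrow> t \<notin> {a..a'} \<Longrightarrow> u t \<omega> = 0) \<Longrightarrow>
    follower_system G \<phi>1 0 u Y \<psi> \<psi>' \<Longrightarrow> t \<in> {t0 G..t1 G} \<Longrightarrow>
    expectation (\<lambda>\<omega>. (norm (Y t \<omega>))\<^sup>2) \<le> C * (a' - a) * (\<integral>p. (norm (u (fst p) (snd p)))\<^sup>2 \<partial>N) \<and>
    expectation (\<lambda>\<omega>. (norm (\<psi> t \<omega>))\<^sup>2) \<le> C * (a' - a) * (\<integral>p. (norm (u (fst p) (snd p)))\<^sup>2 \<partial>N)"
    by (rule follower_estimate) blast
  have "(\<integral>p. (norm (w (fst p) (snd p)))\<^sup>2 \<partial>N) = 0" using w(2) by (intro integral_eq_zero_AE) auto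
  then have z: "expectation (\<lambda>\<omega>. (norm (Y t \<omega>))\<^sup>2) \<le> 0 \<and> expectation (\<lambda>\<omega>. (norm (\<eta> t \<omega>))\<^sup>2) \<le> 0" if "t \<in> {t0 G..t1 G}" for t
    using C[OF s_less_T w(1) _ sol that] by simp
  have "Y \<in> L2C G" "\<eta> \<in> L2C G" using sol by (auto simp: follower_system_def)
  then show "AE p in N. Y (fst p) (snd p) = 0" "AE \<omega> in Om G. Y (t1 G) \<omega> = 0" "AE p in N. \<eta> (fst p) (snd p) = 0"
    using AE_zero_of_second_moment z by blast+
qed

lemma AE_symmetric:
  "AE p in N. transpose (\<phi>1 (fst p) (snd p)) = \<phi>1 (fst p) (snd p) \<and>
    transpose (S1 G (fst p) (snd p)) = S1 G (fst p) (snd p) \<and> transpose (S2 G (fst p) (snd p)) = S2 G (fst p) (snd p) \<and>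
    transpose (cD2 G (fst p) (snd p)) = cD2 G (fst p) (snd p) \<and> transpose (cE2 G (fst p) (snd p)) = cE2 G (fst p) (snd p) \<and>
    transpose (invE1 G (fst p) (snd p)) = invE1 G (fst p) (snd p) \<and> transpose (invE2 G (fst p) (snd p)) = invE2 G (fst p) (snd p) \<and>
    cE2 G (fst p) (snd p) ** invE2 G (fst p) (snd p) = mat 1"
proof -
  have "AE \<omega> in Om G. \<forall>t\<in>{t0 G..t1 G}. symmetric_matrix (\<phi>1 t \<omega>)"
    using phi1 by (auto simp: riccati1_def symmetric_pair_def)
  from AE_paths_N[OF this] AE_space[of N] show ?thesis
  proof eventually_elim
    case (elim p)
    then have p: "fst p \<in> {t0 G..t1 G}" "snd p \<in> space (Om G)" by (auto simp: space_N)
    have sym: "transpose (cE1 G (fst p) (snd p)) = cE1 G (fst p) (snd p)" "transpose (cE2 G (fst p) (snd p)) = cE2 G (fst p) (snd p)"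
      "transpose (cD2 G (fst p) (snd p)) = cD2 G (fst p) (snd p)"
      using game p by (auto simp: lq_game_def symmetric_coeff_def symmetric_matrix_def)
    note inv = invertible_E[OF p]
    show ?case
      using elim(1) sym transpose_matrix_inv[OF sym(1) inv(1)] transpose_matrix_inv[OF sym(2) inv(2)] invertible_matrix_inv_right(1)[OF inv(2)]
      by (simp add: symmetric_matrix_def S1_def S2_def matrix_transpose_mul matrix_mul_assoc)
  qed
qed

lemma response_AE:
  assumes u: "u \<in> L2F G"
  shows "AE p in N. u1s u (fst p) (snd p) = - ((invE1 G (fst p) (snd p) ** transpose (cB1 G (fst p) (snd p))) *v
      (\<phi>1 (fst p) (snd p) *v X (u1s u) u (fst p) (snd p) + \<psi>1 u (fst p) (snd p)))"
proof -
  note r = responseD[OF u]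
  have L: "X (u1s u) u \<in> L2F G" "\<psi>1 u \<in> L2F G"
    using r(2) by (auto simp: follower_system_def intro: L2_continuous_L2_process)
  have "(\<lambda>t \<omega>. - ((invE1 G t \<omega> ** transpose (cB1 G t \<omega>)) *v (\<phi>1 t \<omega> *v X (u1s u) u t \<omega> + \<psi>1 u t \<omega>))) \<in> L2F G"
    by (intro L2_process_uminus L2_process_matrix_vector_mult L2_process_add ess_bounded_matrix_mult ess_bounded_transpose
        ess_bounded_inv_E1 ess_bounded_coefficients ess_bounded_phi1 L)
  then show ?thesis using r(1,3) by (subst (asm) process_eq_iff) (auto simp: L2_process_iff)
qed

lemma L2F_data:
  "(\<lambda>t \<omega>. c\<alpha> G t \<omega> *v mu) \<in> L2F G" "(\<lambda>t \<omega>. c\<beta> G t \<omega> *v mu) \<in> L2F G" "(\<lambda>t \<omega>. c\<gamma> G t \<omega> *v mu) \<in> L2F G"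
  using game by (auto simp: lq_game_def intro: L2_process_bounded_linear[OF bounded_linear_matrix_apply])

lemma sq_integrable_delta: "sq_integrable (Om G) (c\<delta> G)"
  using game by (auto simp: lq_game_def sq_integrable_iff_nn_integral intro: measurable_filtration_M)

lemma sq_integrable_delta_apply: "sq_integrable (Om G) (\<lambda>\<omega>. c\<delta> G \<omega> *v mu)"
  by (rule sq_integrable_bounded_linear[OF bounded_linear_matrix_apply sq_integrable_delta])

text \<open>The running part of the constraint functional, paired with a vector \<open>mu\<close>.
  State \<open>Y\<close>, follower's control \<open>k\<close> and leader's control \<open>w\<close>
  enter as separate arguments, so that the expression is linear in the triple and applies to
  variations as well.\<close>

definition constraint_density ::
  "real^'l \<Rightarrow> ('w, real^'n) process \<Rightarrow> ('w, real^'m) process \<Rightarrow> ('w, real^'m) process \<Rightarrow> real \<times> 'w \<Rightarrow> real" where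
  "constraint_density mu Y k w p = (c\<alpha> G (fst p) (snd p) *v mu) \<bullet> Y (fst p) (snd p)
     + (c\<beta> G (fst p) (snd p) *v mu) \<bullet> k (fst p) (snd p) + (c\<gamma> G (fst p) (snd p) *v mu) \<bullet> w (fst p) (snd p)"

lemma integrable_constraint_density:
  assumes "Y \<in> L2F G" "k \<in> L2F G" "w \<in> L2F G"
  shows "integrable N (constraint_density mu Y k w)"
  unfolding constraint_density_def
  by (intro Bochner_Integration.integrable_add integrable_inner L2F_N[OF L2F_data(1)] L2F_N[OF L2F_data(2)] L2F_N[OF L2F_data(3)]
      L2F_N[OF assms(1)] L2F_N[OF assms(2)] L2F_N[OF assms(3)])

text \<open>Pairing with a fixed vector turns the vector-valued integrals into scalar ones, which
  the product rule can handle.\<close>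

lemma rho_inner:
  assumes u: "u \<in> L2F G"
  shows "\<rho> G X u1s u \<bullet> mu = (\<integral>p. constraint_density mu (X (u1s u) u) (u1s u) u p \<partial>N)
    + expectation (\<lambda>\<omega>. (c\<delta> G \<omega> *v mu) \<bullet> X (u1s u) u (t1 G) \<omega>)"
proof -
  note r = responseD[OF u]
  let ?X = "X (u1s u) u"
  have X: "?X \<in> L2C G" using r(2) by (simp add: follower_system_def)
  have tr: "sq_integrable N (\<lambda>p. transpose (c\<alpha> G (fst p) (snd p)))" "sq_integrable N (\<lambda>p. transpose (c\<beta> G (fst p) (snd p)))"
    "sq_integrable N (\<lambda>p. transpose (c\<gamma> G (fst p) (snd p)))" "sq_integrable (Om G) (\<lambda>\<omega>. transpose (c\<delta> G \<omega>))"
    using game sq_integrable_delta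
    by (auto simp: lq_game_def L2_process_iff intro: sq_integrable_bounded_linear[OF bounded_linear_transpose])
  note XN = L2C_N[OF X] and XT = L2_continuous_sq_integrable[OF X t1_mem]
  let ?f = "\<lambda>t \<omega>. transpose (c\<alpha> G t \<omega>) *v ?X t \<omega> + transpose (c\<beta> G t \<omega>) *v u1s u t \<omega> + transpose (c\<gamma> G t \<omega>) *v u t \<omega>"
  have i: "integrable N (\<lambda>p. ?f (fst p) (snd p))"
    by (intro Bochner_Integration.integrable_add integrable_bounded_bilinear[OF bounded_bilinear_matrix_vector_mult] tr XN L2F_N[OF r(1)] L2F_N[OF u])
  have iT: "integrable (Om G) (\<lambda>\<omega>. transpose (c\<delta> G \<omega>) *v ?X (t1 G) \<omega>)"
    by (intro integrable_bounded_bilinear[OF bounded_bilinear_matrix_vector_mult] tr XT)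
  have "\<rho> G X u1s u = expectation (\<lambda>\<omega>. LBINT t:{t0 G..t1 G}. ?f t \<omega>) + expectation (\<lambda>\<omega>. transpose (c\<delta> G \<omega>) *v ?X (t1 G) \<omega>)"
    unfolding \<rho>_def by (rule Bochner_Integration.integral_add[OF integral_N(2)[OF i] iT])
  also have "expectation (\<lambda>\<omega>. LBINT t:{t0 G..t1 G}. ?f t \<omega>) = (\<integral>p. ?f (fst p) (snd p) \<partial>N)" by (rule integral_N(1)[OF i])
  finally have "\<rho> G X u1s u \<bullet> mu = (\<integral>p. ?f (fst p) (snd p) \<partial>N) \<bullet> mu + expectation (\<lambda>\<omega>. transpose (c\<delta> G \<omega>) *v ?X (t1 G) \<omega>) \<bullet> mu"
    by (simp add: inner_add_left)
  also have "(\<integral>p. ?f (fst p) (snd p) \<partial>N) \<bullet> mu = (\<integral>p. ?f (fst p) (snd p) \<bullet> mu \<partial>N)"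
    by (rule integral_inner_left[symmetric]) (rule i)
  also have "expectation (\<lambda>\<omega>. transpose (c\<delta> G \<omega>) *v ?X (t1 G) \<omega>) \<bullet> mu = expectation (\<lambda>\<omega>. (transpose (c\<delta> G \<omega>) *v ?X (t1 G) \<omega>) \<bullet> mu)"
    by (rule integral_inner_left[symmetric]) (rule iT)
  also have "(\<lambda>p. ?f (fst p) (snd p) \<bullet> mu) = constraint_density mu ?X (u1s u) u"
    unfolding constraint_density_def inner_add_left inner_transpose_matrix ..
  also have "(\<lambda>\<omega>. (transpose (c\<delta> G \<omega>) *v ?X (t1 G) \<omega>) \<bullet> mu) = (\<lambda>\<omega>. (c\<delta> G \<omega> *v mu) \<bullet> ?X (t1 G) \<omega>)"
    unfolding inner_transpose_matrix ..
  finally show ?thesis .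
qed

end

text \<open>Pointwise content of the two duality pairings: \<open>p1\<close> is paired with the state variation \<open>y\<close>,
  \<open>z2\<close> with the variation \<open>e\<close> of the follower's adjoint.\<close>

lemma duality_density:
  fixes F C S f D :: "real^'n^'n" and B1 B2 :: "real^'m^'n" and I1 E2 :: "real^'m^'m"
    and y e e' z1 z2 p1 q1 al :: "real^'n" and be ga u w :: "real^'m"
  assumes sym: "transpose f = f" "transpose S = S" "transpose I1 = I1"
    and u: "E2 *v u = transpose B2 *v (f *v z2 + p1) - ga"
  shows "(D *v z1) \<bullet> y + (E2 *v u) \<bullet> w
      + (al \<bullet> y + be \<bullet> (- ((I1 ** transpose B1) *v (f *v y + e))) + ga \<bullet> w) =
    (p1 \<bullet> (F *v y - S *v e + B2 *v w)
      + (D *v z1 - transpose F *v p1 - transpose C *v q1 + (al - (f ** B1 ** I1) *v be)) \<bullet> y + q1 \<bullet> (C *v y))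
    - (z2 \<bullet> (- (transpose F *v e + transpose C *v e' + f *v (B2 *v w)))
      + (F *v z2 - S *v p1 + (B1 ** I1) *v be) \<bullet> e + (C *v z2) \<bullet> e')"
proof -
  have "(transpose F *v p1) \<bullet> y = p1 \<bullet> (F *v y)" "(transpose C *v q1) \<bullet> y = q1 \<bullet> (C *v y)"
    "z2 \<bullet> (transpose F *v e) = (F *v z2) \<bullet> e" "z2 \<bullet> (transpose C *v e') = (C *v z2) \<bullet> e'"
    "(S *v p1) \<bullet> e = p1 \<bullet> (S *v e)"
    unfolding inner_matrix_adjoint transpose_transpose sym by simp_all
  moreover have "z2 \<bullet> (f *v (B2 *v w)) = (transpose B2 *v (f *v z2)) \<bullet> w" "p1 \<bullet> (B2 *v w) = (transpose B2 *v p1) \<bullet> w"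
    unfolding inner_matrix_adjoint transpose_transpose sym by simp_all
  moreover have "be \<bullet> ((I1 ** transpose B1) *v x) = ((B1 ** I1) *v be) \<bullet> x" for x
    unfolding inner_matrix_adjoint matrix_transpose_mul sym by simp
  moreover have "((B1 ** I1) *v be) \<bullet> (f *v y) = ((f ** B1 ** I1) *v be) \<bullet> y"
    unfolding inner_matrix_adjoint[of "f ** B1 ** I1"] inner_matrix_adjoint[of "B1 ** I1"] matrix_transpose_mul sym
    by (simp add: matrix_vector_mul_assoc matrix_mul_assoc)
  \<comment> \<open>Replacing \<open>E2 u\<close> produces terms with \<open>transpose B2\<close>
    that match those of \<open>B2 w\<close> in both pairings, and its last term cancels the
    contribution of \<open>ga\<close>.\<close>
  ultimately show ?thesis
    unfolding u
    by (simp add: inner_add_left inner_add_right inner_diff_left inner_diff_right matrix_vector_right_distrib)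
qed


section \<open>The Hamiltonian system\<close>

lemma bounded_linear_hstack:
  "bounded_linear (\<lambda>U :: real^'p::finite^'r::finite. hstack U (0 :: real^'q::finite^'r))"
  "bounded_linear (\<lambda>V :: real^'q::finite^'r::finite. hstack (0 :: real^'p::finite^'r) V)"
  unfolding linear_conv_bounded_linear[symmetric]
  by (auto intro!: linearI simp: hstack_def vstack_def vec_eq_iff split: sum.split)

lemma bounded_linear_vstack:
  "bounded_linear (\<lambda>U :: real^'c::finite^'p::finite. vstack U (0 :: real^'c^'q::finite))"
  "bounded_linear (\<lambda>V :: real^'c::finite^'q::finite. vstack (0 :: real^'c^'p::finite) V)"
  unfolding linear_conv_bounded_linear[symmetric]
  by (auto intro!: linearI simp: vstack_def vec_eq_iff split: sum.split)

text \<open>The decomposition into two linear maps of one argument each reduces bounds for block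
  coefficients to bounds for the blocks.\<close>

lemma hstack_split: "hstack U V = hstack U 0 + hstack 0 V" for U :: "real^'p::finite^'r::finite" and V :: "real^'q::finite^'r"
  by (auto simp: hstack_def vstack_def vec_eq_iff split: sum.split)

lemma vstack_split: "vstack U V = vstack U 0 + vstack 0 V" for U :: "real^'c::finite^'p::finite" and V :: "real^'c^'q::finite"
  by (auto simp: vstack_def vec_eq_iff split: sum.split)

context brownian_interval
begin

lemma ess_bounded_hstack:
  fixes U :: "('w, real^'p::finite^'r::finite) process" and V :: "('w, real^'q::finite^'r) process"
  assumes "ess_bounded U" "ess_bounded V"
  shows "ess_bounded (\<lambda>t \<omega>. hstack (U t \<omega>) (V t \<omega>))"
  by (subst hstack_split, intro ess_bounded_add ess_bounded_bounded_linear[OF bounded_linear_hstack(1)] ess_bounded_bounded_linear[OF bounded_linear_hstack(2)] assms)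

lemma ess_bounded_vstack:
  fixes U :: "('w, real^'c::finite^'p::finite) process" and V :: "('w, real^'c^'q::finite) process"
  assumes "ess_bounded U" "ess_bounded V"
  shows "ess_bounded (\<lambda>t \<omega>. vstack (U t \<omega>) (V t \<omega>))"
  by (subst vstack_split, intro ess_bounded_add ess_bounded_bounded_linear[OF bounded_linear_vstack(1)] ess_bounded_bounded_linear[OF bounded_linear_vstack(2)] assms)

lemma ess_bounded_block:
  fixes U :: "('w, real^'p::finite^'r::finite) process" and V :: "('w, real^'q::finite^'r) process"
    and U' :: "('w, real^'p^'k::finite) process" and V' :: "('w, real^'q^'k) process"
  assumes "ess_bounded U" "ess_bounded V" "ess_bounded U'" "ess_bounded V'"
  shows "ess_bounded (\<lambda>t \<omega>. block (U t \<omega>) (V t \<omega>) (U' t \<omega>) (V' t \<omega>))"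
  unfolding block_def by (intro ess_bounded_vstack ess_bounded_hstack assms)

lemma L2_process_vstack:
  fixes U :: "('w, real^'c::finite^'p::finite) process" and V :: "('w, real^'c^'q::finite) process"
  assumes "U \<in> L2_process M W s T" "V \<in> L2_process M W s T"
  shows "(\<lambda>t \<omega>. vstack (U t \<omega>) (V t \<omega>)) \<in> L2_process M W s T"
  by (subst vstack_split, intro L2_process_add L2_process_bounded_linear[OF bounded_linear_vstack(1)] L2_process_bounded_linear[OF bounded_linear_vstack(2)] assms)

lemma ess_bounded_zero: "ess_bounded (\<lambda>t \<omega>. 0)"
  by (auto simp: ess_bounded_def progressive_const intro!: exI[of _ 0])

end

context leader_problem
begin

lemma data_L2F: "c\<alpha> G \<in> L2F G" "c\<beta> G \<in> L2F G" "c\<gamma> G \<in> L2F G"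
  using game by (auto simp: lq_game_def)

lemma feedback_L2F':
  assumes "ess_bounded \<phi>2" "Z \<in> L2F G" "\<psi>2 \<in> L2F G"
  shows "feedback G \<phi>1 \<phi>2 \<psi>2 Z lam \<in> L2F G"
  unfolding feedback_def[abs_def]
  by (intro L2_process_diff L2_process_matrix_vector_mult ess_bounded_diff ess_bounded_hstack ess_bounded_zero ess_bounded_matrix_mult
      ess_bounded_inv_E2 ess_bounded_transpose ess_bounded_coefficients ess_bounded_phi1 assms
      L2_process_bounded_linear[OF bounded_linear_matrix_apply] L2_process_add L2_process_matrix_mult data_L2F)

end

text \<open>The control is tied to the feedback formula only almost everywhere, since the locale is
  instantiated both with a given control and with the feedback control itself.\<close>

locale hamiltonian_problem = leader_problem G X u1s \<psi>1 \<psi>1' \<phi>1 \<phi>1'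
  for G :: "('w, 'n::finite, 'm::finite, 'l::finite) game" and X u1s \<psi>1 \<psi>1' \<phi>1 \<phi>1' +
  fixes \<phi>2 :: "('w, real^('n + 'n)^('n + 'n)) process" and \<psi>2 \<psi>2' :: "('w, real^'l^('n + 'n)) process"
    and lam :: "real^'l" and Z P Q :: "('w, real^('n + 'n)) process" and u :: "('w, 'm) control"
  assumes phi2: "\<phi>2 \<in> LinfC G" "AE \<omega> in Om G. \<forall>t\<in>{t0 G..t1 G}. symmetric_matrix (\<phi>2 t \<omega>)"
    and psi2: "bsde_psi2 G \<phi>1 \<phi>2 \<psi>2 \<psi>2'"
    and ham: "hamiltonian_system G \<phi>1 lam Z P Q"
    and P_eq: "indistinguishable (Om G) (t0 G) (t1 G) P (\<lambda>t \<omega>. - (\<phi>2 t \<omega> *v Z t \<omega>) - \<psi>2 t \<omega> *v lam)"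
    and control: "progressive (Om G) (BM G) (t0 G) (t1 G) u"
      "process_eq (Om G) (t0 G) (t1 G) u (feedback G \<phi>1 \<phi>2 \<psi>2 Z lam)"
begin

abbreviation "Z1 \<equiv> \<lambda>t \<omega>. upper (Z t \<omega>)"
abbreviation "Z2 \<equiv> \<lambda>t \<omega>. lower (Z t \<omega>)"
abbreviation "P1 \<equiv> \<lambda>t \<omega>. upper (P t \<omega>)"
abbreviation "P2 \<equiv> \<lambda>t \<omega>. lower (P t \<omega>)"
abbreviation "Q1 \<equiv> \<lambda>t \<omega>. upper (Q t \<omega>)"
abbreviation "Q2 \<equiv> \<lambda>t \<omega>. lower (Q t \<omega>)"

lemma ess_bounded_phi2: "ess_bounded \<phi>2"
  by (rule ess_bounded_Linf[OF phi2(1)])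

lemma hamD: "Z \<in> L2C G" "P \<in> L2C G" "Q \<in> L2F G"
  "AE \<omega> in Om G. Z (t0 G) \<omega> = vstack (xi G) 0"
  "AE \<omega> in Om G. P (t1 G) \<omega> = - (block (cG2 G \<omega>) 0 0 0 *v Z (t1 G) \<omega>) - vstack (c\<delta> G \<omega>) 0 *v lam"
  using ham by (auto simp: hamiltonian_system_def)

lemma psi2D: "\<psi>2 \<in> L2C G" "\<psi>2' \<in> L2F G" "AE \<omega> in Om G. \<psi>2 (t1 G) \<omega> = vstack (c\<delta> G \<omega>) 0"
  using psi2 by (auto simp: bsde_psi2_def)

lemma halves_L2C: "Z1 \<in> L2C G" "Z2 \<in> L2C G" "P1 \<in> L2C G" "P2 \<in> L2C G"
  by (intro L2_continuous_bounded_linear[OF bounded_linear_upper] L2_continuous_bounded_linear[OF bounded_linear_lower] hamD)+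

lemma halves_L2F: "Z1 \<in> L2F G" "Z2 \<in> L2F G" "P1 \<in> L2F G" "P2 \<in> L2F G" "Q1 \<in> L2F G" "Q2 \<in> L2F G"
  by (intro L2_continuous_L2_process halves_L2C L2_process_bounded_linear[OF bounded_linear_upper]
      L2_process_bounded_linear[OF bounded_linear_lower] hamD)+

lemma feedback_L2F: "feedback G \<phi>1 \<phi>2 \<psi>2 Z lam \<in> L2F G"
  by (intro feedback_L2F' ess_bounded_phi2 L2_continuous_L2_process hamD psi2D)

lemma control_AE: "AE p in N. u (fst p) (snd p) = feedback G \<phi>1 \<phi>2 \<psi>2 Z lam (fst p) (snd p)"
  using control feedback_L2F by (simp add: process_eq_iff L2_process_iff)

lemma control_L2F: "u \<in> L2F G"
  using sq_integrable_cong_AE[OF L2F_N[OF feedback_L2F] progressive_measurable_N[OF control(1)] control_AE] control(1)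
  by (simp add: L2_process_iff)

lemma P_AE: "AE p in N. P (fst p) (snd p) = - (\<phi>2 (fst p) (snd p) *v Z (fst p) (snd p)) - \<psi>2 (fst p) (snd p) *v lam"
  using P_eq unfolding indistinguishable_def by (rule AE_paths_N)

text \<open>Substituting the upper half of \<open>P = - \<phi>2 Z - \<psi>2 lam\<close> turns the
  feedback law into its open-loop form in \<open>Z2\<close> and \<open>P1\<close>.\<close>

lemma control_formula:
  "AE p in N. u (fst p) (snd p) = invE2 G (fst p) (snd p) *v
     (transpose (cB2 G (fst p) (snd p)) *v (\<phi>1 (fst p) (snd p) *v Z2 (fst p) (snd p) + P1 (fst p) (snd p)) - c\<gamma> G (fst p) (snd p) *v lam)"
  using control_AE P_AE
proof eventually_elim
  case (elim p)
  have P1: "upper (P (fst p) (snd p)) = - upper (\<phi>2 (fst p) (snd p) *v Z (fst p) (snd p)) - upper (\<psi>2 (fst p) (snd p) *v lam)"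
    unfolding elim(2) by (simp add: upper_simps)
  show ?case
    unfolding elim(1) P1 feedback_def
    by (simp add: matrix_vector_mult_diff_rdistrib matrix_vector_mult_add_rdistrib matrix_vector_mul_assoc[symmetric] hstack_mult
        matrix_vector_right_distrib matrix_vector_mult_diff_distrib algebra_simps)
qed

text \<open>Multiplication by \<open>cE2\<close> gives the leader's first-order condition, in which
  no inverse occurs.\<close>

lemma control_stationary:
  "AE p in N. cE2 G (fst p) (snd p) *v u (fst p) (snd p) =
     transpose (cB2 G (fst p) (snd p)) *v (\<phi>1 (fst p) (snd p) *v Z2 (fst p) (snd p) + P1 (fst p) (snd p)) - c\<gamma> G (fst p) (snd p) *v lam"
  using control_formula AE_symmetric
proof eventually_elim
  case (elim p)
  then show ?case by (simp add: matrix_vector_mul_assoc)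
qed

section \<open>The four half equations and the follower's response inside them\<close>

lemma Z1_equation:
  "itod G Z1 (\<lambda>t \<omega>. (cA G t \<omega> - S1 G t \<omega> ** \<phi>1 t \<omega>) *v Z1 t \<omega> + (S2 G t \<omega> ** \<phi>1 t \<omega>) *v Z2 t \<omega>
      + (S2 G t \<omega> *v P1 t \<omega> - S1 G t \<omega> *v P2 t \<omega>) - (cB2 G t \<omega> ** invE2 G t \<omega> ** c\<gamma> G t \<omega>) *v lam)
     (\<lambda>t \<omega>. cC G t \<omega> *v Z1 t \<omega>)"
proof -
  have "itod G Z (\<lambda>t \<omega>. Abar G \<phi>1 t \<omega> *v Z t \<omega> + Fbar G t \<omega> *v P t \<omega> + gvec G t \<omega> *v lam) (\<lambda>t \<omega>. Cbar G t \<omega> *v Z t \<omega>)"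
    using ham by (simp add: hamiltonian_system_def)
  from ito_differential_bounded_linear[OF bounded_linear_upper brownian_interval_axioms this]
  show ?thesis
    by (simp add: upper_simps Abar_def Fbar_def gvec_def Cbar_def upper_block_mult upper_vstack_mult matrix_vector_mult_uminus)
qed

text \<open>\<open>Z2\<close> is the multiplier of the follower's backward equation, which explains
  why it runs forward and starts at zero.\<close>

lemma Z2_equation:
  "itod G Z2 (\<lambda>t \<omega>. (cA G t \<omega> - S1 G t \<omega> ** \<phi>1 t \<omega>) *v Z2 t \<omega> - S1 G t \<omega> *v P1 t \<omega>
      + (cB1 G t \<omega> ** invE1 G t \<omega>) *v (c\<beta> G t \<omega> *v lam))
     (\<lambda>t \<omega>. cC G t \<omega> *v Z2 t \<omega>)"
proof -
  have "itod G Z (\<lambda>t \<omega>. Abar G \<phi>1 t \<omega> *v Z t \<omega> + Fbar G t \<omega> *v P t \<omega> + gvec G t \<omega> *v lam) (\<lambda>t \<omega>. Cbar G t \<omega> *v Z t \<omega>)"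
    using ham by (simp add: hamiltonian_system_def)
  from ito_differential_bounded_linear[OF bounded_linear_lower brownian_interval_axioms this]
  show ?thesis
    by (simp add: lower_simps Abar_def Fbar_def gvec_def Cbar_def lower_block_mult lower_vstack_mult matrix_vector_mult_uminus matrix_vector_mul_assoc)
qed

lemma P1_equation:
  "itod G P1 (\<lambda>t \<omega>. cD2 G t \<omega> *v Z1 t \<omega> - transpose (cA G t \<omega> - S1 G t \<omega> ** \<phi>1 t \<omega>) *v P1 t \<omega> - transpose (cC G t \<omega>) *v Q1 t \<omega>
      + (c\<alpha> G t \<omega> *v lam - (\<phi>1 t \<omega> ** cB1 G t \<omega> ** invE1 G t \<omega>) *v (c\<beta> G t \<omega> *v lam)))
     Q1"
proof -
  have "itod G P (\<lambda>t \<omega>. Dbar G \<phi>1 t \<omega> *v Z t \<omega> - transpose (Abar G \<phi>1 t \<omega>) *v P t \<omega>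
              - transpose (Cbar G t \<omega>) *v Q t \<omega> + hvec G \<phi>1 t \<omega> *v lam) Q"
    using ham by (simp add: hamiltonian_system_def)
  from ito_differential_bounded_linear[OF bounded_linear_upper brownian_interval_axioms this]
  show ?thesis
    by (simp add: upper_simps Abar_def Dbar_def hvec_def Cbar_def transpose_block upper_block_mult upper_vstack_mult
        matrix_vector_mult_uminus matrix_vector_mult_diff_rdistrib matrix_vector_mul_assoc)
qed

lemma P2_equation:
  "itod G P2 (\<lambda>t \<omega>. - ((\<phi>1 t \<omega> ** S2 G t \<omega> ** \<phi>1 t \<omega>) *v Z2 t \<omega>)
      - (transpose (S2 G t \<omega> ** \<phi>1 t \<omega>) *v P1 t \<omega> + transpose (cA G t \<omega> - S1 G t \<omega> ** \<phi>1 t \<omega>) *v P2 t \<omega>)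
      - transpose (cC G t \<omega>) *v Q2 t \<omega> + (\<phi>1 t \<omega> ** cB2 G t \<omega> ** invE2 G t \<omega>) *v (c\<gamma> G t \<omega> *v lam))
     Q2"
proof -
  have "itod G P (\<lambda>t \<omega>. Dbar G \<phi>1 t \<omega> *v Z t \<omega> - transpose (Abar G \<phi>1 t \<omega>) *v P t \<omega>
              - transpose (Cbar G t \<omega>) *v Q t \<omega> + hvec G \<phi>1 t \<omega> *v lam) Q"
    using ham by (simp add: hamiltonian_system_def)
  from ito_differential_bounded_linear[OF bounded_linear_lower brownian_interval_axioms this]
  show ?thesis
    by (simp add: lower_simps Abar_def Dbar_def hvec_def Cbar_def transpose_block lower_block_mult lower_vstack_mult
        matrix_vector_mult_uminus matrix_vector_mul_assoc)
qed

lemma ess_bounded_closed_loop: "ess_bounded (\<lambda>t \<omega>. cA G t \<omega> - S1 G t \<omega> ** \<phi>1 t \<omega>)"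
  by (intro ess_bounded_diff ess_bounded_matrix_mult ess_bounded_coefficients ess_bounded_S1 ess_bounded_phi1)

lemmas ess_bounded_intros = ess_bounded_closed_loop ess_bounded_diff ess_bounded_matrix_mult ess_bounded_transpose ess_bounded_coefficients
  ess_bounded_S1 ess_bounded_S2 ess_bounded_phi1 ess_bounded_inv_E1 ess_bounded_inv_E2

lemmas L2F_intros = L2_process_add L2_process_diff L2_process_uminus L2_process_matrix_vector_mult halves_L2F L2F_data

text \<open>By \<open>control_formula\<close>, \<open>S2 (\<phi>1 Z2 + P1)\<close> minus the term
  with \<open>c\<gamma>\<close> is \<open>cB2 u\<close>. This expression occurs in the drift of
  \<open>Z1\<close> and, with the factor \<open>- \<phi>1\<close>, in that of \<open>P2\<close>, so
  \<open>Z1\<close>, \<open>P2\<close> and \<open>Q2\<close> form the response to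
  \<open>u\<close>.\<close>

lemma hamiltonian_follower_system: "follower_system G \<phi>1 (xi G) u Z1 P2 Q2"
  unfolding follower_system_def
proof (intro conjI halves_L2C halves_L2F)
  show "AE \<omega> in Om G. upper (Z (t0 G) \<omega>) = xi G \<and> lower (P (t1 G) \<omega>) = 0"
    using hamD(4,5) by eventually_elim (simp add: lower_simps lower_block_mult lower_vstack_mult)
  show "itod G Z1 (\<lambda>t \<omega>. (cA G t \<omega> - S1 G t \<omega> ** \<phi>1 t \<omega>) *v Z1 t \<omega> - S1 G t \<omega> *v P2 t \<omega> + cB2 G t \<omega> *v u t \<omega>) (\<lambda>t \<omega>. cC G t \<omega> *v Z1 t \<omega>)"
  proof (rule ito_differential_cong_drift[OF Z1_equation])
    show "(\<lambda>t \<omega>. (cA G t \<omega> - S1 G t \<omega> ** \<phi>1 t \<omega>) *v Z1 t \<omega> + (S2 G t \<omega> ** \<phi>1 t \<omega>) *v Z2 t \<omega>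
      + (S2 G t \<omega> *v P1 t \<omega> - S1 G t \<omega> *v P2 t \<omega>) - (cB2 G t \<omega> ** invE2 G t \<omega> ** c\<gamma> G t \<omega>) *v lam) \<in> L2F G"
      by (intro L2F_intros ess_bounded_intros L2_process_bounded_linear[OF bounded_linear_matrix_apply] L2_process_matrix_mult data_L2F)
    show "(\<lambda>t \<omega>. (cA G t \<omega> - S1 G t \<omega> ** \<phi>1 t \<omega>) *v Z1 t \<omega> - S1 G t \<omega> *v P2 t \<omega> + cB2 G t \<omega> *v u t \<omega>) \<in> L2F G"
      by (intro L2F_intros ess_bounded_intros control_L2F)
    show "AE p in N. (cA G (fst p) (snd p) - S1 G (fst p) (snd p) ** \<phi>1 (fst p) (snd p)) *v upper (Z (fst p) (snd p))
        + (S2 G (fst p) (snd p) ** \<phi>1 (fst p) (snd p)) *v lower (Z (fst p) (snd p))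
        + (S2 G (fst p) (snd p) *v upper (P (fst p) (snd p)) - S1 G (fst p) (snd p) *v lower (P (fst p) (snd p)))
        - (cB2 G (fst p) (snd p) ** invE2 G (fst p) (snd p) ** c\<gamma> G (fst p) (snd p)) *v lam =
      (cA G (fst p) (snd p) - S1 G (fst p) (snd p) ** \<phi>1 (fst p) (snd p)) *v upper (Z (fst p) (snd p))
        - S1 G (fst p) (snd p) *v lower (P (fst p) (snd p)) + cB2 G (fst p) (snd p) *v u (fst p) (snd p)"
      using control_formula
    proof eventually_elim
      case (elim p)
      show ?case
        unfolding elim S2_def
        by (simp add: matrix_vector_mul_assoc[symmetric] matrix_vector_right_distrib matrix_vector_mult_diff_distrib)
    qed
  qed
  show "itod G P2 (\<lambda>t \<omega>. - ((transpose (cA G t \<omega>) - \<phi>1 t \<omega> ** S1 G t \<omega>) *v P2 t \<omega>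
                + transpose (cC G t \<omega>) *v Q2 t \<omega> + \<phi>1 t \<omega> *v (cB2 G t \<omega> *v u t \<omega>))) Q2"
  proof (rule ito_differential_cong_drift[OF P2_equation])
    show "(\<lambda>t \<omega>. - ((\<phi>1 t \<omega> ** S2 G t \<omega> ** \<phi>1 t \<omega>) *v Z2 t \<omega>)
      - (transpose (S2 G t \<omega> ** \<phi>1 t \<omega>) *v P1 t \<omega> + transpose (cA G t \<omega> - S1 G t \<omega> ** \<phi>1 t \<omega>) *v P2 t \<omega>)
      - transpose (cC G t \<omega>) *v Q2 t \<omega> + (\<phi>1 t \<omega> ** cB2 G t \<omega> ** invE2 G t \<omega>) *v (c\<gamma> G t \<omega> *v lam)) \<in> L2F G"
      by (intro L2F_intros ess_bounded_intros)
    show "(\<lambda>t \<omega>. - ((transpose (cA G t \<omega>) - \<phi>1 t \<omega> ** S1 G t \<omega>) *v P2 t \<omega>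
                + transpose (cC G t \<omega>) *v Q2 t \<omega> + \<phi>1 t \<omega> *v (cB2 G t \<omega> *v u t \<omega>))) \<in> L2F G"
      by (intro L2F_intros ess_bounded_intros control_L2F)
    show "AE p in N. - ((\<phi>1 (fst p) (snd p) ** S2 G (fst p) (snd p) ** \<phi>1 (fst p) (snd p)) *v lower (Z (fst p) (snd p)))
        - (transpose (S2 G (fst p) (snd p) ** \<phi>1 (fst p) (snd p)) *v upper (P (fst p) (snd p))
           + transpose (cA G (fst p) (snd p) - S1 G (fst p) (snd p) ** \<phi>1 (fst p) (snd p)) *v lower (P (fst p) (snd p)))
        - transpose (cC G (fst p) (snd p)) *v lower (Q (fst p) (snd p))
        + (\<phi>1 (fst p) (snd p) ** cB2 G (fst p) (snd p) ** invE2 G (fst p) (snd p)) *v (c\<gamma> G (fst p) (snd p) *v lam) =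
      - ((transpose (cA G (fst p) (snd p)) - \<phi>1 (fst p) (snd p) ** S1 G (fst p) (snd p)) *v lower (P (fst p) (snd p))
        + transpose (cC G (fst p) (snd p)) *v lower (Q (fst p) (snd p))
        + \<phi>1 (fst p) (snd p) *v (cB2 G (fst p) (snd p) *v u (fst p) (snd p)))"
      using control_formula AE_symmetric
    proof eventually_elim
      case (elim p)
      have tr: "transpose (S2 G (fst p) (snd p) ** \<phi>1 (fst p) (snd p)) = \<phi>1 (fst p) (snd p) ** S2 G (fst p) (snd p)"
        "transpose (cA G (fst p) (snd p) - S1 G (fst p) (snd p) ** \<phi>1 (fst p) (snd p)) =
           transpose (cA G (fst p) (snd p)) - \<phi>1 (fst p) (snd p) ** S1 G (fst p) (snd p)"
        using elim(2) by (simp_all add: matrix_transpose_mul transpose_diff)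
      show ?case
        unfolding tr unfolding elim(1) S2_def
        by (simp add: matrix_vector_mul_assoc[symmetric] matrix_vector_right_distrib matrix_vector_mult_diff_distrib)
    qed
  qed
qed

text \<open>The left-hand side is half the derivative of the Lagrangian at \<open>u\<close> in the
  direction \<open>w\<close>; \<open>Y\<close> and \<open>\<eta>\<close> are the variations of the
  state and of the follower's adjoint, and the third argument of the density is the variation of the
  follower's control.\<close>

lemma duality:
  assumes sol: "follower_system G \<phi>1 0 w Y \<eta> \<eta>'" and w: "w \<in> L2F G"
  shows "(\<integral>p. (cD2 G (fst p) (snd p) *v Z1 (fst p) (snd p)) \<bullet> Y (fst p) (snd p) + (cE2 G (fst p) (snd p) *v u (fst p) (snd p)) \<bullet> w (fst p) (snd p)
      + constraint_density lam Y (\<lambda>t \<omega>. - ((invE1 G t \<omega> ** transpose (cB1 G t \<omega>)) *v (\<phi>1 t \<omega> *v Y t \<omega> + \<eta> t \<omega>))) w p \<partial>N)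
    + expectation (\<lambda>\<omega>. (cG2 G \<omega> *v Z1 (t1 G) \<omega>) \<bullet> Y (t1 G) \<omega> + (c\<delta> G \<omega> *v lam) \<bullet> Y (t1 G) \<omega>) = 0"
proof -
  let ?bY = "\<lambda>t \<omega>. (cA G t \<omega> - S1 G t \<omega> ** \<phi>1 t \<omega>) *v Y t \<omega> - S1 G t \<omega> *v \<eta> t \<omega> + cB2 G t \<omega> *v w t \<omega>"
  let ?b\<eta> = "\<lambda>t \<omega>. - ((transpose (cA G t \<omega>) - \<phi>1 t \<omega> ** S1 G t \<omega>) *v \<eta> t \<omega>
                + transpose (cC G t \<omega>) *v \<eta>' t \<omega> + \<phi>1 t \<omega> *v (cB2 G t \<omega> *v w t \<omega>))"
  let ?bP = "\<lambda>t \<omega>. cD2 G t \<omega> *v Z1 t \<omega> - transpose (cA G t \<omega> - S1 G t \<omega> ** \<phi>1 t \<omega>) *v P1 t \<omega> - transpose (cC G t \<omega>) *v Q1 t \<omega>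
      + (c\<alpha> G t \<omega> *v lam - (\<phi>1 t \<omega> ** cB1 G t \<omega> ** invE1 G t \<omega>) *v (c\<beta> G t \<omega> *v lam))"
  let ?bZ = "\<lambda>t \<omega>. (cA G t \<omega> - S1 G t \<omega> ** \<phi>1 t \<omega>) *v Z2 t \<omega> - S1 G t \<omega> *v P1 t \<omega>
      + (cB1 G t \<omega> ** invE1 G t \<omega>) *v (c\<beta> G t \<omega> *v lam)"
  have S: "Y \<in> L2C G" "\<eta> \<in> L2C G" "\<eta>' \<in> L2F G" "AE \<omega> in Om G. Y (t0 G) \<omega> = 0" "AE \<omega> in Om G. \<eta> (t1 G) \<omega> = 0"
    "itod G Y ?bY (\<lambda>t \<omega>. cC G t \<omega> *v Y t \<omega>)" "itod G \<eta> ?b\<eta> \<eta>'"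
    using sol by (auto simp: follower_system_def)
  note SF = L2_continuous_L2_process[OF S(1)] L2_continuous_L2_process[OF S(2)] S(3)
  have bY: "?bY \<in> L2F G" by (intro L2F_intros ess_bounded_intros SF w)
  have b\<eta>: "?b\<eta> \<in> L2F G" by (intro L2F_intros ess_bounded_intros SF w)
  have bP: "?bP \<in> L2F G" by (intro L2F_intros ess_bounded_intros)
  have bZ: "?bZ \<in> L2F G" by (intro L2F_intros ess_bounded_intros)
  have CY: "(\<lambda>t \<omega>. cC G t \<omega> *v Y t \<omega>) \<in> L2F G" "(\<lambda>t \<omega>. cC G t \<omega> *v Z2 t \<omega>) \<in> L2F G"
    by (intro L2F_intros ess_bounded_intros SF)+
  let ?I1 = "\<lambda>p. P1 (fst p) (snd p) \<bullet> ?bY (fst p) (snd p) + ?bP (fst p) (snd p) \<bullet> Y (fst p) (snd p) + Q1 (fst p) (snd p) \<bullet> (cC G (fst p) (snd p) *v Y (fst p) (snd p))"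
  let ?I2 = "\<lambda>p. Z2 (fst p) (snd p) \<bullet> ?b\<eta> (fst p) (snd p) + ?bZ (fst p) (snd p) \<bullet> \<eta> (fst p) (snd p) + (cC G (fst p) (snd p) *v Z2 (fst p) (snd p)) \<bullet> \<eta>' (fst p) (snd p)"
  have i1: "integrable N ?I1"
    by (intro Bochner_Integration.integrable_add integrable_inner L2F_N[OF bY] L2F_N[OF bP] L2F_N[OF CY(1)] L2F_N[OF halves_L2F(3)] L2F_N[OF halves_L2F(5)] L2F_N[OF SF(1)])
  have i2: "integrable N ?I2"
    by (intro Bochner_Integration.integrable_add integrable_inner L2F_N[OF b\<eta>] L2F_N[OF bZ] L2F_N[OF CY(2)] L2F_N[OF halves_L2F(2)] L2F_N[OF SF(2)] L2F_N[OF SF(3)])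
  \<comment> \<open>At the final time the cut-off of the product rule is void on
    \<open>N\<close>.\<close>
  have full: "(\<integral>p. (if fst p \<le> t1 G then f p else 0) \<partial>N) = (\<integral>p. f p \<partial>N)" for f :: "real \<times> 'w \<Rightarrow> real"
    by (intro Bochner_Integration.integral_cong refl) (auto simp: space_N)
  \<comment> \<open>The initial term vanishes with \<open>Y\<close>; the terminal one carries the
    terminal cost and the terminal part of the constraint.\<close>
  have e1: "expectation (\<lambda>\<omega>. P1 (t1 G) \<omega> \<bullet> Y (t1 G) \<omega>) = (\<integral>p. ?I1 p \<partial>N)"
  proof -
    have "expectation (\<lambda>\<omega>. P1 (t0 G) \<omega> \<bullet> Y (t0 G) \<omega>) = 0" using S(4) by (intro integral_eq_zero_AE) auto
    then show ?thesis using ito_product[OF halves_L2C(3) P1_equation bP S(1,6) bY t1_mem] by (simp only: full add_0)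
  qed
  \<comment> \<open>Here both boundary terms vanish: \<open>Z2\<close> starts at zero and
    \<open>\<eta>\<close> ends at zero.\<close>
  have e2: "(\<integral>p. ?I2 p \<partial>N) = 0"
  proof -
    have "AE \<omega> in Om G. Z2 (t0 G) \<omega> \<bullet> \<eta> (t0 G) \<omega> = 0" using hamD(4) by eventually_elim simp
    then have "expectation (\<lambda>\<omega>. Z2 (t0 G) \<omega> \<bullet> \<eta> (t0 G) \<omega>) = 0" by (rule integral_eq_zero_AE)
    moreover have "expectation (\<lambda>\<omega>. Z2 (t1 G) \<omega> \<bullet> \<eta> (t1 G) \<omega>) = 0" using S(5) by (intro integral_eq_zero_AE) auto
    ultimately show ?thesis using ito_product[OF halves_L2C(2) Z2_equation bZ S(2,7) b\<eta> t1_mem] by (simp only: full add_0)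
  qed
  have e3: "expectation (\<lambda>\<omega>. (cG2 G \<omega> *v Z1 (t1 G) \<omega>) \<bullet> Y (t1 G) \<omega> + (c\<delta> G \<omega> *v lam) \<bullet> Y (t1 G) \<omega>) = - expectation (\<lambda>\<omega>. P1 (t1 G) \<omega> \<bullet> Y (t1 G) \<omega>)"
  proof -
    have "expectation (\<lambda>\<omega>. (cG2 G \<omega> *v Z1 (t1 G) \<omega>) \<bullet> Y (t1 G) \<omega> + (c\<delta> G \<omega> *v lam) \<bullet> Y (t1 G) \<omega>) = expectation (\<lambda>\<omega>. - (P1 (t1 G) \<omega> \<bullet> Y (t1 G) \<omega>))"
    proof (rule integral_cong_AE)
      show "AE \<omega> in Om G. (cG2 G \<omega> *v Z1 (t1 G) \<omega>) \<bullet> Y (t1 G) \<omega> + (c\<delta> G \<omega> *v lam) \<bullet> Y (t1 G) \<omega> = - (P1 (t1 G) \<omega> \<bullet> Y (t1 G) \<omega>)"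
        using hamD(5) by eventually_elim (simp add: upper_simps upper_block_mult upper_vstack_mult inner_diff_left)
      have "terminal_coeff G (cG2 G)" using game by (simp add: lq_game_def)
      then show "(\<lambda>\<omega>. (cG2 G \<omega> *v Z1 (t1 G) \<omega>) \<bullet> Y (t1 G) \<omega> + (c\<delta> G \<omega> *v lam) \<bullet> Y (t1 G) \<omega>) \<in> borel_measurable (Om G)"
        by (intro borel_measurable_add borel_measurable_inner sq_integrable_measurable[OF sq_integrable_terminal]
            sq_integrable_measurable[OF sq_integrable_delta_apply] L2_continuous_sq_integrable[OF halves_L2C(1) t1_mem]
            sq_integrable_measurable[OF L2_continuous_sq_integrable[OF S(1) t1_mem]])
      show "(\<lambda>\<omega>. - (P1 (t1 G) \<omega> \<bullet> Y (t1 G) \<omega>)) \<in> borel_measurable (Om G)"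
        by (intro borel_measurable_uminus borel_measurable_inner sq_integrable_measurable[OF L2_continuous_sq_integrable[OF halves_L2C(3) t1_mem]]
            sq_integrable_measurable[OF L2_continuous_sq_integrable[OF S(1) t1_mem]])
    qed
    then show ?thesis by simp
  qed
  let ?k = "\<lambda>t \<omega>. - ((invE1 G t \<omega> ** transpose (cB1 G t \<omega>)) *v (\<phi>1 t \<omega> *v Y t \<omega> + \<eta> t \<omega>))"
  have kL: "?k \<in> L2F G" by (intro L2F_intros ess_bounded_intros SF)
  have "(\<integral>p. (cD2 G (fst p) (snd p) *v Z1 (fst p) (snd p)) \<bullet> Y (fst p) (snd p) + (cE2 G (fst p) (snd p) *v u (fst p) (snd p)) \<bullet> w (fst p) (snd p)
      + constraint_density lam Y ?k w p \<partial>N) = (\<integral>p. ?I1 p - ?I2 p \<partial>N)"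
  proof (rule integral_cong_AE)
    have L: "(\<lambda>t \<omega>. cD2 G t \<omega> *v Z1 t \<omega>) \<in> L2F G" "(\<lambda>t \<omega>. cE2 G t \<omega> *v u t \<omega>) \<in> L2F G"
      by (intro L2F_intros ess_bounded_intros control_L2F)+
    show "(\<lambda>p. (cD2 G (fst p) (snd p) *v Z1 (fst p) (snd p)) \<bullet> Y (fst p) (snd p) + (cE2 G (fst p) (snd p) *v u (fst p) (snd p)) \<bullet> w (fst p) (snd p)
      + constraint_density lam Y ?k w p) \<in> borel_measurable N"
      by (intro borel_measurable_add borel_measurable_inner sq_integrable_measurable[OF L2F_N[OF L(1)]] sq_integrable_measurable[OF L2F_N[OF L(2)]]
          sq_integrable_measurable[OF L2F_N[OF SF(1)]] sq_integrable_measurable[OF L2F_N[OF w]]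
          borel_measurable_integrable[OF integrable_constraint_density[OF SF(1) kL w]])
    show "(\<lambda>p. ?I1 p - ?I2 p) \<in> borel_measurable N" using i1 i2 by (intro borel_measurable_diff) auto
    show "AE p in N. (cD2 G (fst p) (snd p) *v Z1 (fst p) (snd p)) \<bullet> Y (fst p) (snd p) + (cE2 G (fst p) (snd p) *v u (fst p) (snd p)) \<bullet> w (fst p) (snd p)
      + constraint_density lam Y ?k w p = ?I1 p - ?I2 p"
      using control_stationary AE_symmetric
    proof eventually_elim
      case (elim p)
      have tr: "transpose (cA G (fst p) (snd p)) - \<phi>1 (fst p) (snd p) ** S1 G (fst p) (snd p) = transpose (cA G (fst p) (snd p) - S1 G (fst p) (snd p) ** \<phi>1 (fst p) (snd p))"
        using elim(2) by (simp add: matrix_transpose_mul transpose_diff)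
      show ?case
        unfolding constraint_density_def tr
        by (rule duality_density) (use elim in auto)
    qed
  qed
  also have "\<dots> = (\<integral>p. ?I1 p \<partial>N) - (\<integral>p. ?I2 p \<partial>N)" by (rule Bochner_Integration.integral_diff[OF i1 i2])
  finally show ?thesis using e1 e2 e3 by linarith
qed

end


section \<open>Expansion of the Lagrangian\<close>

lemma quadratic_form_expand:
  fixes D :: "real^'n^'n"
  assumes "transpose D = D"
  shows "(D *v (a + b)) \<bullet> (a + b) = (D *v a) \<bullet> a + (D *v b) \<bullet> b + 2 * ((D *v a) \<bullet> b)"
proof -
  have "(D *v b) \<bullet> a = (D *v a) \<bullet> b" unfolding inner_matrix_adjoint[of D b] assms by (rule inner_commute)
  then show ?thesis by (simp add: matrix_vector_right_distrib inner_add_left inner_add_right)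
qed

context hamiltonian_problem
begin

abbreviation "k0 \<equiv> \<lambda>t \<omega>. - ((invE1 G t \<omega> ** transpose (cB1 G t \<omega>)) *v (\<phi>1 t \<omega> *v Z1 t \<omega> + P2 t \<omega>))"

lemma k0_L2F: "k0 \<in> L2F G"
  by (intro L2F_intros ess_bounded_intros)

text \<open>The Lagrangian at \<open>u\<close>, evaluated along \<open>Z1\<close> and
  \<open>k0\<close> instead of the response assigned to \<open>u\<close>, with which they agree only
  almost everywhere.\<close>

definition dual_value :: real where
  "dual_value = (\<integral>p. (cD2 G (fst p) (snd p) *v Z1 (fst p) (snd p)) \<bullet> Z1 (fst p) (snd p)
      + (cE2 G (fst p) (snd p) *v u (fst p) (snd p)) \<bullet> u (fst p) (snd p) + 2 * constraint_density lam Z1 k0 u p \<partial>N)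
    + expectation (\<lambda>\<omega>. (cG2 G \<omega> *v Z1 (t1 G) \<omega>) \<bullet> Z1 (t1 G) \<omega> + 2 * ((c\<delta> G \<omega> *v lam) \<bullet> Z1 (t1 G) \<omega>)) - 2 * (bnd G \<bullet> lam)"

lemma follower_variation:
  assumes v: "v \<in> L2F G"
  shows "follower_system G \<phi>1 0 (\<lambda>t \<omega>. v t \<omega> - u t \<omega>) (\<lambda>t \<omega>. X (u1s v) v t \<omega> - Z1 t \<omega>) (\<lambda>t \<omega>. \<psi>1 v t \<omega> - P2 t \<omega>) (\<lambda>t \<omega>. \<psi>1' v t \<omega> - Q2 t \<omega>)"
  using follower_system_diff[OF responseD(2)[OF v] hamiltonian_follower_system] by simp

lemma lagrangian_expansion:
  assumes v: "v \<in> L2F G"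
  shows "lagrangian G X u1s lam v = dual_value +
    quadratic_cost G (cD2 G) (cE2 G) (cG2 G) (\<lambda>t \<omega>. X (u1s v) v t \<omega> - Z1 t \<omega>) (\<lambda>t \<omega>. v t \<omega> - u t \<omega>)"
proof -
  let ?X = "X (u1s v) v"
  define Y where "Y = (\<lambda>t \<omega>. ?X t \<omega> - Z1 t \<omega>)"
  define \<eta> where "\<eta> = (\<lambda>t \<omega>. \<psi>1 v t \<omega> - P2 t \<omega>)"
  define w where "w = (\<lambda>t \<omega>. v t \<omega> - u t \<omega>)"
  let ?k = "\<lambda>t \<omega>. - ((invE1 G t \<omega> ** transpose (cB1 G t \<omega>)) *v (\<phi>1 t \<omega> *v Y t \<omega> + \<eta> t \<omega>))"
  have sol: "follower_system G \<phi>1 0 w Y \<eta> (\<lambda>t \<omega>. \<psi>1' v t \<omega> - Q2 t \<omega>)"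
    unfolding w_def Y_def \<eta>_def by (rule follower_variation[OF v])
  have w: "w \<in> L2F G" unfolding w_def by (intro L2_process_diff v control_L2F)
  have YC: "Y \<in> L2C G" "\<eta> \<in> L2C G" using sol by (auto simp: follower_system_def)
  have XC: "?X \<in> L2C G" using responseD(2)[OF v] by (simp add: follower_system_def)
  note F = L2_continuous_L2_process[OF YC(1)] L2_continuous_L2_process[OF YC(2)] L2_continuous_L2_process[OF XC]
  have kL: "?k \<in> L2F G" by (intro L2F_intros ess_bounded_intros F)
  have H: "terminal_coeff G (cG2 G)" using game by (simp add: lq_game_def)
  have D: "ess_bounded (cD2 G)" "ess_bounded (cE2 G)" by (rule ess_bounded_coefficients)+
  let ?D = "\<lambda>p. cD2 G (fst p) (snd p)" and ?E = "\<lambda>p. cE2 G (fst p) (snd p)"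
  have iD: "integrable N (\<lambda>p. (?D p *v f (fst p) (snd p)) \<bullet> g (fst p) (snd p))" if "f \<in> L2F G" "g \<in> L2F G" for f g
    by (rule integrable_inner[OF L2F_N[OF L2_process_matrix_vector_mult[OF D(1) that(1)]] L2F_N[OF that(2)]])
  have iE: "integrable N (\<lambda>p. (?E p *v f (fst p) (snd p)) \<bullet> g (fst p) (snd p))" if "f \<in> L2F G" "g \<in> L2F G" for f g
    by (rule integrable_inner[OF L2F_N[OF L2_process_matrix_vector_mult[OF D(2) that(1)]] L2F_N[OF that(2)]])
  have T: "sq_integrable (Om G) (Z1 (t1 G))" "sq_integrable (Om G) (Y (t1 G))" "sq_integrable (Om G) (?X (t1 G))"
    using halves_L2C(1) YC(1) XC t1_mem L2_continuous_sq_integrable by blast+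
  have iT: "integrable (Om G) (\<lambda>\<omega>. (cG2 G \<omega> *v f \<omega>) \<bullet> g \<omega>)" "integrable (Om G) (\<lambda>\<omega>. (c\<delta> G \<omega> *v lam) \<bullet> g \<omega>)"
    if "sq_integrable (Om G) f" "sq_integrable (Om G) g" for f g
    by (intro integrable_inner sq_integrable_terminal H that sq_integrable_delta_apply)+
  let ?A0 = "\<lambda>p. (?D p *v Z1 (fst p) (snd p)) \<bullet> Z1 (fst p) (snd p) + (?E p *v u (fst p) (snd p)) \<bullet> u (fst p) (snd p) + 2 * constraint_density lam Z1 k0 u p"
  let ?A1 = "\<lambda>p. (?D p *v Y (fst p) (snd p)) \<bullet> Y (fst p) (snd p) + (?E p *v w (fst p) (snd p)) \<bullet> w (fst p) (snd p)"
  let ?A2 = "\<lambda>p. (?D p *v Z1 (fst p) (snd p)) \<bullet> Y (fst p) (snd p) + (?E p *v u (fst p) (snd p)) \<bullet> w (fst p) (snd p) + constraint_density lam Y ?k w p"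
  let ?B0 = "\<lambda>\<omega>. (cG2 G \<omega> *v Z1 (t1 G) \<omega>) \<bullet> Z1 (t1 G) \<omega> + 2 * ((c\<delta> G \<omega> *v lam) \<bullet> Z1 (t1 G) \<omega>)"
  let ?B1 = "\<lambda>\<omega>. (cG2 G \<omega> *v Y (t1 G) \<omega>) \<bullet> Y (t1 G) \<omega>"
  let ?B2 = "\<lambda>\<omega>. (cG2 G \<omega> *v Z1 (t1 G) \<omega>) \<bullet> Y (t1 G) \<omega> + (c\<delta> G \<omega> *v lam) \<bullet> Y (t1 G) \<omega>"
  have iA0: "integrable N ?A0" by (intro Bochner_Integration.integrable_add integrable_mult_right iD iE integrable_constraint_density halves_L2F control_L2F k0_L2F)
  have iA1: "integrable N ?A1" by (intro Bochner_Integration.integrable_add iD iE F w)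
  have iA2: "integrable N ?A2" by (intro Bochner_Integration.integrable_add iD iE integrable_constraint_density halves_L2F control_L2F kL F w)
  have iB0: "integrable (Om G) ?B0" by (intro Bochner_Integration.integrable_add integrable_mult_right iT[OF T(1) T(1)])
  have iB1: "integrable (Om G) ?B1" by (intro iT[OF T(2) T(2)])
  have iB2: "integrable (Om G) ?B2" by (intro Bochner_Integration.integrable_add iT[OF T(1) T(2)])
  \<comment> \<open>Rearrangement into constant part, second variation and twice the first
    variation; the constraint is affine and adds nothing to the second variation.\<close>
  have combine: "c = c0 + c1 \<Longrightarrow> d = d0 + d1 + 2 * d2 \<Longrightarrow> e = e0 + e1 + 2 * e2 \<Longrightarrow>
      d + e + 2 * c = (d0 + e0 + 2 * c0) + (d1 + e1) + 2 * (d2 + e2 + c1)" for c c0 c1 d d0 d1 d2 e e0 e1 e2 :: real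
    by simp
  have N_part: "(\<integral>p. (?D p *v ?X (fst p) (snd p)) \<bullet> ?X (fst p) (snd p) \<partial>N) + (\<integral>p. (?E p *v v (fst p) (snd p)) \<bullet> v (fst p) (snd p) \<partial>N)
      + 2 * (\<integral>p. constraint_density lam ?X (u1s v) v p \<partial>N) = (\<integral>p. ?A0 p \<partial>N) + (\<integral>p. ?A1 p \<partial>N) + 2 * (\<integral>p. ?A2 p \<partial>N)"
  proof -
    note ic = integrable_constraint_density[OF F(3) responseD(1)[OF v] v, of lam]
    have "(\<integral>p. (?D p *v ?X (fst p) (snd p)) \<bullet> ?X (fst p) (snd p) \<partial>N) + (\<integral>p. (?E p *v v (fst p) (snd p)) \<bullet> v (fst p) (snd p) \<partial>N)
        + 2 * (\<integral>p. constraint_density lam ?X (u1s v) v p \<partial>N)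
      = (\<integral>p. (?D p *v ?X (fst p) (snd p)) \<bullet> ?X (fst p) (snd p) + (?E p *v v (fst p) (snd p)) \<bullet> v (fst p) (snd p)
        + 2 * constraint_density lam ?X (u1s v) v p \<partial>N)"
      using iD[OF F(3) F(3)] iE[OF v v] ic by simp
    also have "\<dots> = (\<integral>p. ?A0 p + ?A1 p + 2 * ?A2 p \<partial>N)"
    proof (rule integral_cong_AE)
      show "(\<lambda>p. (?D p *v ?X (fst p) (snd p)) \<bullet> ?X (fst p) (snd p) + (?E p *v v (fst p) (snd p)) \<bullet> v (fst p) (snd p)
        + 2 * constraint_density lam ?X (u1s v) v p) \<in> borel_measurable N"
        by (intro borel_measurable_integrable Bochner_Integration.integrable_add integrable_mult_right iD iE ic F v)
      show "(\<lambda>p. ?A0 p + ?A1 p + 2 * ?A2 p) \<in> borel_measurable N"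
        by (intro borel_measurable_integrable Bochner_Integration.integrable_add[OF Bochner_Integration.integrable_add] integrable_mult_right iA0 iA1 iA2)
      show "AE p in N. (?D p *v ?X (fst p) (snd p)) \<bullet> ?X (fst p) (snd p) + (?E p *v v (fst p) (snd p)) \<bullet> v (fst p) (snd p)
        + 2 * constraint_density lam ?X (u1s v) v p = ?A0 p + ?A1 p + 2 * ?A2 p"
        using response_AE[OF v] AE_symmetric
      proof eventually_elim
        case (elim p)
        have Xv: "?X (fst p) (snd p) = Z1 (fst p) (snd p) + Y (fst p) (snd p)" and vu: "v (fst p) (snd p) = u (fst p) (snd p) + w (fst p) (snd p)"
          and \<psi>v: "\<psi>1 v (fst p) (snd p) = P2 (fst p) (snd p) + \<eta> (fst p) (snd p)"
          by (simp_all add: Y_def w_def \<eta>_def)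
        \<comment> \<open>The follower's control is linear in state and adjoint, so it splits as
          they do.\<close>
        have r: "u1s v (fst p) (snd p) = k0 (fst p) (snd p) + ?k (fst p) (snd p)"
          unfolding elim(1) Xv \<psi>v by (simp add: matrix_vector_right_distrib)
        have "constraint_density lam ?X (u1s v) v p = constraint_density lam Z1 k0 u p + constraint_density lam Y ?k w p"
          unfolding constraint_density_def r Xv vu by (simp only: inner_add_right add_ac)
        moreover have "(?D p *v ?X (fst p) (snd p)) \<bullet> ?X (fst p) (snd p) = (?D p *v Z1 (fst p) (snd p)) \<bullet> Z1 (fst p) (snd p)
          + (?D p *v Y (fst p) (snd p)) \<bullet> Y (fst p) (snd p) + 2 * ((?D p *v Z1 (fst p) (snd p)) \<bullet> Y (fst p) (snd p))"
          unfolding Xv using elim(2) by (intro quadratic_form_expand) auto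
        moreover have "(?E p *v v (fst p) (snd p)) \<bullet> v (fst p) (snd p) = (?E p *v u (fst p) (snd p)) \<bullet> u (fst p) (snd p)
          + (?E p *v w (fst p) (snd p)) \<bullet> w (fst p) (snd p) + 2 * ((?E p *v u (fst p) (snd p)) \<bullet> w (fst p) (snd p))"
          unfolding vu using elim(2) by (intro quadratic_form_expand) auto
        ultimately show ?case by (rule combine)
      qed
    qed
    also have "\<dots> = (\<integral>p. ?A0 p \<partial>N) + (\<integral>p. ?A1 p \<partial>N) + 2 * (\<integral>p. ?A2 p \<partial>N)"
      by (simp only: Bochner_Integration.integral_add[OF Bochner_Integration.integrable_add[OF iA0 iA1] integrable_mult_right[OF iA2]]
          Bochner_Integration.integral_add[OF iA0 iA1] integral_mult_right_zero)
    finally show ?thesis .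
  qed
  have M_part: "expectation (\<lambda>\<omega>. (cG2 G \<omega> *v ?X (t1 G) \<omega>) \<bullet> ?X (t1 G) \<omega>) + 2 * expectation (\<lambda>\<omega>. (c\<delta> G \<omega> *v lam) \<bullet> ?X (t1 G) \<omega>)
      = expectation ?B0 + expectation ?B1 + 2 * expectation ?B2"
  proof -
    have "expectation (\<lambda>\<omega>. (cG2 G \<omega> *v ?X (t1 G) \<omega>) \<bullet> ?X (t1 G) \<omega>) + 2 * expectation (\<lambda>\<omega>. (c\<delta> G \<omega> *v lam) \<bullet> ?X (t1 G) \<omega>)
      = expectation (\<lambda>\<omega>. (cG2 G \<omega> *v ?X (t1 G) \<omega>) \<bullet> ?X (t1 G) \<omega> + 2 * ((c\<delta> G \<omega> *v lam) \<bullet> ?X (t1 G) \<omega>))"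
      using iT[OF T(3) T(3)] by simp
    also have "\<dots> = expectation (\<lambda>\<omega>. ?B0 \<omega> + ?B1 \<omega> + 2 * ?B2 \<omega>)"
    proof (intro Bochner_Integration.integral_cong refl)
      fix \<omega> assume "\<omega> \<in> space (Om G)"
      then have sym: "transpose (cG2 G \<omega>) = cG2 G \<omega>" using H by (simp add: terminal_coeff_def symmetric_matrix_def)
      have Xv: "?X (t1 G) \<omega> = Z1 (t1 G) \<omega> + Y (t1 G) \<omega>" by (simp add: Y_def)
      have "(cG2 G \<omega> *v ?X (t1 G) \<omega>) \<bullet> ?X (t1 G) \<omega> = (cG2 G \<omega> *v Z1 (t1 G) \<omega>) \<bullet> Z1 (t1 G) \<omega>
          + (cG2 G \<omega> *v Y (t1 G) \<omega>) \<bullet> Y (t1 G) \<omega> + 2 * ((cG2 G \<omega> *v Z1 (t1 G) \<omega>) \<bullet> Y (t1 G) \<omega>)"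
        unfolding Xv by (rule quadratic_form_expand[OF sym])
      moreover have "(c\<delta> G \<omega> *v lam) \<bullet> ?X (t1 G) \<omega> = (c\<delta> G \<omega> *v lam) \<bullet> Z1 (t1 G) \<omega> + (c\<delta> G \<omega> *v lam) \<bullet> Y (t1 G) \<omega>"
        unfolding Xv by (rule inner_add_right)
      ultimately show "(cG2 G \<omega> *v ?X (t1 G) \<omega>) \<bullet> ?X (t1 G) \<omega> + 2 * ((c\<delta> G \<omega> *v lam) \<bullet> ?X (t1 G) \<omega>) = ?B0 \<omega> + ?B1 \<omega> + 2 * ?B2 \<omega>"
        by simp
    qed
    also have "\<dots> = expectation ?B0 + expectation ?B1 + 2 * expectation ?B2"
      by (simp only: Bochner_Integration.integral_add[OF Bochner_Integration.integrable_add[OF iB0 iB1] integrable_mult_right[OF iB2]]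
          Bochner_Integration.integral_add[OF iB0 iB1] integral_mult_right_zero)
    finally show ?thesis .
  qed
  have dual: "(\<integral>p. ?A2 p \<partial>N) + expectation ?B2 = 0" by (rule duality[OF sol w])
  have cost: "quadratic_cost G (cD2 G) (cE2 G) (cG2 G) Y w = (\<integral>p. ?A1 p \<partial>N) + expectation ?B1"
    unfolding quadratic_cost_eq[OF D H YC(1) w] using iD[OF F(1) F(1)] iE[OF w w] by simp
  have "lagrangian G X u1s lam v = quadratic_cost G (cD2 G) (cE2 G) (cG2 G) ?X v + 2 * (\<rho> G X u1s v \<bullet> lam) - 2 * (bnd G \<bullet> lam)"
    by (simp add: lagrangian_def J2_def inner_diff_left algebra_simps)
  also have "\<dots> = dual_value + quadratic_cost G (cD2 G) (cE2 G) (cG2 G) Y w"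
    unfolding quadratic_cost_eq[OF D H XC v] rho_inner[OF v] cost dual_value_def
    using N_part M_part dual by argo
  finally show ?thesis unfolding Y_def w_def .
qed

text \<open>Coercivity enters with an explicit \<open>\<epsilon>\<close>, so that the same constant
  serves different multipliers.\<close>

lemma lagrangian_lower_bound:
  assumes coercive: "\<And>w Y \<eta> \<eta>'. w \<in> L2F G \<Longrightarrow> follower_system G \<phi>1 0 w Y \<eta> \<eta>' \<Longrightarrow>
        quadratic_cost G (cD2 G) (cE2 G) (cG2 G) Y w \<ge> \<epsilon> * L2_inner (Om G) (t0 G) (t1 G) w w"
    and v: "v \<in> L2F G"
  shows "dual_value + \<epsilon> * (\<integral>p. (norm (v (fst p) (snd p) - u (fst p) (snd p)))\<^sup>2 \<partial>N) \<le> lagrangian G X u1s lam v"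
proof -
  have w: "(\<lambda>t \<omega>. v t \<omega> - u t \<omega>) \<in> L2F G" by (intro L2_process_diff v control_L2F)
  show ?thesis
    using coercive[OF w follower_variation[OF v]] unfolding lagrangian_expansion[OF v] L2_inner_self[OF w] by simp
qed

lemma AE_eq_state:
  assumes v: "v \<in> L2F G" and eq: "AE p in N. v (fst p) (snd p) = u (fst p) (snd p)"
  shows "AE p in N. X (u1s v) v (fst p) (snd p) = Z1 (fst p) (snd p)" "AE \<omega> in Om G. X (u1s v) v (t1 G) \<omega> = Z1 (t1 G) \<omega>"
    "AE p in N. \<psi>1 v (fst p) (snd p) = P2 (fst p) (snd p)"
proof -
  have w: "(\<lambda>t \<omega>. v t \<omega> - u t \<omega>) \<in> L2F G" by (intro L2_process_diff v control_L2F)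
  have "AE p in N. v (fst p) (snd p) - u (fst p) (snd p) = 0" using eq by eventually_elim simp
  from follower_system_zero[OF follower_variation[OF v] w this]
  show "AE p in N. X (u1s v) v (fst p) (snd p) = Z1 (fst p) (snd p)" "AE \<omega> in Om G. X (u1s v) v (t1 G) \<omega> = Z1 (t1 G) \<omega>"
    "AE p in N. \<psi>1 v (fst p) (snd p) = P2 (fst p) (snd p)"
    by (simp_all only: right_minus_eq)
qed

text \<open>Equality of the controls almost everywhere annihilates the second variation, including
  its terminal part, by uniqueness for the follower's system.\<close>

lemma lagrangian_eq_dual_value:
  assumes v: "v \<in> L2F G" and eq: "AE p in N. v (fst p) (snd p) = u (fst p) (snd p)"
  shows "lagrangian G X u1s lam v = dual_value"
proof -
  let ?Y = "\<lambda>t \<omega>. X (u1s v) v t \<omega> - Z1 t \<omega>" and ?w = "\<lambda>t \<omega>. v t \<omega> - u t \<omega>"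
  note z = AE_eq_state[OF v eq]
  have w: "?w \<in> L2F G" by (intro L2_process_diff v control_L2F)
  have Y: "?Y \<in> L2C G" using follower_variation[OF v] by (simp add: follower_system_def)
  have H: "terminal_coeff G (cG2 G)" using game by (simp add: lq_game_def)
  have 1: "(\<integral>p. (cD2 G (fst p) (snd p) *v ?Y (fst p) (snd p)) \<bullet> ?Y (fst p) (snd p) \<partial>N) = 0"
    using z(1) by (intro integral_eq_zero_AE) (auto elim: eventually_mono)
  have 2: "(\<integral>p. (cE2 G (fst p) (snd p) *v ?w (fst p) (snd p)) \<bullet> ?w (fst p) (snd p) \<partial>N) = 0"
    using eq by (intro integral_eq_zero_AE) (auto elim: eventually_mono)
  have 3: "expectation (\<lambda>\<omega>. (cG2 G \<omega> *v ?Y (t1 G) \<omega>) \<bullet> ?Y (t1 G) \<omega>) = 0"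
    using z(2) by (intro integral_eq_zero_AE) (auto elim: eventually_mono)
  show ?thesis
    unfolding lagrangian_expansion[OF v] quadratic_cost_eq[OF ess_bounded_coefficients(6,8) H Y w] 1 2 3 by simp
qed

text \<open>\<open>mu\<close> is unrelated to the multiplier \<open>lam\<close> behind
  \<open>u\<close>: the vector of constraint values is recovered from its pairings with all
  \<open>mu\<close>.\<close>

lemma rho_control:
  assumes v: "v \<in> L2F G" and eq: "AE p in N. v (fst p) (snd p) = u (fst p) (snd p)"
  shows "\<rho> G X u1s v \<bullet> mu = (\<integral>p. constraint_density mu Z1 k0 u p \<partial>N) + expectation (\<lambda>\<omega>. (c\<delta> G \<omega> *v mu) \<bullet> Z1 (t1 G) \<omega>)"
proof -
  have XC: "X (u1s v) v \<in> L2C G" using responseD(2)[OF v] by (simp add: follower_system_def)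
  note z = AE_eq_state[OF v eq]
  have "(\<integral>p. constraint_density mu (X (u1s v) v) (u1s v) v p \<partial>N) = (\<integral>p. constraint_density mu Z1 k0 u p \<partial>N)"
  proof (rule integral_cong_AE)
    show "constraint_density mu (X (u1s v) v) (u1s v) v \<in> borel_measurable N"
      by (intro borel_measurable_integrable integrable_constraint_density L2_continuous_L2_process XC responseD(1) v)
    show "constraint_density mu Z1 k0 u \<in> borel_measurable N"
      by (intro borel_measurable_integrable integrable_constraint_density halves_L2F k0_L2F control_L2F)
    show "AE p in N. constraint_density mu (X (u1s v) v) (u1s v) v p = constraint_density mu Z1 k0 u p"
      using z(1) z(3) eq response_AE[OF v] by eventually_elim (simp add: constraint_density_def)
  qed
  moreover have "expectation (\<lambda>\<omega>. (c\<delta> G \<omega> *v mu) \<bullet> X (u1s v) v (t1 G) \<omega>) = expectation (\<lambda>\<omega>. (c\<delta> G \<omega> *v mu) \<bullet> Z1 (t1 G) \<omega>)"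
  proof (rule integral_cong_AE)
    show "(\<lambda>\<omega>. (c\<delta> G \<omega> *v mu) \<bullet> X (u1s v) v (t1 G) \<omega>) \<in> borel_measurable (Om G)"
      by (intro borel_measurable_integrable integrable_inner sq_integrable_delta_apply L2_continuous_sq_integrable[OF XC t1_mem])
    show "(\<lambda>\<omega>. (c\<delta> G \<omega> *v mu) \<bullet> Z1 (t1 G) \<omega>) \<in> borel_measurable (Om G)"
      by (intro borel_measurable_integrable integrable_inner sq_integrable_delta_apply L2_continuous_sq_integrable[OF halves_L2C(1) t1_mem])
    show "AE \<omega> in Om G. (c\<delta> G \<omega> *v mu) \<bullet> X (u1s v) v (t1 G) \<omega> = (c\<delta> G \<omega> *v mu) \<bullet> Z1 (t1 G) \<omega>"
      using z(2) by eventually_elim simp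
  qed
  ultimately show ?thesis unfolding rho_inner[OF v] by simp
qed

end


section \<open>The constraint values and the dual problem\<close>

text \<open>This is the drift of \<open>Z \<bullet> (\<psi>2 mu)\<close> in the product rule. The
  terms with \<open>A\<close> and \<open>C\<close> cancel by transposition. Wherever
  \<open>f *v z\<close> occurs it is replaced by \<open>- p - ps *v la\<close>; the terms with
  \<open>F\<close> then reduce to \<open>F\<close> between two copies of \<open>ps\<close>, and the
  term with \<open>f ** g\<close> becomes the pairing of \<open>p + ps *v la\<close> with
  \<open>g *v mu\<close>.\<close>

lemma adjoint_density:
  fixes A F C f :: "real^'k^'k" and ps ps' h g :: "real^'l^'k" and z p :: "real^'k" and la mu :: "real^'l"
  assumes sym: "transpose f = f" "transpose F = F" and p: "p = - (f *v z) - ps *v la"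
  shows "z \<bullet> ((- ((transpose A - f ** F) ** ps + transpose C ** ps' + h + f ** g)) *v mu)
      + (A *v z + F *v p + g *v la) \<bullet> (ps *v mu) + (C *v z) \<bullet> (ps' *v mu) =
    (p + ps *v la) \<bullet> (g *v mu) - z \<bullet> (h *v mu) + (g *v la) \<bullet> (ps *v mu) - (F *v (ps *v la)) \<bullet> (ps *v mu)"
proof -
  have fz: "f *v z = - p - ps *v la" using p by simp
  have "z \<bullet> (transpose A *v (ps *v mu)) = (A *v z) \<bullet> (ps *v mu)" "z \<bullet> (transpose C *v (ps' *v mu)) = (C *v z) \<bullet> (ps' *v mu)"
    unfolding inner_matrix_adjoint[of A] inner_matrix_adjoint[of C] by simp_all
  moreover have adj: "z \<bullet> (f *v y) = (f *v z) \<bullet> y" "(F *v x) \<bullet> y = x \<bullet> (F *v y)" for x y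
    unfolding inner_matrix_adjoint[of f] inner_matrix_adjoint[of F] sym by simp_all
  moreover have "(- ((transpose A - f ** F) ** ps + transpose C ** ps' + h + f ** g)) *v mu =
      - (transpose A *v (ps *v mu)) + f *v (F *v (ps *v mu)) - transpose C *v (ps' *v mu) - h *v mu - f *v (g *v mu)"
    by (simp add: matrix_vector_mult_uminus matrix_vector_mult_add_rdistrib matrix_vector_mult_diff_rdistrib
        matrix_vector_mul_assoc[symmetric])
  ultimately show ?thesis
    by (simp add: inner_add_left inner_add_right inner_diff_left inner_diff_right adj(1) fz)
qed

context hamiltonian_problem
begin

lemma ess_bounded_blocks: "ess_bounded (Abar G \<phi>1)" "ess_bounded (Fbar G)" "ess_bounded (Cbar G)"
  unfolding Abar_def[abs_def] Fbar_def[abs_def] Cbar_def[abs_def]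
  by (intro ess_bounded_block ess_bounded_intros ess_bounded_zero ess_bounded_uminus)+

lemma gvec_L2F: "gvec G \<in> L2F G"
  unfolding gvec_def[abs_def]
  by (intro L2_process_vstack L2_process_uminus L2_process_matrix_mult ess_bounded_intros data_L2F)

lemma hvec_L2F: "hvec G \<phi>1 \<in> L2F G"
  unfolding hvec_def[abs_def]
  by (intro L2_process_vstack L2_process_diff L2_process_matrix_mult ess_bounded_intros data_L2F)

lemma AE_symmetric_blocks:
  "AE p in N. transpose (\<phi>2 (fst p) (snd p)) = \<phi>2 (fst p) (snd p) \<and> transpose (Fbar G (fst p) (snd p)) = Fbar G (fst p) (snd p)"
  using AE_paths_N[OF phi2(2)] AE_symmetric
proof eventually_elim
  case (elim p)
  have "transpose (- S1 G (fst p) (snd p)) = - S1 G (fst p) (snd p)"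
    using elim(2) transpose_diff[of 0 "S1 G (fst p) (snd p)"] by simp
  then show ?case using elim by (simp add: symmetric_matrix_def Fbar_def transpose_block)
qed

text \<open>The blocks \<open>hvec\<close> and \<open>gvec\<close> are made for this identity:
  inserting the responses \<open>k0\<close> and \<open>u\<close> turns the constraint into a pairing
  with \<open>Z\<close> and \<open>P\<close>. The remaining term, bilinear in
  \<open>c\<gamma>\<close>, stems from the explicit \<open>lam\<close> in the control.\<close>

lemma constraint_density_eq:
  "AE p in N. constraint_density mu Z1 k0 u p = Z (fst p) (snd p) \<bullet> (hvec G \<phi>1 (fst p) (snd p) *v mu)
     - P (fst p) (snd p) \<bullet> (gvec G (fst p) (snd p) *v mu)
     - (c\<gamma> G (fst p) (snd p) *v mu) \<bullet> (invE2 G (fst p) (snd p) *v (c\<gamma> G (fst p) (snd p) *v lam))"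
  using control_formula AE_symmetric
proof eventually_elim
  case (elim p)
  let ?z1 = "upper (Z (fst p) (snd p))" and ?z2 = "lower (Z (fst p) (snd p))" and ?p1 = "upper (P (fst p) (snd p))" and ?p2 = "lower (P (fst p) (snd p))"
  let ?f = "\<phi>1 (fst p) (snd p)" and ?B1 = "cB1 G (fst p) (snd p)" and ?B2 = "cB2 G (fst p) (snd p)"
    and ?I1 = "invE1 G (fst p) (snd p)" and ?I2 = "invE2 G (fst p) (snd p)"
  let ?al = "c\<alpha> G (fst p) (snd p) *v mu" and ?be = "c\<beta> G (fst p) (snd p) *v mu" and ?ga = "c\<gamma> G (fst p) (snd p) *v mu"
  have sym: "transpose ?f = ?f" "transpose ?I1 = ?I1" "transpose ?I2 = ?I2" using elim(2) by auto
  have 1: "?be \<bullet> ((?I1 ** transpose ?B1) *v x) = x \<bullet> (?B1 *v (?I1 *v ?be))" for x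
    unfolding inner_commute[of x] inner_matrix_adjoint sym by (simp only: matrix_vector_mul_assoc)
  have 2: "?ga \<bullet> (?I2 *v (transpose ?B2 *v x)) = x \<bullet> (?B2 *v (?I2 *v ?ga))" for x
    unfolding inner_commute[of x] inner_matrix_adjoint sym ..
  have 3: "(?f *v x) \<bullet> y = x \<bullet> (?f *v y)" for x y unfolding inner_matrix_adjoint[of ?f] sym ..
  have Zh: "Z (fst p) (snd p) \<bullet> (hvec G \<phi>1 (fst p) (snd p) *v mu) = ?z1 \<bullet> (?al - ?f *v (?B1 *v (?I1 *v ?be))) + ?z2 \<bullet> (?f *v (?B2 *v (?I2 *v ?ga)))"
    unfolding inner_upper_lower[of "Z (fst p) (snd p)"] hvec_def
    by (simp add: upper_vstack_mult lower_vstack_mult matrix_vector_mult_diff_rdistrib matrix_vector_mul_assoc[symmetric])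
  have Pg: "P (fst p) (snd p) \<bullet> (gvec G (fst p) (snd p) *v mu) = - (?p1 \<bullet> (?B2 *v (?I2 *v ?ga))) + ?p2 \<bullet> (?B1 *v (?I1 *v ?be))"
    unfolding inner_upper_lower[of "P (fst p) (snd p)"] gvec_def
    by (simp add: upper_vstack_mult lower_vstack_mult matrix_vector_mult_uminus matrix_vector_mul_assoc[symmetric])
  have r: "?be \<bullet> (- ((?I1 ** transpose ?B1) *v (?f *v ?z1 + ?p2))) = - (?z1 \<bullet> (?f *v (?B1 *v (?I1 *v ?be)))) - ?p2 \<bullet> (?B1 *v (?I1 *v ?be))"
    unfolding inner_minus_right 1 inner_add_left 3 by simp
  have c: "?ga \<bullet> u (fst p) (snd p) = ?z2 \<bullet> (?f *v (?B2 *v (?I2 *v ?ga))) + ?p1 \<bullet> (?B2 *v (?I2 *v ?ga))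
      - ?ga \<bullet> (?I2 *v (c\<gamma> G (fst p) (snd p) *v lam))"
    unfolding elim(1) matrix_vector_mult_diff_distrib inner_diff_right 2 inner_add_left 3 ..
  show ?case
    unfolding constraint_density_def Zh Pg r c by (simp add: inner_diff_right inner_commute)
qed

definition S0_density :: "real \<Rightarrow> 'w \<Rightarrow> real^'l^'l" where
  "S0_density t \<omega> = transpose (\<psi>2 t \<omega>) ** gvec G t \<omega> + transpose (gvec G t \<omega>) ** \<psi>2 t \<omega>
     - transpose (c\<gamma> G t \<omega>) ** invE2 G t \<omega> ** c\<gamma> G t \<omega> - transpose (\<psi>2 t \<omega>) ** Fbar G t \<omega> ** \<psi>2 t \<omega>"

lemma S0_density_inner:
  "(S0_density t \<omega> *v la) \<bullet> mu = (gvec G t \<omega> *v la) \<bullet> (\<psi>2 t \<omega> *v mu) + (\<psi>2 t \<omega> *v la) \<bullet> (gvec G t \<omega> *v mu)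
    - (c\<gamma> G t \<omega> *v mu) \<bullet> (invE2 G t \<omega> *v (c\<gamma> G t \<omega> *v la)) - (Fbar G t \<omega> *v (\<psi>2 t \<omega> *v la)) \<bullet> (\<psi>2 t \<omega> *v mu)"
proof -
  have eq: "S0_density t \<omega> *v la = transpose (\<psi>2 t \<omega>) *v (gvec G t \<omega> *v la) + transpose (gvec G t \<omega>) *v (\<psi>2 t \<omega> *v la)
    - transpose (c\<gamma> G t \<omega>) *v (invE2 G t \<omega> *v (c\<gamma> G t \<omega> *v la)) - transpose (\<psi>2 t \<omega>) *v (Fbar G t \<omega> *v (\<psi>2 t \<omega> *v la))"
    unfolding S0_density_def matrix_vector_mult_add_rdistrib matrix_vector_mult_diff_rdistrib
    by (simp only: matrix_vector_mul_assoc matrix_mul_assoc)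
  show ?thesis unfolding eq inner_add_left inner_diff_left inner_transpose_matrix by (simp only: inner_commute)
qed

lemma integrable_S0_density: "integrable N (\<lambda>p. S0_density (fst p) (snd p))"
proof -
  have F: "\<psi>2 \<in> L2F G" by (rule L2_continuous_L2_process[OF psi2D(1)])
  have L: "(\<lambda>t \<omega>. invE2 G t \<omega> ** c\<gamma> G t \<omega>) \<in> L2F G" "(\<lambda>t \<omega>. Fbar G t \<omega> ** \<psi>2 t \<omega>) \<in> L2F G"
    by (intro L2_process_matrix_mult ess_bounded_intros ess_bounded_blocks data_L2F F)+
  have T: "(\<lambda>t \<omega>. transpose (\<psi>2 t \<omega>)) \<in> L2F G" "(\<lambda>t \<omega>. transpose (gvec G t \<omega>)) \<in> L2F G" "(\<lambda>t \<omega>. transpose (c\<gamma> G t \<omega>)) \<in> L2F G"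
    by (intro L2_process_bounded_linear[OF bounded_linear_transpose] F gvec_L2F data_L2F)+
  note m = integrable_bounded_bilinear[OF bounded_bilinear_matrix_mult]
  show ?thesis
    \<comment> \<open>Bracketing to the right makes every summand a product of two square integrable
      factors.\<close>
    unfolding S0_density_def matrix_mul_assoc[symmetric, of "transpose _"]
    by (intro Bochner_Integration.integrable_add Bochner_Integration.integrable_diff m[OF L2F_N[OF T(1)] L2F_N[OF gvec_L2F]]
        m[OF L2F_N[OF T(2)] L2F_N[OF F]] m[OF L2F_N[OF T(3)] L2F_N[OF L(1)]] m[OF L2F_N[OF T(1)] L2F_N[OF L(2)]])
qed

lemma bounded_linear_form: "bounded_linear (\<lambda>A :: real^'c::finite^'d::finite. (A *v x) \<bullet> y)"
  by (rule bounded_linear_compose[OF bounded_linear_inner_left bounded_linear_matrix_apply])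

lemma S0_inner: "(S0 G \<psi>2 *v la) \<bullet> mu = - (\<integral>p. (S0_density (fst p) (snd p) *v la) \<bullet> mu \<partial>N)"
proof -
  have "S0 G \<psi>2 = - (\<integral>p. S0_density (fst p) (snd p) \<partial>N)"
    unfolding S0_def using integral_N(1)[OF integrable_S0_density] by (simp add: S0_density_def)
  then show ?thesis
    using integral_bounded_linear[OF bounded_linear_form integrable_S0_density] by (simp add: matrix_vector_mult_uminus)
qed

text \<open>The product rule is applied to \<open>Z\<close> and \<open>\<psi>2 mu\<close>. The
  terminal value yields the terminal part of the constraint, the initial value yields the mean of
  \<open>\<psi>2\<close> at \<open>t0 G\<close>, and the drift added to
  \<open>constraint_density\<close> is \<open>S0_density\<close>, whose integral is
  \<open>- S0\<close>, because the terms with \<open>P\<close> and \<open>hvec\<close>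
  cancel.\<close>

lemma rho_formula:
  assumes v: "v \<in> L2F G" and eq: "AE p in N. v (fst p) (snd p) = u (fst p) (snd p)"
  shows "\<rho> G X u1s v = (\<integral>\<omega>. transpose (\<psi>2 (t0 G) \<omega>) \<partial>Om G) *v vstack (xi G) 0 - S0 G \<psi>2 *v lam"
proof (rule vector_eq_ldot[THEN iffD1, rule_format])
  fix mu :: "real^'l"
  let ?b = "\<lambda>t \<omega>. - ((transpose (Abar G \<phi>1 t \<omega>) - \<phi>2 t \<omega> ** Fbar G t \<omega>) ** \<psi>2 t \<omega>
                + transpose (Cbar G t \<omega>) ** \<psi>2' t \<omega> + hvec G \<phi>1 t \<omega> + \<phi>2 t \<omega> ** gvec G t \<omega>)"
  let ?bZ = "\<lambda>t \<omega>. Abar G \<phi>1 t \<omega> *v Z t \<omega> + Fbar G t \<omega> *v P t \<omega> + gvec G t \<omega> *v lam"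
  let ?pm = "\<lambda>t \<omega>. \<psi>2 t \<omega> *v mu"
  have ZF: "Z \<in> L2F G" "P \<in> L2F G" "\<psi>2 \<in> L2F G" by (intro L2_continuous_L2_process hamD psi2D)+
  have eqZ: "itod G Z ?bZ (\<lambda>t \<omega>. Cbar G t \<omega> *v Z t \<omega>)" using ham by (simp add: hamiltonian_system_def)
  have "itod G \<psi>2 ?b \<psi>2'" using psi2 by (simp add: bsde_psi2_def)
  note eqp = ito_differential_bounded_linear[OF bounded_linear_matrix_apply[of mu] brownian_interval_axioms this]
  have b: "?b \<in> L2F G"
    by (intro L2_process_uminus L2_process_add L2_process_matrix_mult ess_bounded_diff ess_bounded_transpose ess_bounded_matrix_mult
        ess_bounded_blocks ess_bounded_phi2 psi2D ZF gvec_L2F hvec_L2F)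
  have bm: "(\<lambda>t \<omega>. ?b t \<omega> *v mu) \<in> L2F G" by (rule L2_process_bounded_linear[OF bounded_linear_matrix_apply b])
  have bZ: "?bZ \<in> L2F G"
    by (intro L2_process_add L2_process_matrix_vector_mult ess_bounded_blocks ZF L2_process_bounded_linear[OF bounded_linear_matrix_apply] gvec_L2F)
  have pm: "?pm \<in> L2C G" by (rule L2_continuous_bounded_linear[OF bounded_linear_matrix_apply psi2D(1)])
  have CZ: "(\<lambda>t \<omega>. Cbar G t \<omega> *v Z t \<omega>) \<in> L2F G" by (intro L2_process_matrix_vector_mult ess_bounded_blocks ZF)
  have pm': "(\<lambda>t \<omega>. \<psi>2' t \<omega> *v mu) \<in> L2F G" by (rule L2_process_bounded_linear[OF bounded_linear_matrix_apply psi2D(2)])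
  let ?I = "\<lambda>p. Z (fst p) (snd p) \<bullet> (?b (fst p) (snd p) *v mu) + ?bZ (fst p) (snd p) \<bullet> ?pm (fst p) (snd p)
     + (Cbar G (fst p) (snd p) *v Z (fst p) (snd p)) \<bullet> (\<psi>2' (fst p) (snd p) *v mu)"
  have iI: "integrable N ?I"
    by (intro Bochner_Integration.integrable_add integrable_inner L2F_N[OF bm] L2F_N[OF bZ] L2F_N[OF ZF(1)] L2C_N[OF pm] L2F_N[OF CZ] L2F_N[OF pm'])
  have full: "(\<integral>p. (if fst p \<le> t1 G then f p else 0) \<partial>N) = (\<integral>p. f p \<partial>N)" for f :: "real \<times> 'w \<Rightarrow> real"
    by (intro Bochner_Integration.integral_cong refl) (auto simp: space_N)
  have ito: "expectation (\<lambda>\<omega>. Z (t1 G) \<omega> \<bullet> ?pm (t1 G) \<omega>) = expectation (\<lambda>\<omega>. Z (t0 G) \<omega> \<bullet> ?pm (t0 G) \<omega>) + (\<integral>p. ?I p \<partial>N)"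
    using ito_product[OF hamD(1) eqZ bZ pm eqp bm t1_mem] by (simp only: full)
  have final: "expectation (\<lambda>\<omega>. Z (t1 G) \<omega> \<bullet> ?pm (t1 G) \<omega>) = expectation (\<lambda>\<omega>. (c\<delta> G \<omega> *v mu) \<bullet> Z1 (t1 G) \<omega>)"
  proof (rule integral_cong_AE)
    show "AE \<omega> in Om G. Z (t1 G) \<omega> \<bullet> ?pm (t1 G) \<omega> = (c\<delta> G \<omega> *v mu) \<bullet> Z1 (t1 G) \<omega>"
      using psi2D(3)
    proof eventually_elim
      case (elim \<omega>)
      show ?case unfolding elim inner_upper_lower[of "Z (t1 G) \<omega>"] by (simp add: upper_vstack_mult lower_vstack_mult inner_commute)
    qed
    show "(\<lambda>\<omega>. Z (t1 G) \<omega> \<bullet> ?pm (t1 G) \<omega>) \<in> borel_measurable (Om G)"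
      by (intro borel_measurable_integrable integrable_inner L2_continuous_sq_integrable[OF hamD(1) t1_mem] L2_continuous_sq_integrable[OF pm t1_mem])
    show "(\<lambda>\<omega>. (c\<delta> G \<omega> *v mu) \<bullet> Z1 (t1 G) \<omega>) \<in> borel_measurable (Om G)"
      by (intro borel_measurable_integrable integrable_inner sq_integrable_delta_apply L2_continuous_sq_integrable[OF halves_L2C(1) t1_mem])
  qed
  have init: "expectation (\<lambda>\<omega>. Z (t0 G) \<omega> \<bullet> ?pm (t0 G) \<omega>) = ((\<integral>\<omega>. transpose (\<psi>2 (t0 G) \<omega>) \<partial>Om G) *v vstack (xi G) 0) \<bullet> mu"
  proof -
    have s: "sq_integrable (Om G) (\<lambda>\<omega>. transpose (\<psi>2 (t0 G) \<omega>))"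
      by (rule sq_integrable_bounded_linear[OF bounded_linear_transpose L2_continuous_sq_integrable[OF psi2D(1) t0_mem]])
    have i: "integrable (Om G) (\<lambda>\<omega>. transpose (\<psi>2 (t0 G) \<omega>))"
      by (rule sq_integrable_integrable[OF s])
    have "expectation (\<lambda>\<omega>. Z (t0 G) \<omega> \<bullet> ?pm (t0 G) \<omega>) = expectation (\<lambda>\<omega>. (transpose (\<psi>2 (t0 G) \<omega>) *v vstack (xi G) 0) \<bullet> mu)"
    proof (rule integral_cong_AE)
      show "AE \<omega> in Om G. Z (t0 G) \<omega> \<bullet> ?pm (t0 G) \<omega> = (transpose (\<psi>2 (t0 G) \<omega>) *v vstack (xi G) 0) \<bullet> mu"
        using hamD(4)
      proof eventually_elim
        case (elim \<omega>)
        show ?case unfolding elim inner_transpose_matrix by (rule inner_commute)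
      qed
      show "(\<lambda>\<omega>. Z (t0 G) \<omega> \<bullet> ?pm (t0 G) \<omega>) \<in> borel_measurable (Om G)"
        by (intro borel_measurable_integrable integrable_inner L2_continuous_sq_integrable[OF hamD(1) t0_mem] L2_continuous_sq_integrable[OF pm t0_mem])
      show "(\<lambda>\<omega>. (transpose (\<psi>2 (t0 G) \<omega>) *v vstack (xi G) 0) \<bullet> mu) \<in> borel_measurable (Om G)"
        by (rule borel_measurable_integrable[OF integrable_bounded_linear[OF bounded_linear_form i]])
    qed
    then show ?thesis using integral_bounded_linear[OF bounded_linear_form i] by simp
  qed
  have iS: "integrable N (\<lambda>p. (S0_density (fst p) (snd p) *v lam) \<bullet> mu)"
    by (rule integrable_bounded_linear[OF bounded_linear_form integrable_S0_density])
  note ic = integrable_constraint_density[OF halves_L2F(1) k0_L2F control_L2F, of mu]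
  have "(\<integral>p. constraint_density mu Z1 k0 u p \<partial>N) + (\<integral>p. ?I p \<partial>N) = (\<integral>p. constraint_density mu Z1 k0 u p + ?I p \<partial>N)"
    by (rule Bochner_Integration.integral_add[OF ic iI, symmetric])
  also have "\<dots> = (\<integral>p. (S0_density (fst p) (snd p) *v lam) \<bullet> mu \<partial>N)"
  proof (rule integral_cong_AE)
    show "(\<lambda>p. constraint_density mu Z1 k0 u p + ?I p) \<in> borel_measurable N"
      by (rule borel_measurable_integrable[OF Bochner_Integration.integrable_add[OF ic iI]])
    show "(\<lambda>p. (S0_density (fst p) (snd p) *v lam) \<bullet> mu) \<in> borel_measurable N"
      by (rule borel_measurable_integrable[OF iS])
    show "AE p in N. constraint_density mu Z1 k0 u p + ?I p = (S0_density (fst p) (snd p) *v lam) \<bullet> mu"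
      using constraint_density_eq[of mu] AE_symmetric_blocks P_AE
    proof eventually_elim
      case (elim p)
      have I: "?I p = (P (fst p) (snd p) + \<psi>2 (fst p) (snd p) *v lam) \<bullet> (gvec G (fst p) (snd p) *v mu)
        - Z (fst p) (snd p) \<bullet> (hvec G \<phi>1 (fst p) (snd p) *v mu) + (gvec G (fst p) (snd p) *v lam) \<bullet> (\<psi>2 (fst p) (snd p) *v mu)
        - (Fbar G (fst p) (snd p) *v (\<psi>2 (fst p) (snd p) *v lam)) \<bullet> (\<psi>2 (fst p) (snd p) *v mu)"
        by (rule adjoint_density) (use elim in auto)
      have combine: "c = a - b - e \<Longrightarrow> i = b + d - a + f - g \<Longrightarrow> c + i = f + d - e - g" for a b c d e f g i :: real
        by simp
      show ?case
        unfolding S0_density_inner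
        by (rule combine[OF elim(1) I[unfolded inner_add_left[of "P (fst p) (snd p)"]]])
    qed
  qed
  finally have "(\<integral>p. constraint_density mu Z1 k0 u p \<partial>N) + (\<integral>p. ?I p \<partial>N) = - ((S0 G \<psi>2 *v lam) \<bullet> mu)"
    unfolding S0_inner by simp
  then have "\<rho> G X u1s v \<bullet> mu = ((\<integral>\<omega>. transpose (\<psi>2 (t0 G) \<omega>) \<partial>Om G) *v vstack (xi G) 0 - S0 G \<psi>2 *v lam) \<bullet> mu"
    unfolding rho_control[OF v eq] inner_diff_left init[symmetric] using ito final by argo
  then show "mu \<bullet> \<rho> G X u1s v = mu \<bullet> ((\<integral>\<omega>. transpose (\<psi>2 (t0 G) \<omega>) \<partial>Om G) *v vstack (xi G) 0 - S0 G \<psi>2 *v lam)"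
    by (simp only: inner_commute)
qed

end

section \<open>Sufficiency of the KKT condition and the dual problem\<close>

theorem theorem4p4:
  fixes G :: "('w, 'n::finite, 'm::finite, 'l::finite) game"
    and X :: "('w, 'n, 'm) state_map"
    and u1s :: "('w, 'm) control \<Rightarrow> ('w, 'm) control"
    and \<psi>1 \<psi>1' :: "('w, 'm) control \<Rightarrow> ('w, real^'n) process"
    and \<phi>1 \<phi>1' :: "('w, real^'n^'n) process"
    and \<phi>2 \<phi>2' :: "('w, real^('n + 'n)^('n + 'n)) process"
    and \<psi>2 \<psi>2' :: "('w, real^'l^('n + 'n)) process"
    and Z P Q :: "real^'l \<Rightarrow> ('w, real^('n + 'n)) process"
    and Xbar pbar qbar :: "'l \<Rightarrow> ('w, real^'n) process"
    and u2s :: "real^'l \<Rightarrow> ('w, 'm) control"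
    and u2hat :: "('w, 'm) control"
    and lam :: "real^'l"
  assumes game: "lq_game G"
    and state: "\<And>u1 u2. u1 \<in> L2F G \<Longrightarrow> u2 \<in> L2F G \<Longrightarrow> state_solution G (xi G) u1 u2 (X u1 u2)"
    and coercivity1: "coercivity1 G"
    and phi1: "riccati1 G \<phi>1 \<phi>1'"
    and response: "follower_response G X \<phi>1 u1s \<psi>1 \<psi>1'"
    and coercivity2: "coercivity2 G \<phi>1"
    and phi2: "riccati2_unique G \<phi>1 \<phi>2 \<phi>2'"
    and psi2: "bsde_psi2 G \<phi>1 \<phi>2 \<psi>2 \<psi>2'"
    and ZPQ: "\<And>mu. mu \<in> U0 G \<Longrightarrow> hamiltonian_system G \<phi>1 mu (Z mu) (P mu) (Q mu)"
    and P_eq: "\<And>mu. mu \<in> U0 G \<Longrightarrow> indistinguishable (Om G) (t0 G) (t1 G) (P mu)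
                 (\<lambda>t \<omega>. - (\<phi>2 t \<omega> *v Z mu t \<omega>) - \<psi>2 t \<omega> *v mu)"
    and u2s: "\<And>mu. u2s mu = feedback G \<phi>1 \<phi>2 \<psi>2 (Z mu) mu"
    and slater_sys: "\<And>i. slater_system G \<phi>1 i (Xbar i) (pbar i) (qbar i)"
    and slater: "slater G X u1s \<phi>1 Xbar pbar"
    and u2hat: "progressive (Om G) (BM G) (t0 G) (t1 G) u2hat"
    and kkt: "kkt G X u1s u2s u2hat lam"
  shows "leader_optimal G X u1s u2hat \<and>
         (AE \<omega> in Om G. \<rho> G X u1s (u2s lam) =
            (\<integral>\<omega>'. transpose (\<psi>2 (t0 G) \<omega>') \<partial>Om G) *v Z lam (t0 G) \<omega> - S0 G \<psi>2 *v lam) \<and>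
         (positive_definite (S0 G \<psi>2) \<longrightarrow> unique_dual_solution G X u1s u2s lam)"
proof -
  interpret leader_problem G X u1s \<psi>1 \<psi>1' \<phi>1 \<phi>1'
    by unfold_locales (use game state coercivity1 phi1 response coercivity2 in auto)
  have phi2': "\<phi>2 \<in> LinfC G" "AE \<omega> in Om G. \<forall>t\<in>{t0 G..t1 G}. symmetric_matrix (\<phi>2 t \<omega>)"
    using phi2 by (auto simp: riccati2_unique_def riccati2_def symmetric_pair_def)
  have psi2_L2F: "\<psi>2 \<in> L2F G" using psi2 L2_continuous_L2_process by (auto simp: bsde_psi2_def)
  have u2s_L2F: "u2s mu \<in> L2F G" if "mu \<in> U0 G" for mu
    unfolding u2s using ZPQ[OF that] psi2_L2F
    by (intro feedback_L2F' ess_bounded_Linf phi2') (auto simp: hamiltonian_system_def intro: L2_continuous_L2_process)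
  \<comment> \<open>\<open>v\<close> ranges over all progressive processes that agree almost
    everywhere with the feedback control, so that \<open>u2hat\<close> is covered.\<close>
  have H: "hamiltonian_problem G X u1s \<psi>1 \<psi>1' \<phi>1 \<phi>1' \<phi>2 \<psi>2 \<psi>2' mu (Z mu) (P mu) (Q mu) v"
    if "mu \<in> U0 G" "progressive (Om G) (BM G) (t0 G) (t1 G) v" "process_eq (Om G) (t0 G) (t1 G) v (u2s mu)" for mu v
    using phi2' psi2 ZPQ[OF that(1)] P_eq[OF that(1)] that(2,3) unfolding u2s by unfold_locales auto
  have refl: "process_eq (Om G) (t0 G) (t1 G) v v" for v :: "('w, 'm) control" by (simp add: process_eq_def)
  have Hs: "hamiltonian_problem G X u1s \<psi>1 \<psi>1' \<phi>1 \<phi>1' \<phi>2 \<psi>2 \<psi>2' mu (Z mu) (P mu) (Q mu) (u2s mu)" if "mu \<in> U0 G" for mu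
    using u2s_L2F[OF that] by (intro H[OF that] refl) (simp add: L2_process_iff)
  have lam: "lam \<in> U0 G" using kkt by (auto simp: kkt_def U0_def)
  have hat_eq: "process_eq (Om G) (t0 G) (t1 G) u2hat (u2s lam)" using kkt by (simp add: kkt_def)
  interpret hat: hamiltonian_problem G X u1s \<psi>1 \<psi>1' \<phi>1 \<phi>1' \<phi>2 \<psi>2 \<psi>2' lam "Z lam" "P lam" "Q lam" u2hat
    by (rule H[OF lam u2hat hat_eq])
  have ulam: "u2s lam \<in> L2F G" by (rule u2s_L2F[OF lam])
  have hat_AE: "AE p in N. u2s lam (fst p) (snd p) = u2hat (fst p) (snd p)"
    using hat.control_AE unfolding u2s by (auto elim: eventually_mono)
  have rho_lam: "\<rho> G X u1s (u2s lam) = (\<integral>\<omega>. transpose (\<psi>2 (t0 G) \<omega>) \<partial>Om G) *v vstack (xi G) 0 - S0 G \<psi>2 *v lam"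
    by (rule hat.rho_formula[OF ulam hat_AE])
  \<comment> \<open>The KKT condition speaks of \<open>u2s lam\<close>, feasibility of
    \<open>u2hat\<close>; \<open>rho_formula\<close> assigns the same value to both.\<close>
  have rho_hat: "\<rho> G X u1s u2hat = \<rho> G X u1s (u2s lam)"
    unfolding rho_lam by (rule hat.rho_formula[OF hat.control_L2F]) simp
  obtain \<epsilon> where \<epsilon>: "\<epsilon> > 0" "\<And>w Y \<eta> \<eta>'. w \<in> L2F G \<Longrightarrow> follower_system G \<phi>1 0 w Y \<eta> \<eta>' \<Longrightarrow>
        quadratic_cost G (cD2 G) (cE2 G) (cG2 G) Y w \<ge> \<epsilon> * L2_inner (Om G) (t0 G) (t1 G) w w"
    using coercivity2 unfolding coercivity2_def by blast
  \<comment> \<open>Complementary slackness: for each constraint one of the two factors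
    vanishes.\<close>
  have slack_zero: "(\<rho> G X u1s (u2s lam) - bnd G) \<bullet> lam = 0"
    unfolding inner_vec_def
  proof (intro sum.neutral ballI)
    fix i
    show "(\<rho> G X u1s (u2s lam) - bnd G) $ i \<bullet> lam $ i = 0"
      using kkt by (cases "i \<in> ineqs G") (auto simp: kkt_def mult.commute)
  qed
  \<comment> \<open>Weak duality for an arbitrary multiplier: at a feasible control the penalty is
    never positive.\<close>
  have slack_nonpos: "(\<rho> G X u1s v - bnd G) \<bullet> mu \<le> 0"
    if "mu \<in> U0 G" "\<And>i. i \<in> ineqs G \<Longrightarrow> \<rho> G X u1s v $ i \<le> bnd G $ i" "\<And>i. i \<notin> ineqs G \<Longrightarrow> \<rho> G X u1s v $ i = bnd G $ i" for v mu
    unfolding inner_vec_def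
  proof (intro sum_nonpos)
    fix i
    show "(\<rho> G X u1s v - bnd G) $ i \<bullet> mu $ i \<le> 0"
      using that by (cases "i \<in> ineqs G") (auto simp: U0_def intro: mult_nonpos_nonneg)
  qed
  have feasible: "\<And>i. i \<in> ineqs G \<Longrightarrow> \<rho> G X u1s (u2s lam) $ i \<le> bnd G $ i" "\<And>i. i \<notin> ineqs G \<Longrightarrow> \<rho> G X u1s (u2s lam) $ i = bnd G $ i"
    using kkt by (auto simp: kkt_def)
  have "leader_optimal G X u1s u2hat"
    unfolding leader_optimal_def
  proof (intro conjI ballI)
    show "u2hat \<in> U2ad G X u1s" unfolding U2ad_def using hat.control_L2F feasible by (auto simp: rho_hat)
    fix v assume "v \<in> U2ad G X u1s"
    then have v: "v \<in> L2F G" and con: "\<And>i. i \<in> ineqs G \<Longrightarrow> \<rho> G X u1s v $ i \<le> bnd G $ i" "\<And>i. i \<notin> ineqs G \<Longrightarrow> \<rho> G X u1s v $ i = bnd G $ i"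
      by (auto simp: U2ad_def)
    have "J2 G (X (u1s u2hat) u2hat) (u1s u2hat) u2hat = lagrangian G X u1s lam u2hat"
      using slack_zero by (simp add: lagrangian_def rho_hat)
    also have "\<dots> = hat.dual_value" by (rule hat.lagrangian_eq_dual_value[OF hat.control_L2F]) simp
    also have "\<dots> \<le> hat.dual_value + \<epsilon> * (\<integral>p. (norm (v (fst p) (snd p) - u2hat (fst p) (snd p)))\<^sup>2 \<partial>N)" using \<epsilon>(1) by simp
    also have "\<dots> \<le> lagrangian G X u1s lam v" by (rule hat.lagrangian_lower_bound[OF \<epsilon>(2) v])
    also have "\<dots> \<le> J2 G (X (u1s v) v) (u1s v) v"
      using slack_nonpos[OF lam con] by (simp add: lagrangian_def)
    finally show "J2 G (X (u1s u2hat) u2hat) (u1s u2hat) u2hat \<le> J2 G (X (u1s v) v) (u1s v) v" .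
  qed
  moreover have "AE \<omega> in Om G. \<rho> G X u1s (u2s lam) =
      (\<integral>\<omega>'. transpose (\<psi>2 (t0 G) \<omega>') \<partial>Om G) *v Z lam (t0 G) \<omega> - S0 G \<psi>2 *v lam"
    using hat.hamD(4) by eventually_elim (simp add: rho_lam)
  moreover have "unique_dual_solution G X u1s u2s lam" if pd: "positive_definite (S0 G \<psi>2)"
  proof -
    \<comment> \<open>The Lagrangian for \<open>mu\<close> is evaluated at \<open>u2s lam\<close>:
      its expansion around \<open>u2s mu\<close> bounds it from below with the coercive term, while
      feasibility and complementary slackness bound it from above.\<close>
    have gap: "lagrangian G X u1s mu (u2s mu) + \<epsilon> * (\<integral>p. (norm (u2s lam (fst p) (snd p) - u2s mu (fst p) (snd p)))\<^sup>2 \<partial>N)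
        \<le> lagrangian G X u1s lam (u2s lam)" if mu: "mu \<in> U0 G" for mu
    proof -
      interpret mu: hamiltonian_problem G X u1s \<psi>1 \<psi>1' \<phi>1 \<phi>1' \<phi>2 \<psi>2 \<psi>2' mu "Z mu" "P mu" "Q mu" "u2s mu"
        by (rule Hs[OF mu])
      have "lagrangian G X u1s mu (u2s mu) = mu.dual_value"
        by (rule mu.lagrangian_eq_dual_value[OF u2s_L2F[OF mu]]) simp
      then have "lagrangian G X u1s mu (u2s mu) + \<epsilon> * (\<integral>p. (norm (u2s lam (fst p) (snd p) - u2s mu (fst p) (snd p)))\<^sup>2 \<partial>N)
        \<le> lagrangian G X u1s mu (u2s lam)"
        using mu.lagrangian_lower_bound[OF \<epsilon>(2) ulam] by simp
      also have "\<dots> \<le> lagrangian G X u1s lam (u2s lam)"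
        using slack_nonpos[OF mu feasible] slack_zero by (simp add: lagrangian_def)
      finally show ?thesis .
    qed
    show ?thesis
      unfolding unique_dual_solution_def
    proof (intro allI iffI)
      fix mu assume "mu = lam"
      then show "mu \<in> U0 G \<and> (\<forall>nu\<in>U0 G. lagrangian G X u1s nu (u2s nu) \<le> lagrangian G X u1s mu (u2s mu))"
      proof (intro conjI ballI)
        fix nu assume "nu \<in> U0 G"
        have "0 \<le> \<epsilon> * (\<integral>p. (norm (u2s lam (fst p) (snd p) - u2s nu (fst p) (snd p)))\<^sup>2 \<partial>N)" using \<epsilon>(1) by simp
        then show "lagrangian G X u1s nu (u2s nu) \<le> lagrangian G X u1s mu (u2s mu)"
          unfolding \<open>mu = lam\<close> using gap[OF \<open>nu \<in> U0 G\<close>] by linarith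
      qed (use lam in simp)
    next
      fix mu assume max: "mu \<in> U0 G \<and> (\<forall>nu\<in>U0 G. lagrangian G X u1s nu (u2s nu) \<le> lagrangian G X u1s mu (u2s mu))"
      then have mu: "mu \<in> U0 G" by blast
      interpret mu: hamiltonian_problem G X u1s \<psi>1 \<psi>1' \<phi>1 \<phi>1' \<phi>2 \<psi>2 \<psi>2' mu "Z mu" "P mu" "Q mu" "u2s mu"
        by (rule Hs[OF mu])
      let ?d = "\<lambda>p. (norm (u2s lam (fst p) (snd p) - u2s mu (fst p) (snd p)))\<^sup>2"
      have d: "integrable N ?d"
        by (rule sq_integrable_norm[OF L2F_N[OF L2_process_diff[OF ulam u2s_L2F[OF mu]]]])
      \<comment> \<open>Maximality of \<open>mu\<close>, tested with \<open>lam\<close>, closes the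
        gap.\<close>
      have "\<epsilon> * (\<integral>p. ?d p \<partial>N) \<le> 0" using gap[OF mu] max lam by fastforce
      then have "(\<integral>p. ?d p \<partial>N) \<le> 0" using \<epsilon>(1) by (simp add: mult_le_0_iff)
      moreover have "0 \<le> (\<integral>p. ?d p \<partial>N)" by simp
      ultimately have "(\<integral>p. ?d p \<partial>N) = 0" by simp
      then have "AE p in N. ?d p = 0" using d by (subst (asm) integral_nonneg_eq_0_iff_AE) auto
      then have "AE p in N. u2s lam (fst p) (snd p) = u2s mu (fst p) (snd p)" by eventually_elim simp
      \<comment> \<open>\<open>u2s lam\<close> is now a version of both feedback controls, so its
        constraint value has two representations, which differ only in the terms
        \<open>S0 mu\<close> and \<open>S0 lam\<close>.\<close>
      from mu.rho_formula[OF ulam this] rho_lam have "S0 G \<psi>2 *v mu = S0 G \<psi>2 *v lam" by simp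
      then have "(S0 G \<psi>2 *v (mu - lam)) \<bullet> (mu - lam) = 0" by (simp add: matrix_vector_mult_diff_distrib)
      then have "mu - lam = 0" using pd unfolding positive_definite_def by (metis less_irrefl)
      then show "mu = lam" by simp
    qed
  qed
  ultimately show ?thesis by blast
qed

end
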